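(* Let $\boldsymbol e_{\boldsymbol u}=\boldsymbol u-\boldsymbol u_{\tau,h}$ be the velocity error, where $(\boldsymbol u,p)$ is the solution of the nonstationary Stokes system and $\boldsymbol u_{\tau,h}$ is the velocity trajectory of the discrete scheme (G). Then there is a constant $C>0$, independent of the mesh sizes in space and time, such that for all $n=1,\dots,N$ $$\sum_{m=1}^n\tau_m\|\partial_t\boldsymbol e_{\boldsymbol u}(\bar t_m)\|^2+\|\nabla\boldsymbol e_{\boldsymbol u}(t_n)\|^2\le C\big(\|\nabla\boldsymbol e_{\boldsymbol u}(0)\|^2+\tau^4+h^{2r}\big),$$ $$\|\boldsymbol e_{\boldsymbol u}(t_n)\|^2+\sum_{m=1}^n\tau_m\|\nabla\boldsymbol e_{\boldsymbol u}(\bar t_m)\|^2\le C\big(\|\boldsymbol e_{\boldsymbol u}(0)\|^2+\tau^4+h^{2r}\big).$$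
   Context: Let $d\in\{2,3\}$, $\Omega\subset\mathbb R^d$ an open bounded domain, $T>0$, $I=(0,T]$, $\overline I=[0,T]$; $\langle\cdot,\cdot\rangle$ and $\|\cdot\|$ are the inner product and norm of $L^2(\Omega)$ (scalar-, vector- or matrix-valued), $\|\cdot\|_m$ the norm of $H^m(\Omega)$. $\boldsymbol V=H^1_0(\Omega)^d$, $Q=\{q\in L^2(\Omega):\int_\Omega q\,dx=0\}$, $\boldsymbol V^{\mathrm{div}}=\{\boldsymbol v\in\boldsymbol V:\langle\nabla\cdot\boldsymbol v,q\rangle=0\ \forall q\in Q\}$. Time mesh: $0=t_0<\dots<t_N=T$, $I_n=(t_{n-1},t_n]$, $\tau_n=t_n-t_{n-1}$, $\tau=\max_n\tau_n$, $\bar t_n=(t_{n-1}+t_n)/2$. $\mathbb P_k(J;B)$: $B$-valued polynomials in $t\in J$ of degree at most $k$. $w^+$ denotes right-sided limits. Continuous problem: $\partial_t\boldsymbol u-\Delta\boldsymbol u+\nabla p=\boldsymbol f$, $\nabla\cdot\boldsymbol u=0$ in $\Omega\times(0,T]$, $\boldsymbol u(0)=\boldsymbol u_0$ in $\Omega$, $\boldsymbol u=\boldsymbol 0$ on $\partial\Omega\times[0,T]$, with $\boldsymbol u(t)\in\boldsymbol V^{\mathrm{div}}$, $p(t)\in Q$. Standing assumptions: the solution is sufficiently regular up to $t=0$, i.e. $\boldsymbol u\in C^k(\overline I;H^k(\Omega)^d)$, $p\in C^k(\overline I;H^k(\Omega))$ for a sufficiently large $k$ depending only on $r$ (and $\boldsymbol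 f$ is correspondingly regular); the stationary Stokes problem on $\Omega$ is $H^2$-regular, i.e. for every $\boldsymbol g\in L^2(\Omega)^d$ the solution $(\boldsymbol w,s)\in\boldsymbol V\times Q$ of $-\Delta\boldsymbol w+\nabla s=\boldsymbol g$, $\nabla\cdot\boldsymbol w=0$ lies in $H^2\times H^1$ and $\|\boldsymbol w\|_2+\|s\|_1\le C\|\boldsymbol g\|$. Constants $C$ are independent of $h$ and of the time mesh, but may depend on $T$, the data (including $\Omega$), the solution $(\boldsymbol u,p)$, the shape regularity of the space meshes, and the polynomial degree in space. Finite elements: $\{\mathcal T_h\}$ is a shape-regular family of meshes of $\Omega$ with mesh size $h$, and $\boldsymbol V_h=\{\boldsymbol v\in\boldsymbol V:\boldsymbol v|_K\in\boldsymbol V(K)\ \forall K\in\mathcal T_h\}$, $Q_h=\{q\in Q:q|_K\in Q(K)\ \forall K\in\mathcal T_h\}$ with local spaces of mapped polynomials of uniformly bounded degree. Assumption: with $\beta$ independent of $h$, $0<\beta\le\inf_{q_h\in Q_h\setminus\{0\}}\sup_{\boldsymbol v_h\in\boldsymbol V_h\setminus\{0\}}\frac{-\langle\nabla\cdot\boldsymbol v_h,q_h\rangle}{\|\boldsymbol v_h\|_1\|q_h\|}$; and for $\boldsymbol v\in\boldsymbol V\cap H^{r+1}(\Omega)^d$, $q\in Q\cap H^r(\Omega)$ there are $i_h\boldsymbol v\in\boldsymbol V_h$, $j_hq\in Q_h$ with $\|\boldsymbol v-i_h\boldsymbol v\|+h\|\nabla(\boldsymbol v-i_h\boldsymbol v)\|\le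 Ch^{r+1}\|\boldsymbol v\|_{r+1}$, $\|q-j_hq\|\le Ch^r\|q\|_r$. $\boldsymbol V_h^{\mathrm{div}}=\{\boldsymbol v_h\in\boldsymbol V_h:\langle\nabla\cdot\boldsymbol v_h,q_h\rangle=0\ \forall q_h\in Q_h\}$. Operators: $\langle A_h\boldsymbol u,\boldsymbol v_h\rangle=\langle\nabla\boldsymbol u,\nabla\boldsymbol v_h\rangle$, $\langle B_h\boldsymbol v,q_h\rangle=-\langle\nabla\cdot\boldsymbol v,q_h\rangle$, $\langle B_h'q,\boldsymbol v_h\rangle=-\langle\nabla\cdot\boldsymbol v_h,q\rangle$. Scheme (G): let $\boldsymbol u_{\tau,h}(0)=\boldsymbol u_{0,h}\in\boldsymbol V_h^{\mathrm{div}}$ be an approximation of $\boldsymbol u_0$. Successively for $n=1,\dots,N$, $(\boldsymbol u_{\tau,h},p_{\tau,h})|_{I_n}\in\mathbb P_1(I_n;\boldsymbol V_h)\times\mathbb P_1(I_n;Q_h)$ satisfies $\boldsymbol u_{\tau,h}^+(t_{n-1})=\boldsymbol u_{\tau,h}(t_{n-1})$ and $$\int_{I_n}\langle\partial_t\boldsymbol u_{\tau,h}+A_h\boldsymbol u_{\tau,h}+B_h'p_{\tau,h},\boldsymbol v_h\rangle dt=\tfrac{\tau_n}{2}\langle\boldsymbol f(t_{n-1})+\boldsymbol f(t_n),\boldsymbol v_h\rangle,\qquad\int_{I_n}\langle B_h\boldsymbol u_{\tau,h},q_h\rangle dt=0$$ for all $(\boldsymbol v_h,q_h)\in\boldsymbol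 V_h\times Q_h$. The velocity $\boldsymbol u_{\tau,h}$ is uniquely determined. *)

theory Defs
  imports "HOL-Analysis.Analysis"
begin

section \<open>Lebesgue and Sobolev spaces on an open set\<close>

text \<open>
  Functions on \<open>\<Omega>\<close> are represented by total functions on the whole space. Only their values almost
  everywhere in \<open>\<Omega>\<close> matter, and equality is \<open>ae_eq \<Omega>\<close>.
\<close>

definition ae_eq :: "(real^'d) set \<Rightarrow> (real^'d \<Rightarrow> 'b) \<Rightarrow> (real^'d \<Rightarrow> 'b) \<Rightarrow> bool" where
  "ae_eq \<Omega> f g \<longleftrightarrow> (AE x in lebesgue_on \<Omega>. f x = g x)"

definition L2_space :: "(real^'d) set \<Rightarrow> (real^'d \<Rightarrow> 'b::euclidean_space) set" where
  "L2_space \<Omega> = {f. f \<in> borel_measurable (lebesgue_on \<Omega>) \<and>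
                    integrable (lebesgue_on \<Omega>) (\<lambda>x. (norm (f x))\<^sup>2)}"

definition L2_inner ::
  "(real^'d) set \<Rightarrow> (real^'d \<Rightarrow> 'b::euclidean_space) \<Rightarrow> (real^'d \<Rightarrow> 'b) \<Rightarrow> real" where
  "L2_inner \<Omega> f g = (LINT x|lebesgue_on \<Omega>. f x \<bullet> g x)"

definition L2_norm :: "(real^'d) set \<Rightarrow> (real^'d \<Rightarrow> 'b::euclidean_space) \<Rightarrow> real" where
  "L2_norm \<Omega> f = sqrt (L2_inner \<Omega> f f)"

definition pderiv_dir :: "'d \<Rightarrow> (real^'d \<Rightarrow> real) \<Rightarrow> real^'d \<Rightarrow> real" where
  "pderiv_dir i \<phi> = (\<lambda>x. frechet_derivative \<phi> (at x) (axis i 1))"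

definition pderivs :: "'d list \<Rightarrow> (real^'d \<Rightarrow> real) \<Rightarrow> real^'d \<Rightarrow> real" where
  "pderivs is \<phi> = foldr pderiv_dir is \<phi>"

text \<open>
  The space of infinitely differentiable functions with compact support in \<open>\<Omega>\<close>; smoothness is
  expressed by differentiability of all iterated partial derivatives.
\<close>

definition test_functions :: "(real^'d) set \<Rightarrow> (real^'d \<Rightarrow> real) set" where
  "test_functions \<Omega> =
     {\<phi>. (\<forall>is x. pderivs is \<phi> differentiable (at x)) \<and>
         (\<exists>K. compact K \<and> K \<subseteq> \<Omega> \<and> (\<forall>x. x \<notin> K \<longrightarrow> \<phi> x = 0))}"

definition has_weak_deriv ::
  "(real^'d) set \<Rightarrow> 'd list \<Rightarrow> (real^'d \<Rightarrow> 'b::euclidean_space) \<Rightarrow> (real^'d \<Rightarrow> 'b) \<Rightarrow> bool" where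
  "has_weak_deriv \<Omega> is f g \<longleftrightarrow> f \<in> L2_space \<Omega> \<and> g \<in> L2_space \<Omega> \<and>
     (\<forall>\<phi>\<in>test_functions \<Omega>.
        (LINT x|lebesgue_on \<Omega>. pderivs is \<phi> x *\<^sub>R f x) =
        (-1) ^ length is *\<^sub>R (LINT x|lebesgue_on \<Omega>. \<phi> x *\<^sub>R g x))"

text \<open>Weak derivatives are determined up to null sets; \<open>wderiv\<close> picks a representative.\<close>

definition wderiv ::
  "(real^'d) set \<Rightarrow> 'd list \<Rightarrow> (real^'d \<Rightarrow> 'b::euclidean_space) \<Rightarrow> real^'d \<Rightarrow> 'b" where
  "wderiv \<Omega> is f = (SOME g. has_weak_deriv \<Omega> is f g)"

definition H_space :: "nat \<Rightarrow> (real^'d) set \<Rightarrow> (real^'d \<Rightarrow> 'b::euclidean_space) set" where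
  "H_space m \<Omega> = {f. \<forall>is. length is \<le> m \<longrightarrow> (\<exists>g. has_weak_deriv \<Omega> is f g)}"

text \<open>
  The sum of the squared \<open>L\<^sup>2\<close> norms of the derivative tensors of order \<open>0, \<dots>, m\<close>, each with the
  Euclidean norm of tensors: a derivative \<open>\<partial>\<^sup>\<alpha>\<close> is counted once for every ordering of the
  differentiations. For \<open>m \<le> 1\<close> this is literally the sum over multi-indices; for larger \<open>m\<close>
  it is an equivalent norm, with constants depending only on \<open>m\<close>.
\<close>

definition H_norm :: "nat \<Rightarrow> (real^'d) set \<Rightarrow> (real^'d \<Rightarrow> 'b::euclidean_space) \<Rightarrow> real" where
  "H_norm m \<Omega> f = sqrt (\<Sum>is | length is \<le> m. (L2_norm \<Omega> (wderiv \<Omega> is f))\<^sup>2)"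

definition H10_space :: "(real^'d) set \<Rightarrow> (real^'d \<Rightarrow> real) set" where
  "H10_space \<Omega> = {f \<in> H_space 1 \<Omega>.
     \<forall>\<epsilon>>0. \<exists>\<phi>\<in>test_functions \<Omega>. H_norm 1 \<Omega> (\<lambda>x. f x - \<phi> x) < \<epsilon>}"

definition grad_s :: "(real^'d) set \<Rightarrow> (real^'d \<Rightarrow> real) \<Rightarrow> real^'d \<Rightarrow> real^'d" where
  "grad_s \<Omega> q = (\<lambda>x. \<chi> i. wderiv \<Omega> [i] q x)"

definition grad_v :: "(real^'d) set \<Rightarrow> (real^'d \<Rightarrow> real^'d) \<Rightarrow> real^'d \<Rightarrow> real^'d^'d" where
  "grad_v \<Omega> v = (\<lambda>x. \<chi> i j. wderiv \<Omega> [j] v x $ i)"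

definition div_v :: "(real^'d) set \<Rightarrow> (real^'d \<Rightarrow> real^'d) \<Rightarrow> real^'d \<Rightarrow> real" where
  "div_v \<Omega> v = (\<lambda>x. \<Sum>i\<in>UNIV. wderiv \<Omega> [i] v x $ i)"

definition laplace_v :: "(real^'d) set \<Rightarrow> (real^'d \<Rightarrow> real^'d) \<Rightarrow> real^'d \<Rightarrow> real^'d" where
  "laplace_v \<Omega> v = (\<lambda>x. \<Sum>i\<in>UNIV. wderiv \<Omega> [i, i] v x)"

definition V_space :: "(real^'d) set \<Rightarrow> (real^'d \<Rightarrow> real^'d) set" where
  "V_space \<Omega> = {v. \<forall>i. (\<lambda>x. v x $ i) \<in> H10_space \<Omega>}"

definition Q_space :: "(real^'d) set \<Rightarrow> (real^'d \<Rightarrow> real) set" where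
  "Q_space \<Omega> = {q \<in> L2_space \<Omega>. (LINT x|lebesgue_on \<Omega>. q x) = 0}"

definition V_div :: "(real^'d) set \<Rightarrow> (real^'d \<Rightarrow> real^'d) set" where
  "V_div \<Omega> = {v \<in> V_space \<Omega>. \<forall>q\<in>Q_space \<Omega>. L2_inner \<Omega> (div_v \<Omega> v) q = 0}"


section \<open>Time-dependent functions\<close>

text \<open>\<open>C\<^sup>k(S; H\<^sup>m(\<Omega>))\<close>; the sequence \<open>W\<close> consists of the time derivatives of orders \<open>0, \<dots>, k\<close>.\<close>

definition Ck_time ::
  "nat \<Rightarrow> nat \<Rightarrow> (real^'d) set \<Rightarrow> real set \<Rightarrow> (real \<Rightarrow> real^'d \<Rightarrow> 'b::euclidean_space) \<Rightarrow> bool" where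
  "Ck_time k m \<Omega> S w \<longleftrightarrow> (\<exists>W.
     (\<forall>t\<in>S. W 0 t = w t) \<and>
     (\<forall>j\<le>k. \<forall>t\<in>S. W j t \<in> H_space m \<Omega> \<and>
        ((\<lambda>s. H_norm m \<Omega> (\<lambda>x. W j s x - W j t x)) \<longlongrightarrow> 0) (at t within S)) \<and>
     (\<forall>j<k. \<forall>t\<in>S.
        ((\<lambda>s. H_norm m \<Omega> (\<lambda>x. (W j s x - W j t x) /\<^sub>R (s - t) - W (Suc j) t x)) \<longlongrightarrow> 0)
          (at t within S)))"

text \<open>The time derivative at \<open>t\<close>, relative to \<open>S\<close>, as a limit of difference quotients in \<open>L\<^sup>2(\<Omega>)\<close>.\<close>

definition dt ::
  "(real^'d) set \<Rightarrow> real set \<Rightarrow> (real \<Rightarrow> real^'d \<Rightarrow> 'b::euclidean_space) \<Rightarrow> real \<Rightarrow> real^'d \<Rightarrow> 'b" where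
  "dt \<Omega> S w t = (SOME g. g \<in> L2_space \<Omega> \<and>
     ((\<lambda>s. L2_norm \<Omega> (\<lambda>x. (w s x - w t x) /\<^sub>R (s - t) - g x)) \<longlongrightarrow> 0) (at t within S))"

definition P_time ::
  "nat \<Rightarrow> (real^'d) set \<Rightarrow> real set \<Rightarrow> (real^'d \<Rightarrow> 'b::euclidean_space) set \<Rightarrow>
   (real \<Rightarrow> real^'d \<Rightarrow> 'b) \<Rightarrow> bool" where
  "P_time k \<Omega> J B w \<longleftrightarrow>
     (\<exists>c. (\<forall>j\<le>k. c j \<in> B) \<and> (\<forall>t\<in>J. ae_eq \<Omega> (w t) (\<lambda>x. \<Sum>j\<le>k. t ^ j *\<^sub>R c j x)))"

definition time_mesh :: "real \<Rightarrow> nat \<Rightarrow> (nat \<Rightarrow> real) \<Rightarrow> bool" where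
  "time_mesh T N t \<longleftrightarrow> 1 \<le> N \<and> t 0 = 0 \<and> t N = T \<and> (\<forall>n<N. t n < t (Suc n))"

definition time_step :: "(nat \<Rightarrow> real) \<Rightarrow> nat \<Rightarrow> real" where
  "time_step t n = t n - t (n - 1)"

definition max_step :: "nat \<Rightarrow> (nat \<Rightarrow> real) \<Rightarrow> real" where
  "max_step N t = (MAX n\<in>{1..N}. time_step t n)"

definition midpoint_t :: "(nat \<Rightarrow> real) \<Rightarrow> nat \<Rightarrow> real" where
  "midpoint_t t n = (t (n - 1) + t n) / 2"


section \<open>The Stokes problems\<close>

definition stationary_stokes_solution ::
  "(real^'d) set \<Rightarrow> (real^'d \<Rightarrow> real^'d) \<Rightarrow> (real^'d \<Rightarrow> real^'d) \<Rightarrow> (real^'d \<Rightarrow> real) \<Rightarrow> bool" where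
  "stationary_stokes_solution \<Omega> g w s \<longleftrightarrow>
     w \<in> V_space \<Omega> \<and> s \<in> Q_space \<Omega> \<and>
     (\<forall>v\<in>V_space \<Omega>. L2_inner \<Omega> (grad_v \<Omega> w) (grad_v \<Omega> v) - L2_inner \<Omega> (div_v \<Omega> v) s
        = L2_inner \<Omega> g v) \<and>
     (\<forall>q\<in>Q_space \<Omega>. L2_inner \<Omega> (div_v \<Omega> w) q = 0)"

definition stokes_H2_regular :: "(real^'d) set \<Rightarrow> bool" where
  "stokes_H2_regular \<Omega> \<longleftrightarrow> (\<exists>C. \<forall>g\<in>L2_space \<Omega>.
     (\<exists>w s. stationary_stokes_solution \<Omega> g w s) \<and>
     (\<forall>w s. stationary_stokes_solution \<Omega> g w s \<longrightarrow>
        w \<in> H_space 2 \<Omega> \<and> s \<in> H_space 1 \<Omega> \<and>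
        H_norm 2 \<Omega> w + H_norm 1 \<Omega> s \<le> C * L2_norm \<Omega> g))"

text \<open>
  The nonstationary problem in strong form. The boundary condition is part of membership in
  \<open>V_div\<close>. The spatial derivatives make sense for the regular solutions considered here.
\<close>

definition stokes_solution ::
  "(real^'d) set \<Rightarrow> real \<Rightarrow> (real \<Rightarrow> real^'d \<Rightarrow> real^'d) \<Rightarrow> (real^'d \<Rightarrow> real^'d) \<Rightarrow>
   (real \<Rightarrow> real^'d \<Rightarrow> real^'d) \<Rightarrow> (real \<Rightarrow> real^'d \<Rightarrow> real) \<Rightarrow> bool" where
  "stokes_solution \<Omega> T f u0 u p \<longleftrightarrow>
     (\<forall>t\<in>{0..T}. u t \<in> V_div \<Omega> \<and> p t \<in> Q_space \<Omega>) \<and>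
     (\<forall>t\<in>{0<..T}.
        ae_eq \<Omega> (\<lambda>x. dt \<Omega> {0..T} u t x - laplace_v \<Omega> (u t) x + grad_s \<Omega> (p t) x) (f t) \<and>
        ae_eq \<Omega> (div_v \<Omega> (u t)) (\<lambda>x. 0)) \<and>
     ae_eq \<Omega> (u 0) u0"


section \<open>Finite element spaces\<close>

text \<open>
  A mesh together with the local spaces on its cells. Each cell \<open>K\<close> is the image of a reference
  cell under a map; \<open>V_loc M K\<close> and \<open>Q_loc M K\<close> are the spaces \<open>V(K)\<close> and \<open>Q(K)\<close>, whose elements
  only matter on \<open>K\<close>.
\<close>

record ('d::finite) fe_mesh =
  cells :: "(real^'d) set set"
  ref_cell :: "(real^'d) set \<Rightarrow> (real^'d) set"
  cell_map :: "(real^'d) set \<Rightarrow> real^'d \<Rightarrow> real^'d"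
  V_loc :: "(real^'d) set \<Rightarrow> (real^'d \<Rightarrow> real^'d) set"
  Q_loc :: "(real^'d) set \<Rightarrow> (real^'d \<Rightarrow> real) set"

definition C1_diffeo_onto ::
  "(real^'d) set \<Rightarrow> (real^'d) set \<Rightarrow> (real^'d \<Rightarrow> real^'d) \<Rightarrow> bool" where
  "C1_diffeo_onto A B F \<longleftrightarrow> inj_on F A \<and> F ` A = B \<and>
     (\<exists>F'. (\<forall>x\<in>A. (F has_derivative F' x) (at x within A) \<and> inj (F' x)) \<and>
           (\<forall>v. continuous_on A (\<lambda>x. F' x v)))"

definition is_mesh_of :: "(real^'d) set \<Rightarrow> ('d::finite) fe_mesh \<Rightarrow> bool" where
  "is_mesh_of \<Omega> M \<longleftrightarrow>
     finite (cells M) \<and> \<Union> (cells M) = closure \<Omega> \<and>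
     (\<forall>K\<in>cells M. polytope (ref_cell M K) \<and> interior (ref_cell M K) \<noteq> {} \<and>
        C1_diffeo_onto (ref_cell M K) K (cell_map M K)) \<and>
     (\<forall>K\<in>cells M. \<forall>L\<in>cells M. K \<noteq> L \<longrightarrow> interior K \<inter> interior L = {})"

definition mesh_size :: "('d::finite) fe_mesh \<Rightarrow> real" where
  "mesh_size M = Max (diameter ` cells M)"

text \<open>Every cell contains a ball whose diameter is at least a fixed fraction of that of the cell.\<close>

definition shape_regular_family :: "(real^'d) set \<Rightarrow> ('d::finite) fe_mesh set \<Rightarrow> bool" where
  "shape_regular_family \<Omega> \<F> \<longleftrightarrow>
     (\<forall>M\<in>\<F>. is_mesh_of \<Omega> M) \<and>
     (\<exists>\<sigma>>0. \<forall>M\<in>\<F>. \<forall>K\<in>cells M. \<exists>c \<rho>. ball c \<rho> \<subseteq> K \<and> diameter K \<le> \<sigma> * (2 * \<rho>))"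

definition poly_deg_le :: "nat \<Rightarrow> (real^'d \<Rightarrow> 'b::euclidean_space) \<Rightarrow> bool" where
  "poly_deg_le l p \<longleftrightarrow>
     (\<exists>c. \<forall>x. p x = (\<Sum>\<alpha> | sum \<alpha> UNIV \<le> l. (\<Prod>i\<in>UNIV. (x $ i) ^ \<alpha> i) *\<^sub>R c (\<alpha> :: 'd \<Rightarrow> nat)))"

definition mapped_poly_space ::
  "nat \<Rightarrow> (real^'d) set \<Rightarrow> (real^'d \<Rightarrow> real^'d) \<Rightarrow> (real^'d \<Rightarrow> 'b::euclidean_space) set \<Rightarrow> bool" where
  "mapped_poly_space l A F W \<longleftrightarrow>
     (\<lambda>x. 0) \<in> W \<and> (\<forall>v\<in>W. \<forall>w\<in>W. \<forall>a b. (\<lambda>x. a *\<^sub>R v x + b *\<^sub>R w x) \<in> W) \<and>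
     (\<forall>w\<in>W. \<exists>p. poly_deg_le l p \<and> (\<forall>x\<in>A. w (F x) = p x))"

definition bounded_degree_family :: "('d::finite) fe_mesh set \<Rightarrow> bool" where
  "bounded_degree_family \<F> \<longleftrightarrow> (\<exists>l. \<forall>M\<in>\<F>. \<forall>K\<in>cells M.
     mapped_poly_space l (ref_cell M K) (cell_map M K) (V_loc M K) \<and>
     mapped_poly_space l (ref_cell M K) (cell_map M K) (Q_loc M K))"

definition V_h :: "(real^'d) set \<Rightarrow> ('d::finite) fe_mesh \<Rightarrow> (real^'d \<Rightarrow> real^'d) set" where
  "V_h \<Omega> M = {v \<in> V_space \<Omega>.
     \<forall>K\<in>cells M. \<exists>w\<in>V_loc M K. AE x in lebesgue_on \<Omega>. x \<in> K \<longrightarrow> v x = w x}"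

definition Q_h :: "(real^'d) set \<Rightarrow> ('d::finite) fe_mesh \<Rightarrow> (real^'d \<Rightarrow> real) set" where
  "Q_h \<Omega> M = {q \<in> Q_space \<Omega>.
     \<forall>K\<in>cells M. \<exists>w\<in>Q_loc M K. AE x in lebesgue_on \<Omega>. x \<in> K \<longrightarrow> q x = w x}"

definition V_h_div :: "(real^'d) set \<Rightarrow> ('d::finite) fe_mesh \<Rightarrow> (real^'d \<Rightarrow> real^'d) set" where
  "V_h_div \<Omega> M = {v \<in> V_h \<Omega> M. \<forall>q\<in>Q_h \<Omega> M. L2_inner \<Omega> (div_v \<Omega> v) q = 0}"

text \<open>
  Infimum and supremum are taken in \<open>ereal\<close>, so that they also have their usual meaning for empty
  index sets. Elements are excluded as zero if they vanish almost everywhere.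
\<close>

definition inf_sup_stable :: "(real^'d) set \<Rightarrow> ('d::finite) fe_mesh set \<Rightarrow> bool" where
  "inf_sup_stable \<Omega> \<F> \<longleftrightarrow> (\<exists>\<beta>>0. \<forall>M\<in>\<F>.
     ereal \<beta> \<le> (INF q\<in>{q \<in> Q_h \<Omega> M. \<not> ae_eq \<Omega> q (\<lambda>x. 0)}.
                 SUP v\<in>{v \<in> V_h \<Omega> M. \<not> ae_eq \<Omega> v (\<lambda>x. 0)}.
                   ereal (- L2_inner \<Omega> (div_v \<Omega> v) q / (H_norm 1 \<Omega> v * L2_norm \<Omega> q))))"

definition approximation_property :: "(real^'d) set \<Rightarrow> nat \<Rightarrow> ('d::finite) fe_mesh set \<Rightarrow> bool" where
  "approximation_property \<Omega> r \<F> \<longleftrightarrow> (\<exists>C. \<forall>M\<in>\<F>.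
     (\<forall>v \<in> V_space \<Omega> \<inter> H_space (r + 1) \<Omega>. \<exists>w\<in>V_h \<Omega> M.
        L2_norm \<Omega> (\<lambda>x. v x - w x) + mesh_size M * L2_norm \<Omega> (grad_v \<Omega> (\<lambda>x. v x - w x))
          \<le> C * mesh_size M ^ (r + 1) * H_norm (r + 1) \<Omega> v) \<and>
     (\<forall>q \<in> Q_space \<Omega> \<inter> H_space r \<Omega>. \<exists>s\<in>Q_h \<Omega> M.
        L2_norm \<Omega> (\<lambda>x. q x - s x) \<le> C * mesh_size M ^ r * H_norm r \<Omega> q))"


section \<open>The discrete scheme\<close>

text \<open>
  The operators \<open>A_h\<close>, \<open>B_h\<close>, \<open>B_h'\<close> occur only tested with finite element functions, so the
  defining bilinear forms are written out. At an interior time node the time derivative of the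
  discrete velocity need not exist; this single point does not affect the integral.
\<close>

definition scheme_solution ::
  "(real^'d) set \<Rightarrow> ('d::finite) fe_mesh \<Rightarrow> real \<Rightarrow> nat \<Rightarrow> (nat \<Rightarrow> real) \<Rightarrow>
   (real \<Rightarrow> real^'d \<Rightarrow> real^'d) \<Rightarrow> (real^'d \<Rightarrow> real^'d) \<Rightarrow>
   (real \<Rightarrow> real^'d \<Rightarrow> real^'d) \<Rightarrow> (real \<Rightarrow> real^'d \<Rightarrow> real) \<Rightarrow> bool" where
  "scheme_solution \<Omega> M T N t f u0h uh ph \<longleftrightarrow>
     ae_eq \<Omega> (uh 0) u0h \<and>
     (\<forall>n\<in>{1..N}.
        P_time 1 \<Omega> {t (n - 1)<..t n} (V_h \<Omega> M) uh \<and>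
        P_time 1 \<Omega> {t (n - 1)<..t n} (Q_h \<Omega> M) ph \<and>
        ((\<lambda>s. L2_norm \<Omega> (\<lambda>x. uh s x - uh (t (n - 1)) x)) \<longlongrightarrow> 0) (at_right (t (n - 1))) \<and>
        (\<forall>v\<in>V_h \<Omega> M.
           (LINT s|lebesgue_on {t (n - 1)<..t n}.
              L2_inner \<Omega> (dt \<Omega> {0..T} uh s) v + L2_inner \<Omega> (grad_v \<Omega> (uh s)) (grad_v \<Omega> v)
              - L2_inner \<Omega> (div_v \<Omega> v) (ph s))
           = time_step t n / 2 * L2_inner \<Omega> (\<lambda>x. f (t (n - 1)) x + f (t n) x) v) \<and>
        (\<forall>q\<in>Q_h \<Omega> M.
           (LINT s|lebesgue_on {t (n - 1)<..t n}. - L2_inner \<Omega> (div_v \<Omega> (uh s)) q) = 0))"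

end

theory Submission
  imports Defs "HOL-Library.Function_Algebras"
begin

text \<open>
  The idea is to recognise the Galerkin scheme as a Crank-Nicolson recursion for its nodal values and
  to compare these with a Stokes-like projection of the exact solution.

  On each time interval the discrete velocity is affine in time and the discrete pressure is affine
  too. Tested with a discretely divergence-free \<open>v\<close> the pressure disappears, and the time integral of
  the remaining affine function is its midpoint value times \<open>\<tau>\<^sub>n\<close>. Hence the nodal values \<open>U\<^sub>n\<close> are
  discretely divergence-free and satisfy
  \<open>\<langle>(U\<^sub>n - U\<^sub>n\<^sub>-\<^sub>1)/\<tau>\<^sub>n, v\<rangle> + \<langle>\<nabla>(U\<^sub>n + U\<^sub>n\<^sub>-\<^sub>1)/2, \<nabla>v\<rangle> = \<langle>f(t\<^sub>n) + f(t\<^sub>n\<^sub>-\<^sub>1), v\<rangle>/2\<close>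
  (\<open>scheme_nodes\<close>, \<open>crank_nicolson_nodal\<close>). Integration by parts turns the strong equation of the
  exact solution into its weak form, at \<open>t = 0\<close> by continuity (\<open>weak_formulation\<close>).

  The error is split as \<open>e(t\<^sub>n) = \<rho>\<^sub>n + \<Theta>\<^sub>n\<close> with \<open>\<rho>\<^sub>n = u(t\<^sub>n) - R\<^sub>n\<close> and \<open>\<Theta>\<^sub>n = R\<^sub>n - U\<^sub>n\<close>, where \<open>R\<^sub>n\<close> is the
  discretely divergence-free function with
  \<open>\<langle>R\<^sub>n, v\<rangle> + \<langle>\<nabla>R\<^sub>n, \<nabla>v\<rangle> = \<langle>u, v\<rangle> + \<langle>\<nabla>u, \<nabla>v\<rangle> - \<langle>\<nabla>\<cdot>v, p\<rangle>\<close> at time \<open>t\<^sub>n\<close>, for all discretely divergence-free \<open>v\<close>.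
  The full \<open>H\<^sup>1\<close> inner product makes one estimate control \<open>\<rho>\<^sub>n\<close> in \<open>L\<^sup>2\<close> and its gradient. By the
  inf-sup condition, approximation in the discretely divergence-free subspace is as good as
  approximation in the whole velocity space (\<open>kernel_approximation\<close>), so \<open>\<rho>\<^sub>n = O(h\<^sup>r)\<close> in \<open>H\<^sup>1\<close>
  (\<open>ritz_error\<close>). The projection is linear in \<open>(u, p)\<close>, so the same estimate applied to time increments
  gives \<open>(\<rho>\<^sub>n - \<rho>\<^sub>n\<^sub>-\<^sub>1)/\<tau>\<^sub>n = O(h\<^sup>r)\<close>. Since the pressure in the definition of \<open>R\<^sub>n\<close> cancels the one in the
  weak form, \<open>\<Theta>\<close> solves the Crank-Nicolson recursion with a right-hand side \<open>g\<^sub>n\<close> made of \<open>\<rho>\<close>, of its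
  difference quotient and of the error of the trapezoidal rule (\<open>error_equation\<close>). Thus
  \<open>g\<^sub>n = O(h\<^sup>r + \<tau>\<^sup>2)\<close> in \<open>L\<^sup>2\<close>.

  Two choices of the test function finish the argument. With \<open>\<Theta>\<^sub>n - \<Theta>\<^sub>n\<^sub>-\<^sub>1\<close> the gradient term telescopes, and
  the difference quotients on the left absorb half of the right-hand side (\<open>gradient_estimate\<close>). With
  the mean of \<open>\<Theta>\<^sub>n\<close> and \<open>\<Theta>\<^sub>n\<^sub>-\<^sub>1\<close> the \<open>L\<^sup>2\<close> term telescopes, and \<open>\<parallel>\<Theta>\<^sub>n\<parallel> \<le> \<parallel>\<Theta>\<^sub>n\<^sub>-\<^sub>1\<parallel> + \<tau>\<^sub>n \<parallel>g\<^sub>n\<parallel>\<close>, so errors only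
  accumulate linearly in time (\<open>L_estimate\<close>). Midpoint values differ from nodal means and difference
  quotients by further quadrature errors of second order.

  Two facts about function spaces make the objects of the statement usable. Weak derivatives are
  unique almost everywhere, by testing with smooth bump functions supported in boxes, so the chosen
  representatives depend linearly on the function up to null sets (\<open>weak_deriv_unique\<close>). Finite element
  spaces are finite-dimensional up to null sets, because their elements are determined by finitely many
  polynomial coefficients (\<open>piecewise_relation\<close>); this provides the discrete functions defined by
  duality.
\<close>

section \<open>Functions as vectors and semi-inner products\<close>

text \<open>
  Pointwise vector operations turn \<open>L\<^sup>2\<close> and Sobolev functions into elements of a real vector space, so
  that subspaces, sums and linear combinations of the libraries apply to them.
\<close>

instantiation "fun" :: (type, scaleR) scaleR
begin
definition "scaleR c f = (\<lambda>x. c *\<^sub>R f x)"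
instance ..
end

lemma scaleR_fun_apply [simp]: "(c *\<^sub>R f) x = c *\<^sub>R f x"
  by (simp add: scaleR_fun_def)

instance "fun" :: (type, real_vector) real_vector
  by standard (simp_all add: fun_eq_iff algebra_simps)

lemma sum_fun_apply: "(sum f A) x = (\<Sum>a\<in>A. f a x)"
  by (induction A rule: infinite_finite_induct) auto

text \<open>
  Elements of norm zero may differ from zero: the inner products below are positive definite only up to
  null sets. The form is restricted to a subspace \<open>X\<close> because the integrals defining it are bilinear only
  for square integrable arguments.
\<close>

locale semi_inner =
  fixes X :: "'a::real_vector set" and ip :: "'a \<Rightarrow> 'a \<Rightarrow> real"
  assumes subspace_X: "subspace X"
    and ip_commute: "\<And>x y. x \<in> X \<Longrightarrow> y \<in> X \<Longrightarrow> ip x y = ip y x"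
    and ip_add_left: "\<And>x y z. x \<in> X \<Longrightarrow> y \<in> X \<Longrightarrow> z \<in> X \<Longrightarrow> ip (x + y) z = ip x z + ip y z"
    and ip_scaleR_left: "\<And>c x y. x \<in> X \<Longrightarrow> y \<in> X \<Longrightarrow> ip (c *\<^sub>R x) y = c * ip x y"
    and ip_nonneg: "\<And>x. x \<in> X \<Longrightarrow> 0 \<le> ip x x"
begin

definition nrm :: "'a \<Rightarrow> real" where "nrm x = sqrt (ip x x)"

lemma X_closed [simp, intro]:
  "0 \<in> X" "x \<in> X \<Longrightarrow> y \<in> X \<Longrightarrow> x + y \<in> X" "x \<in> X \<Longrightarrow> y \<in> X \<Longrightarrow> x - y \<in> X"
  "x \<in> X \<Longrightarrow> c *\<^sub>R x \<in> X" "x \<in> X \<Longrightarrow> - x \<in> X"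
  using subspace_X by (auto simp: subspace_0 subspace_add subspace_diff subspace_scale subspace_neg)

lemma X_sum [simp, intro]: "(\<And>i. i \<in> A \<Longrightarrow> f i \<in> X) \<Longrightarrow> sum f A \<in> X"
  using subspace_X by (rule subspace_sum)

lemma ip_add_right: "x \<in> X \<Longrightarrow> y \<in> X \<Longrightarrow> z \<in> X \<Longrightarrow> ip z (x + y) = ip z x + ip z y"
  by (metis ip_commute ip_add_left X_closed(2))

lemma ip_scaleR_right: "x \<in> X \<Longrightarrow> y \<in> X \<Longrightarrow> ip y (c *\<^sub>R x) = c * ip y x"
  by (metis ip_commute ip_scaleR_left X_closed(4))

lemma ip_minus_left: "x \<in> X \<Longrightarrow> y \<in> X \<Longrightarrow> ip (- x) y = - ip x y"
  using ip_scaleR_left[of x y "-1"] by simp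

lemma ip_minus_right: "x \<in> X \<Longrightarrow> y \<in> X \<Longrightarrow> ip y (- x) = - ip y x"
  using ip_scaleR_right[of x y "-1"] by simp

lemma ip_diff_left: "x \<in> X \<Longrightarrow> y \<in> X \<Longrightarrow> z \<in> X \<Longrightarrow> ip (x - y) z = ip x z - ip y z"
  using ip_add_left[of x "- y" z] by (simp add: ip_minus_left)

lemma ip_diff_right: "x \<in> X \<Longrightarrow> y \<in> X \<Longrightarrow> z \<in> X \<Longrightarrow> ip z (x - y) = ip z x - ip z y"
  using ip_add_right[of x "- y" z] by (simp add: ip_minus_right)

lemmas ip_bilinear = ip_add_left ip_add_right ip_scaleR_left ip_scaleR_right ip_diff_left
  ip_diff_right ip_minus_left ip_minus_right

lemma ip_zero_left [simp]: "x \<in> X \<Longrightarrow> ip 0 x = 0"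
  using ip_scaleR_left[of 0 x 0] by simp

lemma ip_sum_left: "y \<in> X \<Longrightarrow> (\<And>i. i \<in> A \<Longrightarrow> f i \<in> X) \<Longrightarrow> ip (sum f A) y = (\<Sum>i\<in>A. ip (f i) y)"
  by (induction A rule: infinite_finite_induct) (auto simp: ip_add_left)

lemma nrm_nonneg [simp]: "x \<in> X \<Longrightarrow> 0 \<le> nrm x"
  by (simp add: nrm_def ip_nonneg)

lemma nrm_sq: "x \<in> X \<Longrightarrow> (nrm x)\<^sup>2 = ip x x"
  by (simp add: nrm_def ip_nonneg)

lemma nrm_scaleR: "x \<in> X \<Longrightarrow> nrm (c *\<^sub>R x) = \<bar>c\<bar> * nrm x"
proof -
  assume x: "x \<in> X"
  have "ip (c *\<^sub>R x) (c *\<^sub>R x) = c\<^sup>2 * ip x x"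
    using x by (simp add: ip_bilinear power2_eq_square)
  then show ?thesis by (simp add: nrm_def real_sqrt_mult)
qed

lemma nrm_minus: "x \<in> X \<Longrightarrow> nrm (- x) = nrm x"
  using nrm_scaleR[of x "-1"] by simp

lemma nrm_zero [simp]: "nrm 0 = 0"
  by (simp add: nrm_def)

lemma nrm_diff_commute: "x \<in> X \<Longrightarrow> y \<in> X \<Longrightarrow> nrm (x - y) = nrm (y - x)"
  using nrm_minus[of "x - y"] by simp

lemma Cauchy_Schwarz:
  assumes "x \<in> X" "y \<in> X"
  shows "\<bar>ip x y\<bar> \<le> nrm x * nrm y"
proof -
  have quad: "0 \<le> ip x x - 2 * s * ip x y + s\<^sup>2 * ip y y" for s
  proof -
    have "0 \<le> ip (x - s *\<^sub>R y) (x - s *\<^sub>R y)"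
      using assms by (intro ip_nonneg) auto
    also have "\<dots> = ip x x - 2 * s * ip x y + s\<^sup>2 * ip y y"
      using assms ip_commute[of x y] by (simp add: ip_bilinear power2_eq_square algebra_simps)
    finally show ?thesis .
  qed
  have "(ip x y)\<^sup>2 \<le> ip x x * ip y y"
  proof (cases "ip y y = 0")
    case True
    have "ip x y = 0"
    proof (rule ccontr)
      assume "ip x y \<noteq> 0"
      with quad[of "(ip x x + 1) / (2 * ip x y)"] True show False by (simp add: field_simps)
    qed
    then show ?thesis using True by simp
  next
    case False
    then have pos: "ip y y > 0" using ip_nonneg[OF assms(2)] by simp
    have "0 \<le> ip x x - (ip x y)\<^sup>2 / ip y y"
      using quad[of "ip x y / ip y y"] pos by (simp add: field_simps power2_eq_square)
    then show ?thesis using pos by (simp add: field_simps)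
  qed
  then have "sqrt ((ip x y)\<^sup>2) \<le> sqrt (ip x x * ip y y)" by (rule real_sqrt_le_mono)
  then show ?thesis by (simp add: nrm_def real_sqrt_mult)
qed

lemma ip_le_nrm: "x \<in> X \<Longrightarrow> y \<in> X \<Longrightarrow> ip x y \<le> nrm x * nrm y"
  using Cauchy_Schwarz[of x y] by linarith

lemma nrm_triangle: "x \<in> X \<Longrightarrow> y \<in> X \<Longrightarrow> nrm (x + y) \<le> nrm x + nrm y"
proof -
  assume xy: "x \<in> X" "y \<in> X"
  have "(nrm (x + y))\<^sup>2 \<le> (nrm x + nrm y)\<^sup>2"
    using xy ip_le_nrm[OF xy] ip_commute[OF xy] nrm_sq[OF xy(1)] nrm_sq[OF xy(2)]
    by (simp add: nrm_sq ip_bilinear power2_sum)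
  then show ?thesis by (rule power2_le_imp_le) (use xy in auto)
qed

lemma nrm_triangle_diff: "x \<in> X \<Longrightarrow> y \<in> X \<Longrightarrow> nrm (x - y) \<le> nrm x + nrm y"
  using nrm_triangle[of x "- y"] by (simp add: nrm_minus)

lemma nrm_triangle_via: "x \<in> X \<Longrightarrow> y \<in> X \<Longrightarrow> z \<in> X \<Longrightarrow> nrm (x - z) \<le> nrm (x - y) + nrm (y - z)"
  using nrm_triangle[of "x - y" "y - z"] by simp

lemma nrm_diff_ineq: "x \<in> X \<Longrightarrow> y \<in> X \<Longrightarrow> \<bar>nrm x - nrm y\<bar> \<le> nrm (x - y)"
  using nrm_triangle[of "x - y" y] nrm_triangle[of "y - x" x] nrm_diff_commute[of x y] by simp

lemma ip_null_left: "x \<in> X \<Longrightarrow> y \<in> X \<Longrightarrow> nrm x = 0 \<Longrightarrow> ip x y = 0"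
  using Cauchy_Schwarz[of x y] by simp

text \<open>
  Norm bounds are obtained by pairing an element with itself and cancelling one factor; this carries
  real-valued estimates over to functions.
\<close>

lemma nrm_le_by_duality:
  assumes "x \<in> X" "ip x x \<le> K * nrm x" "0 \<le> K"
  shows "nrm x \<le> K"
proof (rule ccontr)
  assume "\<not> nrm x \<le> K"
  with assms have "K * nrm x < nrm x * nrm x" by (intro mult_strict_right_mono) auto
  with assms show False using nrm_sq[of x] by (simp add: power2_eq_square)
qed

end

section \<open>Differentiation in time and quadrature errors\<close>

text \<open>
  \<open>w'\<close> is the derivative of \<open>w\<close> on \<open>S\<close>, one-sided at boundary points, in the sense that difference
  quotients converge in the seminorm \<open>\<nu>\<close>.
\<close>

definition deriv_in :: "('a::real_vector \<Rightarrow> real) \<Rightarrow> real set \<Rightarrow> (real \<Rightarrow> 'a) \<Rightarrow> (real \<Rightarrow> 'a) \<Rightarrow> bool" where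
  "deriv_in \<nu> S w w' \<longleftrightarrow>
     (\<forall>t\<in>S. ((\<lambda>s. \<nu> ((w s - w t) /\<^sub>R (s - t) - w' t)) \<longlongrightarrow> 0) (at t within S))"

text \<open>
  A bound on the derivative gains one power of \<open>t - a\<close> by the mean value theorem. Iterated, this yields
  Taylor estimates, with cruder constants, from derivatives that are one-sided at the end points.
\<close>

lemma derivative_bound_powers:
  fixes g g' :: "real \<Rightarrow> real"
  assumes der: "\<And>t. t \<in> {a..b} \<Longrightarrow> (g has_real_derivative g' t) (at t within {a..b})"
    and bnd: "\<And>t. t \<in> {a..b} \<Longrightarrow> \<bar>g' t\<bar> \<le> K * (t - a) ^ j"
    and t: "t \<in> {a..b}" and K: "0 \<le> K"
  shows "\<bar>g t - g a\<bar> \<le> K * (t - a) ^ Suc j"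
proof -
  have "\<exists>x\<in>{a..t}. g t - g a = (t - a) * g' x"
  proof (cases "a = t")
    case False
    then have "a < t" using t by auto
    moreover have "(g has_derivative (*) (g' x)) (at x within {a..t})" if "a \<le> x" "x \<le> t" for x
      using der[of x] that t
      by (auto simp: has_field_derivative_def intro: has_derivative_subset)
    ultimately obtain x where "x \<in> {a<..<t}" "g t - g a = g' x * (t - a)"
      using mvt_simple[of a t g "\<lambda>x. (*) (g' x)"] by auto
    then show ?thesis by (intro bexI[of _ x]) auto
  qed auto
  then obtain x where x: "x \<in> {a..t}" and eq: "g t - g a = (t - a) * g' x" by auto
  have "\<bar>g t - g a\<bar> = (t - a) * \<bar>g' x\<bar>" using eq t by (simp add: abs_mult)
  also have "\<dots> \<le> (t - a) * (K * (x - a) ^ j)"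
    using x t by (intro mult_left_mono bnd) auto
  also have "\<dots> \<le> (t - a) * (K * (t - a) ^ j)"
    using x t K by (intro mult_left_mono power_mono) auto
  finally show ?thesis by (simp add: algebra_simps)
qed

text \<open>
  The errors of the trapezoidal and the midpoint rule for \<open>\<phi>'\<close> and of the mean of the end values are
  combinations of the Taylor remainders \<open>R0\<close> and \<open>R1\<close> of \<open>\<phi>\<close> and \<open>\<phi>'\<close> at \<open>a\<close>.
\<close>

lemma quadrature_errors:
  fixes \<phi> :: "nat \<Rightarrow> real \<Rightarrow> real"
  assumes der: "\<And>j t. j < 3 \<Longrightarrow> t \<in> {a..b} \<Longrightarrow>
      (\<phi> j has_real_derivative \<phi> (Suc j) t) (at t within {a..b})"
    and K2: "\<And>t. t \<in> {a..b} \<Longrightarrow> \<bar>\<phi> 2 t\<bar> \<le> K2" and K3: "\<And>t. t \<in> {a..b} \<Longrightarrow> \<bar>\<phi> 3 t\<bar> \<le> K3"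
    and ab: "a \<le> b"
  shows "\<bar>\<phi> 0 b - \<phi> 0 a - (b - a) / 2 * (\<phi> 1 a + \<phi> 1 b)\<bar> \<le> 2 * K3 * (b - a) ^ 3" (is ?A)
    and "\<bar>\<phi> 0 b - \<phi> 0 a - (b - a) * \<phi> 1 ((a + b) / 2)\<bar> \<le> 2 * K3 * (b - a) ^ 3" (is ?B)
    and "\<bar>\<phi> 0 ((a + b) / 2) - (\<phi> 0 a + \<phi> 0 b) / 2\<bar> \<le> K2 * (b - a)\<^sup>2" (is ?C)
proof -
  define c where "c = (a + b) / 2"
  have c: "c \<in> {a..b}" "c - a = (b - a) / 2" using ab by (auto simp: c_def field_simps)
  have K: "0 \<le> K2" "0 \<le> K3" using K2[of a] K3[of a] ab by auto
  have d0: "(\<phi> 0 has_real_derivative \<phi> 1 t) (at t within {a..b})"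
    and d1: "(\<phi> 1 has_real_derivative \<phi> 2 t) (at t within {a..b})"
    and d2: "(\<phi> 2 has_real_derivative \<phi> 3 t) (at t within {a..b})" if "t \<in> {a..b}" for t
    using der[of 0 t] der[of 1 t] der[of 2 t] that by (simp_all add: eval_nat_numeral)
  define R1 where "R1 = (\<lambda>t. \<phi> 1 t - (t - a) * \<phi> 2 a)"
  define R0 where "R0 = (\<lambda>t. \<phi> 0 t - (t - a) * \<phi> 1 a - (t - a)\<^sup>2 / 2 * \<phi> 2 a)"
  have b2: "\<bar>\<phi> 2 t - \<phi> 2 a\<bar> \<le> K3 * (t - a) ^ 1" if "t \<in> {a..b}" for t
    using derivative_bound_powers[of a b "\<phi> 2" "\<phi> 3" K3 0 t] d2 K3 K that by auto
  have b1: "\<bar>R1 t - R1 a\<bar> \<le> K3 * (t - a) ^ 2" if "t \<in> {a..b}" for t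
    unfolding numeral_2_eq_2
    using that K b2
    by (intro derivative_bound_powers[of a b R1 "\<lambda>t. \<phi> 2 t - \<phi> 2 a" K3 1 t, unfolded One_nat_def])
       (auto intro!: derivative_eq_intros d1[unfolded One_nat_def] simp: R1_def)
  have b0: "\<bar>R0 t - R0 a\<bar> \<le> K3 * (t - a) ^ 3" if t: "t \<in> {a..b}" for t
  proof -
    have "(R0 has_real_derivative R1 s - R1 a) (at s within {a..b})" if "s \<in> {a..b}" for s
      unfolding R0_def R1_def using that by (auto intro!: derivative_eq_intros d0)
    then have "\<bar>R0 t - R0 a\<bar> \<le> K3 * (t - a) ^ Suc 2"
      by (rule derivative_bound_powers[OF _ b1 t K(2)])
    then show ?thesis by simp
  qed
  have b0': "\<bar>\<phi> 0 t - (t - a) * \<phi> 1 a - \<phi> 0 a\<bar> \<le> K2 * (t - a) ^ 2" if "t \<in> {a..b}" for t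
  proof -
    have *: "\<bar>\<phi> 1 t - \<phi> 1 a\<bar> \<le> K2 * (t - a) ^ 1" if "t \<in> {a..b}" for t
      using derivative_bound_powers[of a b "\<phi> 1" "\<phi> 2" K2 0 t] d1 K2 K that by auto
    define S where "S t = \<phi> 0 t - (t - a) * \<phi> 1 a" for t
    have "\<bar>S t - S a\<bar> \<le> K2 * (t - a) ^ Suc 1"
      using that K * unfolding S_def
      by (intro derivative_bound_powers[of a b _ "\<lambda>t. \<phi> 1 t - \<phi> 1 a" K2 1 t])
         (auto intro!: derivative_eq_intros d0)
    then show ?thesis by (simp add: S_def power2_eq_square)
  qed
  have b: "b \<in> {a..b}" using ab by auto
  have cube: "(b - a) * (K3 * (b - a) ^ 2) = K3 * (b - a) ^ 3"
    by (simp add: power3_eq_cube power2_eq_square)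
  have "\<phi> 0 b - \<phi> 0 a - (b - a) / 2 * (\<phi> 1 a + \<phi> 1 b) = (R0 b - R0 a) - (b - a) / 2 * (R1 b - R1 a)"
    by (simp add: R0_def R1_def field_simps power2_eq_square)
  also have "\<bar>\<dots>\<bar> \<le> \<bar>R0 b - R0 a\<bar> + (b - a) / 2 * \<bar>R1 b - R1 a\<bar>"
    using ab by (intro abs_triangle_ineq4[THEN order_trans]) (simp add: abs_mult)
  also have "\<dots> \<le> K3 * (b - a) ^ 3 + (b - a) * (K3 * (b - a) ^ 2)"
  proof -
    have "0 \<le> (b - a) * (K3 * (b - a) ^ 2)" using K ab by simp
    then show ?thesis
      using b0[OF b] mult_left_mono[OF b1[OF b], of "(b-a)/2"] ab by (simp add: field_simps)
  qed
  finally show ?A unfolding cube by simp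
  have "K3 * (c - a) ^ 2 \<le> K3 * (b - a) ^ 2"
    using c K ab by (intro mult_left_mono power_mono) auto
  then have R1c: "\<bar>R1 c - R1 a\<bar> \<le> K3 * (b - a) ^ 2" using b1[OF c(1)] by linarith
  have "\<phi> 0 b - \<phi> 0 a - (b - a) * \<phi> 1 c = (R0 b - R0 a) - (b - a) * (R1 c - R1 a)"
    unfolding R0_def R1_def c(2) by (simp add: algebra_simps power2_eq_square add_divide_distrib diff_divide_distrib)
  also have "\<bar>\<dots>\<bar> \<le> \<bar>R0 b - R0 a\<bar> + (b - a) * \<bar>R1 c - R1 a\<bar>"
    using ab by (intro abs_triangle_ineq4[THEN order_trans]) (simp add: abs_mult)
  also have "\<dots> \<le> K3 * (b - a) ^ 3 + (b - a) * (K3 * (b - a) ^ 2)"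
    using b0[OF b] mult_left_mono[OF R1c, of "b-a"] ab by simp
  finally show ?B unfolding cube c_def by simp
  have sq: "K2 * (c - a) ^ 2 \<le> K2 * (b - a) ^ 2 / 2"
  proof -
    have "K2 * (c - a) ^ 2 = K2 * (b - a) ^ 2 / 4" unfolding c(2) by (simp add: power2_eq_square)
    moreover have "0 \<le> K2 * (b - a) ^ 2" using K by simp
    ultimately show ?thesis by linarith
  qed
  have eqC: "\<phi> 0 c - (\<phi> 0 a + \<phi> 0 b) / 2
      = (\<phi> 0 c - (c - a) * \<phi> 1 a - \<phi> 0 a) - (\<phi> 0 b - (b - a) * \<phi> 1 a - \<phi> 0 a) / 2"
    unfolding c(2) by (simp add: field_simps)
  have "\<bar>\<phi> 0 c - (\<phi> 0 a + \<phi> 0 b) / 2\<bar> \<le> K2 * (b - a) ^ 2"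
  proof -
    have "\<bar>x - y / 2\<bar> \<le> q" if "\<bar>x\<bar> \<le> p" "\<bar>y\<bar> \<le> q" "p \<le> q / 2" for x y p q :: real
      using that by linarith
    from this[OF b0'[OF c(1)] b0'[OF b] sq] show ?thesis by (simp only: eqC)
  qed
  then show ?C by (simp add: c_def)
qed

context semi_inner
begin

lemma deriv_in_ip:
  assumes w: "\<And>s. s \<in> S \<Longrightarrow> w s \<in> X" "\<And>s. s \<in> S \<Longrightarrow> w' s \<in> X" and g: "g \<in> X"
    and d: "deriv_in nrm S w w'" and t: "t \<in> S"
  shows "((\<lambda>s. ip (w s) g) has_real_derivative ip (w' t) g) (at t within S)"
proof -
  have lim: "((\<lambda>s. nrm ((w s - w t) /\<^sub>R (s - t) - w' t) * nrm g) \<longlongrightarrow> 0) (at t within S)"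
    using d t unfolding deriv_in_def by (auto intro: tendsto_mult_left_zero)
  have "((\<lambda>s. (ip (w s) g - ip (w t) g) / (s - t) - ip (w' t) g) \<longlongrightarrow> 0) (at t within S)"
  proof (rule Lim_null_comparison[OF _ lim])
    show "\<forall>\<^sub>F s in at t within S. norm ((ip (w s) g - ip (w t) g) / (s - t) - ip (w' t) g)
            \<le> nrm ((w s - w t) /\<^sub>R (s - t) - w' t) * nrm g"
      unfolding eventually_at_filter
    proof (rule always_eventually, intro allI impI)
      fix s assume s: "s \<in> S"
      have "(ip (w s) g - ip (w t) g) / (s - t) - ip (w' t) g = ip ((w s - w t) /\<^sub>R (s - t) - w' t) g"
        using w s t g by (simp add: ip_bilinear divide_inverse_commute)
      then show "norm ((ip (w s) g - ip (w t) g) / (s - t) - ip (w' t) g)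
            \<le> nrm ((w s - w t) /\<^sub>R (s - t) - w' t) * nrm g"
        using w s t g by (simp add: Cauchy_Schwarz)
    qed
  qed
  then show ?thesis
    unfolding has_field_derivative_iff by (simp add: LIM_zero_iff)
qed

lemma deriv_in_subset: "deriv_in nrm S w w' \<Longrightarrow> S' \<subseteq> S \<Longrightarrow> deriv_in nrm S' w w'"
  unfolding deriv_in_def by (meson subsetD tendsto_within_subset)

text \<open>
  The mean value theorem is applied to \<open>\<langle>w(s), w(b) - w(a)\<rangle>\<close>, which pairs the path with its own increment.
\<close>

lemma increment_bound:
  assumes w: "\<And>s. s \<in> {a..b} \<Longrightarrow> w s \<in> X" "\<And>s. s \<in> {a..b} \<Longrightarrow> w' s \<in> X"
    and d: "deriv_in nrm {a..b} w w'" and K: "\<And>s. s \<in> {a..b} \<Longrightarrow> nrm (w' s) \<le> K" and ab: "a \<le> b"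
  shows "nrm (w b - w a) \<le> K * (b - a)"
proof -
  let ?g = "w b - w a"
  have g: "?g \<in> X" using w ab by auto
  have K0: "0 \<le> K" using K[of a] nrm_nonneg[OF w(2)[of a]] ab by auto
  have "\<bar>ip (w b) ?g - ip (w a) ?g\<bar> \<le> (K * nrm ?g) * (b - a) ^ Suc 0"
  proof (rule derivative_bound_powers[where b = b and g' = "\<lambda>s. ip (w' s) ?g"])
    fix t assume t: "t \<in> {a..b}"
    show "((\<lambda>s. ip (w s) ?g) has_real_derivative ip (w' t) ?g) (at t within {a..b})"
      by (rule deriv_in_ip[OF w g d t])
    have "\<bar>ip (w' t) ?g\<bar> \<le> nrm (w' t) * nrm ?g" by (rule Cauchy_Schwarz[OF w(2)[OF t] g])
    also have "\<dots> \<le> K * nrm ?g" using K[OF t] g by (intro mult_right_mono) auto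
    finally show "\<bar>ip (w' t) ?g\<bar> \<le> K * nrm ?g * (t - a) ^ 0" by simp
  qed (use ab g K0 in auto)
  then have "ip ?g ?g \<le> (K * (b - a)) * nrm ?g"
    using w ab by (simp add: ip_bilinear algebra_simps)
  then show ?thesis by (rule nrm_le_by_duality[OF g]) (use K0 ab in auto)
qed

text \<open>
  As in the previous lemma, the scalar result is applied to the pairing of \<open>w\<close> with the error that is to
  be bounded.
\<close>

lemma quadrature_errors_nrm:
  assumes w: "\<And>j s. j \<le> 3 \<Longrightarrow> s \<in> {a..b} \<Longrightarrow> w j s \<in> X"
    and d: "\<And>j. j < 3 \<Longrightarrow> deriv_in nrm {a..b} (w j) (w (Suc j))"
    and K2: "\<And>s. s \<in> {a..b} \<Longrightarrow> nrm (w 2 s) \<le> K2" and K3: "\<And>s. s \<in> {a..b} \<Longrightarrow> nrm (w 3 s) \<le> K3"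
    and ab: "a \<le> b"
  shows "nrm (w 0 b - w 0 a - ((b - a) / 2) *\<^sub>R (w 1 a + w 1 b)) \<le> 2 * K3 * (b - a) ^ 3" (is ?A)
    and "nrm (w 0 b - w 0 a - (b - a) *\<^sub>R w 1 ((a + b) / 2)) \<le> 2 * K3 * (b - a) ^ 3" (is ?B)
    and "nrm (w 0 ((a + b) / 2) - (1 / 2) *\<^sub>R (w 0 a + w 0 b)) \<le> K2 * (b - a)\<^sup>2" (is ?C)
proof -
  have c: "(a + b) / 2 \<in> {a..b}" "a \<in> {a..b}" "b \<in> {a..b}" using ab by auto
  have wX: "w 0 a \<in> X" "w 0 b \<in> X" "w 1 a \<in> X" "w 1 b \<in> X" "w 1 ((a+b)/2) \<in> X" "w 0 ((a+b)/2) \<in> X"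
    using w c by auto
  have K0: "0 \<le> K2" "0 \<le> K3"
    using K2[OF c(2)] K3[OF c(2)] nrm_nonneg[OF w[of 2, OF _ c(2)]] nrm_nonneg[OF w[of 3, OF _ c(2)]]
    by auto
  have der: "((\<lambda>s. ip (w j s) g) has_real_derivative ip (w (Suc j) t) g) (at t within {a..b})"
    if "g \<in> X" "j < 3" "t \<in> {a..b}" for g j t
    by (rule deriv_in_ip[OF _ _ that(1) d[OF that(2)] that(3)]) (use w that in auto)
  have bd: "\<bar>ip (w j t) g\<bar> \<le> K * nrm g"
    if "g \<in> X" "t \<in> {a..b}" "j \<le> 3" "nrm (w j t) \<le> K" for g j t K
    using Cauchy_Schwarz[OF w[OF that(3,2)] that(1)] mult_right_mono[OF that(4) nrm_nonneg[OF that(1)]]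
    by linarith
  note Q = quadrature_errors[of a b "\<lambda>j s. ip (w j s) g" "K2 * nrm g" "K3 * nrm g" for g,
      OF der bd bd ab, OF _ _ _ _ _ _ K2 _ _ _ K3]
  show ?A
  proof (rule nrm_le_by_duality)
    let ?g = "w 0 b - w 0 a - ((b - a) / 2) *\<^sub>R (w 1 a + w 1 b)"
    show g: "?g \<in> X" using wX by auto
    have "ip ?g ?g = ip (w 0 b) ?g - ip (w 0 a) ?g - (b - a) / 2 * (ip (w 1 a) ?g + ip (w 1 b) ?g)"
      using wX g by (subst ip_diff_left, simp, simp, simp, subst ip_diff_left, simp, simp, simp,
          subst ip_scaleR_left, simp, simp, subst ip_add_left) auto
    then show "ip ?g ?g \<le> 2 * K3 * (b - a) ^ 3 * nrm ?g"
      using Q(1)[of ?g] g by (simp add: algebra_simps)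
  qed (use K0 ab in auto)
  show ?B
  proof (rule nrm_le_by_duality)
    let ?g = "w 0 b - w 0 a - (b - a) *\<^sub>R w 1 ((a + b) / 2)"
    show g: "?g \<in> X" using wX by auto
    have "ip ?g ?g = ip (w 0 b) ?g - ip (w 0 a) ?g - (b - a) * ip (w 1 ((a+b)/2)) ?g"
      using wX g by (subst ip_diff_left, simp, simp, simp, subst ip_diff_left, simp, simp, simp,
          subst ip_scaleR_left) auto
    then show "ip ?g ?g \<le> 2 * K3 * (b - a) ^ 3 * nrm ?g"
      using Q(2)[of ?g] g by (simp add: algebra_simps)
  qed (use K0 ab in auto)
  show ?C
  proof (rule nrm_le_by_duality)
    let ?g = "w 0 ((a + b) / 2) - (1 / 2) *\<^sub>R (w 0 a + w 0 b)"
    show g: "?g \<in> X" using wX by auto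
    have "ip ?g ?g = ip (w 0 ((a+b)/2)) ?g - (ip (w 0 a) ?g + ip (w 0 b) ?g) / 2"
      using wX g by (subst ip_diff_left, simp, simp, simp,
          subst ip_scaleR_left, simp, simp, subst ip_add_left) auto
    then show "ip ?g ?g \<le> K2 * (b - a)\<^sup>2 * nrm ?g"
      using Q(3)[of ?g] g by (simp add: algebra_simps)
  qed (use K0 ab in auto)
qed

lemma nrm_tendsto:
  assumes "\<And>s. s \<in> S \<Longrightarrow> w s \<in> X" "l \<in> X" "((\<lambda>s. nrm (w s - l)) \<longlongrightarrow> 0) (at t within S)"
  shows "((\<lambda>s. nrm (w s)) \<longlongrightarrow> nrm l) (at t within S)"
proof -
  have "((\<lambda>s. nrm (w s) - nrm l) \<longlongrightarrow> 0) (at t within S)"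
    by (rule Lim_null_comparison[OF _ assms(3)])
       (use assms nrm_diff_ineq in \<open>auto simp: eventually_at_filter\<close>)
  then show ?thesis by (simp add: LIM_zero_iff)
qed

lemma ip_tendsto:
  assumes "\<And>s. s \<in> S \<Longrightarrow> w s \<in> X" "l \<in> X" "g \<in> X" "((\<lambda>s. nrm (w s - l)) \<longlongrightarrow> 0) (at t within S)"
  shows "((\<lambda>s. ip (w s) g) \<longlongrightarrow> ip l g) (at t within S)"
proof -
  have "((\<lambda>s. ip (w s) g - ip l g) \<longlongrightarrow> 0) (at t within S)"
  proof (rule Lim_null_comparison)
    show "((\<lambda>s. nrm (w s - l) * nrm g) \<longlongrightarrow> 0) (at t within S)"
      using assms(4) by (rule tendsto_mult_left_zero)
    show "\<forall>\<^sub>F s in at t within S. norm (ip (w s) g - ip l g) \<le> nrm (w s - l) * nrm g"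
      unfolding eventually_at_filter
    proof (rule always_eventually, intro allI impI)
      fix s assume "s \<in> S"
      then show "norm (ip (w s) g - ip l g) \<le> nrm (w s - l) * nrm g"
        using assms Cauchy_Schwarz[of "w s - l" g] by (simp add: ip_diff_left)
    qed
  qed
  then show ?thesis by (simp add: LIM_zero_iff)
qed

lemma continuous_imp_bounded:
  fixes w :: "real \<Rightarrow> 'a"
  assumes "\<And>s. s \<in> {a..b} \<Longrightarrow> w s \<in> X"
    and "\<And>t. t \<in> {a..b} \<Longrightarrow> ((\<lambda>s. nrm (w s - w t)) \<longlongrightarrow> 0) (at t within {a..b})"
  shows "\<exists>K. \<forall>t\<in>{a..b}. nrm (w t) \<le> K"
proof -
  have "continuous_on {a..b} (\<lambda>s. nrm (w s))"
    unfolding continuous_on_def by (intro ballI nrm_tendsto assms) auto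
  then have "bounded ((\<lambda>s. nrm (w s)) ` {a..b})"
    by (intro compact_imp_bounded compact_continuous_image compact_Icc)
  then show ?thesis unfolding bounded_iff by auto (meson abs_le_D1)
qed

end

section \<open>Finite-dimensional subspaces and duality\<close>

context semi_inner
begin

text \<open>
  A bound on the length of linearly independent families, where independence is understood up to
  elements of norm zero. The property passes to subsets and can be verified by counting coefficients.
\<close>

definition fin_dim :: "'a set \<Rightarrow> bool" where
  "fin_dim Z \<longleftrightarrow> (\<exists>m::nat. \<forall>e. (\<forall>i<m. e i \<in> Z) \<longrightarrow>
     (\<exists>a. (\<exists>i<m. a i \<noteq> 0) \<and> nrm (\<Sum>i<m. a i *\<^sub>R e i) = 0))"

lemma fin_dim_subset: "fin_dim Z \<Longrightarrow> Z' \<subseteq> Z \<Longrightarrow> fin_dim Z'"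
  unfolding fin_dim_def by (meson subsetD)

definition orthonormal :: "nat \<Rightarrow> (nat \<Rightarrow> 'a) \<Rightarrow> bool" where
  "orthonormal m e \<longleftrightarrow> (\<forall>i<m. \<forall>j<m. ip (e i) (e j) = (if i = j then 1 else 0))"

text \<open>
  An orthonormal family of maximal length exists since orthonormal families are independent. Its
  expansion recovers every element up to norm zero: otherwise the normalised remainder would extend the
  family.
\<close>

lemma orthonormal_basis:
  assumes Z: "subspace Z" "Z \<subseteq> X" and fd: "fin_dim Z"
  obtains m e where "\<And>i. i < m \<Longrightarrow> e i \<in> Z" "orthonormal m e"
    "\<And>z. z \<in> Z \<Longrightarrow> nrm (z - (\<Sum>i<m. ip z (e i) *\<^sub>R e i)) = 0"
proof -
  define P where "P m \<longleftrightarrow> (\<exists>e. (\<forall>i<m. e i \<in> Z) \<and> orthonormal m e)" for m :: nat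
  obtain M :: nat where M: "\<And>e. (\<forall>i<M. e i \<in> Z) \<Longrightarrow>
      \<exists>a. (\<exists>i<M. a i \<noteq> 0) \<and> nrm (\<Sum>i<M. a i *\<^sub>R e i) = 0"
    using fd unfolding fin_dim_def by blast
  have bound: "m < M" if Pm: "P m" for m
  proof (rule ccontr)
    assume "\<not> m < M"
    then have mM: "M \<le> m" by simp
    obtain e where e: "\<forall>i<m. e i \<in> Z" "orthonormal m e" using Pm unfolding P_def by auto
    then obtain a k where a: "k < M" "a k \<noteq> 0" "nrm (\<Sum>i<M. a i *\<^sub>R e i) = 0"
      using M[of e] mM by (meson less_le_trans)
    have eX: "e i \<in> X" if "i < M" for i using e Z mM that by auto
    have "0 = ip (\<Sum>i<M. a i *\<^sub>R e i) (e k)"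
      using a eX by (subst ip_null_left) auto
    also have "\<dots> = (\<Sum>i<M. a i * ip (e i) (e k))"
      using eX a by (subst ip_sum_left) (auto simp: ip_scaleR_left)
    also have "\<dots> = (\<Sum>i<M. if i = k then a k else 0)"
      using e(2) a mM unfolding orthonormal_def by (intro sum.cong) auto
    also have "\<dots> = a k" using a by simp
    finally show False using a by simp
  qed
  have "P 0" unfolding P_def orthonormal_def by auto
  define m where "m = Greatest P"
  have Pm: "P m" unfolding m_def
    by (rule GreatestI_nat[of P 0 M]) (use \<open>P 0\<close> bound in \<open>auto intro: less_imp_le\<close>)
  have max: "\<not> P (Suc m)"
    using Greatest_le_nat[of P "Suc m" M] bound unfolding m_def by (auto intro: less_imp_le)
  obtain e where e: "\<forall>i<m. e i \<in> Z" "orthonormal m e" using Pm unfolding P_def by auto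
  have eX: "e i \<in> X" if "i < m" for i using e Z that by auto
  have "nrm (z - (\<Sum>i<m. ip z (e i) *\<^sub>R e i)) = 0" if z: "z \<in> Z" for z
  proof (rule ccontr)
    define y where "y = z - (\<Sum>i<m. ip z (e i) *\<^sub>R e i)"
    assume "nrm (z - (\<Sum>i<m. ip z (e i) *\<^sub>R e i)) \<noteq> 0"
    then have ny: "nrm y \<noteq> 0" by (simp add: y_def)
    have yZ: "y \<in> Z" unfolding y_def
      using Z z e by (intro subspace_diff subspace_sum subspace_scale) auto
    have yX: "y \<in> X" and zX: "z \<in> X" using yZ z Z by auto
    have orth: "ip y (e j) = 0" if j: "j < m" for j
    proof -
      have "ip y (e j) = ip z (e j) - (\<Sum>i<m. ip z (e i) * ip (e i) (e j))"
      proof -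
        have "ip (\<Sum>i<m. ip z (e i) *\<^sub>R e i) (e j) = (\<Sum>i<m. ip (ip z (e i) *\<^sub>R e i) (e j))"
          using eX j by (intro ip_sum_left) auto
        also have "\<dots> = (\<Sum>i<m. ip z (e i) * ip (e i) (e j))"
          using eX j by (intro sum.cong) (auto simp: ip_scaleR_left)
        finally show ?thesis unfolding y_def using zX eX j by (subst ip_diff_left) auto
      qed
      also have "(\<Sum>i<m. ip z (e i) * ip (e i) (e j)) = (\<Sum>i<m. if i = j then ip z (e j) else 0)"
        using e(2) j unfolding orthonormal_def by (intro sum.cong) auto
      also have "\<dots> = ip z (e j)" using j by simp
      finally show ?thesis by simp
    qed
    define e' where "e' = e(m := (1 / nrm y) *\<^sub>R y)"
    have "ip y y = nrm y * nrm y" using nrm_sq[OF yX] by (simp add: power2_eq_square)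
    then have n1: "ip (e' m) (e' m) = 1"
      using yX ny by (simp add: e'_def ip_scaleR_left ip_scaleR_right)
    have "orthonormal (Suc m) e'"
      unfolding orthonormal_def
    proof (intro allI impI)
      fix i j assume ij: "i < Suc m" "j < Suc m"
      consider "i < m" "j < m" | "i = m" "j < m" | "i < m" "j = m" | "i = m" "j = m"
        using ij by linarith
      then show "ip (e' i) (e' j) = (if i = j then 1 else 0)"
      proof cases
        case 1 then show ?thesis using e(2) by (auto simp: orthonormal_def e'_def)
      next
        case 2 then show ?thesis using orth eX yX by (auto simp: e'_def ip_scaleR_left)
      next
        case 3
        then have "ip (e i) y = 0" using orth[of i] ip_commute[OF yX eX[of i]] by simp
        then show ?thesis using 3 eX yX by (auto simp: e'_def ip_scaleR_right)
      next
        case 4 then show ?thesis using n1 by simp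
      qed
    qed
    moreover have "\<forall>i<Suc m. e' i \<in> Z"
      using e yZ Z by (auto simp: e'_def less_Suc_eq intro: subspace_scale)
    ultimately show False using max unfolding P_def by blast
  qed
  then show ?thesis using e that by blast
qed

text \<open>
  The representing element is \<open>\<Sum>\<^sub>i fl(e\<^sub>i) e\<^sub>i\<close> for an orthonormal basis \<open>e\<close>. Boundedness of \<open>fl\<close> makes it vanish
  on elements of norm zero, hence it only sees the expansion.
\<close>

lemma Riesz_fin_dim:
  assumes Z: "subspace Z" "Z \<subseteq> X" "fin_dim Z"
    and add: "\<And>x y. x \<in> Z \<Longrightarrow> y \<in> Z \<Longrightarrow> fl (x + y) = fl x + fl y"
    and scale: "\<And>c x. x \<in> Z \<Longrightarrow> fl (c *\<^sub>R x) = c * fl x"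
    and bd: "\<And>x. x \<in> Z \<Longrightarrow> \<bar>fl x\<bar> \<le> K * nrm x"
  obtains w where "w \<in> Z" "\<And>z. z \<in> Z \<Longrightarrow> ip w z = fl z"
proof -
  obtain m e where e: "\<And>i. i < m \<Longrightarrow> e i \<in> Z" "orthonormal m e"
    "\<And>z. z \<in> Z \<Longrightarrow> nrm (z - (\<Sum>i<m. ip z (e i) *\<^sub>R e i)) = 0"
    using orthonormal_basis[OF Z] by blast
  have eX: "e i \<in> X" if "i < m" for i using e Z that by auto
  have l0: "fl 0 = 0" using scale[of 0 0] Z(1) by (simp add: subspace_0)
  define w where "w = (\<Sum>i<m. fl (e i) *\<^sub>R e i)"
  have wZ: "w \<in> Z" unfolding w_def using Z(1) e(1) by (intro subspace_sum subspace_scale) auto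
  have "ip w z = fl z" if z: "z \<in> Z" for z
  proof -
    define y where "y = (\<Sum>i<m. ip z (e i) *\<^sub>R e i)"
    have yZ: "y \<in> Z" unfolding y_def using Z(1) e(1) by (intro subspace_sum subspace_scale) auto
    have zyZ: "z - y \<in> Z" using Z(1) z yZ by (intro subspace_diff) auto
    have lsum: "fl (\<Sum>i\<in>A. c i *\<^sub>R e i) = (\<Sum>i\<in>A. c i * fl (e i))"
      if "A \<subseteq> {..<m}" for A and c :: "nat \<Rightarrow> real"
      using finite_subset[OF that finite_lessThan] that
    proof (induction A rule: finite_induct)
      case (insert x A)
      have "(\<Sum>i\<in>A. c i *\<^sub>R e i) \<in> Z"
        using Z(1) e(1) insert by (intro subspace_sum subspace_scale) auto
      then show ?case using insert e(1) Z(1) by (simp add: add scale subspace_scale)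
    qed (simp add: l0)
    have "\<bar>fl (z - y)\<bar> \<le> K * nrm (z - y)" by (rule bd[OF zyZ])
    then have "fl (z - y) = 0" using e(3)[OF z] by (simp add: y_def)
    moreover have "fl ((z - y) + y) = fl (z - y) + fl y" by (rule add[OF zyZ yZ])
    ultimately have "fl z = fl y" by simp
    also have "\<dots> = (\<Sum>i<m. ip z (e i) * fl (e i))" unfolding y_def by (rule lsum) simp
    also have "\<dots> = (\<Sum>i<m. fl (e i) * ip (e i) z)"
      using z Z eX by (intro sum.cong refl) (simp add: ip_commute subset_iff)
    also have "\<dots> = ip w z"
      unfolding w_def using z Z eX by (subst ip_sum_left) (auto simp: ip_scaleR_left subset_iff)
    finally show ?thesis by simp
  qed
  then show ?thesis using that wZ by blast
qed

end

section \<open>The discrete Stokes problem\<close>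

text \<open>
  The velocity space carries the inner product \<open>ip\<close>, the pressure space \<open>iq\<close>, and \<open>b\<close> is the divergence
  form. The inf-sup condition is stated in dual form: \<open>\<beta>\<close> times the norm of \<open>q\<close> is at most any bound for the
  functional \<open>b(\<cdot>, q)\<close> on the discrete velocities.
\<close>

locale discrete_stokes = X: semi_inner X ip + Q: semi_inner Q iq
  for X :: "'a::real_vector set" and ip and Q :: "'b::real_vector set" and iq +
  fixes b :: "'a \<Rightarrow> 'b \<Rightarrow> real" and cb :: real and Vh :: "'a set" and Qh :: "'b set" and \<beta> :: real
  assumes b_add_left: "\<And>x y q. x \<in> X \<Longrightarrow> y \<in> X \<Longrightarrow> q \<in> Q \<Longrightarrow> b (x + y) q = b x q + b y q"
    and b_scaleR_left: "\<And>c x q. x \<in> X \<Longrightarrow> q \<in> Q \<Longrightarrow> b (c *\<^sub>R x) q = c * b x q"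
    and b_add_right: "\<And>x p q. x \<in> X \<Longrightarrow> p \<in> Q \<Longrightarrow> q \<in> Q \<Longrightarrow> b x (p + q) = b x p + b x q"
    and b_scaleR_right: "\<And>c x q. x \<in> X \<Longrightarrow> q \<in> Q \<Longrightarrow> b x (c *\<^sub>R q) = c * b x q"
    and b_bound: "\<And>x q. x \<in> X \<Longrightarrow> q \<in> Q \<Longrightarrow> \<bar>b x q\<bar> \<le> cb * X.nrm x * Q.nrm q"
    and cb: "0 \<le> cb"
    and Vh: "subspace Vh" "Vh \<subseteq> X" "X.fin_dim Vh"
    and Qh: "subspace Qh" "Qh \<subseteq> Q"
    and \<beta>: "0 < \<beta>"
    and inf_sup: "\<And>q c. q \<in> Qh \<Longrightarrow> 0 \<le> c \<Longrightarrow> (\<And>v. v \<in> Vh \<Longrightarrow> \<bar>b v q\<bar> \<le> c * X.nrm v) \<Longrightarrow> \<beta> * Q.nrm q \<le> c"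
begin

definition Zh :: "'a set" where "Zh = {v \<in> Vh. \<forall>q\<in>Qh. b v q = 0}"

lemma b_diff_left: "x \<in> X \<Longrightarrow> y \<in> X \<Longrightarrow> q \<in> Q \<Longrightarrow> b (x - y) q = b x q - b y q"
  using b_add_left[of x "-1 *\<^sub>R y" q] b_scaleR_left[of y q "-1"] by simp

lemma b_diff_right: "x \<in> X \<Longrightarrow> p \<in> Q \<Longrightarrow> q \<in> Q \<Longrightarrow> b x (p - q) = b x p - b x q"
  using b_add_right[of x p "-1 *\<^sub>R q"] b_scaleR_right[of x q "-1"] by simp

lemma VhX: "v \<in> Vh \<Longrightarrow> v \<in> X" using Vh by auto
lemma QhQ: "q \<in> Qh \<Longrightarrow> q \<in> Q" using Qh by auto

lemma subspace_Zh: "subspace Zh"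
  unfolding subspace_def Zh_def
proof (intro conjI ballI allI; clarsimp)
  show "0 \<in> Vh \<and> (\<forall>q\<in>Qh. b 0 q = 0)"
    using Vh(1) b_scaleR_left[of 0 _ 0] QhQ by (auto simp: subspace_0)
next
  fix x y assume "x \<in> Vh" "\<forall>q\<in>Qh. b x q = 0" "y \<in> Vh" "\<forall>q\<in>Qh. b y q = 0"
  then show "x + y \<in> Vh \<and> (\<forall>q\<in>Qh. b (x + y) q = 0)"
    using Vh(1) VhX QhQ by (auto simp: subspace_add b_add_left)
next
  fix x c assume "x \<in> Vh" "\<forall>q\<in>Qh. b x q = 0"
  then show "c *\<^sub>R x \<in> Vh \<and> (\<forall>q\<in>Qh. b (c *\<^sub>R x) q = 0)"
    using Vh(1) VhX QhQ by (auto simp: subspace_scale b_scaleR_left)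
qed

lemma ZhX: "Zh \<subseteq> X" using Vh by (auto simp: Zh_def)

lemma fin_dim_Zh: "X.fin_dim Zh"
  by (rule X.fin_dim_subset[OF Vh(3)]) (auto simp: Zh_def)

text \<open>
  Let \<open>R\<close> be the set of the discrete velocities representing the functionals \<open>b(\<cdot>, q)\<close>. It is the orthogonal
  complement of the kernel \<open>Zh\<close>: for the projection \<open>y\<close> of \<open>i\<close> onto \<open>R\<close>, the remainder \<open>w = i - y\<close> is
  orthogonal to all representatives, that is \<open>b(w, q') = 0\<close>. The correction \<open>y\<close> is small because the
  pressure \<open>q\<close> behind it is bounded by \<open>y\<close> through the inf-sup condition, while
  \<open>\<langle>y, y\<rangle> = b(i, q) = b(i - u, q)\<close> as \<open>u\<close> is discretely divergence-free.
\<close>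

lemma kernel_approximation:
  assumes u: "u \<in> X" "\<And>q. q \<in> Qh \<Longrightarrow> b u q = 0" and i: "i \<in> Vh"
  obtains w where "w \<in> Zh" "X.nrm (u - w) \<le> (1 + cb / \<beta>) * X.nrm (u - i)"
proof -
  define R where "R = {y \<in> Vh. \<exists>q\<in>Qh. \<forall>v\<in>Vh. ip y v = b v q}"
  have R: "subspace R"
    unfolding subspace_def R_def
  proof (intro conjI ballI allI; clarsimp)
    show "0 \<in> Vh \<and> (\<exists>q\<in>Qh. \<forall>v\<in>Vh. ip 0 v = b v q)"
      using Vh(1) Qh(1) VhX b_scaleR_right[of _ 0 0]
      by (auto simp: subspace_0 intro!: bexI[of _ 0])
  next
    fix x y p q assume h: "x \<in> Vh" "y \<in> Vh" "p \<in> Qh" "q \<in> Qh" "\<forall>v\<in>Vh. ip x v = b v p" "\<forall>v\<in>Vh. ip y v = b v q"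
    then show "x + y \<in> Vh \<and> (\<exists>q\<in>Qh. \<forall>v\<in>Vh. ip (x + y) v = b v q)"
      using Vh(1) Qh(1) VhX QhQ
      by (auto simp: subspace_add b_add_right X.ip_add_left intro!: bexI[of _ "p + q"])
  next
    fix x c q assume h: "x \<in> Vh" "q \<in> Qh" "\<forall>v\<in>Vh. ip x v = b v q"
    then show "c *\<^sub>R x \<in> Vh \<and> (\<exists>q\<in>Qh. \<forall>v\<in>Vh. ip (c *\<^sub>R x) v = b v q)"
      using Vh(1) Qh(1) VhX QhQ
      by (auto simp: subspace_scale b_scaleR_right X.ip_scaleR_left intro!: bexI[of _ "c *\<^sub>R q"])
  qed
  have RX: "R \<subseteq> X" "R \<subseteq> Vh" using Vh by (auto simp: R_def)
  have iX: "i \<in> X" using i VhX by auto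
  obtain y where y: "y \<in> R" "\<And>z. z \<in> R \<Longrightarrow> ip y z = ip i z"
  proof (rule X.Riesz_fin_dim[OF R RX(1), of "\<lambda>z. ip i z" "X.nrm i"])
    show "X.fin_dim R" by (rule X.fin_dim_subset[OF Vh(3) RX(2)])
  qed (use RX iX in \<open>auto simp: X.ip_add_right X.ip_scaleR_right X.Cauchy_Schwarz subset_iff\<close>)
  then obtain q where q: "q \<in> Qh" "\<And>v. v \<in> Vh \<Longrightarrow> ip y v = b v q" by (auto simp: R_def)
  have yX: "y \<in> X" "y \<in> Vh" using y RX by auto
  define w where "w = i - y"
  have wV: "w \<in> Vh" using Vh(1) i yX by (auto simp: w_def subspace_diff)
  have wX: "w \<in> X" using wV VhX by auto
  have bw: "b w q' = 0" if q': "q' \<in> Qh" for q'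
  proof -
    obtain g where g: "g \<in> Vh" "\<And>v. v \<in> Vh \<Longrightarrow> ip g v = b v q'"
    proof (rule X.Riesz_fin_dim[OF Vh, of "\<lambda>v. b v q'" "cb * Q.nrm q'"])
      show "\<bar>b x q'\<bar> \<le> cb * Q.nrm q' * X.nrm x" if "x \<in> Vh" for x
        using b_bound[OF VhX[OF that] QhQ[OF q']] by (simp add: mult_ac)
    qed (use VhX QhQ q' in \<open>auto simp: b_add_left b_scaleR_left\<close>)
    have gR: "g \<in> R" using g q' by (auto simp: R_def)
    then have gX: "g \<in> X" using RX by auto
    have "b w q' = ip g w" using g wV by simp
    also have "\<dots> = ip w g" using gX wX by (simp add: X.ip_commute)
    also have "\<dots> = 0" using y(2)[OF gR] gX iX yX by (simp add: w_def X.ip_diff_left)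
    finally show ?thesis .
  qed
  have wZ: "w \<in> Zh" using wV bw by (auto simp: Zh_def)
  have qy: "\<beta> * Q.nrm q \<le> X.nrm y"
  proof (rule inf_sup[OF q(1)])
    fix v assume v: "v \<in> Vh"
    show "\<bar>b v q\<bar> \<le> X.nrm y * X.nrm v"
      using q(2)[OF v] X.Cauchy_Schwarz[OF yX(1) VhX[OF v]] by simp
  qed (use yX in auto)
  have uiX: "i - u \<in> X" using u iX by auto
  have "ip y y = b i q - b w q"
    using q(2)[OF yX(2)] iX wX QhQ[OF q(1)] b_diff_left[of i w q] by (simp add: w_def)
  also have "\<dots> = b (i - u) q" using bw[OF q(1)] u q iX QhQ by (simp add: b_diff_left)
  also have "\<dots> \<le> cb * X.nrm (i - u) * Q.nrm q"
    using b_bound[OF uiX QhQ[OF q(1)]] by simp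
  also have "\<dots> \<le> cb * X.nrm (i - u) * (X.nrm y / \<beta>)"
    using qy \<beta> cb uiX by (intro mult_left_mono mult_nonneg_nonneg) (auto simp: field_simps)
  also have "\<dots> = (cb / \<beta> * X.nrm (u - i)) * X.nrm y"
    using u iX by (simp add: X.nrm_diff_commute)
  finally have ny: "X.nrm y \<le> cb / \<beta> * X.nrm (u - i)"
    by (rule X.nrm_le_by_duality[OF yX(1)]) (use cb \<beta> u iX in auto)
  have "u - w = (u - i) + y" by (simp add: w_def algebra_simps)
  then have "X.nrm (u - w) = X.nrm ((u - i) + y)" by (rule arg_cong)
  then have "X.nrm (u - w) \<le> X.nrm (u - i) + X.nrm y"
    using X.nrm_triangle[of "u - i" y] u iX yX by auto
  then show ?thesis using ny by (intro that[OF wZ]) (simp add: algebra_simps)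
qed

text \<open>
  The projection of a velocity-pressure pair onto the discretely divergence-free velocities: it satisfies
  the same variational equation as \<open>(u, p)\<close>, restricted to \<open>Zh\<close>.
\<close>

definition ritz :: "'a \<Rightarrow> 'b \<Rightarrow> 'a \<Rightarrow> bool" where
  "ritz u p W \<longleftrightarrow> W \<in> Zh \<and> (\<forall>v\<in>Zh. ip W v = ip u v - b v p)"

lemma ritz_exists:
  assumes "u \<in> X" "p \<in> Q"
  shows "\<exists>W. ritz u p W"
proof -
  obtain W where "W \<in> Zh" "\<And>v. v \<in> Zh \<Longrightarrow> ip W v = ip u v - b v p"
  proof (rule X.Riesz_fin_dim[OF subspace_Zh ZhX fin_dim_Zh, of "\<lambda>v. ip u v - b v p" "X.nrm u + cb * Q.nrm p"])
    fix x assume x: "x \<in> Zh"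
    then have "x \<in> X" using ZhX by auto
    then show "\<bar>ip u x - b x p\<bar> \<le> (X.nrm u + cb * Q.nrm p) * X.nrm x"
      using X.Cauchy_Schwarz[of u x] b_bound[of x p] assms by (simp add: algebra_simps)
  qed (use ZhX assms in \<open>auto simp: X.ip_add_right X.ip_scaleR_right b_add_left b_scaleR_left subset_iff algebra_simps\<close>)
  then show ?thesis by (auto simp: ritz_def)
qed

lemma ritz_diff:
  assumes "ritz u p W" "ritz u' p' W'" "u \<in> X" "u' \<in> X" "p \<in> Q" "p' \<in> Q"
  shows "ritz (u - u') (p - p') (W - W')"
  using assms ZhX subspace_diff[OF subspace_Zh]
  by (auto simp: ritz_def X.ip_diff_left b_diff_right subset_iff)

text \<open>
  On \<open>Zh\<close> the pressure \<open>p\<close> may be replaced by \<open>p - q\<close> with any discrete \<open>q\<close>, so that \<open>W\<close> is almost the best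
  approximation of \<open>u\<close> in \<open>Zh\<close>, up to the approximation error of the pressure.
\<close>

lemma ritz_error:
  assumes W: "ritz u p W" and u: "u \<in> X" "\<And>q. q \<in> Qh \<Longrightarrow> b u q = 0" and p: "p \<in> Q"
    and i: "i \<in> Vh" and q: "q \<in> Qh"
  shows "X.nrm (u - W) \<le> 2 * (1 + cb / \<beta>) * X.nrm (u - i) + cb * Q.nrm (p - q)"
proof -
  obtain w where w: "w \<in> Zh" "X.nrm (u - w) \<le> (1 + cb / \<beta>) * X.nrm (u - i)"
    using kernel_approximation[OF u i] by blast
  have WZ: "W \<in> Zh" using W by (simp add: ritz_def)
  define d where "d = w - W"
  have dZ: "d \<in> Zh" unfolding d_def by (rule subspace_diff[OF subspace_Zh w(1) WZ])
  have X: "w \<in> X" "W \<in> X" "d \<in> X" using w WZ dZ ZhX by auto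
  have qQ: "q \<in> Q" using q QhQ by auto
  have "ip W d = ip u d - b d p" using W dZ by (auto simp: ritz_def)
  moreover have "b d q = 0" using dZ q by (auto simp: Zh_def)
  ultimately have "ip d d = ip (w - u) d + b d (p - q)"
    using X u(1) p qQ by (simp add: b_diff_right X.ip_diff_left d_def)
  also have "\<dots> \<le> X.nrm (w - u) * X.nrm d + cb * X.nrm d * Q.nrm (p - q)"
    using X u(1) p qQ X.Cauchy_Schwarz[of "w - u" d] b_bound[of d "p - q"] by fastforce
  also have "\<dots> = (X.nrm (u - w) + cb * Q.nrm (p - q)) * X.nrm d"
    using X u(1) by (simp add: X.nrm_diff_commute algebra_simps)
  finally have "X.nrm d \<le> X.nrm (u - w) + cb * Q.nrm (p - q)"
    by (rule X.nrm_le_by_duality[OF X(3)]) (use X u cb p qQ in auto)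
  moreover have "X.nrm (u - W) \<le> X.nrm (u - w) + X.nrm d"
    unfolding d_def using X u(1) by (intro X.nrm_triangle_via) auto
  moreover have "2 * (1 + cb / \<beta>) * X.nrm (u - i) = 2 * ((1 + cb / \<beta>) * X.nrm (u - i))" by simp
  ultimately show ?thesis using w(2) by linarith
qed

end

section \<open>Energy estimates for the Crank-Nicolson recursion\<close>

lemma nonneg_recursion_bound:
  fixes x y :: "nat \<Rightarrow> real"
  assumes "\<And>m. m \<in> {1..n} \<Longrightarrow> x m \<le> x (m - 1) + y m"
  shows "x n \<le> x 0 + (\<Sum>m=1..n. y m)"
  using assms
proof (induction n)
  case (Suc n)
  then have "x n \<le> x 0 + (\<Sum>m=1..n. y m)" by auto
  then show ?case using Suc.prems[of "Suc n"] by simp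
qed simp

text \<open>
  The recursion is demanded only for the two test functions of the energy method, the increment and the
  mean of consecutive values. The right-hand side \<open>g\<close> lies in the larger space \<open>Y\<close>, since it contains time
  derivatives that are only known to be square integrable.
\<close>

locale crank_nicolson = L: semi_inner Y m + A: semi_inner X a
  for Y X :: "'a::real_vector set" and m a +
  fixes \<Theta> :: "nat \<Rightarrow> 'a" and g :: "nat \<Rightarrow> 'a" and \<tau> :: "nat \<Rightarrow> real" and N :: nat
  assumes XY: "X \<subseteq> Y"
    and \<Theta>: "\<And>n. n \<le> N \<Longrightarrow> \<Theta> n \<in> X" and g: "\<And>n. n \<in> {1..N} \<Longrightarrow> g n \<in> Y"
    and \<tau>: "\<And>n. n \<in> {1..N} \<Longrightarrow> 0 < \<tau> n"
    and step_diff: "\<And>n. n \<in> {1..N} \<Longrightarrow>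
       m ((1 / \<tau> n) *\<^sub>R (\<Theta> n - \<Theta> (n - 1))) (\<Theta> n - \<Theta> (n - 1))
         + a ((1 / 2) *\<^sub>R (\<Theta> n + \<Theta> (n - 1))) (\<Theta> n - \<Theta> (n - 1)) = m (g n) (\<Theta> n - \<Theta> (n - 1))"
    and step_mean: "\<And>n. n \<in> {1..N} \<Longrightarrow>
       m ((1 / \<tau> n) *\<^sub>R (\<Theta> n - \<Theta> (n - 1))) ((1 / 2) *\<^sub>R (\<Theta> n + \<Theta> (n - 1)))
         + a ((1 / 2) *\<^sub>R (\<Theta> n + \<Theta> (n - 1))) ((1 / 2) *\<^sub>R (\<Theta> n + \<Theta> (n - 1)))
         = m (g n) ((1 / 2) *\<^sub>R (\<Theta> n + \<Theta> (n - 1)))"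
begin

definition D :: "nat \<Rightarrow> 'a" where "D n = (1 / \<tau> n) *\<^sub>R (\<Theta> n - \<Theta> (n - 1))"
definition M :: "nat \<Rightarrow> 'a" where "M n = (1 / 2) *\<^sub>R (\<Theta> n + \<Theta> (n - 1))"

lemma members:
  assumes "n \<in> {1..N}"
  shows "\<Theta> n \<in> X" "\<Theta> (n - 1) \<in> X" "\<Theta> n \<in> Y" "\<Theta> (n - 1) \<in> Y" "D n \<in> Y" "M n \<in> X" "M n \<in> Y"
proof -
  show 1: "\<Theta> n \<in> X" "\<Theta> (n - 1) \<in> X" using \<Theta> assms by auto
  then show 2: "\<Theta> n \<in> Y" "\<Theta> (n - 1) \<in> Y" using XY by auto
  show "D n \<in> Y" "M n \<in> X" "M n \<in> Y" using 1 2 by (auto simp: D_def M_def)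
qed

text \<open>
  Tested with the increment, the \<open>a\<close>-term becomes half the difference of the squared norms of
  consecutive values, and Young's inequality lets the difference quotient absorb half of the right-hand
  side.
\<close>

lemma gradient_step:
  assumes n: "n \<in> {1..N}"
  shows "(A.nrm (\<Theta> n))\<^sup>2 + \<tau> n * (L.nrm (D n))\<^sup>2
     \<le> (A.nrm (\<Theta> (n - 1)))\<^sup>2 + \<tau> n * (L.nrm (g n))\<^sup>2"
proof -
  note mem = members[OF n] and t = \<tau>[OF n]
  have eq: "\<Theta> n - \<Theta> (n - 1) = \<tau> n *\<^sub>R D n" using t by (simp add: D_def)
  have 1: "m (D n) (\<tau> n *\<^sub>R D n) = \<tau> n * (L.nrm (D n))\<^sup>2"
    using mem by (simp add: L.ip_scaleR_right L.nrm_sq)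
  have 2: "a (M n) (\<Theta> n - \<Theta> (n - 1)) = ((A.nrm (\<Theta> n))\<^sup>2 - (A.nrm (\<Theta> (n - 1)))\<^sup>2) / 2"
    using mem A.ip_commute[of "\<Theta> n" "\<Theta> (n - 1)"]
    by (simp add: M_def A.ip_bilinear A.nrm_sq) (simp add: field_simps)
  have "m (g n) (\<tau> n *\<^sub>R D n) \<le> \<tau> n * (L.nrm (g n) * L.nrm (D n))"
    using mem g[OF n] t by (simp add: L.ip_scaleR_right L.ip_le_nrm)
  also have "\<dots> \<le> \<tau> n * (((L.nrm (g n))\<^sup>2 + (L.nrm (D n))\<^sup>2) / 2)"
    using t sum_squares_bound[of "L.nrm (g n)" "L.nrm (D n)"] by (intro mult_left_mono) auto
  finally have 3: "m (g n) (\<tau> n *\<^sub>R D n) \<le> \<tau> n * (((L.nrm (g n))\<^sup>2 + (L.nrm (D n))\<^sup>2) / 2)" .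
  have "m (D n) (\<tau> n *\<^sub>R D n) + a (M n) (\<Theta> n - \<Theta> (n - 1)) = m (g n) (\<tau> n *\<^sub>R D n)"
    using step_diff[OF n] by (simp add: M_def flip: eq) (simp add: D_def)
  then show ?thesis using 1 2 3 by (simp add: field_simps)
qed

theorem gradient_estimate:
  assumes n: "n \<le> N"
  shows "(A.nrm (\<Theta> n))\<^sup>2 + (\<Sum>k=1..n. \<tau> k * (L.nrm (D k))\<^sup>2)
     \<le> (A.nrm (\<Theta> 0))\<^sup>2 + (\<Sum>k=1..n. \<tau> k * (L.nrm (g k))\<^sup>2)"
proof -
  have "(A.nrm (\<Theta> n))\<^sup>2 \<le> (A.nrm (\<Theta> 0))\<^sup>2
      + (\<Sum>k=1..n. \<tau> k * (L.nrm (g k))\<^sup>2 - \<tau> k * (L.nrm (D k))\<^sup>2)"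
    by (rule nonneg_recursion_bound[of n "\<lambda>k. (A.nrm (\<Theta> k))\<^sup>2"]) (use gradient_step n in force)
  then show ?thesis by (simp add: sum_subtractf)
qed

lemma mean_step:
  assumes n: "n \<in> {1..N}"
  shows "(L.nrm (\<Theta> n))\<^sup>2 + 2 * \<tau> n * (A.nrm (M n))\<^sup>2
     = (L.nrm (\<Theta> (n - 1)))\<^sup>2 + 2 * \<tau> n * m (g n) (M n)"
proof -
  note mem = members[OF n] and t = \<tau>[OF n]
  have 2: "\<tau> n * m (D n) (M n) = ((L.nrm (\<Theta> n))\<^sup>2 - (L.nrm (\<Theta> (n - 1)))\<^sup>2) / 2"
    using mem t L.ip_commute[of "\<Theta> n" "\<Theta> (n - 1)"]
    by (simp add: M_def D_def L.ip_bilinear L.nrm_sq) (simp add: field_simps)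
  have "m (D n) (M n) + (A.nrm (M n))\<^sup>2 = m (g n) (M n)"
    using step_mean[OF n] unfolding A.nrm_sq[OF mem(6)] unfolding M_def D_def .
  then have "\<tau> n * m (D n) (M n) + \<tau> n * (A.nrm (M n))\<^sup>2 = \<tau> n * m (g n) (M n)"
    by (metis distrib_left)
  then show ?thesis using 2 by (simp add: field_simps)
qed

text \<open>
  After testing with the mean, the difference of squares factors, and the common factor
  \<open>\<parallel>\<Theta>\<^sub>k\<parallel> + \<parallel>\<Theta>\<^sub>k\<^sub>-\<^sub>1\<parallel>\<close> cancels against the bound of the right-hand side.
\<close>

lemma L_bound:
  assumes n: "n \<le> N"
  shows "L.nrm (\<Theta> n) \<le> L.nrm (\<Theta> 0) + (\<Sum>k=1..n. \<tau> k * L.nrm (g k))"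
proof (rule nonneg_recursion_bound)
  fix k assume "k \<in> {1..n}"
  then have k: "k \<in> {1..N}" using n by auto
  note mem = members[OF k] and t = \<tau>[OF k]
  let ?p = "L.nrm (\<Theta> k)" and ?q = "L.nrm (\<Theta> (k - 1))"
  have nn: "0 \<le> ?p" "0 \<le> ?q" "0 \<le> L.nrm (g k)" using mem g[OF k] by auto
  have "m (g k) (M k) \<le> L.nrm (g k) * L.nrm (M k)" using mem g[OF k] by (intro L.ip_le_nrm)
  also have "L.nrm (M k) \<le> (?p + ?q) / 2"
    using mem L.nrm_triangle[of "\<Theta> k" "\<Theta> (k - 1)"] by (simp add: M_def L.nrm_scaleR)
  finally have "m (g k) (M k) \<le> L.nrm (g k) * ((?p + ?q) / 2)" using nn by (simp add: mult_left_mono)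
  then have "2 * \<tau> k * m (g k) (M k) \<le> 2 * \<tau> k * (L.nrm (g k) * ((?p + ?q) / 2))"
    using t by (intro mult_left_mono) auto
  moreover have "0 \<le> 2 * \<tau> k * (A.nrm (M k))\<^sup>2" using t by simp
  ultimately have "?p\<^sup>2 - ?q\<^sup>2 \<le> \<tau> k * L.nrm (g k) * (?p + ?q)"
    using mean_step[OF k] by (simp add: algebra_simps)
  then have *: "(?p - ?q) * (?p + ?q) \<le> (\<tau> k * L.nrm (g k)) * (?p + ?q)"
    by (simp add: power2_eq_square algebra_simps)
  show "?p \<le> ?q + \<tau> k * L.nrm (g k)"
  proof (cases "?p + ?q = 0")
    case True
    have "0 \<le> \<tau> k * L.nrm (g k)" using nn t by simp
    then show ?thesis using True nn by linarith
  next
    case False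
    then have "0 < ?p + ?q" using nn by linarith
    with * have "?p - ?q \<le> \<tau> k * L.nrm (g k)" by (meson mult_le_cancel_right_pos)
    then show ?thesis by simp
  qed
qed

text \<open>
  All values are bounded by \<open>S\<close>, the initial value plus the accumulated right-hand sides. Inserting this
  bound into the summed energy identity costs \<open>S\<^sup>2 + 2S\<^sup>2\<close>.
\<close>

theorem L_estimate:
  assumes n: "n \<le> N"
  shows "(L.nrm (\<Theta> n))\<^sup>2 + (\<Sum>k=1..n. \<tau> k * (A.nrm (M k))\<^sup>2)
     \<le> 3 * (L.nrm (\<Theta> 0) + (\<Sum>k=1..n. \<tau> k * L.nrm (g k)))\<^sup>2"
proof -
  define S where "S = L.nrm (\<Theta> 0) + (\<Sum>k=1..n. \<tau> k * L.nrm (g k))"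
  have gk: "0 \<le> \<tau> k * L.nrm (g k)" if "k \<in> {1..N}" for k
    using \<tau>[OF that] g[OF that] by simp
  have T0: "0 \<le> L.nrm (\<Theta> 0)" using \<Theta>[of 0] XY by auto
  have bd: "L.nrm (\<Theta> k) \<le> S" if "k \<le> n" for k
  proof -
    have "(\<Sum>k=1..k. \<tau> k * L.nrm (g k)) \<le> (\<Sum>k=1..n. \<tau> k * L.nrm (g k))"
      using that n gk by (intro sum_mono2) auto
    then show ?thesis using L_bound[of k] that n unfolding S_def by linarith
  qed
  have S0: "0 \<le> S" using bd[of 0] T0 by simp
  have "(L.nrm (\<Theta> n))\<^sup>2 \<le> (L.nrm (\<Theta> 0))\<^sup>2
      + (\<Sum>k=1..n. 2 * (\<tau> k * L.nrm (g k)) * S - 2 * (\<tau> k * (A.nrm (M k))\<^sup>2))"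
  proof (rule nonneg_recursion_bound[of n "\<lambda>k. (L.nrm (\<Theta> k))\<^sup>2"])
    fix k assume kn: "k \<in> {1..n}"
    then have k: "k \<in> {1..N}" using n by auto
    note mem = members[OF k] and t = \<tau>[OF k]
    have "m (g k) (M k) \<le> L.nrm (g k) * L.nrm (M k)" using mem g[OF k] by (intro L.ip_le_nrm)
    also have "\<dots> \<le> L.nrm (g k) * S"
    proof (rule mult_left_mono)
      have "L.nrm (M k) \<le> (L.nrm (\<Theta> k) + L.nrm (\<Theta> (k - 1))) / 2"
        using mem L.nrm_triangle[of "\<Theta> k" "\<Theta> (k - 1)"] by (simp add: M_def L.nrm_scaleR)
      moreover have "L.nrm (\<Theta> k) \<le> S" "L.nrm (\<Theta> (k - 1)) \<le> S" using kn by (auto intro!: bd)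
      moreover have "x \<le> S" if "x \<le> (y + z) / 2" "y \<le> S" "z \<le> S" for x y z using that by simp
      ultimately show "L.nrm (M k) \<le> S" by blast
    qed (use g[OF k] in auto)
    finally have "2 * \<tau> k * m (g k) (M k) \<le> 2 * \<tau> k * (L.nrm (g k) * S)"
      using t by (intro mult_left_mono) auto
    then show "(L.nrm (\<Theta> k))\<^sup>2 \<le> (L.nrm (\<Theta> (k - 1)))\<^sup>2
        + (2 * (\<tau> k * L.nrm (g k)) * S - 2 * (\<tau> k * (A.nrm (M k))\<^sup>2))"
      using mean_step[OF k] by (simp add: algebra_simps)
  qed
  moreover have "(\<Sum>k=1..n. 2 * (\<tau> k * L.nrm (g k)) * S - 2 * (\<tau> k * (A.nrm (M k))\<^sup>2))
      = 2 * S * (\<Sum>k=1..n. \<tau> k * L.nrm (g k)) - 2 * (\<Sum>k=1..n. \<tau> k * (A.nrm (M k))\<^sup>2)"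
    by (simp add: sum_subtractf sum_distrib_left mult_ac)
  moreover have "2 * S * (\<Sum>k=1..n. \<tau> k * L.nrm (g k)) \<le> 2 * S * S"
    using S0 T0 unfolding S_def by (intro mult_left_mono) auto
  moreover have "(L.nrm (\<Theta> 0))\<^sup>2 \<le> S\<^sup>2" using bd[of 0] T0 by (intro power_mono) auto
  moreover have "0 \<le> (\<Sum>k=1..n. \<tau> k * (A.nrm (M k))\<^sup>2)"
    using \<tau> n by (intro sum_nonneg mult_nonneg_nonneg) (auto intro: less_imp_le)
  ultimately show ?thesis unfolding S_def[symmetric] by (simp add: power2_eq_square)
qed

end

section \<open>Smooth bump functions\<close>

text \<open>
  With \<open>q = 1\<close> and \<open>m = 0\<close> this is a smooth function supported in \<open>[a, b]\<close> that tends to the indicator of the open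
  interval as \<open>c\<close> grows. The polynomial and the power of the inverse are included because this larger
  class is closed under differentiation.
\<close>

definition bump :: "real \<Rightarrow> real \<Rightarrow> real \<Rightarrow> real poly \<Rightarrow> nat \<Rightarrow> real \<Rightarrow> real" where
  "bump c a b q m s =
     (if a < s \<and> s < b then poly q s * inverse ((s - a) * (b - s)) ^ m * exp (- inverse (c * ((s - a) * (b - s))))
      else 0)"

lemma power_over_fact_le_exp:
  fixes z :: real
  assumes "0 \<le> z"
  shows "z ^ k / fact k \<le> exp z"
proof -
  have "sum (\<lambda>n. z ^ n /\<^sub>R fact n) {k} \<le> (\<Sum>n. z ^ n /\<^sub>R fact n)"
    by (rule sum_le_suminf) (use assms summable_exp_generic[of z] in auto)
  then show ?thesis by (simp add: exp_def divide_inverse mult.commute)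
qed

lemma exp_minus_inverse_le:
  fixes y :: real
  assumes "0 < y"
  shows "exp (- inverse y) \<le> fact k * y ^ k"
proof -
  have "inverse y ^ k / fact k \<le> exp (inverse y)" by (rule power_over_fact_le_exp) (use assms in auto)
  then have "inverse (exp (inverse y)) \<le> inverse (inverse y ^ k / fact k)"
    by (rule le_imp_inverse_le) (use assms in auto)
  then show ?thesis using assms by (simp add: exp_minus power_inverse field_simps)
qed

text \<open>
  The exponential beats every power of the distance to the end points. Quadratic decay at all points
  outside the open interval yields derivative zero there, at the end points as well as beyond them.
\<close>

lemma bump_quadratic_decay:
  assumes "0 < c" and s0: "\<not> (a < s0 \<and> s0 < b)"
  shows "\<exists>K. \<forall>s. \<bar>bump c a b q m s\<bar> \<le> K * (s - s0)\<^sup>2"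
proof -
  have "bounded (poly q ` {a..b})"
    by (intro compact_imp_bounded compact_continuous_image continuous_intros compact_Icc)
  then obtain B where B: "\<And>s. s \<in> {a..b} \<Longrightarrow> \<bar>poly q s\<bar> \<le> B" unfolding bounded_iff by force
  define K where "K = \<bar>B\<bar> * (fact (m + 2) * c ^ (m + 2)) * (b - a)\<^sup>2"
  have "\<bar>bump c a b q m s\<bar> \<le> K * (s - s0)\<^sup>2" for s
  proof (cases "a < s \<and> s < b")
    case False
    then have "bump c a b q m s = 0" by (auto simp: bump_def)
    moreover have "0 \<le> K * (s - s0)\<^sup>2" using assms by (simp add: K_def)
    ultimately show ?thesis by simp
  next
    case True
    define y where "y = (s - a) * (b - s)"
    have y: "0 < y" using True by (simp add: y_def)
    have yle: "y \<le> (b - a) * \<bar>s - s0\<bar>"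
    proof (cases "s0 \<le> a")
      case True2: True
      have "(s - a) * (b - s) \<le> \<bar>s - s0\<bar> * (b - a)" using True True2 by (intro mult_mono) auto
      then show ?thesis by (simp add: y_def mult.commute)
    next
      case False
      then have "b \<le> s0" using s0 by auto
      then have "(s - a) * (b - s) \<le> (b - a) * \<bar>s - s0\<bar>" using True by (intro mult_mono) auto
      then show ?thesis by (simp add: y_def)
    qed
    have "\<bar>bump c a b q m s\<bar> = \<bar>poly q s\<bar> * inverse y ^ m * exp (- inverse (c * y))"
      using True y by (simp add: bump_def y_def[symmetric] abs_mult power_abs)
    also have "\<dots> \<le> \<bar>B\<bar> * inverse y ^ m * (fact (m + 2) * (c * y) ^ (m + 2))"
      using B[of s] True y assms by (intro mult_mono exp_minus_inverse_le) auto
    also have "\<dots> = \<bar>B\<bar> * (fact (m + 2) * c ^ (m + 2)) * (inverse y ^ m * y ^ (m + 2))"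
      by (simp only: power_mult_distrib mult_ac)
    also have "inverse y ^ m * y ^ (m + 2) = y\<^sup>2"
      using y by (simp add: power_add power_inverse power2_eq_square field_simps)
    also have "\<bar>B\<bar> * (fact (m + 2) * c ^ (m + 2)) * y\<^sup>2
        \<le> \<bar>B\<bar> * (fact (m + 2) * c ^ (m + 2)) * ((b - a) * \<bar>s - s0\<bar>)\<^sup>2"
      using y yle assms by (intro mult_left_mono power_mono) auto
    also have "\<dots> = K * (s - s0)\<^sup>2" by (simp add: K_def power_mult_distrib)
    finally show ?thesis .
  qed
  then show ?thesis by blast
qed

text \<open>
  With \<open>w = (s - a)(b - s)\<close>, the derivative of \<open>q w\<^sup>-\<^sup>m exp(-1/(c w))\<close> has numerator
  \<open>q' w\<^sup>2 - m w' w q + w' q / c\<close> over \<open>w\<^sup>m\<^sup>+\<^sup>2\<close>.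
\<close>

definition bump_deriv_poly :: "real \<Rightarrow> real \<Rightarrow> real \<Rightarrow> real poly \<Rightarrow> nat \<Rightarrow> real poly" where
  "bump_deriv_poly c a b q m =
     (let w = [:- a, 1:] * [:b, - 1:] in
       pderiv q * w\<^sup>2 - smult (of_nat m) (pderiv w * w * q) + smult (inverse c) (pderiv w * q))"

lemma bump_has_derivative:
  assumes c: "0 < c"
  shows "(bump c a b q m has_real_derivative bump c a b (bump_deriv_poly c a b q m) (m + 2) s) (at s)"
proof (cases "a < s \<and> s < b")
  case True
  define w where "w = [:- a, 1:] * [:b, - 1:]"
  have w: "poly w t = (t - a) * (b - t)" for t by (simp add: w_def algebra_simps)
  have w0: "poly w s \<noteq> 0" using True by (simp add: w)
  define v where "v = inverse (poly w s)"
  define E where "E = exp (- inverse (c * poly w s))"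
  have iv: "((\<lambda>t. inverse (poly w t)) has_real_derivative - (poly (pderiv w) s * v\<^sup>2)) (at s)"
    using w0 by (auto intro!: derivative_eq_intros poly_DERIV simp: v_def power2_eq_square)
  have ivm: "((\<lambda>t. inverse (poly w t) ^ m) has_real_derivative - (real m * poly (pderiv w) s * v ^ (m + 1))) (at s)"
  proof -
    have "((\<lambda>t. inverse (poly w t) ^ m) has_real_derivative
        real m * (inverse (poly w s)) ^ (m - Suc 0) * - (poly (pderiv w) s * v\<^sup>2)) (at s)"
      using DERIV_power[OF iv, of m] by (simp add: mult_ac)
    moreover have "real m * (inverse (poly w s)) ^ (m - Suc 0) * - (poly (pderiv w) s * v\<^sup>2)
        = - (real m * poly (pderiv w) s * v ^ (m + 1))"
      by (cases m) (auto simp: v_def power2_eq_square)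
    ultimately show ?thesis by (simp only:)
  qed
  have ev: "((\<lambda>t. exp (- inverse (c * poly w t))) has_real_derivative inverse c * poly (pderiv w) s * v\<^sup>2 * E) (at s)"
  proof -
    have "((\<lambda>t. exp (- (inverse c * inverse (poly w t)))) has_real_derivative
        exp (- (inverse c * inverse (poly w s))) * (- (inverse c * - (poly (pderiv w) s * v\<^sup>2)))) (at s)"
      by (intro DERIV_fun_exp DERIV_minus DERIV_cmult iv)
    then show ?thesis by (simp add: E_def mult_ac)
  qed
  have "((\<lambda>t. poly q t * inverse (poly w t) ^ m * exp (- inverse (c * poly w t))) has_real_derivative
      poly (pderiv q) s * v ^ m * E - poly q s * (real m * poly (pderiv w) s * v ^ (m + 1)) * E
      + poly q s * v ^ m * (inverse c * poly (pderiv w) s * v\<^sup>2 * E)) (at s)"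
    by (rule DERIV_cong[OF DERIV_mult[OF DERIV_mult[OF poly_DERIV ivm] ev]])
       (simp add: E_def v_def algebra_simps)
  moreover have "poly (pderiv q) s * v ^ m * E - poly q s * (real m * poly (pderiv w) s * v ^ (m + 1)) * E
      + poly q s * v ^ m * (inverse c * poly (pderiv w) s * v\<^sup>2 * E)
      = bump c a b (bump_deriv_poly c a b q m) (m + 2) s"
  proof -
    have wv: "poly w s * v = 1" using w0 by (simp add: v_def)
    have "(poly w s)\<^sup>2 * v ^ (m + 2) = v ^ m * (poly w s * v)\<^sup>2"
      by (simp add: power_add power2_eq_square)
    then have 1: "v ^ m = (poly w s)\<^sup>2 * v ^ (m + 2)" using wv by simp
    have "poly w s * v ^ (m + 2) = v ^ (m + 1) * (poly w s * v)"
      by (simp add: power_add power2_eq_square)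
    then have 2: "v ^ (m + 1) = poly w s * v ^ (m + 2)" using wv by simp
    have 3: "v ^ m * v\<^sup>2 = v ^ (m + 2)" by (simp only: power_add)
    have "bump c a b (bump_deriv_poly c a b q m) (m + 2) s
        = poly (bump_deriv_poly c a b q m) s * v ^ (m + 2) * E"
      using True by (simp add: bump_def w v_def E_def)
    also have "poly (bump_deriv_poly c a b q m) s
        = poly (pderiv q) s * (poly w s)\<^sup>2 - real m * (poly (pderiv w) s * poly w s * poly q s)
          + inverse c * (poly (pderiv w) s * poly q s)"
      unfolding bump_deriv_poly_def w_def[symmetric] Let_def
      by (simp only: poly_add poly_diff poly_mult poly_smult poly_power)
    also have "\<dots> * v ^ (m + 2) * E
       = poly (pderiv q) s * ((poly w s)\<^sup>2 * v ^ (m + 2)) * E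
         - poly q s * (real m * poly (pderiv w) s * (poly w s * v ^ (m + 2))) * E
         + poly q s * (inverse c * poly (pderiv w) s * v ^ (m + 2) * E)"
      by (simp only: algebra_simps)
    finally show ?thesis unfolding 1[symmetric] 2[symmetric] unfolding 3[symmetric] by (simp add: mult_ac)
  qed
  ultimately have D: "((\<lambda>t. poly q t * inverse (poly w t) ^ m * exp (- inverse (c * poly w t)))
      has_real_derivative bump c a b (bump_deriv_poly c a b q m) (m + 2) s) (at s)" by simp
  show ?thesis
    by (rule has_field_derivative_transform_within_open[OF D, of "{a<..<b}"])
       (use True in \<open>auto simp: bump_def w\<close>)
next
  case False
  obtain K where K: "\<And>t. \<bar>bump c a b q m t\<bar> \<le> K * (t - s)\<^sup>2"
    using bump_quadratic_decay[OF c False] by blast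
  have s0: "bump c a b q' m' s = 0" for q' m' using False by (auto simp: bump_def)
  have "((\<lambda>t. (bump c a b q m t - bump c a b q m s) / (t - s)) \<longlongrightarrow> 0) (at s)"
  proof (rule Lim_null_comparison)
    show "((\<lambda>t. K * \<bar>t - s\<bar>) \<longlongrightarrow> 0) (at s)"
      by (auto intro!: tendsto_eq_intros)
    show "\<forall>\<^sub>F t in at s. norm ((bump c a b q m t - bump c a b q m s) / (t - s)) \<le> K * \<bar>t - s\<bar>"
      unfolding eventually_at_filter
    proof (rule always_eventually, intro allI impI)
      fix t :: real assume "t \<noteq> s"
      have "\<bar>bump c a b q m t\<bar> \<le> K * (\<bar>t - s\<bar> * \<bar>t - s\<bar>)" using K[of t] by (simp add: power2_eq_square)
      then show "norm ((bump c a b q m t - bump c a b q m s) / (t - s)) \<le> K * \<bar>t - s\<bar>"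
        using \<open>t \<noteq> s\<close> by (simp add: s0 pos_divide_le_eq mult.assoc)
    qed
  qed
  then show ?thesis by (simp add: has_field_derivative_iff s0)
qed

definition box_bump :: "real \<Rightarrow> real^'d \<Rightarrow> real^'d \<Rightarrow> ('d \<Rightarrow> real poly) \<Rightarrow> ('d \<Rightarrow> nat) \<Rightarrow> real^'d \<Rightarrow> real" where
  "box_bump c a b q m x = (\<Prod>i\<in>UNIV. bump c (a $ i) (b $ i) (q i) (m i) (x $ i))"

lemma box_bump_has_derivative:
  fixes a b :: "real^'d"
  assumes "0 < c"
  shows "(box_bump c a b q m has_derivative
     (\<lambda>y. \<Sum>i\<in>UNIV. bump c (a $ i) (b $ i) (bump_deriv_poly c (a $ i) (b $ i) (q i) (m i)) (m i + 2) (x $ i) * y $ i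
          * (\<Prod>j\<in>UNIV - {i}. bump c (a $ j) (b $ j) (q j) (m j) (x $ j)))) (at x)"
proof -
  have "((\<lambda>x. \<Prod>i\<in>UNIV. bump c (a $ i) (b $ i) (q i) (m i) (x $ i)) has_derivative
     (\<lambda>y. \<Sum>i\<in>UNIV. (\<lambda>i y. bump c (a $ i) (b $ i) (bump_deriv_poly c (a $ i) (b $ i) (q i) (m i)) (m i + 2) (x $ i) * y $ i) i y
          * (\<Prod>j\<in>UNIV - {i}. (\<lambda>i x. bump c (a $ i) (b $ i) (q i) (m i) (x $ i)) j x))) (at x)"
  proof (rule has_derivative_prod[where f = "\<lambda>i x. bump c (a $ i) (b $ i) (q i) (m i) (x $ i)" and
      f' = "\<lambda>i y. bump c (a $ i) (b $ i) (bump_deriv_poly c (a $ i) (b $ i) (q i) (m i)) (m i + 2) (x $ i) * y $ i"])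
    fix i :: 'd
    let ?D = "bump c (a $ i) (b $ i) (bump_deriv_poly c (a $ i) (b $ i) (q i) (m i)) (m i + 2) (x $ i)"
    have 1: "((\<lambda>x. x $ i) has_derivative (\<lambda>y. y $ i)) (at x)"
      by (rule bounded_linear_imp_has_derivative[OF bounded_linear_vec_nth])
    have 2: "(bump c (a $ i) (b $ i) (q i) (m i) has_derivative (*) ?D) (at (x $ i))"
      using bump_has_derivative[OF assms] unfolding has_field_derivative_def .
    show "((\<lambda>x. bump c (a $ i) (b $ i) (q i) (m i) (x $ i)) has_derivative (\<lambda>y. ?D * y $ i)) (at x)"
      by (rule has_derivative_compose[OF 1 2])
  qed
  then show ?thesis by (simp only: box_bump_def[abs_def])
qed

lemma pderiv_dir_box_bump:
  fixes a b :: "real^'d"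
  assumes "0 < c"
  shows "pderiv_dir k (box_bump c a b q m) =
     box_bump c a b (q(k := bump_deriv_poly c (a $ k) (b $ k) (q k) (m k))) (m(k := m k + 2))"
proof
  fix x
  let ?f = "\<lambda>i. bump c (a $ i) (b $ i) (bump_deriv_poly c (a $ i) (b $ i) (q i) (m i)) (m i + 2) (x $ i)"
  let ?P = "\<lambda>i. (\<Prod>j\<in>UNIV - {i}. bump c (a $ j) (b $ j) (q j) (m j) (x $ j))"
  have "pderiv_dir k (box_bump c a b q m) x = (\<Sum>i\<in>UNIV. ?f i * axis k 1 $ i * ?P i)"
    unfolding pderiv_dir_def
    by (subst frechet_derivative_at[OF box_bump_has_derivative[OF assms, of a b q m x], symmetric]) (rule refl)
  also have "\<dots> = (\<Sum>i\<in>UNIV. if i = k then ?f k * ?P k else 0)"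
    by (intro sum.cong) (auto simp: axis_def)
  also have "\<dots> = ?f k * ?P k" by simp
  also have "\<dots> = box_bump c a b (q(k := bump_deriv_poly c (a $ k) (b $ k) (q k) (m k))) (m(k := m k + 2)) x"
    unfolding box_bump_def
    by (subst prod.remove[of UNIV k]) (auto intro!: prod.cong)
  finally show "pderiv_dir k (box_bump c a b q m) x = \<dots>" .
qed

lemma pderivs_Nil [simp]: "pderivs [] \<phi> = \<phi>"
  and pderivs_Cons: "pderivs (i # ks) \<phi> = pderiv_dir i (pderivs ks \<phi>)"
  by (simp_all only: pderivs_def foldr.simps o_apply id_apply)

text \<open>
  Products of one-dimensional bumps are closed under partial differentiation, which gives derivatives of
  every order.
\<close>

lemma pderivs_box_bump:
  assumes "0 < c"
  shows "\<exists>q' m'. pderivs ks (box_bump c a b q m) = box_bump c a b q' m'"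
proof (induction ks)
  case Nil
  show ?case by (rule exI[of _ q], rule exI[of _ m]) (rule pderivs_Nil)
next
  case (Cons i ks)
  then obtain q' m' where "pderivs ks (box_bump c a b q m) = box_bump c a b q' m'" by (elim exE)
  then have "pderivs (i # ks) (box_bump c a b q m) = pderiv_dir i (box_bump c a b q' m')"
    by (simp only: pderivs_Cons)
  then show ?case unfolding pderiv_dir_box_bump[OF assms] by (intro exI)
qed

lemma box_bump_test_function:
  assumes "0 < c" "cbox a b \<subseteq> \<Omega>"
  shows "box_bump c a b q m \<in> test_functions \<Omega>"
  unfolding test_functions_def
proof (intro CollectI conjI allI exI)
  fix ks x
  obtain q' m' where "pderivs ks (box_bump c a b q m) = box_bump c a b q' m'"
    using pderivs_box_bump[OF assms(1)] by blast
  then show "pderivs ks (box_bump c a b q m) differentiable at x"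
    using box_bump_has_derivative[OF assms(1), of a b q' m' x] by (simp add: differentiableI)
  show "compact (cbox a b)" by simp
  show "cbox a b \<subseteq> \<Omega>" by fact
  show "x \<notin> cbox a b \<longrightarrow> box_bump c a b q m x = 0"
  proof
    assume "x \<notin> cbox a b"
    then obtain i where "\<not> (a $ i < x $ i \<and> x $ i < b $ i)"
      by (auto simp: mem_box_cart intro: less_imp_le)
    then have "bump c (a $ i) (b $ i) (q i) (m i) (x $ i) = 0" unfolding bump_def by (rule if_not_P)
    then show "box_bump c a b q m x = 0" unfolding box_bump_def by (intro prod_zero) auto
  qed
qed

lemma box_bump_tendsto_indicator:
  "(\<lambda>n. box_bump (real (Suc n)) a b (\<lambda>i. 1) (\<lambda>i. 0) x) \<longlonglongrightarrow> indicator (box a b) x"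
proof (cases "x \<in> box a b")
  case True
  then have in_i: "a $ i < x $ i \<and> x $ i < b $ i" for i by (simp add: mem_box_cart)
  have "(\<lambda>n. \<Prod>i\<in>UNIV. exp (- inverse (real (Suc n) * ((x $ i - a $ i) * (b $ i - x $ i))))) \<longlonglongrightarrow> (\<Prod>i\<in>(UNIV::'a set). exp (- (0 * inverse ((x $ i - a $ i) * (b $ i - x $ i)))))"
    unfolding inverse_mult_distrib[of "real _"]
    by (intro tendsto_prod tendsto_exp tendsto_minus tendsto_mult tendsto_const LIMSEQ_inverse_real_of_nat)
  then show ?thesis using True in_i by (simp add: box_bump_def bump_def)
next
  case False
  then obtain i where i: "\<not> (a $ i < x $ i \<and> x $ i < b $ i)" by (auto simp: mem_box_cart)
  have "box_bump (real (Suc n)) a b (\<lambda>i. 1) (\<lambda>i. 0) x = 0" for n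
    unfolding box_bump_def by (rule prod_zero) (use i in \<open>auto simp: bump_def\<close>)
  then show ?thesis using False by simp
qed

lemma box_bump_bound: "\<bar>box_bump (real (Suc n)) a b (\<lambda>i. 1) (\<lambda>i. 0) x\<bar> \<le> 1"
proof -
  have "\<bar>bump (real (Suc n)) \<alpha> \<beta> 1 0 s\<bar> \<le> 1" for \<alpha> \<beta> s
    by (auto simp: bump_def)
  then show ?thesis unfolding box_bump_def abs_prod by (intro prod_le_1) auto
qed

section \<open>The fundamental lemma of the calculus of variations\<close>

text \<open>
  Boxes are stable under intersection and generate the Borel sets, so by Dynkin's lemma the integral of
  \<open>f\<close> vanishes over every Borel set.
\<close>

lemma AE_zero_if_box_integrals_zero:
  fixes f :: "'a::euclidean_space \<Rightarrow> real"
  assumes f: "integrable lborel f"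
    and box: "\<And>a b. (LINT x:box a b|lborel. f x) = 0" and UNIV: "(LINT x|lborel. f x) = 0"
  shows "AE x in lborel. f x = 0"
proof (rule sigma_finite_measure.density_zero[OF sigma_finite_lborel f])
  fix A :: "'a set" assume "A \<in> sets lborel"
  then have A: "A \<in> sigma_sets UNIV (range (\<lambda>(a, b). box a b))"
    by (simp add: borel_eq_box)
  have sets: "B \<in> sets lborel" if "B \<in> sigma_sets UNIV (range (\<lambda>(a, b). box a b :: 'a set))" for B
    using that by (simp add: borel_eq_box)
  have int: "set_integrable lborel B f" if "B \<in> sets lborel" for B
    using f that unfolding set_integrable_def by (intro integrable_mult_indicator)
  have "Int_stable (range (\<lambda>(a, b). box a b :: 'a set))"
    by (auto simp: Int_stable_def box_Int_box)
  moreover have "range (\<lambda>(a, b). box a b :: 'a set) \<subseteq> Pow UNIV" by simp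
  ultimately show "(LINT x:A|lborel. f x) = 0"
    using A
  proof (induction rule: sigma_sets_induct_disjoint)
    case (basic B) then show ?case using box by auto
  next
    case empty then show ?case by (simp add: set_lebesgue_integral_def)
  next
    case (compl B)
    have "(LINT x:UNIV|lborel. f x) = (LINT x:B|lborel. f x) + (LINT x:UNIV - B|lborel. f x)"
      by (subst set_integral_Un[symmetric]) (use compl sets int in \<open>auto intro!: int\<close>)
    then show ?case using compl UNIV by (simp add: set_lebesgue_integral_def)
  next
    case (union B)
    have "(LINT x:(\<Union>i. B i)|lborel. f x) = (\<Sum>i. (LINT x:B i|lborel. f x))"
    proof (rule lebesgue_integral_countable_add)
      show "B i \<in> sets lborel" for i using union sets by auto
      then show "set_integrable lborel (\<Union>i. B i) f" by (intro int) auto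
    qed (use union in \<open>auto simp: disjoint_family_on_def\<close>)
    then show ?case using union by simp
  qed
qed

text \<open>
  Bump functions approximate the indicator of every box with closure in \<open>\<Omega>\<close>, hence \<open>g\<close> has integral
  zero over such boxes by dominated convergence. On a fixed closed box \<open>R\<close> inside \<open>\<Omega>\<close> all boxes intersected
  with \<open>R\<close> are of this kind, so \<open>g = 0\<close> almost everywhere on \<open>R\<close>; countably many \<open>R\<close> cover \<open>\<Omega>\<close>.
\<close>

lemma fundamental_lemma_real:
  fixes g :: "real^'d \<Rightarrow> real"
  assumes \<Omega>: "open \<Omega>" and g: "integrable (lebesgue_on \<Omega>) g"
    and test: "\<And>\<phi>. \<phi> \<in> test_functions \<Omega> \<Longrightarrow> (LINT x|lebesgue_on \<Omega>. \<phi> x * g x) = 0"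
  shows "AE x in lebesgue_on \<Omega>. g x = 0"
proof -
  have \<Omega>s: "\<Omega> \<in> sets lebesgue" using \<Omega> by (simp add: borel_open)
  have box0: "(LINT x|lebesgue_on \<Omega>. indicator (box a b) x * g x) = 0" if ab: "cbox a b \<subseteq> \<Omega>" for a b
  proof -
    let ?\<phi> = "\<lambda>n. box_bump (real (Suc n)) a b (\<lambda>i. 1) (\<lambda>i. 0)"
    have tf: "?\<phi> n \<in> test_functions \<Omega>" for n by (rule box_bump_test_function) (use ab in auto)
    have "?\<phi> n \<in> borel_measurable borel" for n
    proof (rule borel_measurable_continuous_onI)
      show "continuous_on UNIV (?\<phi> n)"
        using box_bump_has_derivative[of "real (Suc n)" a b]
        by (intro differentiable_imp_continuous_on) (auto simp: differentiable_on_def differentiable_def)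
    qed
    then have meas: "?\<phi> n \<in> borel_measurable (lebesgue_on \<Omega>)" for n
      by (intro measurable_restrict_space1 measurable_completion) auto
    have bm: "indicator (box a b) \<in> borel_measurable (lebesgue_on \<Omega>)"
      by (intro measurable_restrict_space1 borel_measurable_indicator) auto
    have "(\<lambda>n. LINT x|lebesgue_on \<Omega>. ?\<phi> n x * g x) \<longlonglongrightarrow> (LINT x|lebesgue_on \<Omega>. indicator (box a b) x * g x)"
    proof (rule integral_dominated_convergence[where w = "\<lambda>x. \<bar>g x\<bar>"])
      show "integrable (lebesgue_on \<Omega>) (\<lambda>x. \<bar>g x\<bar>)" using g by simp
      show "(\<lambda>x. indicator (box a b) x * g x) \<in> borel_measurable (lebesgue_on \<Omega>)"
        using g bm by (intro borel_measurable_times) auto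
      show "(\<lambda>x. ?\<phi> n x * g x) \<in> borel_measurable (lebesgue_on \<Omega>)" for n
        using g meas by (intro borel_measurable_times) auto
      show "AE x in lebesgue_on \<Omega>. (\<lambda>n. ?\<phi> n x * g x) \<longlonglongrightarrow> indicator (box a b) x * g x"
        by (intro always_eventually allI tendsto_mult tendsto_const box_bump_tendsto_indicator)
      show "AE x in lebesgue_on \<Omega>. norm (?\<phi> n x * g x) \<le> \<bar>g x\<bar>" for n
        using box_bump_bound[of n a b]
        by (intro always_eventually allI) (auto simp: abs_mult intro: mult_left_le_one_le)
    qed
    then show ?thesis using test[OF tf] by (simp add: LIMSEQ_const_iff)
  qed
  \<comment> \<open>A Borel representative of the extension by zero, to which the criterion for box integrals applies.\<close>
  define G where "G x = indicator \<Omega> x * g x" for x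
  have G: "integrable lebesgue G" and Gm: "G \<in> borel_measurable lebesgue"
    using g \<Omega>s by (auto simp: G_def[abs_def] integrable_restrict_space)
  obtain G' where G'm: "G' \<in> borel_measurable lborel" and GG': "AE x in lborel. G x = G' x"
    using completion_ex_borel_measurable_real[OF Gm] by auto
  have GG'c: "AE x in lebesgue. G x = G' x" using GG' by (rule AE_completion)
  have G'i: "integrable lborel G'"
  proof -
    have "integrable lebesgue G'"
      using G GG'c G'm by (subst integrable_cong_AE[of _ _ G]) (auto intro: measurable_completion)
    then show ?thesis using G'm by (simp add: integrable_completion)
  qed
  obtain \<D> where \<D>: "countable \<D>" "\<D> \<subseteq> Pow \<Omega>" "\<And>X. X \<in> \<D> \<Longrightarrow> \<exists>a b. X = cbox a b" "\<Union>\<D> = \<Omega>"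
    using open_countable_Union_open_cbox[OF \<Omega>] by metis
  have "AE x in lborel. x \<in> R \<longrightarrow> G' x = 0" if R: "R \<in> \<D>" for R
  proof -
    obtain p q where "R = cbox p q" using \<D>(3)[OF R] by blast
    then have pq: "R = cbox p q" "cbox p q \<subseteq> \<Omega>" using \<D>(2) R by auto
    have b0: "(LINT x|lborel. indicator (box a b \<inter> box p q) x * G' x) = 0" for a b
    proof -
      obtain a' b' where ab': "box a b \<inter> box p q = box a' b'" using box_Int_box[of a b p q] by blast
      have *: "cbox a' b' \<subseteq> \<Omega> \<or> box a' b' = {}"
      proof (cases "box a' b' = {}")
        case False
        then have "cbox a' b' = closure (box a' b')" by (simp add: closure_box)
        also have "\<dots> \<subseteq> cbox p q"
          using ab' box_subset_cbox[of p q] by (intro closure_minimal) auto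
        finally show ?thesis using pq by auto
      qed auto
      have "(LINT x|lborel. indicator (box a' b') x * G' x) = (LINT x|lebesgue. indicator (box a' b') x * G' x)"
        by (rule integral_completion[symmetric]) (use G'm in measurable)
      also have "\<dots> = (LINT x|lebesgue. indicator (box a' b') x * G x)"
      proof (rule integral_cong_AE)
        have "indicator (box a' b') \<in> borel_measurable (lebesgue :: (real^'d) measure)"
          by (rule borel_measurable_indicator) simp
        then show "(\<lambda>x. indicator (box a' b') x * G' x) \<in> borel_measurable lebesgue"
          "(\<lambda>x. indicator (box a' b') x * G x) \<in> borel_measurable lebesgue"
          using Gm measurable_completion[OF G'm] by (auto intro: borel_measurable_times)
        show "AE x in lebesgue. indicator (box a' b') x * G' x = indicator (box a' b') x * G x"
          using GG'c by eventually_elim simp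
      qed
      also have "\<dots> = (LINT x|lebesgue_on \<Omega>. indicator (box a' b') x * g x)"
        using \<Omega>s by (simp add: integral_restrict_space G_def mult_ac)
      also have "\<dots> = 0" using * box0 by auto
      finally show ?thesis by (simp add: ab')
    qed
    have "AE x in lborel. indicator (box p q) x * G' x = 0"
    proof (rule AE_zero_if_box_integrals_zero)
      show "integrable lborel (\<lambda>x. indicator (box p q) x * G' x)"
        using integrable_mult_indicator[OF _ G'i, of "box p q"] by simp
      show "(LINT x:box a b|lborel. indicator (box p q) x * G' x) = 0" for a b
        using b0[of a b] by (simp add: set_lebesgue_integral_def indicator_inter_arith mult_ac)
      show "(LINT x|lborel. indicator (box p q) x * G' x) = 0"
        using b0[of p q] by simp
    qed
    moreover have "AE x in lborel. x \<notin> cbox p q - box p q"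
    proof -
      have "cbox p q - box p q \<in> null_sets lebesgue"
        using negligible_frontier_interval[of p q] by (simp add: negligible_iff_null_sets)
      then have "cbox p q - box p q \<in> null_sets lborel"
        by (simp add: null_sets_def)
      then show ?thesis by (rule AE_not_in)
    qed
    ultimately show ?thesis
      by eventually_elim (auto simp: pq indicator_def)
  qed
  then have "AE x in lborel. \<forall>R\<in>\<D>. x \<in> R \<longrightarrow> G' x = 0"
    unfolding AE_ball_countable[OF \<D>(1)] by simp
  with GG' have "AE x in lborel. x \<in> \<Omega> \<longrightarrow> g x = 0"
    by eventually_elim (use \<D>(4) in \<open>auto simp: G_def indicator_def\<close>)
  then have "AE x in lebesgue. x \<in> \<Omega> \<longrightarrow> g x = 0" by (rule AE_completion)
  then show ?thesis using \<Omega>s by (simp add: AE_restrict_space_iff)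
qed

section \<open>The space of square integrable functions\<close>

lemma L2_measurable: "f \<in> L2_space \<Omega> \<Longrightarrow> f \<in> borel_measurable (lebesgue_on \<Omega>)"
  and L2_integrable_square: "f \<in> L2_space \<Omega> \<Longrightarrow> integrable (lebesgue_on \<Omega>) (\<lambda>x. (norm (f x))\<^sup>2)"
  by (auto simp: L2_space_def)

text \<open>
  All products of square integrable functions used below, inner products as well as scalar multiples, are
  dominated by the product of the norms.
\<close>

lemma integrable_by_L2_product:
  fixes f :: "real^'d \<Rightarrow> 'b::euclidean_space" and g :: "real^'d \<Rightarrow> 'c::euclidean_space"
    and h :: "real^'d \<Rightarrow> 'e::euclidean_space"
  assumes f: "f \<in> L2_space \<Omega>" and g: "g \<in> L2_space \<Omega>" and h: "h \<in> borel_measurable (lebesgue_on \<Omega>)"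
    and le: "\<And>x. norm (h x) \<le> norm (f x) * norm (g x)"
  shows "integrable (lebesgue_on \<Omega>) h"
proof (rule Bochner_Integration.integrable_bound[OF _ h])
  show "integrable (lebesgue_on \<Omega>) (\<lambda>x. (norm (f x))\<^sup>2 + (norm (g x))\<^sup>2)"
    using f g by (intro Bochner_Integration.integrable_add L2_integrable_square)
  show "AE x in lebesgue_on \<Omega>. norm (h x) \<le> norm ((norm (f x))\<^sup>2 + (norm (g x))\<^sup>2)"
  proof (intro always_eventually allI)
    fix x
    have "2 * (norm (f x) * norm (g x)) \<le> (norm (f x))\<^sup>2 + (norm (g x))\<^sup>2"
      using sum_squares_bound[of "norm (f x)" "norm (g x)"] by simp
    moreover have "0 \<le> norm (f x) * norm (g x)" by simp
    ultimately have "norm (f x) * norm (g x) \<le> (norm (f x))\<^sup>2 + (norm (g x))\<^sup>2" by linarith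
    then show "norm (h x) \<le> norm ((norm (f x))\<^sup>2 + (norm (g x))\<^sup>2)"
      using le[of x] by (simp add: order_trans)
  qed
qed

lemma L2_inner_integrable:
  assumes "f \<in> L2_space \<Omega>" "g \<in> L2_space \<Omega>"
  shows "integrable (lebesgue_on \<Omega>) (\<lambda>x. f x \<bullet> g x)"
  by (rule integrable_by_L2_product[OF assms])
     (use L2_measurable[OF assms(1)] L2_measurable[OF assms(2)] Cauchy_Schwarz_ineq2 in
       \<open>auto intro!: borel_measurable_inner\<close>)

lemma L2_scaleR_integrable:
  fixes f :: "real^'d \<Rightarrow> real" and g :: "real^'d \<Rightarrow> 'c::euclidean_space"
  assumes "f \<in> L2_space \<Omega>" "g \<in> L2_space \<Omega>"
  shows "integrable (lebesgue_on \<Omega>) (\<lambda>x. f x *\<^sub>R g x)"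
  by (rule integrable_by_L2_product[OF assms])
     (use L2_measurable[OF assms(1)] L2_measurable[OF assms(2)] in \<open>auto intro!: borel_measurable_scaleR\<close>)

lemma L2_spaceI_bound:
  fixes h :: "real^'d \<Rightarrow> 'b::euclidean_space" and f :: "real^'d \<Rightarrow> 'c::euclidean_space"
  assumes h: "h \<in> borel_measurable (lebesgue_on \<Omega>)" and f: "f \<in> L2_space \<Omega>"
    and le: "\<And>x. norm (h x) \<le> K * norm (f x)"
  shows "h \<in> L2_space \<Omega>"
proof -
  have "integrable (lebesgue_on \<Omega>) (\<lambda>x. (norm (h x))\<^sup>2)"
  proof (rule Bochner_Integration.integrable_bound)
    show "integrable (lebesgue_on \<Omega>) (\<lambda>x. K\<^sup>2 * (norm (f x))\<^sup>2)"
      using f by (intro integrable_mult_right L2_integrable_square)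
    show "(\<lambda>x. (norm (h x))\<^sup>2) \<in> borel_measurable (lebesgue_on \<Omega>)" using h by simp
    show "AE x in lebesgue_on \<Omega>. norm ((norm (h x))\<^sup>2) \<le> norm (K\<^sup>2 * (norm (f x))\<^sup>2)"
    proof (intro always_eventually allI)
      fix x
      have "(norm (h x))\<^sup>2 \<le> (K * norm (f x))\<^sup>2" using le[of x] by (intro power_mono) auto
      then show "norm ((norm (h x))\<^sup>2) \<le> norm (K\<^sup>2 * (norm (f x))\<^sup>2)"
        by (simp add: power_mult_distrib)
    qed
  qed
  then show ?thesis using h by (simp add: L2_space_def)
qed

lemma subspace_L2: "subspace (L2_space \<Omega>)"
  unfolding subspace_def
proof (intro conjI ballI allI)
  show "0 \<in> L2_space \<Omega>" by (simp add: L2_space_def zero_fun_def)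
next
  fix f g :: "real^'a \<Rightarrow> 'b" assume f: "f \<in> L2_space \<Omega>" and g: "g \<in> L2_space \<Omega>"
  have m: "f + g \<in> borel_measurable (lebesgue_on \<Omega>)"
    unfolding plus_fun_def using f g by (intro borel_measurable_add L2_measurable)
  have "integrable (lebesgue_on \<Omega>) (\<lambda>x. (norm ((f + g) x))\<^sup>2)"
  proof (rule Bochner_Integration.integrable_bound)
    show "integrable (lebesgue_on \<Omega>) (\<lambda>x. 2 * (norm (f x))\<^sup>2 + 2 * (norm (g x))\<^sup>2)"
      using f g by (intro Bochner_Integration.integrable_add integrable_mult_right L2_integrable_square)
    show "(\<lambda>x. (norm ((f + g) x))\<^sup>2) \<in> borel_measurable (lebesgue_on \<Omega>)"
      using m by measurable
    show "AE x in lebesgue_on \<Omega>. norm ((norm ((f + g) x))\<^sup>2) \<le> norm (2 * (norm (f x))\<^sup>2 + 2 * (norm (g x))\<^sup>2)"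
    proof (intro always_eventually allI)
      fix x
      have "(norm (f x + g x))\<^sup>2 \<le> (norm (f x) + norm (g x))\<^sup>2"
        by (intro power_mono norm_triangle_ineq) auto
      also have "\<dots> \<le> 2 * (norm (f x))\<^sup>2 + 2 * (norm (g x))\<^sup>2"
        using sum_squares_bound[of "norm (f x)" "norm (g x)"] by (simp add: power2_sum)
      finally show "norm ((norm ((f + g) x))\<^sup>2) \<le> norm (2 * (norm (f x))\<^sup>2 + 2 * (norm (g x))\<^sup>2)"
        by simp
    qed
  qed
  then show "f + g \<in> L2_space \<Omega>" using m by (simp add: L2_space_def)
next
  fix c and f :: "real^'a \<Rightarrow> 'b" assume f: "f \<in> L2_space \<Omega>"
  show "c *\<^sub>R f \<in> L2_space \<Omega>"
    by (rule L2_spaceI_bound[OF _ f, of _ "\<bar>c\<bar>"])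
       (use L2_measurable[OF f] in \<open>auto simp: scaleR_fun_def\<close>)
qed

lemma semi_inner_L2: "semi_inner (L2_space \<Omega>) (L2_inner \<Omega>)"
proof
  show "subspace (L2_space \<Omega>)" by (rule subspace_L2)
next
  fix f g :: "real^'a \<Rightarrow> 'b" show "L2_inner \<Omega> f g = L2_inner \<Omega> g f"
    by (simp add: L2_inner_def inner_commute)
next
  fix f g h :: "real^'a \<Rightarrow> 'b"
  assume "f \<in> L2_space \<Omega>" "g \<in> L2_space \<Omega>" "h \<in> L2_space \<Omega>"
  then show "L2_inner \<Omega> (f + g) h = L2_inner \<Omega> f h + L2_inner \<Omega> g h"
    by (simp add: L2_inner_def inner_add_left L2_inner_integrable)
next
  fix c and f g :: "real^'a \<Rightarrow> 'b"
  show "L2_inner \<Omega> (c *\<^sub>R f) g = c * L2_inner \<Omega> f g"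
    by (simp add: L2_inner_def)
next
  fix f :: "real^'a \<Rightarrow> 'b"
  show "0 \<le> L2_inner \<Omega> f f"
    by (simp add: L2_inner_def integral_nonneg_AE)
qed

interpretation L2: semi_inner "L2_space \<Omega>" "L2_inner \<Omega>"
  rewrites "semi_inner.nrm (L2_inner \<Omega>) = L2_norm \<Omega>"
  using semi_inner_L2 by (auto simp: L2_norm_def semi_inner.nrm_def[OF semi_inner_L2])

lemma L2_norm_sq: "(L2_norm \<Omega> f)\<^sup>2 = L2_inner \<Omega> f f"
  by (simp add: L2_norm_def L2_inner_def integral_nonneg_AE)

lemma ae_eq_refl [simp, intro]: "ae_eq \<Omega> f f"
  and ae_eq_sym: "ae_eq \<Omega> f g \<Longrightarrow> ae_eq \<Omega> g f"
  by (auto simp: ae_eq_def elim: eventually_mono)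

lemma ae_eq_diff:
  assumes "ae_eq \<Omega> f f'" "ae_eq \<Omega> g g'" shows "ae_eq \<Omega> (f - g) (f' - g')"
  using assms unfolding ae_eq_def by eventually_elim simp

lemma ae_eq_nth: "ae_eq \<Omega> f g \<Longrightarrow> ae_eq \<Omega> (\<lambda>x. f x $ i) (\<lambda>x. g x $ i)"
  unfolding ae_eq_def by (elim eventually_mono) simp

lemma L2_inner_cong:
  assumes "ae_eq \<Omega> f f'" "ae_eq \<Omega> g g'" "f \<in> L2_space \<Omega>" "f' \<in> L2_space \<Omega>" "g \<in> L2_space \<Omega>" "g' \<in> L2_space \<Omega>"
  shows "L2_inner \<Omega> f g = L2_inner \<Omega> f' g'"
  unfolding L2_inner_def
proof (rule integral_cong_AE)
  show "AE x in lebesgue_on \<Omega>. f x \<bullet> g x = f' x \<bullet> g' x"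
    using assms(1,2) unfolding ae_eq_def by eventually_elim simp
qed (intro borel_measurable_inner L2_measurable assms)+

lemma L2_norm_cong:
  "ae_eq \<Omega> f f' \<Longrightarrow> f \<in> L2_space \<Omega> \<Longrightarrow> f' \<in> L2_space \<Omega> \<Longrightarrow> L2_norm \<Omega> f = L2_norm \<Omega> f'"
  unfolding L2_norm_def using L2_inner_cong by metis

lemma L2_norm_zero_imp:
  assumes f: "f \<in> L2_space \<Omega>" and 0: "L2_norm \<Omega> f = 0"
  shows "ae_eq \<Omega> f (\<lambda>x. 0)"
proof -
  have "(LINT x|lebesgue_on \<Omega>. (norm (f x))\<^sup>2) = 0"
    using 0 by (simp add: L2_norm_def L2_inner_def power2_norm_eq_inner)
  then have "AE x in lebesgue_on \<Omega>. (norm (f x))\<^sup>2 = 0"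
    using L2_integrable_square[OF f] by (subst (asm) integral_nonneg_eq_0_iff_AE) auto
  then show ?thesis unfolding ae_eq_def by (elim eventually_mono) simp
qed

lemma L2_eq_if_norm_diff_zero:
  assumes "f \<in> L2_space \<Omega>" "g \<in> L2_space \<Omega>" "L2_norm \<Omega> (f - g) = 0"
  shows "ae_eq \<Omega> f g"
  using L2_norm_zero_imp[of "f - g" \<Omega>] assms by (simp add: ae_eq_def L2.X_closed)

lemma L2_comp:
  assumes f: "f \<in> L2_space \<Omega>"
  shows "(\<lambda>x. f x \<bullet> b) \<in> L2_space \<Omega>"
proof (rule L2_spaceI_bound[OF _ f, of _ "norm b"])
  show "(\<lambda>x. f x \<bullet> b) \<in> borel_measurable (lebesgue_on \<Omega>)"
    using L2_measurable[OF f] by (intro borel_measurable_inner) auto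
  show "norm (f x \<bullet> b) \<le> norm b * norm (f x)" for x
    using Cauchy_Schwarz_ineq2[of "f x" b] by (simp add: mult.commute)
qed

lemma L2_nth:
  fixes f :: "real^'d \<Rightarrow> real^'n"
  shows "f \<in> L2_space \<Omega> \<Longrightarrow> (\<lambda>x. f x $ i) \<in> L2_space \<Omega>"
  using L2_comp[of f \<Omega> "axis i 1"] by (simp add: inner_axis)

lemma L2_scaleR_vec:
  fixes f :: "real^'d \<Rightarrow> real" and b :: "'b::euclidean_space"
  assumes f: "f \<in> L2_space \<Omega>"
  shows "(\<lambda>x. f x *\<^sub>R b) \<in> L2_space \<Omega>"
  by (rule L2_spaceI_bound[OF _ f, of _ "norm b"])
     (use L2_measurable[OF f] in \<open>auto intro!: borel_measurable_scaleR\<close>)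

text \<open>
  Statements about vector-valued functions reduce to their components through this decomposition.
\<close>

lemma vec_as_sum: "v = (\<Sum>i\<in>UNIV. (\<lambda>x. (v x $ i) *\<^sub>R axis i 1))" for v :: "real^'d \<Rightarrow> real^'n"
proof
  fix x
  have "v x = (\<Sum>i\<in>UNIV. (v x $ i) *\<^sub>R axis i 1)"
    by (simp add: vec_eq_iff axis_def if_distrib cong: if_cong)
  then show "v x = (\<Sum>i\<in>UNIV. (\<lambda>x. (v x $ i) *\<^sub>R axis i 1)) x"
    by (simp only: sum_fun_apply)
qed

lemma L2_vec:
  fixes f :: "real^'d \<Rightarrow> real^'n"
  assumes "\<And>i. (\<lambda>x. f x $ i) \<in> L2_space \<Omega>"
  shows "f \<in> L2_space \<Omega>"
  by (subst vec_as_sum) (intro L2.X_sum L2_scaleR_vec assms)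

lemma L2_inner_vec:
  fixes f g :: "real^'d \<Rightarrow> real^'n"
  assumes "f \<in> L2_space \<Omega>" "g \<in> L2_space \<Omega>"
  shows "L2_inner \<Omega> f g = (\<Sum>i\<in>UNIV. L2_inner \<Omega> (\<lambda>x. f x $ i) (\<lambda>x. g x $ i))"
proof -
  have "integrable (lebesgue_on \<Omega>) (\<lambda>x. (f x $ i) \<bullet> (g x $ i))" for i
    using assms by (intro L2_inner_integrable L2_nth)
  then show ?thesis by (simp add: L2_inner_def inner_vec_def)
qed

section \<open>Test functions\<close>

lemma pderivs_append: "pderivs (ks @ ls) \<phi> = pderivs ks (pderivs ls \<phi>)"
  by (simp add: pderivs_def)

lemma test_differentiable: "\<phi> \<in> test_functions \<Omega> \<Longrightarrow> \<phi> differentiable (at x)"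
  using pderivs_Nil[of \<phi>] unfolding test_functions_def by (metis (mono_tags, lifting) mem_Collect_eq)

lemma test_pderivs_differentiable: "\<phi> \<in> test_functions \<Omega> \<Longrightarrow> pderivs ks \<phi> differentiable (at x)"
  unfolding test_functions_def by auto

lemma test_support:
  assumes "\<phi> \<in> test_functions \<Omega>"
  obtains K where "compact K" "K \<subseteq> \<Omega>" "\<And>x. x \<notin> K \<Longrightarrow> \<phi> x = 0"
  using assms unfolding test_functions_def by auto

lemma pderiv_dir_outside_support:
  assumes K: "compact K" and 0: "\<And>x. x \<notin> K \<Longrightarrow> \<phi> x = 0" and x: "x \<notin> K"
  shows "pderiv_dir i \<phi> x = 0"
proof -
  have "(\<phi> has_derivative (\<lambda>y. 0)) (at x)"
  proof (rule has_derivative_transform_within_open[where s = "- K"])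
    show "((\<lambda>x. 0) has_derivative (\<lambda>y. 0)) (at x)" by simp
    show "open (- K)" using compact_imp_closed[OF K] by auto
  qed (use x 0 in auto)
  from frechet_derivative_at[OF this, symmetric] show ?thesis by (simp add: pderiv_dir_def)
qed

lemma test_pderiv_dir:
  assumes "\<phi> \<in> test_functions \<Omega>"
  shows "pderiv_dir i \<phi> \<in> test_functions \<Omega>"
proof -
  obtain K where K: "compact K" "K \<subseteq> \<Omega>" "\<And>x. x \<notin> K \<Longrightarrow> \<phi> x = 0" using test_support[OF assms] by blast
  have "pderivs ks (pderiv_dir i \<phi>) differentiable (at x)" for ks x
    using test_pderivs_differentiable[OF assms, of "ks @ [i]" x]
    by (simp add: pderivs_append pderivs_Cons)
  moreover have "pderiv_dir i \<phi> x = 0" if "x \<notin> K" for x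
    by (rule pderiv_dir_outside_support[OF K(1,3) that])
  ultimately show ?thesis unfolding test_functions_def using K(1,2) by blast
qed

lemma pderiv_dir_linear:
  assumes "\<And>x. \<phi> differentiable (at x)" "\<And>x. \<psi> differentiable (at x)"
  shows "pderiv_dir i (a *\<^sub>R \<phi> + b *\<^sub>R \<psi>) = a *\<^sub>R pderiv_dir i \<phi> + b *\<^sub>R pderiv_dir i \<psi>"
proof
  fix x
  have "((\<lambda>x. a *\<^sub>R \<phi> x + b *\<^sub>R \<psi> x) has_derivative
     (\<lambda>y. a *\<^sub>R frechet_derivative \<phi> (at x) y + b *\<^sub>R frechet_derivative \<psi> (at x) y)) (at x)"
    using assms[unfolded frechet_derivative_works] by (intro derivative_intros)
  from frechet_derivative_at[OF this, symmetric]
  show "pderiv_dir i (a *\<^sub>R \<phi> + b *\<^sub>R \<psi>) x = (a *\<^sub>R pderiv_dir i \<phi> + b *\<^sub>R pderiv_dir i \<psi>) x"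
    by (simp add: pderiv_dir_def plus_fun_def scaleR_fun_def)
qed

lemma pderivs_linear:
  assumes \<phi>: "\<phi> \<in> test_functions \<Omega>" and \<psi>: "\<psi> \<in> test_functions \<Omega>"
  shows "pderivs ks (a *\<^sub>R \<phi> + b *\<^sub>R \<psi>) = a *\<^sub>R pderivs ks \<phi> + b *\<^sub>R pderivs ks \<psi>"
proof (induction ks)
  case (Cons i ks)
  show ?case
    unfolding pderivs_Cons Cons.IH
    by (intro pderiv_dir_linear test_pderivs_differentiable[OF \<phi>] test_pderivs_differentiable[OF \<psi>])
qed (simp only: pderivs_Nil)

lemma test_linear:
  assumes \<phi>: "\<phi> \<in> test_functions \<Omega>" and \<psi>: "\<psi> \<in> test_functions \<Omega>"
  shows "a *\<^sub>R \<phi> + b *\<^sub>R \<psi> \<in> test_functions \<Omega>"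
proof -
  obtain K where K: "compact K" "K \<subseteq> \<Omega>" "\<And>x. x \<notin> K \<Longrightarrow> \<phi> x = 0" using test_support[OF \<phi>] by blast
  obtain L where L: "compact L" "L \<subseteq> \<Omega>" "\<And>x. x \<notin> L \<Longrightarrow> \<psi> x = 0" using test_support[OF \<psi>] by blast
  have "pderivs ks (a *\<^sub>R \<phi> + b *\<^sub>R \<psi>) differentiable (at x)" for ks x
  proof -
    have "(\<lambda>x. a *\<^sub>R pderivs ks \<phi> x + b *\<^sub>R pderivs ks \<psi> x) differentiable (at x)"
      using test_pderivs_differentiable[OF \<phi>] test_pderivs_differentiable[OF \<psi>]
      by (intro differentiable_add differentiable_scaleR differentiable_const) auto
    then show ?thesis
      unfolding pderivs_linear[OF \<phi> \<psi>] by (simp only: plus_fun_def scaleR_fun_def)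
  qed
  moreover have "compact (K \<union> L)" "K \<union> L \<subseteq> \<Omega>" "\<And>x. x \<notin> K \<union> L \<Longrightarrow> (a *\<^sub>R \<phi> + b *\<^sub>R \<psi>) x = 0"
    using K L by auto
  ultimately show ?thesis unfolding test_functions_def by blast
qed

lemma test_zero: "0 \<in> test_functions \<Omega>"
proof -
  have "pderivs ks (0 :: real^'a \<Rightarrow> real) = 0" for ks
  proof (induction ks)
    case (Cons i ks)
    have "((0 :: real^'a \<Rightarrow> real) has_derivative (\<lambda>y. 0)) (at x)" for x
      unfolding zero_fun_def by simp
    from frechet_derivative_at[OF this, symmetric]
    have "pderiv_dir i 0 = (0 :: real^'a \<Rightarrow> real)" by (simp add: pderiv_dir_def fun_eq_iff)
    then show ?case by (simp only: pderivs_Cons Cons.IH)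
  qed (simp only: pderivs_Nil)
  then show ?thesis
    unfolding test_functions_def by (auto simp: zero_fun_def intro!: exI[of _ "{}"])
qed

lemma test_continuous: "\<phi> \<in> test_functions \<Omega> \<Longrightarrow> continuous_on S \<phi>"
  by (meson continuous_at_imp_continuous_on differentiable_imp_continuous_within test_differentiable)

lemma test_borel: "\<phi> \<in> test_functions \<Omega> \<Longrightarrow> \<phi> \<in> borel_measurable borel"
  by (rule borel_measurable_continuous_onI) (rule test_continuous)

lemma test_bounded:
  assumes "\<phi> \<in> test_functions \<Omega>"
  obtains B where "0 \<le> B" "\<And>x. \<bar>\<phi> x\<bar> \<le> B"
proof -
  obtain K where K: "compact K" "K \<subseteq> \<Omega>" "\<And>x. x \<notin> K \<Longrightarrow> \<phi> x = 0" using test_support[OF assms] by blast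
  have "compact (\<phi> ` K)" by (rule compact_continuous_image[OF test_continuous[OF assms] K(1)])
  then obtain B where B: "\<And>x. x \<in> K \<Longrightarrow> \<bar>\<phi> x\<bar> \<le> B"
    using compact_imp_bounded bounded_iff[of "\<phi> ` K"] by force
  have "\<bar>\<phi> x\<bar> \<le> \<bar>B\<bar>" for x using B[of x] K(3)[of x] by (cases "x \<in> K") auto
  then show ?thesis by (intro that[of "\<bar>B\<bar>"]) auto
qed

text \<open>
  Difference quotients of \<open>F\<close> have integral zero by translation invariance. They are bounded by \<open>B\<close>,
  supported in a fixed ball and converge to the partial derivative.
\<close>

lemma integral_pderiv_zero:
  fixes F G :: "real^'d \<Rightarrow> real"
  assumes F: "\<And>x. F differentiable (at x)" and K: "compact K" "\<And>x. x \<notin> K \<Longrightarrow> F x = 0"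
    and G: "pderiv_dir i F = G" and Gm: "G \<in> borel_measurable borel" and B: "\<And>x. \<bar>G x\<bar> \<le> B"
  shows "(LINT x|lborel. G x) = 0"
proof -
  define e :: "real^'d" where "e = axis i 1"
  have Fc: "continuous_on UNIV F"
    using F by (meson continuous_at_imp_continuous_on differentiable_imp_continuous_within)
  have Fm: "F \<in> borel_measurable borel" by (rule borel_measurable_continuous_onI[OF Fc])
  have line: "((\<lambda>s. F (x + s *\<^sub>R e)) has_real_derivative G (x + s *\<^sub>R e)) (at s)" for x s
  proof -
    have 1: "((\<lambda>s. x + s *\<^sub>R e) has_derivative (\<lambda>s. s *\<^sub>R e)) (at s)"
      by (auto intro!: derivative_eq_intros)
    have 2: "(F has_derivative frechet_derivative F (at (x + s *\<^sub>R e))) (at (x + s *\<^sub>R e))"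
      using F frechet_derivative_works by blast
    have "((\<lambda>s. F (x + s *\<^sub>R e)) has_derivative (\<lambda>r. frechet_derivative F (at (x + s *\<^sub>R e)) (r *\<^sub>R e))) (at s)"
      by (rule has_derivative_compose[OF 1 2])
    moreover have "frechet_derivative F (at (x + s *\<^sub>R e)) (r *\<^sub>R e) = G (x + s *\<^sub>R e) * r" for r
      using linear_frechet_derivative[OF F, of "x + s *\<^sub>R e"]
      by (simp add: linear_cmul e_def G[symmetric] pderiv_dir_def)
    ultimately show ?thesis by (simp add: has_field_derivative_def)
  qed
  have lip: "\<bar>F (x + s *\<^sub>R e) - F x\<bar> \<le> B * \<bar>s\<bar>" for x s
  proof -
    have "norm (F (x + s *\<^sub>R e) - F (x + 0 *\<^sub>R e)) \<le> B * norm (s - 0)"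
      by (rule field_differentiable_bound[of UNIV "\<lambda>s. F (x + s *\<^sub>R e)" "\<lambda>s. G (x + s *\<^sub>R e)"])
         (use line B in auto)
    then show ?thesis by simp
  qed
  have B0: "0 \<le> B" using B[of 0] by linarith
  obtain R where R: "0 < R" "K \<subseteq> cball 0 R"
    using compact_imp_bounded[OF K(1)] unfolding bounded_pos by (auto simp: subset_iff)
  \<comment> \<open>Steps of length at most one, so that all supports stay in the ball of radius R + 1.\<close>
  define D where "D n x = real (Suc n) * (F (x + inverse (real (Suc n)) *\<^sub>R e) - F x)" for n x
  have Fint: "integrable lborel F"
  proof -
    obtain C where C: "\<And>x. x \<in> K \<Longrightarrow> \<bar>F x\<bar> \<le> C"
      using compact_imp_bounded[OF compact_continuous_image[OF continuous_on_subset[OF Fc] K(1)]]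
        bounded_iff[of "F ` K"] by force
    show ?thesis
    proof (rule integrableI_bounded_set[of K])
      from C show "AE x in lborel. x \<in> K \<longrightarrow> norm (F x) \<le> C" by simp
      show "emeasure lborel K < \<infinity>" by (rule emeasure_bounded_finite[OF compact_imp_bounded[OF K(1)]])
      show "K \<in> sets lborel" using compact_imp_closed[OF K(1)] by (simp add: borel_closed)
    qed (use K Fm in auto)
  qed
  have shift: "integrable lborel (\<lambda>x. F (x + c))" "(LINT x|lborel. F (x + c)) = (LINT x|lborel. F x)" for c
  proof -
    have d: "distr lborel borel (\<lambda>x. x + c) = (lborel :: (real^'d) measure)"
      using lborel_distr_plus[of c] by (simp add: add.commute[of _ c])
    have "integrable (distr lborel borel (\<lambda>x. x + c)) F" using Fint by (simp add: d)
    then show "integrable lborel (\<lambda>x. F (x + c))"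
      by (subst (asm) integrable_distr_eq) (use Fm in auto)
    have "(LINT x|lborel. F x) = (LINT x|distr lborel borel (\<lambda>x. x + c). F x)" by (simp add: d)
    also have "\<dots> = (LINT x|lborel. F (x + c))" by (subst integral_distr) (use Fm in auto)
    finally show "(LINT x|lborel. F (x + c)) = (LINT x|lborel. F x)" by simp
  qed
  have D0: "(LINT x|lborel. D n x) = 0" for n
    unfolding D_def using shift Fint by simp
  have "(\<lambda>n. LINT x|lborel. D n x) \<longlonglongrightarrow> (LINT x|lborel. G x)"
  proof (rule integral_dominated_convergence[where w = "\<lambda>x. B * indicator (cball 0 (R + 1)) x"])
    show "G \<in> borel_measurable lborel" using Gm by simp
    show "D n \<in> borel_measurable lborel" for n
      unfolding D_def using shift Fint by (intro borel_measurable_integrable) auto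
    have "emeasure lborel (cball (0::real^'d) (R + 1)) < \<infinity>"
      by (rule emeasure_bounded_finite) simp
    then show "integrable lborel (\<lambda>x. B * indicator (cball (0::real^'d) (R + 1)) x)"
      by (intro integrable_mult_right integrable_real_indicator) auto
    show "AE x in lborel. (\<lambda>n. D n x) \<longlonglongrightarrow> G x"
    proof (intro always_eventually allI)
      fix x
      have "((\<lambda>s. (F (x + s *\<^sub>R e) - F x) / s) \<longlongrightarrow> G x) (at 0)"
        using line[of x 0] by (simp add: has_field_derivative_iff)
      moreover have "filterlim (\<lambda>n. inverse (real (Suc n))) (at 0) sequentially"
        unfolding filterlim_at using LIMSEQ_inverse_real_of_nat by auto
      ultimately have "(\<lambda>n. (F (x + inverse (real (Suc n)) *\<^sub>R e) - F x) / inverse (real (Suc n))) \<longlonglongrightarrow> G x"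
        by (rule filterlim_compose)
      then show "(\<lambda>n. D n x) \<longlonglongrightarrow> G x" by (simp add: D_def[abs_def] field_simps)
    qed
    show "AE x in lborel. norm (D n x) \<le> B * indicator (cball 0 (R + 1)) x" for n
    proof (intro always_eventually allI)
      fix x
      let ?s = "inverse (real (Suc n))"
      have s: "0 < ?s" "?s \<le> 1" by (auto simp: field_simps)
      show "norm (D n x) \<le> B * indicator (cball 0 (R + 1)) x"
      proof (cases "x \<in> cball 0 (R + 1)")
        case True
        have "norm (D n x) = real (Suc n) * \<bar>F (x + ?s *\<^sub>R e) - F x\<bar>" by (simp add: D_def abs_mult)
        also have "\<dots> \<le> real (Suc n) * (B * ?s)" using lip[of x ?s] s by (intro mult_left_mono) auto
        also have "\<dots> = B" by (simp add: field_simps)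
        finally show ?thesis using True by simp
      next
        case False
        have "norm x \<le> norm (x + ?s *\<^sub>R e) + norm (?s *\<^sub>R e)" using norm_triangle_ineq4[of "x + ?s *\<^sub>R e" "?s *\<^sub>R e"] by simp
        moreover have "norm (?s *\<^sub>R e) \<le> 1" using s by (simp add: e_def norm_axis_1)
        ultimately have "R < norm (x + ?s *\<^sub>R e)" "R < norm x" using False by auto
        then have "x + ?s *\<^sub>R e \<notin> K" "x \<notin> K" using R by auto
        then show ?thesis using False K by (simp add: D_def)
      qed
    qed
  qed
  then show ?thesis by (simp add: D0 LIMSEQ_const_iff)
qed

section \<open>Weak derivatives\<close>

locale bounded_domain =
  fixes \<Omega> :: "(real^'d) set"
  assumes open_domain: "open \<Omega>" and bounded_domain: "bounded \<Omega>"
begin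

lemma domain_sets: "\<Omega> \<in> sets lebesgue" "\<Omega> \<inter> space lebesgue \<in> sets lebesgue"
  using open_domain by (auto simp: borel_open)

lemma finite_measure_domain: "finite_measure (lebesgue_on \<Omega>)"
  using open_domain bounded_domain by (intro finite_measure_lebesgue_on bounded_set_imp_lmeasurable domain_sets)

lemma const_L2: "(\<lambda>x. c) \<in> L2_space \<Omega>"
  using finite_measure.integrable_const[OF finite_measure_domain] by (auto simp: L2_space_def)

lemma L2_integrable: "f \<in> L2_space \<Omega> \<Longrightarrow> integrable (lebesgue_on \<Omega>) f"
  using L2_scaleR_integrable[OF const_L2[of 1]] by simp

text \<open>
  Lebesgue measure is complete, so changing a function on a null set keeps it measurable. Membership in
  the function spaces is therefore a property of the class of functions equal almost everywhere.
\<close>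

lemma borel_measurable_cong_AE:
  fixes f g :: "real^'d \<Rightarrow> 'b::euclidean_space"
  assumes f: "f \<in> borel_measurable (lebesgue_on \<Omega>)" and eq: "ae_eq \<Omega> f g"
  shows "g \<in> borel_measurable (lebesgue_on \<Omega>)"
proof -
  have "(\<lambda>x. if x \<in> \<Omega> then f x else 0) \<in> borel_measurable lebesgue"
    using f domain_sets by (simp add: borel_measurable_if)
  moreover have "AE x in lebesgue. (if x \<in> \<Omega> then f x else 0) = (if x \<in> \<Omega> then g x else 0)"
    using eq domain_sets unfolding ae_eq_def
    by (subst (asm) AE_restrict_space_iff) (auto elim: eventually_mono)
  ultimately have "(\<lambda>x. if x \<in> \<Omega> then g x else 0) \<in> borel_measurable lebesgue"
    by (rule borel_measurable_AE)
  then show ?thesis using domain_sets by (simp add: borel_measurable_if)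
qed

lemma L2_ae_closed:
  assumes f: "f \<in> L2_space \<Omega>" and eq: "ae_eq \<Omega> f g"
  shows "g \<in> L2_space \<Omega>"
proof -
  have g: "g \<in> borel_measurable (lebesgue_on \<Omega>)"
    by (rule borel_measurable_cong_AE[OF L2_measurable[OF f] eq])
  have "integrable (lebesgue_on \<Omega>) (\<lambda>x. (norm (g x))\<^sup>2)"
  proof (subst integrable_cong_AE)
    show "AE x in lebesgue_on \<Omega>. (norm (g x))\<^sup>2 = (norm (f x))\<^sup>2"
      using eq unfolding ae_eq_def by eventually_elim simp
  qed (use g L2_measurable[OF f] L2_integrable_square[OF f] in auto)
  with g show ?thesis by (simp add: L2_space_def)
qed

lemma test_L2:
  assumes "\<phi> \<in> test_functions \<Omega>"
  shows "\<phi> \<in> L2_space \<Omega>"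
proof -
  obtain B where B: "0 \<le> B" "\<And>x. \<bar>\<phi> x\<bar> \<le> B" using test_bounded[OF assms] by blast
  have "\<phi> \<in> borel_measurable (lebesgue_on \<Omega>)"
    using test_borel[OF assms] by (intro measurable_restrict_space1 measurable_completion) auto
  then show ?thesis
    by (rule L2_spaceI_bound[OF _ const_L2[of "1::real"], of _ B]) (use B in auto)
qed

lemma pderivs_test: "\<phi> \<in> test_functions \<Omega> \<Longrightarrow> pderivs ks \<phi> \<in> test_functions \<Omega>"
  by (induction ks) (auto simp: pderivs_Cons test_pderiv_dir)

lemma test_integration_by_parts:
  assumes \<phi>: "\<phi> \<in> test_functions \<Omega>" and \<psi>: "\<psi> \<in> test_functions \<Omega>"
  shows "(LINT x|lebesgue_on \<Omega>. pderiv_dir i \<phi> x * \<psi> x) = - (LINT x|lebesgue_on \<Omega>. \<phi> x * pderiv_dir i \<psi> x)"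
proof -
  let ?F = "\<lambda>x. \<phi> x * \<psi> x" and ?G = "\<lambda>x. \<phi> x * pderiv_dir i \<psi> x + pderiv_dir i \<phi> x * \<psi> x"
  note d\<phi> = test_pderiv_dir[OF \<phi>, of i] and d\<psi> = test_pderiv_dir[OF \<psi>, of i]
  obtain K where K: "compact K" "K \<subseteq> \<Omega>" "\<And>x. x \<notin> K \<Longrightarrow> \<phi> x = 0" using test_support[OF \<phi>] by blast
  have D: "(?F has_derivative (\<lambda>y. \<phi> x * frechet_derivative \<psi> (at x) y + frechet_derivative \<phi> (at x) y * \<psi> x)) (at x)" for x
    using test_differentiable[OF \<phi>] test_differentiable[OF \<psi>]
    by (intro has_derivative_mult) (auto simp: frechet_derivative_works)
  have G: "pderiv_dir i ?F = ?G"
    using frechet_derivative_at[OF D, symmetric] by (simp add: pderiv_dir_def fun_eq_iff)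
  obtain B1 where B1: "0 \<le> B1" "\<And>x. \<bar>\<phi> x\<bar> \<le> B1" using test_bounded[OF \<phi>] by blast
  obtain B2 where B2: "0 \<le> B2" "\<And>x. \<bar>\<psi> x\<bar> \<le> B2" using test_bounded[OF \<psi>] by blast
  obtain B3 where B3: "0 \<le> B3" "\<And>x. \<bar>pderiv_dir i \<phi> x\<bar> \<le> B3" using test_bounded[OF d\<phi>] by blast
  obtain B4 where B4: "0 \<le> B4" "\<And>x. \<bar>pderiv_dir i \<psi> x\<bar> \<le> B4" using test_bounded[OF d\<psi>] by blast
  have Gm: "?G \<in> borel_measurable borel"
    using test_borel[OF \<phi>] test_borel[OF \<psi>] test_borel[OF d\<phi>] test_borel[OF d\<psi>]
    by (intro borel_measurable_add borel_measurable_times)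
  have "(LINT x|lborel. ?G x) = 0"
  proof (rule integral_pderiv_zero[OF _ K(1) _ G Gm, of "B1 * B4 + B3 * B2"])
    show "?F differentiable at x" for x using D[of x] by (rule differentiableI)
    show "?F x = 0" if "x \<notin> K" for x using K(3)[OF that] by simp
    show "\<bar>?G x\<bar> \<le> B1 * B4 + B3 * B2" for x
    proof -
      have "\<bar>?G x\<bar> \<le> \<bar>\<phi> x\<bar> * \<bar>pderiv_dir i \<psi> x\<bar> + \<bar>pderiv_dir i \<phi> x\<bar> * \<bar>\<psi> x\<bar>"
        unfolding abs_mult[symmetric] by (rule abs_triangle_ineq)
      also have "\<dots> \<le> B1 * B4 + B3 * B2"
        using B1 B2 B3 B4 by (intro add_mono mult_mono) auto
      finally show ?thesis .
    qed
  qed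
  moreover have "(LINT x|lebesgue_on \<Omega>. ?G x) = (LINT x|lborel. ?G x)"
  proof -
    have ind: "indicator \<Omega> x *\<^sub>R ?G x = ?G x" for x
    proof (cases "x \<in> \<Omega>")
      case False
      then have "x \<notin> K" using K(2) by auto
      then show ?thesis
        using False K(3) pderiv_dir_outside_support[where \<phi> = \<phi> and K = K and x = x and i = i, OF K(1,3)] by simp
    qed simp
    have "(LINT x|lebesgue_on \<Omega>. ?G x) = (LINT x|lebesgue. indicator \<Omega> x *\<^sub>R ?G x)"
      by (rule integral_restrict_space[OF domain_sets(2)])
    also have "\<dots> = (LINT x|lebesgue. ?G x)" by (simp only: ind)
    also have "\<dots> = (LINT x|lborel. ?G x)" using Gm by (intro integral_completion) simp
    finally show ?thesis .
  qed
  moreover have "(LINT x|lebesgue_on \<Omega>. ?G x)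
      = (LINT x|lebesgue_on \<Omega>. \<phi> x * pderiv_dir i \<psi> x) + (LINT x|lebesgue_on \<Omega>. pderiv_dir i \<phi> x * \<psi> x)"
    using L2_inner_integrable[OF test_L2[OF \<phi>] test_L2[OF d\<psi>]]
      L2_inner_integrable[OF test_L2[OF d\<phi>] test_L2[OF \<psi>]]
    by (intro Bochner_Integration.integral_add) auto
  ultimately show ?thesis by simp
qed

text \<open>
  Two weak derivatives have the same integral against every test function; the fundamental lemma is
  applied to the components of their difference.
\<close>

lemma weak_deriv_unique:
  fixes f g g' :: "real^'d \<Rightarrow> 'b::euclidean_space"
  assumes "has_weak_deriv \<Omega> ks f g" "has_weak_deriv \<Omega> ks f g'"
  shows "ae_eq \<Omega> g g'"
proof -
  have L: "g \<in> L2_space \<Omega>" "g' \<in> L2_space \<Omega>" using assms by (auto simp: has_weak_deriv_def)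
  have "AE x in lebesgue_on \<Omega>. (g x - g' x) \<bullet> b = 0" for b
  proof (rule fundamental_lemma_real[OF open_domain])
    have d: "g - g' \<in> L2_space \<Omega>" using L by (rule L2.X_closed)
    then show "integrable (lebesgue_on \<Omega>) (\<lambda>x. (g x - g' x) \<bullet> b)"
      using L2_integrable[OF L2_comp[OF d, of b]] by simp
    fix \<phi> assume \<phi>: "\<phi> \<in> test_functions \<Omega>"
    have i: "integrable (lebesgue_on \<Omega>) (\<lambda>x. \<phi> x *\<^sub>R g x)" "integrable (lebesgue_on \<Omega>) (\<lambda>x. \<phi> x *\<^sub>R g' x)"
      using L by (auto intro: L2_scaleR_integrable[OF test_L2[OF \<phi>]])
    have "(LINT x|lebesgue_on \<Omega>. pderivs ks \<phi> x *\<^sub>R f x) = (-1) ^ length ks *\<^sub>R (LINT x|lebesgue_on \<Omega>. \<phi> x *\<^sub>R g x)"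
      and "(LINT x|lebesgue_on \<Omega>. pderivs ks \<phi> x *\<^sub>R f x) = (-1) ^ length ks *\<^sub>R (LINT x|lebesgue_on \<Omega>. \<phi> x *\<^sub>R g' x)"
      using assms \<phi> by (auto simp: has_weak_deriv_def)
    then have eq: "(LINT x|lebesgue_on \<Omega>. \<phi> x *\<^sub>R g x) = (LINT x|lebesgue_on \<Omega>. \<phi> x *\<^sub>R g' x)"
      by simp
    have "(LINT x|lebesgue_on \<Omega>. \<phi> x * ((g x - g' x) \<bullet> b))
        = (LINT x|lebesgue_on \<Omega>. (\<phi> x *\<^sub>R g x - \<phi> x *\<^sub>R g' x) \<bullet> b)"
      by (simp add: inner_diff_left algebra_simps)
    also have "\<dots> = (LINT x|lebesgue_on \<Omega>. (\<phi> x *\<^sub>R g x - \<phi> x *\<^sub>R g' x)) \<bullet> b"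
      using i by (intro integral_inner_left) auto
    also have "\<dots> = 0" using i eq by simp
    finally show "(LINT x|lebesgue_on \<Omega>. \<phi> x * ((g x - g' x) \<bullet> b)) = 0" .
  qed
  then have *: "AE x in lebesgue_on \<Omega>. \<forall>b\<in>Basis. (g x - g' x) \<bullet> b = 0"
    by (intro AE_finite_allI) auto
  have "v = w" if "\<forall>b\<in>Basis. (v - w) \<bullet> b = 0" for v w :: 'b
    using that euclidean_all_zero_iff[of "v - w"] by (metis right_minus_eq)
  with * show ?thesis unfolding ae_eq_def by (rule eventually_mono)
qed

lemma weak_deriv_cong:
  assumes "has_weak_deriv \<Omega> ks f g" "ae_eq \<Omega> f f'" "ae_eq \<Omega> g g'"
  shows "has_weak_deriv \<Omega> ks f' g'"
proof -
  have L: "f \<in> L2_space \<Omega>" "g \<in> L2_space \<Omega>" using assms(1) by (auto simp: has_weak_deriv_def)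
  have L': "f' \<in> L2_space \<Omega>" "g' \<in> L2_space \<Omega>" using L assms L2_ae_closed by blast+
  have int_eq: "(LINT x|lebesgue_on \<Omega>. \<phi> x *\<^sub>R h' x) = (LINT x|lebesgue_on \<Omega>. \<phi> x *\<^sub>R h x)"
    if "\<phi> \<in> test_functions \<Omega>" "ae_eq \<Omega> h h'" "h \<in> L2_space \<Omega>" "h' \<in> L2_space \<Omega>"
    for \<phi> and h h' :: "real^'d \<Rightarrow> 'a"
  proof (rule integral_cong_AE)
    show "AE x in lebesgue_on \<Omega>. \<phi> x *\<^sub>R h' x = \<phi> x *\<^sub>R h x"
      using that(2) unfolding ae_eq_def by eventually_elim simp
  qed (use that L2_measurable[OF test_L2[OF that(1)]] L2_measurable[OF that(3)] L2_measurable[OF that(4)]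
      in \<open>auto intro!: borel_measurable_scaleR\<close>)
  show ?thesis
    using assms(1) L L' int_eq[OF _ assms(2) L(1) L'(1)] int_eq[OF _ assms(3) L(2) L'(2)] pderivs_test
    unfolding has_weak_deriv_def by simp
qed

lemma weak_deriv_linear:
  assumes f: "has_weak_deriv \<Omega> ks f g" and f': "has_weak_deriv \<Omega> ks f' g'"
  shows "has_weak_deriv \<Omega> ks (a *\<^sub>R f + b *\<^sub>R f') (a *\<^sub>R g + b *\<^sub>R g')"
proof -
  have L: "f \<in> L2_space \<Omega>" "g \<in> L2_space \<Omega>" "f' \<in> L2_space \<Omega>" "g' \<in> L2_space \<Omega>"
    using f f' by (auto simp: has_weak_deriv_def)
  have lin: "(LINT x|lebesgue_on \<Omega>. \<phi> x *\<^sub>R (a *\<^sub>R h + b *\<^sub>R h') x)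
     = a *\<^sub>R (LINT x|lebesgue_on \<Omega>. \<phi> x *\<^sub>R h x) + b *\<^sub>R (LINT x|lebesgue_on \<Omega>. \<phi> x *\<^sub>R h' x)"
    if \<phi>: "\<phi> \<in> test_functions \<Omega>" and h: "h \<in> L2_space \<Omega>" "h' \<in> L2_space \<Omega>" for \<phi> and h h' :: "real^'d \<Rightarrow> 'a"
  proof -
    have i: "integrable (lebesgue_on \<Omega>) (\<lambda>x. \<phi> x *\<^sub>R h x)" "integrable (lebesgue_on \<Omega>) (\<lambda>x. \<phi> x *\<^sub>R h' x)"
      using h by (auto intro: L2_scaleR_integrable[OF test_L2[OF \<phi>]])
    have "(LINT x|lebesgue_on \<Omega>. \<phi> x *\<^sub>R (a *\<^sub>R h + b *\<^sub>R h') x)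
        = (LINT x|lebesgue_on \<Omega>. a *\<^sub>R (\<phi> x *\<^sub>R h x) + b *\<^sub>R (\<phi> x *\<^sub>R h' x))"
      by (simp add: algebra_simps)
    also have "\<dots> = (LINT x|lebesgue_on \<Omega>. a *\<^sub>R (\<phi> x *\<^sub>R h x)) + (LINT x|lebesgue_on \<Omega>. b *\<^sub>R (\<phi> x *\<^sub>R h' x))"
      using i by (intro Bochner_Integration.integral_add integrable_scaleR_right)
    also have "\<dots> = a *\<^sub>R (LINT x|lebesgue_on \<Omega>. \<phi> x *\<^sub>R h x) + b *\<^sub>R (LINT x|lebesgue_on \<Omega>. \<phi> x *\<^sub>R h' x)"
      by (simp only: integral_scaleR_right)
    finally show ?thesis .
  qed
  show ?thesis
    unfolding has_weak_deriv_def
  proof (intro conjI ballI)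
    show "a *\<^sub>R f + b *\<^sub>R f' \<in> L2_space \<Omega>" "a *\<^sub>R g + b *\<^sub>R g' \<in> L2_space \<Omega>" using L by (auto intro!: L2.X_closed)
    fix \<phi> assume \<phi>: "\<phi> \<in> test_functions \<Omega>"
    have e: "(LINT x|lebesgue_on \<Omega>. pderivs ks \<phi> x *\<^sub>R f x) = (-1) ^ length ks *\<^sub>R (LINT x|lebesgue_on \<Omega>. \<phi> x *\<^sub>R g x)"
      "(LINT x|lebesgue_on \<Omega>. pderivs ks \<phi> x *\<^sub>R f' x) = (-1) ^ length ks *\<^sub>R (LINT x|lebesgue_on \<Omega>. \<phi> x *\<^sub>R g' x)"
      using f f' \<phi> by (auto simp: has_weak_deriv_def)
    show "(LINT x|lebesgue_on \<Omega>. pderivs ks \<phi> x *\<^sub>R (a *\<^sub>R f + b *\<^sub>R f') x)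
        = (-1) ^ length ks *\<^sub>R (LINT x|lebesgue_on \<Omega>. \<phi> x *\<^sub>R (a *\<^sub>R g + b *\<^sub>R g') x)"
      unfolding lin[OF pderivs_test[OF \<phi>] L(1,3)] lin[OF \<phi> L(2,4)] e
      by (simp add: scaleR_add_right mult.commute)
  qed
qed

lemma has_weak_deriv_wderiv: "has_weak_deriv \<Omega> ks f g \<Longrightarrow> has_weak_deriv \<Omega> ks f (wderiv \<Omega> ks f)"
  unfolding wderiv_def by (rule someI[of "has_weak_deriv \<Omega> ks f"])

lemma wderiv_eq: "has_weak_deriv \<Omega> ks f g \<Longrightarrow> ae_eq \<Omega> (wderiv \<Omega> ks f) g"
  using has_weak_deriv_wderiv weak_deriv_unique by blast

lemma H_has_weak_deriv: "f \<in> H_space m \<Omega> \<Longrightarrow> length ks \<le> m \<Longrightarrow> has_weak_deriv \<Omega> ks f (wderiv \<Omega> ks f)"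
  using has_weak_deriv_wderiv unfolding H_space_def by blast

lemma wderiv_L2: "f \<in> H_space m \<Omega> \<Longrightarrow> length ks \<le> m \<Longrightarrow> wderiv \<Omega> ks f \<in> L2_space \<Omega>"
  using H_has_weak_deriv unfolding has_weak_deriv_def by blast

lemma H_L2: "f \<in> H_space m \<Omega> \<Longrightarrow> f \<in> L2_space \<Omega>"
  using H_has_weak_deriv[of f m "[]"] unfolding has_weak_deriv_def by auto

lemma H_space_mono: "f \<in> H_space m \<Omega> \<Longrightarrow> k \<le> m \<Longrightarrow> f \<in> H_space k \<Omega>"
  unfolding H_space_def by auto

lemma weak_deriv_Nil: "f \<in> L2_space \<Omega> \<Longrightarrow> has_weak_deriv \<Omega> [] f f"
  by (simp add: has_weak_deriv_def)

lemma wderiv_Nil: "f \<in> L2_space \<Omega> \<Longrightarrow> ae_eq \<Omega> (wderiv \<Omega> [] f) f"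
  by (rule wderiv_eq[OF weak_deriv_Nil])

lemma H_linear:
  assumes f: "f \<in> H_space m \<Omega>" and g: "g \<in> H_space m \<Omega>"
  shows "a *\<^sub>R f + b *\<^sub>R g \<in> H_space m \<Omega>"
  unfolding H_space_def using weak_deriv_linear[OF H_has_weak_deriv[OF f] H_has_weak_deriv[OF g]] by blast

lemma wderiv_linear:
  assumes f: "f \<in> H_space m \<Omega>" and g: "g \<in> H_space m \<Omega>" and m: "length ks \<le> m"
  shows "ae_eq \<Omega> (wderiv \<Omega> ks (a *\<^sub>R f + b *\<^sub>R g)) (a *\<^sub>R wderiv \<Omega> ks f + b *\<^sub>R wderiv \<Omega> ks g)"
  using weak_deriv_linear[OF H_has_weak_deriv[OF f m] H_has_weak_deriv[OF g m]] by (rule wderiv_eq)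

lemma wderiv_add:
  assumes f: "f \<in> H_space m \<Omega>" and g: "g \<in> H_space m \<Omega>" and m: "length ks \<le> m"
  shows "ae_eq \<Omega> (wderiv \<Omega> ks (f + g)) (wderiv \<Omega> ks f + wderiv \<Omega> ks g)"
  using wderiv_linear[OF f g m, of 1 1] by simp

lemma wderiv_scaleR:
  assumes f: "f \<in> H_space m \<Omega>" and m: "length ks \<le> m"
  shows "ae_eq \<Omega> (wderiv \<Omega> ks (a *\<^sub>R f)) (a *\<^sub>R wderiv \<Omega> ks f)"
  using wderiv_linear[OF f f m, of a 0] by simp

lemma subspace_H: "subspace (H_space m \<Omega>)"
  unfolding subspace_def
proof (intro conjI ballI allI)
  have "has_weak_deriv \<Omega> ks 0 0" for ks
    unfolding has_weak_deriv_def using L2.X_closed(1) by auto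
  then show "0 \<in> H_space m \<Omega>" unfolding H_space_def by blast
  show "x + y \<in> H_space m \<Omega>" if "x \<in> H_space m \<Omega>" "y \<in> H_space m \<Omega>" for x y
    using H_linear[OF that, of 1 1] by simp
  show "c *\<^sub>R x \<in> H_space m \<Omega>" if "x \<in> H_space m \<Omega>" for c x
    using H_linear[OF that that, of c 0] by simp
qed

lemma H_ae_closed: "f \<in> H_space m \<Omega> \<Longrightarrow> ae_eq \<Omega> f g \<Longrightarrow> g \<in> H_space m \<Omega>"
  unfolding H_space_def using weak_deriv_cong[OF _ _ ae_eq_refl] by blast

lemma wderiv_cong: "f \<in> H_space m \<Omega> \<Longrightarrow> length ks \<le> m \<Longrightarrow> ae_eq \<Omega> f g \<Longrightarrow> ae_eq \<Omega> (wderiv \<Omega> ks f) (wderiv \<Omega> ks g)"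
  using weak_deriv_cong[OF H_has_weak_deriv _ ae_eq_refl] wderiv_eq ae_eq_sym by blast

text \<open>
  The representatives chosen by \<open>wderiv\<close> are linear in the function only almost everywhere, which is enough
  for a bilinear form. The Sobolev inner products and the gradient form are sums of this shape.
\<close>

lemma semi_inner_wderiv_sum:
  assumes A: "finite A" "\<And>ks. ks \<in> A \<Longrightarrow> length ks \<le> m"
  shows "semi_inner (H_space m \<Omega> :: (real^'d \<Rightarrow> 'b::euclidean_space) set)
     (\<lambda>f g. \<Sum>ks\<in>A. L2_inner \<Omega> (wderiv \<Omega> ks f) (wderiv \<Omega> ks g))"
proof
  show "subspace (H_space m \<Omega> :: (real^'d \<Rightarrow> 'b) set)" by (rule subspace_H)
next
  fix f g h :: "real^'d \<Rightarrow> 'b" and c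
  assume f: "f \<in> H_space m \<Omega>" and g: "g \<in> H_space m \<Omega>"
  note fD = wderiv_L2[OF f A(2)] and gD = wderiv_L2[OF g A(2)]
  show "(\<Sum>ks\<in>A. L2_inner \<Omega> (wderiv \<Omega> ks f) (wderiv \<Omega> ks g)) = (\<Sum>ks\<in>A. L2_inner \<Omega> (wderiv \<Omega> ks g) (wderiv \<Omega> ks f))"
    by (intro sum.cong refl L2.ip_commute fD gD)
  show "(\<Sum>ks\<in>A. L2_inner \<Omega> (wderiv \<Omega> ks (c *\<^sub>R f)) (wderiv \<Omega> ks g)) = c * (\<Sum>ks\<in>A. L2_inner \<Omega> (wderiv \<Omega> ks f) (wderiv \<Omega> ks g))"
    unfolding sum_distrib_left
  proof (intro sum.cong refl)
    fix ks assume ks: "ks \<in> A"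
    have cf: "c *\<^sub>R f \<in> H_space m \<Omega>" using subspace_H f by (rule subspace_scale)
    have "L2_inner \<Omega> (wderiv \<Omega> ks (c *\<^sub>R f)) (wderiv \<Omega> ks g) = L2_inner \<Omega> (c *\<^sub>R wderiv \<Omega> ks f) (wderiv \<Omega> ks g)"
      using wderiv_scaleR[OF f A(2)[OF ks]] fD[OF ks] gD[OF ks] wderiv_L2[OF cf A(2)[OF ks]]
      by (intro L2_inner_cong) auto
    then show "L2_inner \<Omega> (wderiv \<Omega> ks (c *\<^sub>R f)) (wderiv \<Omega> ks g) = c * L2_inner \<Omega> (wderiv \<Omega> ks f) (wderiv \<Omega> ks g)"
      using fD[OF ks] gD[OF ks] by (simp add: L2.ip_scaleR_left)
  qed
  assume h: "h \<in> H_space m \<Omega>"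
  note hD = wderiv_L2[OF h A(2)]
  show "(\<Sum>ks\<in>A. L2_inner \<Omega> (wderiv \<Omega> ks (f + g)) (wderiv \<Omega> ks h))
      = (\<Sum>ks\<in>A. L2_inner \<Omega> (wderiv \<Omega> ks f) (wderiv \<Omega> ks h)) + (\<Sum>ks\<in>A. L2_inner \<Omega> (wderiv \<Omega> ks g) (wderiv \<Omega> ks h))"
    unfolding sum.distrib[symmetric]
  proof (intro sum.cong refl)
    fix ks assume ks: "ks \<in> A"
    have fg: "f + g \<in> H_space m \<Omega>" using subspace_H f g by (rule subspace_add)
    have "L2_inner \<Omega> (wderiv \<Omega> ks (f + g)) (wderiv \<Omega> ks h) = L2_inner \<Omega> (wderiv \<Omega> ks f + wderiv \<Omega> ks g) (wderiv \<Omega> ks h)"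
      using wderiv_add[OF f g A(2)[OF ks]] fD[OF ks] gD[OF ks] hD[OF ks] wderiv_L2[OF fg A(2)[OF ks]]
      by (intro L2_inner_cong) auto
    then show "L2_inner \<Omega> (wderiv \<Omega> ks (f + g)) (wderiv \<Omega> ks h)
        = L2_inner \<Omega> (wderiv \<Omega> ks f) (wderiv \<Omega> ks h) + L2_inner \<Omega> (wderiv \<Omega> ks g) (wderiv \<Omega> ks h)"
      using fD[OF ks] gD[OF ks] hD[OF ks] by (simp add: L2.ip_add_left)
  qed
next
  fix f :: "real^'d \<Rightarrow> 'b" assume f: "f \<in> H_space m \<Omega>"
  show "0 \<le> (\<Sum>ks\<in>A. L2_inner \<Omega> (wderiv \<Omega> ks f) (wderiv \<Omega> ks f))"
    by (intro sum_nonneg L2.ip_nonneg wderiv_L2[OF f A(2)])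
qed

definition H_ip :: "nat \<Rightarrow> (real^'d \<Rightarrow> 'b::euclidean_space) \<Rightarrow> (real^'d \<Rightarrow> 'b) \<Rightarrow> real" where
  "H_ip m f g = (\<Sum>ks | length ks \<le> m. L2_inner \<Omega> (wderiv \<Omega> ks f) (wderiv \<Omega> ks g))"

lemma finite_multiindices: "finite {ks :: 'd list. length ks \<le> m}"
  using finite_lists_length_le[of "UNIV :: 'd set" m] by simp

lemma semi_inner_H: "semi_inner (H_space m \<Omega> :: (real^'d \<Rightarrow> 'b::euclidean_space) set) (H_ip m)"
  unfolding H_ip_def[abs_def] by (rule semi_inner_wderiv_sum) (auto simp: finite_multiindices)

lemma nrm_H: "semi_inner.nrm (H_ip m) = (H_norm m \<Omega> :: (real^'d \<Rightarrow> 'b::euclidean_space) \<Rightarrow> real)"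
  by (rule ext) (simp add: semi_inner.nrm_def[OF semi_inner_H] H_norm_def H_ip_def L2_norm_sq)

lemma wderiv_norm_le_H_norm: "length ks \<le> m \<Longrightarrow> L2_norm \<Omega> (wderiv \<Omega> ks f) \<le> H_norm m \<Omega> f"
proof -
  assume "length ks \<le> m"
  then have "(\<Sum>is\<in>{ks}. (L2_norm \<Omega> (wderiv \<Omega> is f))\<^sup>2) \<le> (\<Sum>is | length is \<le> m. (L2_norm \<Omega> (wderiv \<Omega> is f))\<^sup>2)"
    by (intro sum_mono2 finite_multiindices) auto
  then have "(L2_norm \<Omega> (wderiv \<Omega> ks f))\<^sup>2 \<le> (\<Sum>is | length is \<le> m. (L2_norm \<Omega> (wderiv \<Omega> is f))\<^sup>2)"
    by simp
  then show ?thesis unfolding H_norm_def by (rule real_le_rsqrt)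
qed

lemma H_norm_mono: "k \<le> m \<Longrightarrow> H_norm k \<Omega> f \<le> H_norm m \<Omega> f"
  unfolding H_norm_def by (intro real_sqrt_le_mono sum_mono2 finite_multiindices) auto

lemma L2_norm_le_H_norm:
  assumes f: "f \<in> L2_space \<Omega>"
  shows "L2_norm \<Omega> f \<le> H_norm m \<Omega> f"
proof -
  have "L2_norm \<Omega> (wderiv \<Omega> [] f) = L2_norm \<Omega> f"
    by (rule L2_norm_cong[OF wderiv_Nil[OF f] L2_ae_closed[OF f ae_eq_sym[OF wderiv_Nil[OF f]]] f])
  then show ?thesis using wderiv_norm_le_H_norm[of "[]" m f] by simp
qed

lemma weak_deriv_nth:
  fixes f :: "real^'d \<Rightarrow> real^'n"
  assumes "has_weak_deriv \<Omega> ks f g"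
  shows "has_weak_deriv \<Omega> ks (\<lambda>x. f x $ i) (\<lambda>x. g x $ i)"
  unfolding has_weak_deriv_def
proof (intro conjI ballI)
  have L: "f \<in> L2_space \<Omega>" "g \<in> L2_space \<Omega>" using assms by (auto simp: has_weak_deriv_def)
  then show "(\<lambda>x. f x $ i) \<in> L2_space \<Omega>" "(\<lambda>x. g x $ i) \<in> L2_space \<Omega>" by (auto intro: L2_nth)
  fix \<phi> assume \<phi>: "\<phi> \<in> test_functions \<Omega>"
  have nth: "(LINT x|lebesgue_on \<Omega>. \<psi> x *\<^sub>R (h x $ i)) = (LINT x|lebesgue_on \<Omega>. \<psi> x *\<^sub>R h x) $ i"
    if "\<psi> \<in> test_functions \<Omega>" "h \<in> L2_space \<Omega>" for \<psi> and h :: "real^'d \<Rightarrow> real^'n"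
    using integral_bounded_linear[OF bounded_linear_vec_nth L2_scaleR_integrable[OF test_L2[OF that(1)] that(2)], of i]
    by simp
  show "(LINT x|lebesgue_on \<Omega>. pderivs ks \<phi> x *\<^sub>R (f x $ i)) = (-1) ^ length ks *\<^sub>R (LINT x|lebesgue_on \<Omega>. \<phi> x *\<^sub>R (g x $ i))"
    unfolding nth[OF pderivs_test[OF \<phi>] L(1)] nth[OF \<phi> L(2)]
    using assms \<phi> by (simp add: has_weak_deriv_def)
qed

lemma weak_deriv_scaleR_vec:
  fixes f :: "real^'d \<Rightarrow> real" and b :: "real^'n"
  assumes "has_weak_deriv \<Omega> ks f g"
  shows "has_weak_deriv \<Omega> ks (\<lambda>x. f x *\<^sub>R b) (\<lambda>x. g x *\<^sub>R b)"
  unfolding has_weak_deriv_def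
proof (intro conjI ballI)
  have L: "f \<in> L2_space \<Omega>" "g \<in> L2_space \<Omega>" using assms by (auto simp: has_weak_deriv_def)
  then show "(\<lambda>x. f x *\<^sub>R b) \<in> L2_space \<Omega>" "(\<lambda>x. g x *\<^sub>R b) \<in> L2_space \<Omega>" by (auto intro: L2_scaleR_vec)
  fix \<phi> assume \<phi>: "\<phi> \<in> test_functions \<Omega>"
  have sc: "(LINT x|lebesgue_on \<Omega>. \<psi> x *\<^sub>R (h x *\<^sub>R b)) = (LINT x|lebesgue_on \<Omega>. \<psi> x *\<^sub>R h x) *\<^sub>R b"
    if "\<psi> \<in> test_functions \<Omega>" "h \<in> L2_space \<Omega>" for \<psi> and h :: "real^'d \<Rightarrow> real"
    using integral_bounded_linear[OF bounded_linear_scaleR_left L2_scaleR_integrable[OF test_L2[OF that(1)] that(2)], of b]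
    by simp
  show "(LINT x|lebesgue_on \<Omega>. pderivs ks \<phi> x *\<^sub>R (f x *\<^sub>R b)) = (-1) ^ length ks *\<^sub>R (LINT x|lebesgue_on \<Omega>. \<phi> x *\<^sub>R (g x *\<^sub>R b))"
    unfolding sc[OF pderivs_test[OF \<phi>] L(1)] sc[OF \<phi> L(2)]
    using assms \<phi> by (simp add: has_weak_deriv_def)
qed

lemma weak_deriv_sum:
  assumes "finite A" "\<And>i. i \<in> A \<Longrightarrow> has_weak_deriv \<Omega> ks (f i) (g i)"
  shows "has_weak_deriv \<Omega> ks (sum f A) (sum g A)"
  using assms
proof (induction A rule: finite_induct)
  case empty
  show ?case unfolding has_weak_deriv_def using L2.X_closed(1) by auto
next
  case (insert i A)
  then have "has_weak_deriv \<Omega> ks (1 *\<^sub>R f i + 1 *\<^sub>R sum f A) (1 *\<^sub>R g i + 1 *\<^sub>R sum g A)"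
    by (intro weak_deriv_linear) auto
  then show ?case unfolding sum.insert[OF insert(1,2)] scaleR_one .
qed

lemma weak_deriv_vec:
  fixes f g :: "real^'d \<Rightarrow> real^'n"
  assumes "\<And>i. has_weak_deriv \<Omega> ks (\<lambda>x. f x $ i) (\<lambda>x. g x $ i)"
  shows "has_weak_deriv \<Omega> ks f g"
  by (subst (1 2) vec_as_sum) (intro weak_deriv_sum weak_deriv_scaleR_vec assms; simp)

text \<open>
  Classical derivatives of test functions are weak derivatives, by integration by parts between test
  functions. This makes the norm in the definition of \<open>H10_space\<close> meaningful.
\<close>

lemma weak_deriv_test:
  assumes "\<phi> \<in> test_functions \<Omega>"
  shows "has_weak_deriv \<Omega> [i] \<phi> (pderiv_dir i \<phi>)"
  unfolding has_weak_deriv_def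
  using test_L2[OF assms] test_L2[OF test_pderiv_dir[OF assms]] test_integration_by_parts[OF _ assms]
  by (simp add: pderivs_Cons)

lemma test_H1:
  assumes "\<phi> \<in> test_functions \<Omega>"
  shows "\<phi> \<in> H_space 1 \<Omega>"
  unfolding H_space_def
proof (intro CollectI allI impI)
  fix ks :: "'d list" assume "length ks \<le> 1"
  then consider "ks = []" | i where "ks = [i]" by (cases ks) auto
  then show "\<exists>g. has_weak_deriv \<Omega> ks \<phi> g"
    using weak_deriv_Nil[OF test_L2[OF assms]] weak_deriv_test[OF assms] by cases blast+
qed

end

section \<open>Velocity and pressure spaces\<close>

lemma semi_inner_cong:
  assumes s: "semi_inner X ip" and eq: "\<And>x y. x \<in> X \<Longrightarrow> y \<in> X \<Longrightarrow> ip' x y = ip x y"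
  shows "semi_inner X ip'"
proof -
  interpret semi_inner X ip by (rule s)
  show ?thesis by standard (auto simp: eq subspace_X ip_bilinear ip_commute ip_nonneg)
qed

lemma semi_inner_subset:
  assumes s: "semi_inner X ip" and Y: "subspace Y" "Y \<subseteq> X"
  shows "semi_inner Y ip"
proof -
  interpret semi_inner X ip by (rule s)
  show ?thesis using Y by unfold_locales (auto simp: ip_bilinear ip_commute ip_nonneg subset_iff)
qed

context bounded_domain
begin

sublocale H: semi_inner "H_space m \<Omega> :: (real^'d \<Rightarrow> 'b::euclidean_space) set" "H_ip m"
  rewrites "semi_inner.nrm (H_ip m) = (H_norm m \<Omega> :: (real^'d \<Rightarrow> 'b::euclidean_space) \<Rightarrow> real)" for m
  using semi_inner_H nrm_H by auto

lemma H_norm_cong: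
  assumes "f \<in> H_space m \<Omega>" "ae_eq \<Omega> f g"
  shows "H_norm m \<Omega> f = H_norm m \<Omega> g"
proof -
  have g: "g \<in> H_space m \<Omega>" by (rule H_ae_closed[OF assms])
  have "L2_norm \<Omega> (wderiv \<Omega> ks f) = L2_norm \<Omega> (wderiv \<Omega> ks g)" if "length ks \<le> m" for ks
    by (rule L2_norm_cong[OF wderiv_cong[OF assms(1) that assms(2)] wderiv_L2[OF assms(1) that] wderiv_L2[OF g that]])
  then show ?thesis by (auto simp: H_norm_def intro!: sum.cong)
qed

lemma H10_H1: "f \<in> H10_space \<Omega> \<Longrightarrow> f \<in> H_space 1 \<Omega>"
  by (simp add: H10_space_def)

lemma H10_approx:
  assumes "f \<in> H10_space \<Omega>" "0 < \<epsilon>"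
  obtains \<phi> where "\<phi> \<in> test_functions \<Omega>" "H_norm 1 \<Omega> (f - \<phi>) < \<epsilon>"
  using assms by (auto simp: H10_space_def fun_diff_def)

text \<open>
  Restating the definition with pointwise subtraction of functions allows the norm lemmas to apply.
\<close>

lemma H10I:
  assumes "f \<in> H_space 1 \<Omega>" "\<And>\<epsilon>. 0 < \<epsilon> \<Longrightarrow> \<exists>\<phi>\<in>test_functions \<Omega>. H_norm 1 \<Omega> (f - \<phi>) < \<epsilon>"
  shows "f \<in> H10_space \<Omega>"
  using assms by (auto simp: H10_space_def fun_diff_def)

lemma H10_ae_closed:
  assumes f: "f \<in> H10_space \<Omega>" and eq: "ae_eq \<Omega> f g"
  shows "g \<in> H10_space \<Omega>"
proof (rule H10I)
  show "g \<in> H_space 1 \<Omega>" by (rule H_ae_closed[OF H10_H1[OF f] eq])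
  fix \<epsilon> :: real assume "0 < \<epsilon>"
  then obtain \<phi> where \<phi>: "\<phi> \<in> test_functions \<Omega>" "H_norm 1 \<Omega> (f - \<phi>) < \<epsilon>" using H10_approx[OF f] by blast
  have "H_norm 1 \<Omega> (f - \<phi>) = H_norm 1 \<Omega> (g - \<phi>)"
    by (rule H_norm_cong[OF H.X_closed(3)[OF H10_H1[OF f] test_H1[OF \<phi>(1)]] ae_eq_diff[OF eq ae_eq_refl]])
  then show "\<exists>\<phi>\<in>test_functions \<Omega>. H_norm 1 \<Omega> (g - \<phi>) < \<epsilon>" using \<phi> by auto
qed

lemma subspace_H10: "subspace (H10_space \<Omega>)"
  unfolding subspace_def
proof (intro conjI ballI allI)
  show "0 \<in> H10_space \<Omega>"
    by (rule H10I) (use test_zero in \<open>auto intro!: bexI[of _ 0]\<close>)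
next
  fix f g assume f: "f \<in> H10_space \<Omega>" and g: "g \<in> H10_space \<Omega>"
  note f1 = H10_H1[OF f] and g1 = H10_H1[OF g]
  show "f + g \<in> H10_space \<Omega>"
  proof (rule H10I)
    show "f + g \<in> H_space 1 \<Omega>" using f1 g1 by (rule H.X_closed)
    fix \<epsilon> :: real assume \<epsilon>: "0 < \<epsilon>"
    obtain \<phi> where \<phi>: "\<phi> \<in> test_functions \<Omega>" "H_norm 1 \<Omega> (f - \<phi>) < \<epsilon> / 2" using H10_approx[OF f, of "\<epsilon> / 2"] \<epsilon> by auto
    obtain \<psi> where \<psi>: "\<psi> \<in> test_functions \<Omega>" "H_norm 1 \<Omega> (g - \<psi>) < \<epsilon> / 2" using H10_approx[OF g, of "\<epsilon> / 2"] \<epsilon> by auto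
    note t = test_H1[OF \<phi>(1)] test_H1[OF \<psi>(1)]
    have "(f + g) - (\<phi> + \<psi>) = (f - \<phi>) + (g - \<psi>)" by simp
    then have "H_norm 1 \<Omega> ((f + g) - (\<phi> + \<psi>)) \<le> H_norm 1 \<Omega> (f - \<phi>) + H_norm 1 \<Omega> (g - \<psi>)"
      using H.nrm_triangle[OF H.X_closed(3)[OF f1 t(1)] H.X_closed(3)[OF g1 t(2)]] by (simp only:)
    moreover have "\<phi> + \<psi> \<in> test_functions \<Omega>" using test_linear[OF \<phi>(1) \<psi>(1), of 1 1] by simp
    ultimately show "\<exists>\<phi>\<in>test_functions \<Omega>. H_norm 1 \<Omega> (f + g - \<phi>) < \<epsilon>"
      using \<phi>(2) \<psi>(2) by (intro bexI[of _ "\<phi> + \<psi>"]) auto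
  qed
next
  fix c :: real and f assume f: "f \<in> H10_space \<Omega>"
  note f1 = H10_H1[OF f]
  show "c *\<^sub>R f \<in> H10_space \<Omega>"
  proof (rule H10I)
    show "c *\<^sub>R f \<in> H_space 1 \<Omega>" using f1 by (rule H.X_closed)
    fix \<epsilon> :: real assume \<epsilon>: "0 < \<epsilon>"
    then have "0 < \<epsilon> / (\<bar>c\<bar> + 1)" by simp
    then obtain \<phi> where \<phi>: "\<phi> \<in> test_functions \<Omega>" "H_norm 1 \<Omega> (f - \<phi>) < \<epsilon> / (\<bar>c\<bar> + 1)"
      using H10_approx[OF f] by blast
    have fp: "f - \<phi> \<in> H_space 1 \<Omega>" using f1 test_H1[OF \<phi>(1)] by (rule H.X_closed)
    have "c *\<^sub>R f - c *\<^sub>R \<phi> = c *\<^sub>R (f - \<phi>)" by (simp only: scaleR_diff_right)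
    then have "H_norm 1 \<Omega> (c *\<^sub>R f - c *\<^sub>R \<phi>) = \<bar>c\<bar> * H_norm 1 \<Omega> (f - \<phi>)"
      using H.nrm_scaleR[OF fp] by metis
    also have "\<dots> \<le> (\<bar>c\<bar> + 1) * H_norm 1 \<Omega> (f - \<phi>)"
      using H.nrm_nonneg[OF fp] by (intro mult_right_mono) auto
    also have "\<dots> < \<epsilon>" using \<phi>(2) by (simp add: field_simps)
    finally have "H_norm 1 \<Omega> (c *\<^sub>R f - c *\<^sub>R \<phi>) < \<epsilon>" .
    moreover have "c *\<^sub>R \<phi> \<in> test_functions \<Omega>" using test_linear[OF \<phi>(1) \<phi>(1), of c 0] by simp
    ultimately show "\<exists>\<phi>\<in>test_functions \<Omega>. H_norm 1 \<Omega> (c *\<^sub>R f - \<phi>) < \<epsilon>" by blast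
  qed
qed

lemma V_H1:
  assumes v: "v \<in> V_space \<Omega>"
  shows "v \<in> H_space 1 \<Omega>"
  unfolding H_space_def
proof (intro CollectI allI impI)
  fix ks :: "'d list" assume ks: "length ks \<le> 1"
  define g where "g x = (\<chi> i. wderiv \<Omega> ks (\<lambda>x. v x $ i) x)" for x
  have "has_weak_deriv \<Omega> ks v g"
  proof (rule weak_deriv_vec)
    fix i
    have "has_weak_deriv \<Omega> ks (\<lambda>x. v x $ i) (wderiv \<Omega> ks (\<lambda>x. v x $ i))"
      using v ks H10_H1 H_has_weak_deriv unfolding V_space_def by blast
    then show "has_weak_deriv \<Omega> ks (\<lambda>x. v x $ i) (\<lambda>x. g x $ i)" by (simp add: g_def)
  qed
  then show "\<exists>g. has_weak_deriv \<Omega> ks v g" by blast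
qed

lemma V_L2: "v \<in> V_space \<Omega> \<Longrightarrow> v \<in> L2_space \<Omega>"
  using V_H1 H_L2 by blast

lemma subspace_V: "subspace (V_space \<Omega>)"
  unfolding subspace_def
proof (intro conjI ballI allI)
  show "0 \<in> V_space \<Omega>"
    using subspace_0[OF subspace_H10] by (simp add: V_space_def zero_fun_def)
  show "f + g \<in> V_space \<Omega>" if "f \<in> V_space \<Omega>" "g \<in> V_space \<Omega>" for f g
  proof -
    have "(\<lambda>x. f x $ i) + (\<lambda>x. g x $ i) \<in> H10_space \<Omega>" for i
      using that by (intro subspace_add[OF subspace_H10]) (auto simp: V_space_def)
    then show ?thesis by (simp add: V_space_def plus_fun_def)
  qed
  show "c *\<^sub>R f \<in> V_space \<Omega>" if "f \<in> V_space \<Omega>" for c f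
  proof -
    have "c *\<^sub>R (\<lambda>x. f x $ i) \<in> H10_space \<Omega>" for i
      using that by (intro subspace_scale[OF subspace_H10]) (auto simp: V_space_def)
    then show ?thesis by (simp add: V_space_def scaleR_fun_def)
  qed
qed

lemma V_ae_closed: "v \<in> V_space \<Omega> \<Longrightarrow> ae_eq \<Omega> v w \<Longrightarrow> w \<in> V_space \<Omega>"
  unfolding V_space_def using H10_ae_closed[OF _ ae_eq_nth] by blast

section \<open>Integration by parts\<close>

text \<open>
  For a test function in place of \<open>f\<close> the identity is the definition of the weak derivative. Both sides are
  continuous in \<open>f\<close> with respect to the \<open>H\<^sup>1\<close> norm, in which test functions are dense.
\<close>

lemma H10_integration_by_parts:
  assumes zy: "has_weak_deriv \<Omega> [j] z y" and f: "f \<in> H10_space \<Omega>"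
  shows "L2_inner \<Omega> y f = - L2_inner \<Omega> z (wderiv \<Omega> [j] f)"
proof -
  have L: "z \<in> L2_space \<Omega>" "y \<in> L2_space \<Omega>" using zy by (auto simp: has_weak_deriv_def)
  note f1 = H10_H1[OF f]
  have fL: "f \<in> L2_space \<Omega>" and dfL: "wderiv \<Omega> [j] f \<in> L2_space \<Omega>"
    using H_L2[OF f1] wderiv_L2[OF f1, of "[j]"] by auto
  let ?K = "L2_norm \<Omega> y + L2_norm \<Omega> z"
  have K: "0 \<le> ?K" using L by simp
  have "\<bar>L2_inner \<Omega> y f + L2_inner \<Omega> z (wderiv \<Omega> [j] f)\<bar> \<le> ?K * \<epsilon>" if \<epsilon>: "0 < \<epsilon>" for \<epsilon>
  proof -
    obtain \<phi> where \<phi>: "\<phi> \<in> test_functions \<Omega>" "H_norm 1 \<Omega> (f - \<phi>) < \<epsilon>" using H10_approx[OF f \<epsilon>] by blast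
    note t1 = test_H1[OF \<phi>(1)] and tL = test_L2[OF \<phi>(1)]
    have fp: "f - \<phi> \<in> H_space 1 \<Omega>" using f1 t1 by (rule H.X_closed)
    have fpL: "f - \<phi> \<in> L2_space \<Omega>" using H_L2[OF fp] .
    have dL: "wderiv \<Omega> [j] (f - \<phi>) \<in> L2_space \<Omega>" "pderiv_dir j \<phi> \<in> L2_space \<Omega>"
      using wderiv_L2[OF fp, of "[j]"] test_L2[OF test_pderiv_dir[OF \<phi>(1)]] by auto
    have "has_weak_deriv \<Omega> [j] (1 *\<^sub>R f + (-1) *\<^sub>R \<phi>) (1 *\<^sub>R wderiv \<Omega> [j] f + (-1) *\<^sub>R pderiv_dir j \<phi>)"
      by (rule weak_deriv_linear[OF H_has_weak_deriv[OF f1] weak_deriv_test[OF \<phi>(1)]]) simp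
    then have "has_weak_deriv \<Omega> [j] (f - \<phi>) (wderiv \<Omega> [j] f - pderiv_dir j \<phi>)" by simp
    then have d: "ae_eq \<Omega> (wderiv \<Omega> [j] (f - \<phi>)) (wderiv \<Omega> [j] f - pderiv_dir j \<phi>)" by (rule wderiv_eq)
    have "(LINT x|lebesgue_on \<Omega>. pderivs [j] \<phi> x *\<^sub>R z x) = (-1) ^ length [j] *\<^sub>R (LINT x|lebesgue_on \<Omega>. \<phi> x *\<^sub>R y x)"
      using zy \<phi>(1) by (simp add: has_weak_deriv_def)
    then have e0: "L2_inner \<Omega> y \<phi> + L2_inner \<Omega> z (pderiv_dir j \<phi>) = 0"
      by (simp add: L2_inner_def pderivs_Cons mult.commute)
    have "L2_inner \<Omega> z (wderiv \<Omega> [j] (f - \<phi>)) = L2_inner \<Omega> z (wderiv \<Omega> [j] f - pderiv_dir j \<phi>)"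
      by (rule L2_inner_cong[OF ae_eq_refl d L(1) L(1) dL(1) L2.X_closed(3)[OF dfL dL(2)]])
    then have "L2_inner \<Omega> y f + L2_inner \<Omega> z (wderiv \<Omega> [j] f)
        = L2_inner \<Omega> y (f - \<phi>) + L2_inner \<Omega> z (wderiv \<Omega> [j] (f - \<phi>))"
      using e0 L fL dfL tL dL by (simp add: L2.ip_diff_right)
    also have "\<bar>\<dots>\<bar> \<le> L2_norm \<Omega> y * L2_norm \<Omega> (f - \<phi>) + L2_norm \<Omega> z * L2_norm \<Omega> (wderiv \<Omega> [j] (f - \<phi>))"
      using L2.Cauchy_Schwarz[OF L(2) fpL] L2.Cauchy_Schwarz[OF L(1) dL(1)] by linarith
    also have "\<dots> \<le> L2_norm \<Omega> y * \<epsilon> + L2_norm \<Omega> z * \<epsilon>"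
      using \<phi>(2) L2_norm_le_H_norm[OF fpL, of 1] wderiv_norm_le_H_norm[of "[j]" 1 "f - \<phi>"] L
      by (intro add_mono mult_left_mono) auto
    finally show ?thesis by (simp add: algebra_simps)
  qed
  note bd = this
  have "\<bar>L2_inner \<Omega> y f + L2_inner \<Omega> z (wderiv \<Omega> [j] f)\<bar> \<le> 0 + e" if e: "0 < e" for e
  proof -
    have "0 < e / (?K + 1)" using K e by simp
    from bd[OF this] have "\<bar>L2_inner \<Omega> y f + L2_inner \<Omega> z (wderiv \<Omega> [j] f)\<bar> \<le> ?K * (e / (?K + 1))" .
    also have "\<dots> \<le> e" using K e by (simp add: field_simps)
    finally show ?thesis by simp
  qed
  then have "\<bar>L2_inner \<Omega> y f + L2_inner \<Omega> z (wderiv \<Omega> [j] f)\<bar> \<le> 0" by (rule field_le_epsilon)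
  then show ?thesis by simp
qed

lemma wderiv_nth:
  fixes v :: "real^'d \<Rightarrow> real^'n"
  assumes "v \<in> H_space m \<Omega>" "length ks \<le> m"
  shows "ae_eq \<Omega> (wderiv \<Omega> ks (\<lambda>x. v x $ i)) (\<lambda>x. wderiv \<Omega> ks v x $ i)"
  by (rule wderiv_eq[OF weak_deriv_nth[OF H_has_weak_deriv[OF assms]]])

lemma V_component_integration_by_parts:
  assumes zy: "has_weak_deriv \<Omega> [j] z y" and v: "v \<in> V_space \<Omega>"
  shows "L2_inner \<Omega> y (\<lambda>x. v x $ i) = - L2_inner \<Omega> z (\<lambda>x. wderiv \<Omega> [j] v x $ i)"
proof -
  have f: "(\<lambda>x. v x $ i) \<in> H10_space \<Omega>" using v by (simp add: V_space_def)
  have z: "z \<in> L2_space \<Omega>" using zy by (simp add: has_weak_deriv_def)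
  have "L2_inner \<Omega> z (wderiv \<Omega> [j] (\<lambda>x. v x $ i)) = L2_inner \<Omega> z (\<lambda>x. wderiv \<Omega> [j] v x $ i)"
    using wderiv_nth[OF V_H1[OF v], of "[j]"] wderiv_L2[OF H10_H1[OF f], of "[j]"] wderiv_L2[OF V_H1[OF v], of "[j]"] z
    by (intro L2_inner_cong) (auto intro: L2_nth)
  then show ?thesis using H10_integration_by_parts[OF zy f] by simp
qed

lemma V_integration_by_parts:
  assumes zy: "has_weak_deriv \<Omega> [j] z y" and v: "v \<in> V_space \<Omega>"
  shows "L2_inner \<Omega> y v = - L2_inner \<Omega> z (wderiv \<Omega> [j] v)"
proof -
  have L: "z \<in> L2_space \<Omega>" "y \<in> L2_space \<Omega>" using zy by (auto simp: has_weak_deriv_def)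
  have vL: "v \<in> L2_space \<Omega>" "wderiv \<Omega> [j] v \<in> L2_space \<Omega>"
    using V_L2[OF v] wderiv_L2[OF V_H1[OF v], of "[j]"] by auto
  show ?thesis
    unfolding L2_inner_vec[OF L(2) vL(1)] L2_inner_vec[OF L(1) vL(2)]
    using V_component_integration_by_parts[OF weak_deriv_nth[OF zy] v] by (simp add: sum_negf)
qed

section \<open>The gradient and divergence forms\<close>

text \<open>
  Sorting the entries of the gradient matrices by the direction of differentiation expresses the form
  through \<open>wderiv\<close>. The index set of singleton lists matches the one of the Sobolev norms.
\<close>

lemma grad_form_eq:
  assumes u: "u \<in> H_space 1 \<Omega>" and v: "v \<in> H_space 1 \<Omega>"
  shows "L2_inner \<Omega> (grad_v \<Omega> u) (grad_v \<Omega> v)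
      = (\<Sum>ks\<in>(\<lambda>j. [j]) ` UNIV. L2_inner \<Omega> (wderiv \<Omega> ks u) (wderiv \<Omega> ks v))"
proof -
  have i: "integrable (lebesgue_on \<Omega>) (\<lambda>x. wderiv \<Omega> [j] u x \<bullet> wderiv \<Omega> [j] v x)" for j
    using wderiv_L2[OF u, of "[j]"] wderiv_L2[OF v, of "[j]"] by (intro L2_inner_integrable) auto
  have "grad_v \<Omega> u x \<bullet> grad_v \<Omega> v x = (\<Sum>j\<in>UNIV. wderiv \<Omega> [j] u x \<bullet> wderiv \<Omega> [j] v x)" for x
    unfolding grad_v_def inner_vec_def by (simp add: inner_vec_def) (rule sum.swap)
  then have "L2_inner \<Omega> (grad_v \<Omega> u) (grad_v \<Omega> v) = (\<Sum>j\<in>UNIV. L2_inner \<Omega> (wderiv \<Omega> [j] u) (wderiv \<Omega> [j] v))"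
    using i by (simp add: L2_inner_def)
  also have "\<dots> = (\<Sum>ks\<in>(\<lambda>j. [j]) ` UNIV. L2_inner \<Omega> (wderiv \<Omega> ks u) (wderiv \<Omega> ks v))"
    by (subst sum.reindex) (auto simp: inj_on_def)
  finally show ?thesis .
qed

lemma semi_inner_grad: "semi_inner (H_space 1 \<Omega>) (\<lambda>u v. L2_inner \<Omega> (grad_v \<Omega> u) (grad_v \<Omega> v))"
  by (rule semi_inner_cong[OF semi_inner_wderiv_sum[of "(\<lambda>j. [j]) ` UNIV" 1] grad_form_eq]) auto

sublocale A: semi_inner "H_space 1 \<Omega> :: (real^'d \<Rightarrow> real^'d) set" "\<lambda>u v. L2_inner \<Omega> (grad_v \<Omega> u) (grad_v \<Omega> v)"
  rewrites "semi_inner.nrm (\<lambda>u v. L2_inner \<Omega> (grad_v \<Omega> u) (grad_v \<Omega> v)) = (\<lambda>u. L2_norm \<Omega> (grad_v \<Omega> u))"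
  using semi_inner_grad by (auto simp: semi_inner.nrm_def[OF semi_inner_grad] L2_norm_def)

lemma H1_ip_eq:
  assumes u: "u \<in> H_space 1 \<Omega>" and v: "v \<in> H_space 1 \<Omega>"
  shows "H_ip 1 u v = L2_inner \<Omega> u v + L2_inner \<Omega> (grad_v \<Omega> u) (grad_v \<Omega> v)"
proof -
  have set: "{ks :: 'd list. length ks \<le> 1} = insert [] ((\<lambda>j. [j]) ` UNIV)"
    by (auto simp: le_Suc_eq length_Suc_conv)
  have "L2_inner \<Omega> (wderiv \<Omega> [] u) (wderiv \<Omega> [] v) = L2_inner \<Omega> u v"
    using wderiv_Nil[OF H_L2[OF u]] wderiv_Nil[OF H_L2[OF v]] wderiv_L2[OF u, of "[]"] wderiv_L2[OF v, of "[]"]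
      H_L2[OF u] H_L2[OF v] by (intro L2_inner_cong) auto
  then show ?thesis unfolding H_ip_def set grad_form_eq[OF u v]
    by (subst sum.insert) auto
qed

lemma H1_norm_sq:
  assumes u: "u \<in> H_space 1 \<Omega>"
  shows "(H_norm 1 \<Omega> u)\<^sup>2 = (L2_norm \<Omega> u)\<^sup>2 + (L2_norm \<Omega> (grad_v \<Omega> u))\<^sup>2"
  using H.nrm_sq[OF u] H1_ip_eq[OF u u] L2.nrm_sq[OF H_L2[OF u]] A.nrm_sq[OF u] by simp

lemma grad_norm_le_H1:
  assumes u: "u \<in> H_space 1 \<Omega>"
  shows "L2_norm \<Omega> (grad_v \<Omega> u) \<le> H_norm 1 \<Omega> u"
  by (rule power2_le_imp_le) (use H1_norm_sq[OF u] H.nrm_nonneg[OF u] in simp_all)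

lemma H1_norm_le:
  assumes u: "u \<in> H_space 1 \<Omega>"
  shows "H_norm 1 \<Omega> u \<le> L2_norm \<Omega> u + L2_norm \<Omega> (grad_v \<Omega> u)"
proof (rule power2_le_imp_le)
  have n: "0 \<le> L2_norm \<Omega> u" "0 \<le> L2_norm \<Omega> (grad_v \<Omega> u)"
    using L2.nrm_nonneg[OF H_L2[OF u]] A.nrm_nonneg[OF u] by auto
  then show "(H_norm 1 \<Omega> u)\<^sup>2 \<le> (L2_norm \<Omega> u + L2_norm \<Omega> (grad_v \<Omega> u))\<^sup>2"
    unfolding H1_norm_sq[OF u] by (simp add: power2_sum)
  show "0 \<le> L2_norm \<Omega> u + L2_norm \<Omega> (grad_v \<Omega> u)" using n by simp
qed

text \<open>
  The difference of two functions that agree almost everywhere has \<open>H\<^sup>1\<close> norm zero and is therefore null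
  for the gradient form.
\<close>

lemma grad_norm_cong: "u \<in> H_space 1 \<Omega> \<Longrightarrow> ae_eq \<Omega> u w \<Longrightarrow> L2_norm \<Omega> (grad_v \<Omega> u) = L2_norm \<Omega> (grad_v \<Omega> w)"
  and grad_inner_cong: "u \<in> H_space 1 \<Omega> \<Longrightarrow> ae_eq \<Omega> u w \<Longrightarrow> v \<in> H_space 1 \<Omega> \<Longrightarrow>
     L2_inner \<Omega> (grad_v \<Omega> u) (grad_v \<Omega> v) = L2_inner \<Omega> (grad_v \<Omega> w) (grad_v \<Omega> v)"
proof -
  assume u: "u \<in> H_space 1 \<Omega>" and eq: "ae_eq \<Omega> u w"
  have w: "w \<in> H_space 1 \<Omega>" by (rule H_ae_closed[OF u eq])
  have d: "u - w \<in> H_space 1 \<Omega>" using u w by (rule H.X_closed)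
  have "ae_eq \<Omega> (u - w) 0" using eq by (simp add: ae_eq_def)
  then have "H_norm 1 \<Omega> (u - w) = 0" using H_norm_cong[OF d] by fastforce
  then have z: "L2_norm \<Omega> (grad_v \<Omega> (u - w)) = 0"
    using grad_norm_le_H1[OF d] A.nrm_nonneg[OF d] by simp
  then show "L2_norm \<Omega> (grad_v \<Omega> u) = L2_norm \<Omega> (grad_v \<Omega> w)"
    using A.nrm_diff_ineq[OF u w] by simp
  assume v: "v \<in> H_space 1 \<Omega>"
  show "L2_inner \<Omega> (grad_v \<Omega> u) (grad_v \<Omega> v) = L2_inner \<Omega> (grad_v \<Omega> w) (grad_v \<Omega> v)"
    using A.ip_null_left[OF d v z] A.ip_diff_left[OF u w v] by simp
qed

lemma div_eq_sum: "div_v \<Omega> v = (\<Sum>i\<in>UNIV. (\<lambda>x. wderiv \<Omega> [i] v x $ i))"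
  by (simp add: div_v_def fun_eq_iff sum_fun_apply)

lemma div_L2: "v \<in> H_space 1 \<Omega> \<Longrightarrow> div_v \<Omega> v \<in> L2_space \<Omega>"
  unfolding div_eq_sum by (intro L2.X_sum L2_nth wderiv_L2) auto

lemma div_linear:
  assumes u: "u \<in> H_space 1 \<Omega>" and v: "v \<in> H_space 1 \<Omega>"
  shows "ae_eq \<Omega> (div_v \<Omega> (a *\<^sub>R u + b *\<^sub>R v)) (a *\<^sub>R div_v \<Omega> u + b *\<^sub>R div_v \<Omega> v)"
proof -
  have "AE x in lebesgue_on \<Omega>. \<forall>j\<in>UNIV. wderiv \<Omega> [j] (a *\<^sub>R u + b *\<^sub>R v) x = a *\<^sub>R wderiv \<Omega> [j] u x + b *\<^sub>R wderiv \<Omega> [j] v x"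
    using wderiv_linear[OF u v, of "[_]" a b] by (intro AE_finite_allI) (auto simp: ae_eq_def)
  then show ?thesis unfolding ae_eq_def
    by (rule eventually_mono) (simp add: div_v_def sum.distrib sum_distrib_left)
qed

lemma div_form_linear:
  assumes u: "u \<in> H_space 1 \<Omega>" and v: "v \<in> H_space 1 \<Omega>" and q: "q \<in> L2_space \<Omega>"
  shows "L2_inner \<Omega> (div_v \<Omega> (a *\<^sub>R u + b *\<^sub>R v)) q = a * L2_inner \<Omega> (div_v \<Omega> u) q + b * L2_inner \<Omega> (div_v \<Omega> v) q"
proof -
  have d: "div_v \<Omega> u \<in> L2_space \<Omega>" "div_v \<Omega> v \<in> L2_space \<Omega>" using u v div_L2 by auto
  have w: "a *\<^sub>R u + b *\<^sub>R v \<in> H_space 1 \<Omega>" using u v by (rule H_linear)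
  have "L2_inner \<Omega> (div_v \<Omega> (a *\<^sub>R u + b *\<^sub>R v)) q = L2_inner \<Omega> (a *\<^sub>R div_v \<Omega> u + b *\<^sub>R div_v \<Omega> v) q"
    using div_linear[OF u v] d q div_L2[OF w] by (intro L2_inner_cong) auto
  then show ?thesis using d q by (simp add: L2.ip_add_left L2.ip_scaleR_left)
qed

lemma div_form_cong:
  assumes u: "u \<in> H_space 1 \<Omega>" and eq: "ae_eq \<Omega> u w" and q: "q \<in> L2_space \<Omega>"
  shows "L2_inner \<Omega> (div_v \<Omega> u) q = L2_inner \<Omega> (div_v \<Omega> w) q"
proof -
  have "AE x in lebesgue_on \<Omega>. \<forall>j\<in>UNIV. wderiv \<Omega> [j] u x = wderiv \<Omega> [j] w x"
    using wderiv_cong[OF u _ eq, of "[_]"] by (intro AE_finite_allI) (auto simp: ae_eq_def)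
  then have "ae_eq \<Omega> (div_v \<Omega> u) (div_v \<Omega> w)" unfolding ae_eq_def
    by (rule eventually_mono) (simp add: div_v_def)
  then show ?thesis using div_L2[OF u] div_L2[OF H_ae_closed[OF u eq]] q by (intro L2_inner_cong) auto
qed

lemma L2_norm_nth_le:
  fixes f :: "real^'d \<Rightarrow> real^'n"
  assumes f: "f \<in> L2_space \<Omega>"
  shows "L2_norm \<Omega> (\<lambda>x. f x $ i) \<le> L2_norm \<Omega> f"
proof (rule power2_le_imp_le)
  have "L2_inner \<Omega> (\<lambda>x. f x $ i) (\<lambda>x. f x $ i) \<le> (\<Sum>j\<in>UNIV. L2_inner \<Omega> (\<lambda>x. f x $ j) (\<lambda>x. f x $ j))"
    by (rule member_le_sum) (auto intro!: L2.ip_nonneg L2_nth[OF f])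
  then show "(L2_norm \<Omega> (\<lambda>x. f x $ i))\<^sup>2 \<le> (L2_norm \<Omega> f)\<^sup>2"
    unfolding L2_norm_sq L2_inner_vec[OF f f] .
qed (use f in auto)

lemma div_norm_le:
  assumes v: "v \<in> H_space 1 \<Omega>"
  shows "L2_norm \<Omega> (div_v \<Omega> v) \<le> real CARD('d) * H_norm 1 \<Omega> v"
proof -
  have w: "wderiv \<Omega> [i] v \<in> L2_space \<Omega>" for i using wderiv_L2[OF v, of "[i]"] by simp
  have "L2_norm \<Omega> (\<Sum>i\<in>A. (\<lambda>x. wderiv \<Omega> [i] v x $ i)) \<le> (\<Sum>i\<in>A. H_norm 1 \<Omega> v)" if "finite A" for A
    using that
  proof (induction A rule: finite_induct)
    case (insert i A)
    have "L2_norm \<Omega> (\<Sum>i\<in>insert i A. (\<lambda>x. wderiv \<Omega> [i] v x $ i))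
        \<le> L2_norm \<Omega> (\<lambda>x. wderiv \<Omega> [i] v x $ i) + L2_norm \<Omega> (\<Sum>i\<in>A. (\<lambda>x. wderiv \<Omega> [i] v x $ i))"
      unfolding sum.insert[OF insert(1,2)] by (intro L2.nrm_triangle L2_nth[OF w] L2.X_sum)
    also have "L2_norm \<Omega> (\<lambda>x. wderiv \<Omega> [i] v x $ i) \<le> H_norm 1 \<Omega> v"
      using L2_norm_nth_le[OF w] wderiv_norm_le_H_norm[of "[i]" 1 v] by (rule order_trans) simp
    also have "L2_norm \<Omega> (\<Sum>i\<in>A. (\<lambda>x. wderiv \<Omega> [i] v x $ i)) \<le> (\<Sum>i\<in>A. H_norm 1 \<Omega> v)"
      by (rule insert.IH)
    finally show ?case by (simp only: sum.insert[OF insert(1,2)])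
  qed (simp only: sum.empty L2.nrm_zero order_refl)
  from this[of UNIV] show ?thesis unfolding div_eq_sum by simp
qed

lemma div_form_bound:
  assumes v: "v \<in> H_space 1 \<Omega>" and q: "q \<in> L2_space \<Omega>"
  shows "\<bar>L2_inner \<Omega> (div_v \<Omega> v) q\<bar> \<le> real CARD('d) * H_norm 1 \<Omega> v * L2_norm \<Omega> q"
proof -
  have "\<bar>L2_inner \<Omega> (div_v \<Omega> v) q\<bar> \<le> L2_norm \<Omega> (div_v \<Omega> v) * L2_norm \<Omega> q"
    by (rule L2.Cauchy_Schwarz[OF div_L2[OF v] q])
  also have "\<dots> \<le> real CARD('d) * H_norm 1 \<Omega> v * L2_norm \<Omega> q"
    using div_norm_le[OF v] q by (intro mult_right_mono) auto
  finally show ?thesis .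
qed

lemma pressure_gradient_weak:
  assumes p: "p \<in> H_space 1 \<Omega>" and v: "v \<in> V_space \<Omega>"
  shows "grad_s \<Omega> p \<in> L2_space \<Omega>" and "L2_inner \<Omega> (grad_s \<Omega> p) v = - L2_inner \<Omega> (div_v \<Omega> v) p"
proof -
  have d: "wderiv \<Omega> [i] p \<in> L2_space \<Omega>" for i using wderiv_L2[OF p, of "[i]"] by simp
  show g: "grad_s \<Omega> p \<in> L2_space \<Omega>"
    by (rule L2_vec) (use d in \<open>simp add: grad_s_def\<close>)
  have vd: "wderiv \<Omega> [i] v \<in> L2_space \<Omega>" for i using wderiv_L2[OF V_H1[OF v], of "[i]"] by simp
  have "L2_inner \<Omega> (grad_s \<Omega> p) v = (\<Sum>i\<in>UNIV. L2_inner \<Omega> (wderiv \<Omega> [i] p) (\<lambda>x. v x $ i))"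
    unfolding L2_inner_vec[OF g V_L2[OF v]] by (simp add: grad_s_def)
  also have "\<dots> = (\<Sum>i\<in>UNIV. - L2_inner \<Omega> p (\<lambda>x. wderiv \<Omega> [i] v x $ i))"
    by (intro sum.cong refl V_component_integration_by_parts[OF H_has_weak_deriv[OF p] v]) simp
  also have "\<dots> = - (\<Sum>i\<in>UNIV. L2_inner \<Omega> (\<lambda>x. wderiv \<Omega> [i] v x $ i) p)"
    by (simp add: sum_negf L2_inner_def mult.commute)
  also have "(\<Sum>i\<in>UNIV. L2_inner \<Omega> (\<lambda>x. wderiv \<Omega> [i] v x $ i) p) = L2_inner \<Omega> (div_v \<Omega> v) p"
    unfolding div_eq_sum by (rule L2.ip_sum_left[symmetric]) (auto intro: H_L2[OF p] L2_nth vd)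
  finally show "L2_inner \<Omega> (grad_s \<Omega> p) v = - L2_inner \<Omega> (div_v \<Omega> v) p" .
qed

text \<open>
  The test function for the second derivative is obtained by differentiating a test function once.
\<close>

lemma weak_deriv_second:
  assumes u: "u \<in> H_space 2 \<Omega>"
  shows "has_weak_deriv \<Omega> [i] (wderiv \<Omega> [i] u) (wderiv \<Omega> [i, i] u)"
  unfolding has_weak_deriv_def
proof (intro conjI ballI)
  show "wderiv \<Omega> [i] u \<in> L2_space \<Omega>" "wderiv \<Omega> [i, i] u \<in> L2_space \<Omega>" using wderiv_L2[OF u] by auto
  fix \<phi> assume \<phi>: "\<phi> \<in> test_functions \<Omega>"
  have "(LINT x|lebesgue_on \<Omega>. pderivs [i] (pderiv_dir i \<phi>) x *\<^sub>R u x)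
      = (-1) ^ length [i] *\<^sub>R (LINT x|lebesgue_on \<Omega>. pderiv_dir i \<phi> x *\<^sub>R wderiv \<Omega> [i] u x)"
    using H_has_weak_deriv[OF u, of "[i]"] test_pderiv_dir[OF \<phi>] by (simp add: has_weak_deriv_def)
  moreover have "(LINT x|lebesgue_on \<Omega>. pderivs [i, i] \<phi> x *\<^sub>R u x)
      = (-1) ^ length [i, i] *\<^sub>R (LINT x|lebesgue_on \<Omega>. \<phi> x *\<^sub>R wderiv \<Omega> [i, i] u x)"
    using H_has_weak_deriv[OF u, of "[i, i]"] \<phi> by (simp add: has_weak_deriv_def)
  ultimately have "- (LINT x|lebesgue_on \<Omega>. pderivs [i] \<phi> x *\<^sub>R wderiv \<Omega> [i] u x)
      = (LINT x|lebesgue_on \<Omega>. \<phi> x *\<^sub>R wderiv \<Omega> [i, i] u x)"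
    by (simp add: pderivs_Cons)
  from arg_cong[OF this, of uminus]
  show "(LINT x|lebesgue_on \<Omega>. pderivs [i] \<phi> x *\<^sub>R wderiv \<Omega> [i] u x)
      = (-1) ^ length [i] *\<^sub>R (LINT x|lebesgue_on \<Omega>. \<phi> x *\<^sub>R wderiv \<Omega> [i, i] u x)"
    by simp
qed

lemma laplace_weak:
  assumes u: "u \<in> H_space 2 \<Omega>" and v: "v \<in> V_space \<Omega>"
  shows "laplace_v \<Omega> u \<in> L2_space \<Omega>"
    and "L2_inner \<Omega> (laplace_v \<Omega> u) v = - L2_inner \<Omega> (grad_v \<Omega> u) (grad_v \<Omega> v)"
proof -
  have eq: "laplace_v \<Omega> u = (\<Sum>i\<in>UNIV. wderiv \<Omega> [i, i] u)"
    by (simp add: laplace_v_def fun_eq_iff sum_fun_apply)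
  have d: "wderiv \<Omega> [i, i] u \<in> L2_space \<Omega>" for i using wderiv_L2[OF u, of "[i, i]"] by simp
  show "laplace_v \<Omega> u \<in> L2_space \<Omega>" unfolding eq by (intro L2.X_sum d)
  have u1: "u \<in> H_space 1 \<Omega>" by (rule H_space_mono[OF u]) simp
  have "L2_inner \<Omega> (laplace_v \<Omega> u) v = (\<Sum>i\<in>UNIV. L2_inner \<Omega> (wderiv \<Omega> [i, i] u) v)"
    unfolding eq by (rule L2.ip_sum_left[OF V_L2[OF v] d])
  also have "\<dots> = (\<Sum>i\<in>UNIV. - L2_inner \<Omega> (wderiv \<Omega> [i] u) (wderiv \<Omega> [i] v))"
    by (intro sum.cong refl V_integration_by_parts[OF weak_deriv_second[OF u] v])
  also have "\<dots> = - L2_inner \<Omega> (grad_v \<Omega> u) (grad_v \<Omega> v)"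
    unfolding grad_form_eq[OF u1 V_H1[OF v]] by (subst sum.reindex) (auto simp: inj_on_def sum_negf)
  finally show "L2_inner \<Omega> (laplace_v \<Omega> u) v = - L2_inner \<Omega> (grad_v \<Omega> u) (grad_v \<Omega> v)" .
qed

lemma subspace_Q: "subspace (Q_space \<Omega>)"
  unfolding subspace_def
proof (intro conjI ballI allI)
  show "0 \<in> Q_space \<Omega>" using L2.X_closed(1) by (simp add: Q_space_def zero_fun_def)
  show "p + q \<in> Q_space \<Omega>" if "p \<in> Q_space \<Omega>" "q \<in> Q_space \<Omega>" for p q
    using that L2_integrable[of p] L2_integrable[of q] L2.X_closed(2)[of p \<Omega> q]
    by (simp add: Q_space_def plus_fun_def Bochner_Integration.integral_add)
  show "c *\<^sub>R q \<in> Q_space \<Omega>" if "q \<in> Q_space \<Omega>" for c q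
    using that L2.X_closed(4)[of q \<Omega> c] by (auto simp: Q_space_def scaleR_fun_def)
qed

lemma Q_L2: "q \<in> Q_space \<Omega> \<Longrightarrow> q \<in> L2_space \<Omega>"
  by (simp add: Q_space_def)

end

section \<open>Finite element spaces\<close>

text \<open>
  Gaussian elimination: a vector with nonzero entry in column \<open>j\<close> is used to clear this column in all other
  vectors, which leaves one equation less and one vector less.
\<close>

lemma nontrivial_linear_relation:
  fixes c :: "'i \<Rightarrow> 'j \<Rightarrow> real"
  assumes "finite J" "finite I" "card J < card I"
  shows "\<exists>a. (\<exists>i\<in>I. a i \<noteq> 0) \<and> (\<forall>j\<in>J. (\<Sum>i\<in>I. a i * c i j) = 0)"
  using assms
proof (induction J arbitrary: I c rule: finite_induct)
  case empty
  then obtain i where "i \<in> I" by fastforce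
  then show ?case by (intro exI[of _ "\<lambda>_. 1"]) auto
next
  case (insert j J)
  show ?case
  proof (cases "\<forall>i\<in>I. c i j = 0")
    case True
    obtain a where "\<exists>i\<in>I. a i \<noteq> 0" "\<forall>j\<in>J. (\<Sum>i\<in>I. a i * c i j) = 0"
      using insert.IH[of I c] insert.prems insert.hyps by auto
    then show ?thesis using True by (intro exI[of _ a]) auto
  next
    case False
    then obtain k where k: "k \<in> I" "c k j \<noteq> 0" by auto
    define c' where "c' i l = c i l - c i j / c k j * c k l" for i l
    have "card J < card (I - {k})" using insert.prems insert.hyps k by (simp add: card_insert_if)
    then obtain a where a: "\<exists>i\<in>I - {k}. a i \<noteq> 0" "\<forall>l\<in>J. (\<Sum>i\<in>I - {k}. a i * c' i l) = 0"
      using insert.IH[of "I - {k}" c'] insert.prems by auto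
    define b where "b = a(k := - (\<Sum>i\<in>I - {k}. a i * c i j) / c k j)"
    have sum: "(\<Sum>i\<in>I. b i * c i l) = (\<Sum>i\<in>I - {k}. a i * c' i l)" for l
    proof -
      have "(\<Sum>i\<in>I. b i * c i l) = b k * c k l + (\<Sum>i\<in>I - {k}. b i * c i l)"
        using k insert.prems by (subst sum.remove[of I k]) auto
      also have "(\<Sum>i\<in>I - {k}. b i * c i l) = (\<Sum>i\<in>I - {k}. a i * c i l)"
        by (intro sum.cong) (auto simp: b_def)
      also have "b k * c k l = - (\<Sum>i\<in>I - {k}. a i * (c i j / c k j * c k l))"
      proof -
        have "(\<Sum>i\<in>I - {k}. a i * (c i j / c k j * c k l)) = (\<Sum>i\<in>I - {k}. a i * c i j) * (c k l / c k j)"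
          unfolding sum_distrib_right by (intro sum.cong) auto
        then show ?thesis by (simp add: b_def)
      qed
      finally show ?thesis by (simp add: c'_def right_diff_distrib sum_subtractf)
    qed
    have "c' i j = 0" for i using k by (simp add: c'_def)
    then have "\<forall>l\<in>insert j J. (\<Sum>i\<in>I. b i * c i l) = 0" using a(2) by (auto simp: sum)
    moreover have "\<exists>i\<in>I. b i \<noteq> 0" using a(1) by (auto simp: b_def)
    ultimately show ?thesis by blast
  qed
qed

lemma finite_monomials: "finite {\<alpha> :: 'd::finite \<Rightarrow> nat. sum \<alpha> UNIV \<le> l}"
proof (rule finite_subset)
  show "{\<alpha> :: 'd \<Rightarrow> nat. sum \<alpha> UNIV \<le> l} \<subseteq> PiE UNIV (\<lambda>_. {..l})"
  proof
    fix \<alpha> :: "'d \<Rightarrow> nat" assume "\<alpha> \<in> {\<alpha>. sum \<alpha> UNIV \<le> l}"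
    then have "\<alpha> i \<le> l" for i using member_le_sum[of i UNIV \<alpha>] by auto
    then show "\<alpha> \<in> PiE UNIV (\<lambda>_. {..l})" by (simp add: PiE_UNIV_domain)
  qed
  show "finite (PiE (UNIV :: 'd set) (\<lambda>_. {..l}))" by (rule finite_PiE) auto
qed

text \<open>
  The common local structure of velocity and pressure finite elements, for values in any Euclidean space.
\<close>

definition piecewise_space ::
  "(real^'d) set \<Rightarrow> (real^'d) set set \<Rightarrow> ((real^'d) set \<Rightarrow> (real^'d \<Rightarrow> 'b::euclidean_space) set) \<Rightarrow> (real^'d \<Rightarrow> 'b) set" where
  "piecewise_space \<Omega> \<K> W = {v. \<forall>K\<in>\<K>. \<exists>w\<in>W K. AE x in lebesgue_on \<Omega>. x \<in> K \<longrightarrow> v x = w x}"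

lemma subspace_piecewise:
  assumes W: "\<And>K. K \<in> \<K> \<Longrightarrow> mapped_poly_space l (R K) (F K) (W K)"
  shows "subspace (piecewise_space \<Omega> \<K> W)"
proof -
  have lin: "a *\<^sub>R v + b *\<^sub>R v' \<in> piecewise_space \<Omega> \<K> W"
    if vv: "v \<in> piecewise_space \<Omega> \<K> W" "v' \<in> piecewise_space \<Omega> \<K> W" for v v' a b
    unfolding piecewise_space_def
  proof (intro CollectI ballI)
    fix K assume K: "K \<in> \<K>"
    obtain w w' where w: "w \<in> W K" "AE x in lebesgue_on \<Omega>. x \<in> K \<longrightarrow> v x = w x"
      "w' \<in> W K" "AE x in lebesgue_on \<Omega>. x \<in> K \<longrightarrow> v' x = w' x"
      using vv K unfolding piecewise_space_def by blast
    have "(\<lambda>x. a *\<^sub>R w x + b *\<^sub>R w' x) \<in> W K"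
      using W[OF K] w by (auto simp: mapped_poly_space_def)
    moreover have "AE x in lebesgue_on \<Omega>. x \<in> K \<longrightarrow> (a *\<^sub>R v + b *\<^sub>R v') x = a *\<^sub>R w x + b *\<^sub>R w' x"
      using w(2,4) by eventually_elim simp
    ultimately show "\<exists>w\<in>W K. AE x in lebesgue_on \<Omega>. x \<in> K \<longrightarrow> (a *\<^sub>R v + b *\<^sub>R v') x = w x"
      by (rule bexI[where x = "\<lambda>x. a *\<^sub>R w x + b *\<^sub>R w' x", rotated])
  qed
  have zero: "0 \<in> piecewise_space \<Omega> \<K> W"
    unfolding piecewise_space_def using W by (auto simp: mapped_poly_space_def zero_fun_def intro!: bexI[of _ "\<lambda>x. 0"])
  show ?thesis
    unfolding subspace_def
  proof (intro conjI ballI allI)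
    show "v + v' \<in> piecewise_space \<Omega> \<K> W"
      if "v \<in> piecewise_space \<Omega> \<K> W" "v' \<in> piecewise_space \<Omega> \<K> W" for v v'
      using lin[OF that, of 1 1] by simp
    show "c *\<^sub>R v \<in> piecewise_space \<Omega> \<K> W" if "v \<in> piecewise_space \<Omega> \<K> W" for c v
      using lin[OF that that, of c 0] by simp
  qed (rule zero)
qed

lemma piecewise_ae_closed:
  assumes v: "v \<in> piecewise_space \<Omega> \<K> W" and eq: "ae_eq \<Omega> v v'"
  shows "v' \<in> piecewise_space \<Omega> \<K> W"
  unfolding piecewise_space_def
proof (intro CollectI ballI)
  fix K assume "K \<in> \<K>"
  then obtain w where w: "w \<in> W K" "AE x in lebesgue_on \<Omega>. x \<in> K \<longrightarrow> v x = w x"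
    using v unfolding piecewise_space_def by blast
  have "AE x in lebesgue_on \<Omega>. x \<in> K \<longrightarrow> v' x = w x"
    using w(2) eq unfolding ae_eq_def by eventually_elim simp
  then show "\<exists>w\<in>W K. AE x in lebesgue_on \<Omega>. x \<in> K \<longrightarrow> v' x = w x" by (rule bexI[OF _ w(1)])
qed

text \<open>
  An element is determined almost everywhere by its polynomial coefficients on the reference cells, one
  for each cell, monomial and coordinate. With one function more than there are coefficients, some
  nontrivial combination has all coefficients zero.
\<close>

lemma piecewise_relation:
  assumes fin: "finite \<K>" and cover: "\<Omega> \<subseteq> \<Union>\<K>"
    and W: "\<And>K. K \<in> \<K> \<Longrightarrow> mapped_poly_space l (R K) (F K) (W K)" and FR: "\<And>K. K \<in> \<K> \<Longrightarrow> F K ` R K = K"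
  shows "\<exists>m::nat. \<forall>e. (\<forall>i<m. e i \<in> piecewise_space \<Omega> \<K> (W :: _ \<Rightarrow> (real^'d \<Rightarrow> 'b::euclidean_space) set)) \<longrightarrow>
     (\<exists>a. (\<exists>i<m. a i \<noteq> 0) \<and> ae_eq \<Omega> (\<Sum>i<m. a i *\<^sub>R e i) 0)"
proof -
  let ?I = "{\<alpha> :: 'd \<Rightarrow> nat. sum \<alpha> UNIV \<le> l}"
  define J where "J = \<K> \<times> ?I \<times> (Basis :: 'b set)"
  have J: "finite J" unfolding J_def using fin finite_monomials by (intro finite_cartesian_product) auto
  define m where "m = Suc (card J)"
  have "\<exists>a. (\<exists>i<m. a i \<noteq> 0) \<and> ae_eq \<Omega> (\<Sum>i<m. a i *\<^sub>R e i) 0"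
    if e: "\<forall>i<m. e i \<in> piecewise_space \<Omega> \<K> W" for e :: "nat \<Rightarrow> real^'d \<Rightarrow> 'b"
  proof -
    define w where "w i K = (SOME w. w \<in> W K \<and> (AE x in lebesgue_on \<Omega>. x \<in> K \<longrightarrow> e i x = w x))" for i K
    have ex_w: "\<exists>w. w \<in> W K \<and> (AE x in lebesgue_on \<Omega>. x \<in> K \<longrightarrow> e i x = w x)"
      if "i < m" "K \<in> \<K>" for i K
    proof -
      have "e i \<in> piecewise_space \<Omega> \<K> W" using e that(1) by simp
      then show ?thesis using that(2) unfolding piecewise_space_def Bex_def[symmetric] by simp
    qed
    have w_prop: "w i K \<in> W K \<and> (AE x in lebesgue_on \<Omega>. x \<in> K \<longrightarrow> e i x = w i K x)"
      if "i < m" "K \<in> \<K>" for i K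
      unfolding w_def by (rule someI_ex[OF ex_w[OF that]])
    note w = conjunct1[OF w_prop] conjunct2[OF w_prop]
    have ex_c: "\<exists>c. \<forall>y\<in>R K. w i K (F K y) = (\<Sum>\<alpha>\<in>?I. (\<Prod>k\<in>UNIV. (y $ k) ^ \<alpha> k) *\<^sub>R c \<alpha>)" if iK: "i < m" "K \<in> \<K>" for i K
    proof -
      obtain p where p: "poly_deg_le l p" "\<forall>x\<in>R K. w i K (F K x) = p x"
        using W[OF iK(2)] w(1)[OF iK] unfolding mapped_poly_space_def by blast
      then show ?thesis unfolding poly_deg_le_def by fastforce
    qed
    define c where "c i K = (SOME c. \<forall>y\<in>R K. w i K (F K y) = (\<Sum>\<alpha>\<in>?I. (\<Prod>k\<in>UNIV. (y $ k) ^ \<alpha> k) *\<^sub>R c \<alpha>))" for i K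
    have c: "w i K (F K y) = (\<Sum>\<alpha>\<in>?I. (\<Prod>k\<in>UNIV. (y $ k) ^ \<alpha> k) *\<^sub>R c i K \<alpha>)"
      if "i < m" "K \<in> \<K>" "y \<in> R K" for i K y
      using someI_ex[OF ex_c[OF that(1,2)]] that(3) unfolding c_def by blast
    \<comment> \<open>One relation for all cells, monomials and coordinates simultaneously.\<close>
    obtain a where a: "\<exists>i\<in>{..<m}. a i \<noteq> 0"
      "\<forall>j\<in>J. (\<Sum>i\<in>{..<m}. a i * (case j of (K, \<alpha>, b) \<Rightarrow> c i K \<alpha> \<bullet> b)) = 0"
      using nontrivial_linear_relation[OF J, of "{..<m}" "\<lambda>i j. case j of (K, \<alpha>, b) \<Rightarrow> c i K \<alpha> \<bullet> b"]
      by (auto simp: m_def)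
    have z: "(\<Sum>i<m. a i *\<^sub>R c i K \<alpha>) = 0" if "K \<in> \<K>" "\<alpha> \<in> ?I" for K \<alpha>
    proof (rule euclidean_eqI)
      fix b :: 'b assume "b \<in> Basis"
      then have "(\<Sum>i<m. a i * (c i K \<alpha> \<bullet> b)) = 0" using a(2) that by (force simp: J_def)
      then show "(\<Sum>i<m. a i *\<^sub>R c i K \<alpha>) \<bullet> b = 0 \<bullet> b" by (simp add: inner_sum_left)
    qed
    have zero: "(\<Sum>i<m. a i *\<^sub>R w i K x) = 0" if K: "K \<in> \<K>" and x: "x \<in> K" for K x
    proof -
      obtain y where y: "y \<in> R K" "x = F K y" using FR[OF K] x by auto
      have "(\<Sum>i<m. a i *\<^sub>R w i K x) = (\<Sum>i<m. \<Sum>\<alpha>\<in>?I. (\<Prod>k\<in>UNIV. (y $ k) ^ \<alpha> k) *\<^sub>R (a i *\<^sub>R c i K \<alpha>))"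
        using c[OF _ K y(1)] by (simp add: y(2) scaleR_sum_right mult.commute)
      also have "\<dots> = (\<Sum>\<alpha>\<in>?I. (\<Prod>k\<in>UNIV. (y $ k) ^ \<alpha> k) *\<^sub>R (\<Sum>i<m. a i *\<^sub>R c i K \<alpha>))"
        by (subst sum.swap) (simp add: scaleR_sum_right)
      also have "\<dots> = 0" using z[OF K] by simp
      finally show ?thesis .
    qed
    have "AE x in lebesgue_on \<Omega>. \<forall>K\<in>\<K>. \<forall>i\<in>{..<m}. x \<in> K \<longrightarrow> e i x = w i K x"
      using w(2) fin by (intro AE_finite_allI) auto
    moreover have "AE x in lebesgue_on \<Omega>. x \<in> \<Omega>"
      by (rule AE_I2) simp
    ultimately have "AE x in lebesgue_on \<Omega>. (\<Sum>i<m. a i *\<^sub>R e i) x = 0"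
    proof eventually_elim
      case (elim x)
      then obtain K where K: "K \<in> \<K>" "x \<in> K" using cover by auto
      have "(\<Sum>i<m. a i *\<^sub>R e i) x = (\<Sum>i<m. a i *\<^sub>R e i x)" by (simp add: sum_fun_apply)
      also have "\<dots> = (\<Sum>i<m. a i *\<^sub>R w i K x)" using elim(1) K by (intro sum.cong) auto
      also have "\<dots> = 0" by (rule zero[OF K])
      finally show ?case .
    qed
    then have "ae_eq \<Omega> (\<Sum>i<m. a i *\<^sub>R e i) 0" by (simp add: ae_eq_def zero_fun_def)
    with a(1) show ?thesis by auto
  qed
  then show ?thesis by blast
qed

locale fe_space = bounded_domain \<Omega> for \<Omega> :: "(real^'d) set" +
  fixes M :: "'d fe_mesh" and l :: nat and \<beta> :: real
  assumes nonempty: "\<Omega> \<noteq> {}" and mesh: "is_mesh_of \<Omega> M"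
    and V_loc: "\<And>K. K \<in> cells M \<Longrightarrow> mapped_poly_space l (ref_cell M K) (cell_map M K) (V_loc M K)"
    and Q_loc: "\<And>K. K \<in> cells M \<Longrightarrow> mapped_poly_space l (ref_cell M K) (cell_map M K) (Q_loc M K)"
    and \<beta>_pos: "0 < \<beta>"
    and inf_sup_bound: "ereal \<beta> \<le> (INF q\<in>{q \<in> Q_h \<Omega> M. \<not> ae_eq \<Omega> q (\<lambda>x. 0)}.
                 SUP v\<in>{v \<in> V_h \<Omega> M. \<not> ae_eq \<Omega> v (\<lambda>x. 0)}.
                   ereal (- L2_inner \<Omega> (div_v \<Omega> v) q / (H_norm 1 \<Omega> v * L2_norm \<Omega> q)))"
begin

lemma V_h_eq: "V_h \<Omega> M = V_space \<Omega> \<inter> piecewise_space \<Omega> (cells M) (V_loc M)"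
  by (auto simp: V_h_def piecewise_space_def)

lemma Q_h_eq: "Q_h \<Omega> M = Q_space \<Omega> \<inter> piecewise_space \<Omega> (cells M) (Q_loc M)"
  by (auto simp: Q_h_def piecewise_space_def)

lemma subspace_V_h: "subspace (V_h \<Omega> M)"
  unfolding V_h_eq by (intro subspace_inter subspace_V subspace_piecewise[OF V_loc])

lemma subspace_Q_h: "subspace (Q_h \<Omega> M)"
  unfolding Q_h_eq by (intro subspace_inter subspace_Q subspace_piecewise[OF Q_loc])

lemma V_h_ae_closed: "v \<in> V_h \<Omega> M \<Longrightarrow> ae_eq \<Omega> v w \<Longrightarrow> w \<in> V_h \<Omega> M"
  unfolding V_h_eq using V_ae_closed piecewise_ae_closed by blast

lemma V_h_V: "v \<in> V_h \<Omega> M \<Longrightarrow> v \<in> V_space \<Omega>"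
  by (simp add: V_h_def)

lemma Q_h_L2: "q \<in> Q_h \<Omega> M \<Longrightarrow> q \<in> L2_space \<Omega>"
  by (simp add: Q_h_def Q_L2)

lemma cells_cover: "\<Union> (cells M) = closure \<Omega>" and finite_cells: "finite (cells M)"
  using mesh by (auto simp: is_mesh_of_def)

lemma cell_image: "K \<in> cells M \<Longrightarrow> cell_map M K ` ref_cell M K = K"
  using mesh by (auto simp: is_mesh_of_def C1_diffeo_onto_def)

lemma fin_dim_V_h: "semi_inner.fin_dim (H_ip 1) (V_h \<Omega> M)"
  unfolding H.fin_dim_def
proof -
  have "\<Omega> \<subseteq> \<Union> (cells M)" using cells_cover closure_subset by auto
  then obtain m :: nat where m: "\<And>e. \<forall>i<m. e i \<in> piecewise_space \<Omega> (cells M) (V_loc M) \<Longrightarrow>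
     (\<exists>a. (\<exists>i<m. a i \<noteq> 0) \<and> ae_eq \<Omega> (\<Sum>i<m. a i *\<^sub>R e i) 0)"
    using piecewise_relation[OF finite_cells _ V_loc cell_image] by blast
  have ex: "\<exists>a. (\<exists>i<m. a i \<noteq> 0) \<and> H_norm 1 \<Omega> (\<Sum>i<m. a i *\<^sub>R e i) = 0"
    if e: "\<forall>i<m. e i \<in> V_h \<Omega> M" for e
  proof -
    obtain a where a: "\<exists>i<m. a i \<noteq> 0" "ae_eq \<Omega> (\<Sum>i<m. a i *\<^sub>R e i) 0"
      using m[of e] e by (auto simp: V_h_eq)
    have "(\<Sum>i<m. a i *\<^sub>R e i) \<in> H_space 1 \<Omega>"
      using e V_h_V V_H1 by (intro H.X_sum H.X_closed) auto
    from H_norm_cong[OF this a(2)] show ?thesis using a(1) by (auto simp: H.nrm_zero)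
  qed
  show "\<exists>m::nat. \<forall>e. (\<forall>i<m. e i \<in> V_h \<Omega> M) \<longrightarrow> (\<exists>a. (\<exists>i<m. a i \<noteq> 0) \<and> H_norm 1 \<Omega> (\<Sum>i<m. a i *\<^sub>R e i) = 0)"
    by (intro exI[of _ m] allI impI ex) blast
qed

text \<open>
  For \<open>q\<close> that is not zero, each quotient in the supremum is at most \<open>c\<close> divided by the norm of \<open>q\<close>. A
  velocity that vanishes in norm contributes the value zero, by the convention for division.
\<close>

lemma inf_sup_dual:
  assumes q: "q \<in> Q_h \<Omega> M" and c: "0 \<le> c"
    and bd: "\<And>v. v \<in> V_h \<Omega> M \<Longrightarrow> \<bar>L2_inner \<Omega> (div_v \<Omega> v) q\<bar> \<le> c * H_norm 1 \<Omega> v"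
  shows "\<beta> * L2_norm \<Omega> q \<le> c"
proof (cases "L2_norm \<Omega> q = 0")
  case True
  then show ?thesis using c by simp
next
  case False
  have qL: "q \<in> L2_space \<Omega>" by (rule Q_h_L2[OF q])
  have pos: "0 < L2_norm \<Omega> q" using False L2.nrm_nonneg[OF qL] by linarith
  have "\<not> ae_eq \<Omega> q (\<lambda>x. 0)"
  proof
    assume "ae_eq \<Omega> q (\<lambda>x. 0)"
    then have "L2_norm \<Omega> q = L2_norm \<Omega> (\<lambda>x. 0 :: real)" by (rule L2_norm_cong[OF _ qL const_L2])
    also have "\<dots> = 0" by (simp add: L2_norm_def L2_inner_def)
    finally show False using False by simp
  qed
  then have "ereal \<beta> \<le> (SUP v\<in>{v \<in> V_h \<Omega> M. \<not> ae_eq \<Omega> v (\<lambda>x. 0)}.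
                   ereal (- L2_inner \<Omega> (div_v \<Omega> v) q / (H_norm 1 \<Omega> v * L2_norm \<Omega> q)))"
    using q by (intro order_trans[OF inf_sup_bound INF_lower]) auto
  also have "\<dots> \<le> ereal (c / L2_norm \<Omega> q)"
  proof (rule SUP_least)
    fix v assume "v \<in> {v \<in> V_h \<Omega> M. \<not> ae_eq \<Omega> v (\<lambda>x. 0)}"
    then have v: "v \<in> V_h \<Omega> M" by simp
    have v0: "0 \<le> H_norm 1 \<Omega> v" by (rule H.nrm_nonneg[OF V_H1[OF V_h_V[OF v]]])
    show "ereal (- L2_inner \<Omega> (div_v \<Omega> v) q / (H_norm 1 \<Omega> v * L2_norm \<Omega> q)) \<le> ereal (c / L2_norm \<Omega> q)"
    proof (cases "H_norm 1 \<Omega> v = 0")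
      case True
      then show ?thesis using c pos by simp
    next
      case False
      then have v1: "0 < H_norm 1 \<Omega> v" using v0 by simp
      have "- L2_inner \<Omega> (div_v \<Omega> v) q \<le> c * H_norm 1 \<Omega> v" using bd[OF v] by linarith
      then show ?thesis using v1 pos by (simp add: field_simps)
    qed
  qed
  finally have "\<beta> \<le> c / L2_norm \<Omega> q" by simp
  then show ?thesis using pos by (simp add: field_simps)
qed

sublocale DS: discrete_stokes "V_space \<Omega>" "H_ip 1" "L2_space \<Omega>" "L2_inner \<Omega>"
    "\<lambda>v q. L2_inner \<Omega> (div_v \<Omega> v) q" "real CARD('d)" "V_h \<Omega> M" "Q_h \<Omega> M" \<beta>
  rewrites "semi_inner.nrm (H_ip 1) = (H_norm 1 \<Omega> :: (real^'d \<Rightarrow> real^'d) \<Rightarrow> real)"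
    and "semi_inner.nrm (L2_inner \<Omega>) = (L2_norm \<Omega> :: (real^'d \<Rightarrow> real) \<Rightarrow> real)"
proof -
  have n1: "semi_inner.nrm (H_ip 1) = (H_norm 1 \<Omega> :: (real^'d \<Rightarrow> real^'d) \<Rightarrow> real)" by (rule nrm_H)
  have n2: "semi_inner.nrm (L2_inner \<Omega>) = (L2_norm \<Omega> :: (real^'d \<Rightarrow> real) \<Rightarrow> real)"
    by (auto simp: L2_norm_def semi_inner.nrm_def[OF semi_inner_L2])
  have VX: "V_space \<Omega> \<subseteq> H_space 1 \<Omega>" using V_H1 by auto
  have s: "semi_inner (V_space \<Omega>) (H_ip 1)" by (rule semi_inner_subset[OF semi_inner_H subspace_V VX])
  show "discrete_stokes (V_space \<Omega>) (H_ip 1) (L2_space \<Omega>) (L2_inner \<Omega>) (\<lambda>v q. L2_inner \<Omega> (div_v \<Omega> v) q)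
     (real CARD('d)) (V_h \<Omega> M) (Q_h \<Omega> M) \<beta>"
    unfolding discrete_stokes_def discrete_stokes_axioms_def n1 n2
  proof (intro conjI allI impI)
    show "semi_inner (V_space \<Omega>) (H_ip 1)" by (rule s)
    show "semi_inner (L2_space \<Omega>) (L2_inner \<Omega>)" by (rule semi_inner_L2)
    show "L2_inner \<Omega> (div_v \<Omega> (x + y)) q = L2_inner \<Omega> (div_v \<Omega> x) q + L2_inner \<Omega> (div_v \<Omega> y) q"
      if "x \<in> V_space \<Omega>" "y \<in> V_space \<Omega>" "q \<in> L2_space \<Omega>" for x y q
      using div_form_linear[OF V_H1[OF that(1)] V_H1[OF that(2)] that(3), of 1 1] by simp
    show "L2_inner \<Omega> (div_v \<Omega> (c *\<^sub>R x)) q = c * L2_inner \<Omega> (div_v \<Omega> x) q"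
      if "x \<in> V_space \<Omega>" "q \<in> L2_space \<Omega>" for c x q
      using div_form_linear[OF V_H1[OF that(1)] V_H1[OF that(1)] that(2), of c 0] by simp
    show "L2_inner \<Omega> (div_v \<Omega> x) (p + q) = L2_inner \<Omega> (div_v \<Omega> x) p + L2_inner \<Omega> (div_v \<Omega> x) q"
      if "x \<in> V_space \<Omega>" "p \<in> L2_space \<Omega>" "q \<in> L2_space \<Omega>" for x p q
      using that by (intro L2.ip_add_right div_L2 V_H1)
    show "L2_inner \<Omega> (div_v \<Omega> x) (c *\<^sub>R q) = c * L2_inner \<Omega> (div_v \<Omega> x) q"
      if "x \<in> V_space \<Omega>" "q \<in> L2_space \<Omega>" for c x q
      using that by (intro L2.ip_scaleR_right div_L2 V_H1)
    show "\<bar>L2_inner \<Omega> (div_v \<Omega> x) q\<bar> \<le> real CARD('d) * H_norm 1 \<Omega> x * L2_norm \<Omega> q"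
      if "x \<in> V_space \<Omega>" "q \<in> L2_space \<Omega>" for x q
      by (rule div_form_bound[OF V_H1[OF that(1)] that(2)])
    show "0 \<le> real CARD('d)" by simp
    show "subspace (V_h \<Omega> M)" "V_h \<Omega> M \<subseteq> V_space \<Omega>" "semi_inner.fin_dim (H_ip 1) (V_h \<Omega> M)"
      using subspace_V_h V_h_V fin_dim_V_h by auto
    show "subspace (Q_h \<Omega> M)" "Q_h \<Omega> M \<subseteq> L2_space \<Omega>" using subspace_Q_h Q_h_L2 by auto
    show "0 < \<beta>" by (rule \<beta>_pos)
    show "\<beta> * L2_norm \<Omega> q \<le> c"
      if "q \<in> Q_h \<Omega> M" "0 \<le> c" "\<forall>v. v \<in> V_h \<Omega> M \<longrightarrow> \<bar>L2_inner \<Omega> (div_v \<Omega> v) q\<bar> \<le> c * H_norm 1 \<Omega> v" for q c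
      by (rule inf_sup_dual[OF that(1,2)]) (use that(3) in blast)
  qed
  show "semi_inner.nrm (H_ip 1) = (H_norm 1 \<Omega> :: (real^'d \<Rightarrow> real^'d) \<Rightarrow> real)" by (rule n1)
  show "semi_inner.nrm (L2_inner \<Omega>) = (L2_norm \<Omega> :: (real^'d \<Rightarrow> real) \<Rightarrow> real)" by (rule n2)
qed

lemma Zh_eq: "DS.Zh = V_h_div \<Omega> M"
  by (auto simp: DS.Zh_def V_h_div_def)

text \<open>
  Positivity is needed to divide the approximation property by the mesh size; it holds because a cell is
  the injective image of a set with interior points and hence contains two different points.
\<close>

lemma mesh_size_bounds: "0 < mesh_size M" "mesh_size M \<le> diameter (closure \<Omega>)"
proof -
  have bd: "bounded (closure \<Omega>)" using bounded_domain by (rule bounded_closure)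
  have sub: "K \<subseteq> closure \<Omega>" if "K \<in> cells M" for K using cells_cover that by auto
  obtain K where K: "K \<in> cells M" using nonempty cells_cover closure_subset[of \<Omega>] by fastforce
  have "interior (ref_cell M K) \<noteq> {}" and inj: "inj_on (cell_map M K) (ref_cell M K)"
    using mesh K by (auto simp: is_mesh_of_def C1_diffeo_onto_def)
  then have "infinite (ref_cell M K)"
    using finite_imp_closed interior_subset finite_subset by (metis finite_imp_not_open open_interior)
  then have "infinite K" using finite_image_iff[OF inj] cell_image[OF K] by metis
  then obtain x y where xy: "x \<in> K" "y \<in> K" "x \<noteq> y"
    by (metis finite.emptyI finite_insert insertI1 finite_subset subsetI singleton_iff)
  have "dist x y \<le> diameter K"
    using xy bounded_subset[OF bd sub[OF K]] by (intro diameter_bounded_bound)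
  then have "0 < diameter K" using xy by (meson dist_pos_lt less_le_trans)
  also have "\<dots> \<le> mesh_size M" unfolding mesh_size_def using finite_cells K by (intro Max_ge) auto
  finally show "0 < mesh_size M" .
  show "mesh_size M \<le> diameter (closure \<Omega>)"
    unfolding mesh_size_def
  proof (rule Max.boundedI)
    fix d assume "d \<in> diameter ` cells M"
    then show "d \<le> diameter (closure \<Omega>)" using diameter_subset[OF sub bd] by auto
  qed (use finite_cells K in auto)
qed

end

section \<open>From the Galerkin scheme to a Crank-Nicolson recursion\<close>

text \<open>
  The definitions write difference quotients pointwise; the lemmas on norms use the vector operations.
\<close>

lemma fun_quotient_eq: "(\<lambda>x. (f x - g x) /\<^sub>R c - h x) = (f - g) /\<^sub>R c - h"
  by (simp add: fun_eq_iff)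

text \<open>
  The integrand may be arbitrary at the right end point. This matters because the time derivative of the
  discrete velocity is not determined at the nodes.
\<close>

lemma lebesgue_integral_affine:
  fixes g :: "real \<Rightarrow> real"
  assumes ab: "a < b" and g: "\<And>s. a < s \<Longrightarrow> s < b \<Longrightarrow> g s = \<alpha> + \<beta> * s"
  shows "(LINT s|lebesgue_on {a<..b}. g s) = (b - a) * (\<alpha> + \<beta> * ((a + b) / 2))"
proof -
  let ?h = "\<lambda>s. \<alpha> + \<beta> * s"
  have m1: "(\<lambda>s. indicator {a..b} s *\<^sub>R ?h s) \<in> borel_measurable lebesgue"
    by (intro measurable_completion borel_measurable_scaleR borel_measurable_indicator) auto
  have "negligible {a, b}" by (rule negligible_finite) simp
  then have "AE s in lebesgue. s \<notin> {a, b}"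
    unfolding negligible_iff_null_sets by (rule AE_not_in)
  then have ae: "AE s in lebesgue. indicator {a..b} s *\<^sub>R ?h s = indicator {a<..b} s *\<^sub>R g s"
    by eventually_elim (use g in \<open>auto simp: indicator_def\<close>)
  have "(LINT s|lebesgue_on {a<..b}. g s) = (LINT s|lebesgue. indicator {a<..b} s *\<^sub>R g s)"
    by (rule integral_restrict_space) simp
  also have "\<dots> = (LINT s|lebesgue. indicator {a..b} s *\<^sub>R ?h s)"
    by (rule integral_cong_AE[OF borel_measurable_AE[OF m1 ae] m1]) (use ae in \<open>auto elim: eventually_mono\<close>)
  also have "\<dots> = (LINT s|lebesgue_on {a..b}. ?h s)"
    by (rule integral_restrict_space[symmetric]) simp
  also have "\<dots> = integral {a..b} ?h"
  proof (rule lebesgue_integral_eq_integral)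
    show "integrable (lebesgue_on {a..b}) ?h"
      by (rule continuous_imp_integrable_real) (intro continuous_intros)
  qed simp
  also have "\<dots> = (b - a) * (\<alpha> + \<beta> * ((a + b) / 2))"
  proof (rule integral_unique)
    have "(?h has_integral (\<alpha> * b + \<beta> * b\<^sup>2 / 2) - (\<alpha> * a + \<beta> * a\<^sup>2 / 2)) {a..b}"
      using ab by (intro fundamental_theorem_of_calculus)
        (auto intro!: derivative_eq_intros simp: has_real_derivative_iff_has_vector_derivative[symmetric])
    moreover have "(\<alpha> * b + \<beta> * b\<^sup>2 / 2) - (\<alpha> * a + \<beta> * a\<^sup>2 / 2) = (b - a) * (\<alpha> + \<beta> * ((a + b) / 2))"
      by (simp add: field_simps power2_eq_square)
    ultimately show "(?h has_integral (b - a) * (\<alpha> + \<beta> * ((a + b) / 2))) {a..b}" by simp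
  qed
  finally show ?thesis .
qed

context bounded_domain
begin

text \<open>
  \<open>dt\<close> picks some limit of the difference quotients; limits in \<open>L\<^sup>2\<close> agree almost everywhere.
\<close>

lemma dt_eq:
  fixes w :: "real \<Rightarrow> real^'d \<Rightarrow> 'b::euclidean_space"
  assumes g: "g \<in> L2_space \<Omega>" and nt: "at t within S \<noteq> bot"
    and L: "\<forall>\<^sub>F s in at t within S. w s \<in> L2_space \<Omega>" "w t \<in> L2_space \<Omega>"
    and lim: "((\<lambda>s. L2_norm \<Omega> ((w s - w t) /\<^sub>R (s - t) - g)) \<longlongrightarrow> 0) (at t within S)"
  shows "dt \<Omega> S w t \<in> L2_space \<Omega>" "ae_eq \<Omega> (dt \<Omega> S w t) g"
proof -
  let ?P = "\<lambda>g. g \<in> L2_space \<Omega> \<and>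
     ((\<lambda>s. L2_norm \<Omega> (\<lambda>x. (w s x - w t x) /\<^sub>R (s - t) - g x)) \<longlongrightarrow> 0) (at t within S)"
  have "?P g" by (subst fun_quotient_eq) (intro conjI g lim)
  then have P: "?P (dt \<Omega> S w t)" unfolding dt_def by (rule someI[where P = ?P])
  then show dL: "dt \<Omega> S w t \<in> L2_space \<Omega>" by (rule conjunct1)
  let ?d = "dt \<Omega> S w t"
  have lim': "((\<lambda>s. L2_norm \<Omega> ((w s - w t) /\<^sub>R (s - t) - ?d)) \<longlongrightarrow> 0) (at t within S)"
    using conjunct2[OF P] by (subst (asm) fun_quotient_eq)
  have lim2: "((\<lambda>s. L2_norm \<Omega> ((w s - w t) /\<^sub>R (s - t) - ?d) + L2_norm \<Omega> ((w s - w t) /\<^sub>R (s - t) - g)) \<longlongrightarrow> 0 + 0) (at t within S)"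
    by (rule tendsto_add[OF lim' lim])
  have ev: "\<forall>\<^sub>F s in at t within S. L2_norm \<Omega> (?d - g)
      \<le> L2_norm \<Omega> ((w s - w t) /\<^sub>R (s - t) - ?d) + L2_norm \<Omega> ((w s - w t) /\<^sub>R (s - t) - g)"
    using L(1)
  proof eventually_elim
    case (elim s)
    let ?q = "(w s - w t) /\<^sub>R (s - t)"
    have q: "?q \<in> L2_space \<Omega>" using elim L(2) by (intro L2.X_closed)
    show ?case
      using L2.nrm_triangle_via[OF dL q g] L2.nrm_diff_commute[OF dL q] by simp
  qed
  have "L2_norm \<Omega> (?d - g) \<le> 0 + 0" by (rule tendsto_lowerbound[OF lim2 ev nt])
  then have "L2_norm \<Omega> (?d - g) = 0" using L2.nrm_nonneg[OF L2.X_closed(3)[OF dL g]] by linarith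
  then show "ae_eq \<Omega> ?d g" by (rule L2_eq_if_norm_diff_zero[OF dL g])
qed

lemma dt_affine:
  assumes c: "c0 \<in> L2_space \<Omega>" "c1 \<in> L2_space \<Omega>" and ab: "a < t" "t < b" "{a<..<b} \<subseteq> S"
    and w: "\<And>s. a < s \<Longrightarrow> s < b \<Longrightarrow> ae_eq \<Omega> (w s) (c0 + s *\<^sub>R c1)"
  shows "dt \<Omega> S w t \<in> L2_space \<Omega>" "ae_eq \<Omega> (dt \<Omega> S w t) c1"
proof -
  have ev: "\<forall>\<^sub>F s in at t within S. a < s \<and> s < b"
    unfolding eventually_at_topological using ab by (intro exI[of _ "{a<..<b}"]) auto
  have L: "w s \<in> L2_space \<Omega>" if "a < s" "s < b" for s
    by (rule L2_ae_closed[OF _ ae_eq_sym[OF w[OF that]]]) (use c in \<open>auto intro!: L2.X_closed\<close>)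
  have nt: "at t within S \<noteq> bot"
  proof -
    have "at t within {a<..<b} = at t" using ab by (intro at_within_open) auto
    then have "at t \<le> at t within S" using at_le[OF ab(3), of t] by simp
    then show ?thesis using at_neq_bot[of t] le_bot by fastforce
  qed
  have zero: "L2_norm \<Omega> ((w s - w t) /\<^sub>R (s - t) - c1) = 0" if "a < s" "s < b" "s \<noteq> t" for s
  proof -
    have "ae_eq \<Omega> ((w s - w t) /\<^sub>R (s - t) - c1) 0"
      using w[OF that(1,2)] w[OF ab(1,2)] unfolding ae_eq_def
    proof eventually_elim
      case (elim x)
      have "w s x - w t x = (s - t) *\<^sub>R c1 x" using elim by (simp add: scaleR_left_diff_distrib)
      then show ?case using that(3) by simp
    qed
    then have "L2_norm \<Omega> ((w s - w t) /\<^sub>R (s - t) - c1) = L2_norm \<Omega> (0 :: real^'d \<Rightarrow> 'a)"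
      using L[OF that(1,2)] L[OF ab(1,2)] c by (intro L2_norm_cong) (auto intro!: L2.X_closed)
    then show ?thesis by (simp only: L2.nrm_zero)
  qed
  have ne: "\<forall>\<^sub>F s in at t within S. s \<noteq> t" by (simp add: eventually_at_filter)
  have lim: "((\<lambda>s. L2_norm \<Omega> ((w s - w t) /\<^sub>R (s - t) - c1)) \<longlongrightarrow> 0) (at t within S)"
    by (rule tendsto_eventually) (use ev ne zero in \<open>auto elim: eventually_elim2\<close>)
  have evL: "\<forall>\<^sub>F s in at t within S. w s \<in> L2_space \<Omega>"
    using ev by (rule eventually_mono) (use L in auto)
  show "dt \<Omega> S w t \<in> L2_space \<Omega>" "ae_eq \<Omega> (dt \<Omega> S w t) c1"
    by (rule dt_eq[OF c(2) nt evL L[OF ab(1,2)] lim])+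
qed

end

lemma P_time_1D:
  assumes "P_time 1 \<Omega> J B w"
  obtains c0 c1 where "c0 \<in> B" "c1 \<in> B" "\<And>s. s \<in> J \<Longrightarrow> ae_eq \<Omega> (w s) (c0 + s *\<^sub>R c1)"
proof -
  obtain c where c: "\<forall>j\<le>1. c j \<in> B" "\<forall>t\<in>J. ae_eq \<Omega> (w t) (\<lambda>x. \<Sum>j\<le>(1::nat). t ^ j *\<^sub>R c j x)"
    using assms unfolding P_time_def by (elim exE conjE)
  show ?thesis
  proof (rule that[of "c 0" "c 1"])
    fix s assume "s \<in> J"
    then show "ae_eq \<Omega> (w s) (c 0 + s *\<^sub>R c 1)" using c(2) by (simp add: ae_eq_def)
  qed (use c in auto)
qed

lemma mesh_mono:
  assumes "time_mesh T N t" "i \<le> j" "j \<le> N"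
  shows "t i \<le> t j"
  using assms(2,3)
proof (induction j rule: dec_induct)
  case (step j)
  then have "t j < t (Suc j)" using assms(1) by (auto simp: time_mesh_def)
  then show ?case using step by simp
qed simp

lemma mesh_node:
  assumes "time_mesh T N t" "n \<in> {1..N}"
  shows "t (n - 1) < t n" "0 \<le> t (n - 1)" "t n \<le> T" "0 < time_step t n" "time_step t n \<le> max_step N t"
proof -
  have "n - 1 < N" "Suc (n - 1) = n" using assms(2) by auto
  then show 1: "t (n - 1) < t n" using assms(1) unfolding time_mesh_def by metis
  show "0 \<le> t (n - 1)" using mesh_mono[OF assms(1), of 0 "n - 1"] assms by (auto simp: time_mesh_def)
  show "t n \<le> T" using mesh_mono[OF assms(1), of n N] assms by (auto simp: time_mesh_def)
  show "0 < time_step t n" using 1 by (simp add: time_step_def)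
  show "time_step t n \<le> max_step N t" unfolding max_step_def using assms(2) by (intro Max_ge) auto
qed

lemma sum_time_steps: "(\<Sum>m=1..n. time_step t m) = t n - t 0"
proof (induction n)
  case (Suc n)
  have "(\<Sum>m=1..Suc n. time_step t m) = (\<Sum>m=1..n. time_step t m) + time_step t (Suc n)" by simp
  also have "\<dots> = (t n - t 0) + (t (Suc n) - t n)"
    unfolding Suc.IH by (simp add: time_step_def)
  finally show ?case by simp
qed simp

context fe_space
begin

text \<open>
  The scheme provides an affine function on the half-open interval only. The right-sided continuity at
  \<open>t\<^sub>n\<^sub>-\<^sub>1\<close> forces the previous nodal value to be the value of this affine function.
\<close>

lemma scheme_interval:
  assumes mesh_t: "time_mesh T N t" and sol: "scheme_solution \<Omega> M T N t f u0h uh ph"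
    and n: "n \<in> {1..N}" and left: "uh (t (n - 1)) \<in> L2_space \<Omega>"
  obtains c0 c1 where "c0 \<in> V_h \<Omega> M" "c1 \<in> V_h \<Omega> M"
    "\<And>s. t (n - 1) \<le> s \<Longrightarrow> s \<le> t n \<Longrightarrow> ae_eq \<Omega> (uh s) (c0 + s *\<^sub>R c1)"
proof -
  let ?a = "t (n - 1)" and ?b = "t n"
  note ab = mesh_node[OF mesh_t n]
  have "P_time 1 \<Omega> {?a<..?b} (V_h \<Omega> M) uh" using sol n unfolding scheme_solution_def by blast
  then obtain c0 c1 where c: "c0 \<in> V_h \<Omega> M" "c1 \<in> V_h \<Omega> M"
    "\<And>s. s \<in> {?a<..?b} \<Longrightarrow> ae_eq \<Omega> (uh s) (c0 + s *\<^sub>R c1)" by (rule P_time_1D) (rule that)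
  have cL: "c0 \<in> L2_space \<Omega>" "c1 \<in> L2_space \<Omega>" using c V_h_V V_L2 by blast+
  have afL: "c0 + s *\<^sub>R c1 \<in> L2_space \<Omega>" for s using cL by (intro L2.X_closed)
  have uL: "uh s \<in> L2_space \<Omega>" if "s \<in> {?a<..?b}" for s
    by (rule L2_ae_closed[OF afL ae_eq_sym[OF c(3)[OF that]]])
  have lim: "((\<lambda>s. L2_norm \<Omega> (uh s - uh ?a)) \<longlongrightarrow> 0) (at_right ?a)"
    using sol n unfolding scheme_solution_def fun_diff_def by blast
  have lim2: "((\<lambda>s. \<bar>s - ?a\<bar> * L2_norm \<Omega> c1) \<longlongrightarrow> 0) (at_right ?a)"
    by (auto intro!: tendsto_eq_intros)
  have ev: "\<forall>\<^sub>F s in at_right ?a. s \<in> {?a<..?b}"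
    unfolding eventually_at_right_field using ab(1) by (intro exI[of _ ?b]) auto
  have "\<forall>\<^sub>F s in at_right ?a. L2_norm \<Omega> (uh ?a - (c0 + ?a *\<^sub>R c1))
      \<le> L2_norm \<Omega> (uh s - uh ?a) + \<bar>s - ?a\<bar> * L2_norm \<Omega> c1"
    using ev
  proof eventually_elim
    case (elim s)
    have eqn: "L2_norm \<Omega> (uh s - (c0 + ?a *\<^sub>R c1)) = L2_norm \<Omega> ((s - ?a) *\<^sub>R c1)"
    proof (rule L2_norm_cong)
      show "ae_eq \<Omega> (uh s - (c0 + ?a *\<^sub>R c1)) ((s - ?a) *\<^sub>R c1)"
        using c(3)[OF elim] unfolding ae_eq_def
        by eventually_elim (simp add: scaleR_left_diff_distrib)
    qed (use uL[OF elim] afL cL in \<open>auto intro!: L2.X_closed\<close>)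
    then show ?case
      using L2.nrm_triangle_via[OF left uL[OF elim] afL[of ?a]] L2.nrm_diff_commute[OF left uL[OF elim]]
        L2.nrm_scaleR[OF cL(2), of "s - ?a"] by simp
  qed
  then have "L2_norm \<Omega> (uh ?a - (c0 + ?a *\<^sub>R c1)) \<le> 0 + 0"
    by (rule tendsto_lowerbound[OF tendsto_add[OF lim lim2] _ trivial_limit_at_right_real])
  then have "L2_norm \<Omega> (uh ?a - (c0 + ?a *\<^sub>R c1)) = 0"
    using L2.nrm_nonneg[OF L2.X_closed(3)[OF left afL[of ?a]]] by linarith
  then have "ae_eq \<Omega> (uh ?a) (c0 + ?a *\<^sub>R c1)" by (rule L2_eq_if_norm_diff_zero[OF left afL])
  then have "ae_eq \<Omega> (uh s) (c0 + s *\<^sub>R c1)" if "?a \<le> s" "s \<le> ?b" for s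
    using c(3)[of s] that by (cases "s = ?a") auto
  then show ?thesis using c(1,2) that by blast
qed

text \<open>
  The divergence equation says that the divergence form vanishes at the interval midpoint. As it is affine
  in time and vanishes at the left node, it vanishes at the right node.
\<close>

lemma scheme_nodes:
  assumes mesh_t: "time_mesh T N t" and sol: "scheme_solution \<Omega> M T N t f u0h uh ph"
    and u0h: "u0h \<in> V_h_div \<Omega> M" and n: "n \<le> N"
  shows "uh (t n) \<in> V_h_div \<Omega> M"
  using n
proof (induction n)
  case 0
  have eq: "ae_eq \<Omega> u0h (uh (t 0))"
    using sol mesh_t by (auto simp: scheme_solution_def time_mesh_def intro: ae_eq_sym)
  have V: "u0h \<in> V_h \<Omega> M" using u0h by (simp add: V_h_div_def)
  then have "uh (t 0) \<in> V_h \<Omega> M" by (rule V_h_ae_closed[OF _ eq])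
  then show ?case
    using u0h div_form_cong[OF V_H1[OF V_h_V[OF V]] eq] Q_h_L2 by (auto simp: V_h_div_def)
next
  case (Suc k)
  let ?n = "Suc k"
  have n: "?n \<in> {1..N}" and k: "t (?n - 1) = t k" using Suc by auto
  have prev: "uh (t k) \<in> V_h_div \<Omega> M" using Suc by auto
  note ab = mesh_node[OF mesh_t n, unfolded k]
  have left: "uh (t (?n - 1)) \<in> L2_space \<Omega>"
    using prev V_L2[OF V_h_V] by (auto simp: V_h_div_def)
  obtain c0 c1 where c: "c0 \<in> V_h \<Omega> M" "c1 \<in> V_h \<Omega> M"
    "\<And>s. t k \<le> s \<Longrightarrow> s \<le> t ?n \<Longrightarrow> ae_eq \<Omega> (uh s) (c0 + s *\<^sub>R c1)"
    using scheme_interval[OF mesh_t sol n left] unfolding k by blast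
  have h1: "c0 \<in> H_space 1 \<Omega>" "c1 \<in> H_space 1 \<Omega>" using c V_h_V V_H1 by blast+
  have af: "c0 + s *\<^sub>R c1 \<in> V_h \<Omega> M" for s
    using c by (intro subspace_add[OF subspace_V_h] subspace_scale[OF subspace_V_h])
  have uV: "uh s \<in> V_h \<Omega> M" if "t k \<le> s" "s \<le> t ?n" for s
    by (rule V_h_ae_closed[OF af ae_eq_sym[OF c(3)[OF that]]])
  have div_s: "L2_inner \<Omega> (div_v \<Omega> (uh s)) q = L2_inner \<Omega> (div_v \<Omega> c0) q + L2_inner \<Omega> (div_v \<Omega> c1) q * s"
    if "t k \<le> s" "s \<le> t ?n" "q \<in> Q_h \<Omega> M" for s q
    using div_form_cong[OF V_H1[OF V_h_V[OF uV[OF that(1,2)]]] c(3)[OF that(1,2)] Q_h_L2[OF that(3)]]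
      div_form_linear[OF h1 Q_h_L2[OF that(3)], of 1 s] by (simp add: mult.commute)
  have "L2_inner \<Omega> (div_v \<Omega> (uh (t ?n))) q = 0" if q: "q \<in> Q_h \<Omega> M" for q
  proof -
    let ?A = "L2_inner \<Omega> (div_v \<Omega> c0) q" and ?B = "L2_inner \<Omega> (div_v \<Omega> c1) q"
    have "(LINT s|lebesgue_on {t k<..t ?n}. - L2_inner \<Omega> (div_v \<Omega> (uh s)) q) = 0"
      using sol n q unfolding scheme_solution_def k[symmetric] by blast
    moreover have "(LINT s|lebesgue_on {t k<..t ?n}. - L2_inner \<Omega> (div_v \<Omega> (uh s)) q)
        = (t ?n - t k) * (- ?A + - ?B * ((t k + t ?n) / 2))"
      by (rule lebesgue_integral_affine[OF ab(1)]) (use div_s[OF _ _ q] in auto)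
    ultimately have "- ?A + - ?B * ((t k + t ?n) / 2) = 0" using ab(1) by simp
    moreover have "?A + ?B * t k = 0"
      using div_s[OF order_refl less_imp_le[OF ab(1)] q] prev q by (simp add: V_h_div_def)
    ultimately have "?A + ?B * t ?n = 0" by (simp add: field_simps)
    then show ?thesis using div_s[OF less_imp_le[OF ab(1)] order_refl q] by simp
  qed
  then show ?case using uV[OF less_imp_le[OF ab(1)] order_refl] by (auto simp: V_h_div_def)
qed

lemma V_h_div_V_h: "v \<in> V_h_div \<Omega> M \<Longrightarrow> v \<in> V_h \<Omega> M"
  by (simp add: V_h_div_def)

lemma V_h_div_H1: "v \<in> V_h_div \<Omega> M \<Longrightarrow> v \<in> H_space 1 \<Omega>"
  using V_h_div_V_h V_h_V V_H1 by blast

lemma V_h_div_L2: "v \<in> V_h_div \<Omega> M \<Longrightarrow> v \<in> L2_space \<Omega>"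
  using V_h_div_H1 H_L2 by blast

theorem crank_nicolson_nodal:
  assumes mesh_t: "time_mesh T N t" and sol: "scheme_solution \<Omega> M T N t f u0h uh ph"
    and u0h: "u0h \<in> V_h_div \<Omega> M" and n: "n \<in> {1..N}"
    and f: "\<And>s. s \<in> {0..T} \<Longrightarrow> f s \<in> L2_space \<Omega>"
  defines "D \<equiv> (1 / time_step t n) *\<^sub>R (uh (t n) - uh (t (n - 1)))"
  shows "\<And>s. t (n - 1) \<le> s \<Longrightarrow> s \<le> t n \<Longrightarrow> ae_eq \<Omega> (uh s) (uh (t (n - 1)) + (s - t (n - 1)) *\<^sub>R D)"
    and "v \<in> V_h_div \<Omega> M \<Longrightarrow> L2_inner \<Omega> D v
       + L2_inner \<Omega> (grad_v \<Omega> ((1 / 2) *\<^sub>R (uh (t n) + uh (t (n - 1))))) (grad_v \<Omega> v)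
       = (L2_inner \<Omega> (f (t (n - 1))) v + L2_inner \<Omega> (f (t n)) v) / 2"
proof -
  let ?a = "t (n - 1)" and ?b = "t n"
  note ab = mesh_node[OF mesh_t n]
  have Ua: "uh ?a \<in> V_h_div \<Omega> M" and Ub: "uh ?b \<in> V_h_div \<Omega> M"
    using scheme_nodes[OF mesh_t sol u0h] n by auto
  obtain c0 c1 where c: "c0 \<in> V_h \<Omega> M" "c1 \<in> V_h \<Omega> M"
    "\<And>s. ?a \<le> s \<Longrightarrow> s \<le> ?b \<Longrightarrow> ae_eq \<Omega> (uh s) (c0 + s *\<^sub>R c1)"
    using scheme_interval[OF mesh_t sol n V_h_div_L2[OF Ua]] by blast
  have h1: "c0 \<in> H_space 1 \<Omega>" "c1 \<in> H_space 1 \<Omega>" using c V_h_V V_H1 by blast+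
  have L: "c0 \<in> L2_space \<Omega>" "c1 \<in> L2_space \<Omega>" using h1 H_L2 by blast+
  have ea: "ae_eq \<Omega> (uh ?a) (c0 + ?a *\<^sub>R c1)" and eb: "ae_eq \<Omega> (uh ?b) (c0 + ?b *\<^sub>R c1)"
    using c(3) ab(1) by auto
  have step: "time_step t n = ?b - ?a" by (simp add: time_step_def)
  have D: "ae_eq \<Omega> D c1"
    using ea eb unfolding ae_eq_def
  proof eventually_elim
    case (elim x)
    have "uh ?b x - uh ?a x = (?b - ?a) *\<^sub>R c1 x" using elim by (simp add: scaleR_left_diff_distrib)
    then show ?case using ab(1) by (simp add: D_def step)
  qed
  show "ae_eq \<Omega> (uh s) (uh ?a + (s - ?a) *\<^sub>R D)" if "?a \<le> s" "s \<le> ?b" for s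
    using c(3)[OF that] ea D unfolding ae_eq_def
    by eventually_elim (simp add: scaleR_left_diff_distrib)
  assume v: "v \<in> V_h_div \<Omega> M"
  have vV: "v \<in> V_h \<Omega> M" and v1: "v \<in> H_space 1 \<Omega>" and vL: "v \<in> L2_space \<Omega>"
    using v V_h_div_V_h V_h_div_H1 V_h_div_L2 by auto
  have "P_time 1 \<Omega> {?a<..?b} (Q_h \<Omega> M) ph" using sol n unfolding scheme_solution_def by blast
  then obtain d0 d1 where d: "d0 \<in> Q_h \<Omega> M" "d1 \<in> Q_h \<Omega> M"
    "\<And>s. s \<in> {?a<..?b} \<Longrightarrow> ae_eq \<Omega> (ph s) (d0 + s *\<^sub>R d1)" by (rule P_time_1D) (rule that)
  have p0: "L2_inner \<Omega> (div_v \<Omega> v) (ph s) = 0" if s: "s \<in> {?a<..?b}" for s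
  proof -
    have af: "d0 + s *\<^sub>R d1 \<in> Q_h \<Omega> M"
      using d by (intro subspace_add[OF subspace_Q_h] subspace_scale[OF subspace_Q_h])
    have "L2_inner \<Omega> (div_v \<Omega> v) (ph s) = L2_inner \<Omega> (div_v \<Omega> v) (d0 + s *\<^sub>R d1)"
      by (rule L2_inner_cong[OF ae_eq_refl d(3)[OF s] div_L2[OF v1] div_L2[OF v1]
            L2_ae_closed[OF Q_h_L2[OF af] ae_eq_sym[OF d(3)[OF s]]] Q_h_L2[OF af]])
    also have "\<dots> = 0" using v af by (simp add: V_h_div_def)
    finally show ?thesis .
  qed
  let ?G = "\<lambda>w. L2_inner \<Omega> (grad_v \<Omega> w) (grad_v \<Omega> v)"
  have gs: "?G (uh s) = ?G c0 + ?G c1 * s" if "?a \<le> s" "s \<le> ?b" for s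
  proof -
    have "?G (uh s) = ?G (c0 + s *\<^sub>R c1)"
      using grad_inner_cong[OF _ ae_eq_sym[OF c(3)[OF that]] v1] h1 by (simp add: H.X_closed)
    then show ?thesis using A.ip_add_left[OF h1(1) _ v1, of "s *\<^sub>R c1"] A.ip_scaleR_left[OF h1(2) v1] h1
      by (simp add: H.X_closed mult.commute)
  qed
  have ds: "L2_inner \<Omega> (dt \<Omega> {0..T} uh s) v = L2_inner \<Omega> c1 v" if s: "?a < s" "s < ?b" for s
  proof -
    have sub: "{?a<..<?b} \<subseteq> {0..T}" using ab by auto
    have w: "ae_eq \<Omega> (uh s) (c0 + s *\<^sub>R c1)" if "?a < s" "s < ?b" for s using c(3) that by auto
    show ?thesis
      by (rule L2_inner_cong[OF dt_affine(2)[OF L s sub w] ae_eq_refl dt_affine(1)[OF L s sub w] L(2) vL vL])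
  qed
  have "(LINT s|lebesgue_on {?a<..?b}.
              L2_inner \<Omega> (dt \<Omega> {0..T} uh s) v + L2_inner \<Omega> (grad_v \<Omega> (uh s)) (grad_v \<Omega> v)
              - L2_inner \<Omega> (div_v \<Omega> v) (ph s))
      = (?b - ?a) * (L2_inner \<Omega> c1 v + ?G c0 + ?G c1 * ((?a + ?b) / 2))"
    by (rule lebesgue_integral_affine[OF ab(1)]) (use ds gs p0 in auto)
  moreover have "(LINT s|lebesgue_on {?a<..?b}.
              L2_inner \<Omega> (dt \<Omega> {0..T} uh s) v + L2_inner \<Omega> (grad_v \<Omega> (uh s)) (grad_v \<Omega> v)
              - L2_inner \<Omega> (div_v \<Omega> v) (ph s))
      = time_step t n / 2 * L2_inner \<Omega> (f ?a + f ?b) v"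
    using sol n vV unfolding scheme_solution_def plus_fun_def by blast
  moreover have "L2_inner \<Omega> (f ?a + f ?b) v = L2_inner \<Omega> (f ?a) v + L2_inner \<Omega> (f ?b) v"
    using f ab vL by (intro L2.ip_add_left) auto
  ultimately have "(?b - ?a) * (L2_inner \<Omega> c1 v + ?G c0 + ?G c1 * ((?a + ?b) / 2))
      = (?b - ?a) * ((L2_inner \<Omega> (f ?a) v + L2_inner \<Omega> (f ?b) v) / 2)"
    by (simp add: step)
  then have main: "L2_inner \<Omega> c1 v + ?G c0 + ?G c1 * ((?a + ?b) / 2) = (L2_inner \<Omega> (f ?a) v + L2_inner \<Omega> (f ?b) v) / 2"
    by (rule mult_left_cancel[THEN iffD1, rotated]) (use ab(1) in simp)
  have Dv: "L2_inner \<Omega> D v = L2_inner \<Omega> c1 v"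
    using V_h_div_L2[OF Ua] V_h_div_L2[OF Ub] vL L(2)
    by (intro L2_inner_cong[OF D]) (auto simp: D_def intro!: L2.X_closed)
  have "?G ((1 / 2) *\<^sub>R (uh ?b + uh ?a)) = (?G (uh ?b) + ?G (uh ?a)) / 2"
    using V_h_div_H1[OF Ua] V_h_div_H1[OF Ub] v1 by (simp add: A.ip_scaleR_left A.ip_add_left H.X_closed)
  also have "\<dots> = ?G c0 + ?G c1 * ((?a + ?b) / 2)"
    using gs[of ?a] gs[of ?b] ab(1) by (simp add: field_simps)
  finally show "L2_inner \<Omega> D v + ?G ((1 / 2) *\<^sub>R (uh ?b + uh ?a)) = (L2_inner \<Omega> (f ?a) v + L2_inner \<Omega> (f ?b) v) / 2"
    using main Dv by simp
qed

end

section \<open>Regular solutions\<close>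

lemma deriv_in_mono:
  assumes X: "subspace X" and w: "\<And>s. s \<in> S \<Longrightarrow> w s \<in> X" "\<And>s. s \<in> S \<Longrightarrow> w' s \<in> X"
    and \<nu>: "\<And>f. f \<in> X \<Longrightarrow> 0 \<le> \<nu> f" "\<And>f. f \<in> X \<Longrightarrow> \<nu> f \<le> \<mu> f" and d: "deriv_in \<mu> S w w'"
  shows "deriv_in \<nu> S w w'"
  unfolding deriv_in_def
proof
  fix t assume t: "t \<in> S"
  show "((\<lambda>s. \<nu> ((w s - w t) /\<^sub>R (s - t) - w' t)) \<longlongrightarrow> 0) (at t within S)"
  proof (rule Lim_null_comparison)
    show "((\<lambda>s. \<mu> ((w s - w t) /\<^sub>R (s - t) - w' t)) \<longlongrightarrow> 0) (at t within S)"
      using d t by (simp add: deriv_in_def)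
    show "\<forall>\<^sub>F s in at t within S. norm (\<nu> ((w s - w t) /\<^sub>R (s - t) - w' t)) \<le> \<mu> ((w s - w t) /\<^sub>R (s - t) - w' t)"
      unfolding eventually_at_filter
    proof (rule always_eventually, intro allI impI)
      fix s assume s: "s \<in> S"
      have "(w s - w t) /\<^sub>R (s - t) - w' t \<in> X"
        by (intro subspace_diff[OF X] subspace_scale[OF X] w s t)
      then show "norm (\<nu> ((w s - w t) /\<^sub>R (s - t) - w' t)) \<le> \<mu> ((w s - w t) /\<^sub>R (s - t) - w' t)"
        using \<nu> by simp
    qed
  qed
qed

context bounded_domain
begin

definition regular_seq :: "nat \<Rightarrow> real \<Rightarrow> (nat \<Rightarrow> real \<Rightarrow> real^'d \<Rightarrow> 'b::euclidean_space) \<Rightarrow> bool" where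
  "regular_seq k T W \<longleftrightarrow>
     (\<forall>j\<le>k. \<forall>t\<in>{0..T}. W j t \<in> H_space k \<Omega> \<and>
        ((\<lambda>s. H_norm k \<Omega> (W j s - W j t)) \<longlongrightarrow> 0) (at t within {0..T})) \<and>
     (\<forall>j<k. deriv_in (H_norm k \<Omega>) {0..T} (W j) (W (Suc j)))"

text \<open>
  The sequence of derivatives may be chosen to start with the function itself on the whole real line,
  since the conditions only concern times in the closed interval.
\<close>

lemma Ck_time_regular_seq:
  assumes "Ck_time k k \<Omega> {0..T} w"
  obtains W where "W 0 = w" "regular_seq k T W"
proof -
  obtain W where W: "\<forall>t\<in>{0..T}. W 0 t = w t"
     "\<forall>j\<le>k. \<forall>t\<in>{0..T}. W j t \<in> H_space k \<Omega> \<and>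
        ((\<lambda>s. H_norm k \<Omega> (\<lambda>x. W j s x - W j t x)) \<longlongrightarrow> 0) (at t within {0..T})"
     "\<forall>j<k. \<forall>t\<in>{0..T}.
        ((\<lambda>s. H_norm k \<Omega> (\<lambda>x. (W j s x - W j t x) /\<^sub>R (s - t) - W (Suc j) t x)) \<longlongrightarrow> 0)
          (at t within {0..T})"
    using assms unfolding Ck_time_def by (elim exE conjE)
  \<comment> \<open>W 0 agrees with w on the interval only; outside it may be arbitrary.\<close>
  define W' where "W' j t = (if j = 0 then w t else W j t)" for j t
  have eq: "W' j t = W j t" if "t \<in> {0..T}" for j t using W(1) that by (auto simp: W'_def)
  have ev: "\<forall>\<^sub>F s in at t within {0..T}. s \<in> {0..T}" for t
    by (simp add: eventually_at_filter)
  show ?thesis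
  proof (rule that[of W'])
    show "W' 0 = w" by (simp add: W'_def fun_eq_iff)
    show "regular_seq k T W'"
      unfolding regular_seq_def deriv_in_def
    proof (intro conjI allI impI ballI)
      fix j t assume j: "j \<le> k" and t: "t \<in> {0..T}"
      show "W' j t \<in> H_space k \<Omega>" using W(2) j t by (simp add: eq)
      have "((\<lambda>s. H_norm k \<Omega> (W j s - W j t)) \<longlongrightarrow> 0) (at t within {0..T})"
        using W(2) j t by (simp add: fun_diff_def)
      then show "((\<lambda>s. H_norm k \<Omega> (W' j s - W' j t)) \<longlongrightarrow> 0) (at t within {0..T})"
        by (rule Lim_transform_eventually) (use ev[of t] in \<open>rule eventually_mono, simp only: eq t\<close>)
    next
      fix j t assume j: "j < k" and t: "t \<in> {0..T}"
      have "((\<lambda>s. H_norm k \<Omega> (\<lambda>x. (W j s x - W j t x) /\<^sub>R (s - t) - W (Suc j) t x)) \<longlongrightarrow> 0) (at t within {0..T})"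
        using W(3) j t by blast
      then have "((\<lambda>s. H_norm k \<Omega> ((W j s - W j t) /\<^sub>R (s - t) - W (Suc j) t)) \<longlongrightarrow> 0) (at t within {0..T})"
        by (subst (asm) fun_quotient_eq)
      then show "((\<lambda>s. H_norm k \<Omega> ((W' j s - W' j t) /\<^sub>R (s - t) - W' (Suc j) t)) \<longlongrightarrow> 0) (at t within {0..T})"
        by (rule Lim_transform_eventually) (use ev[of t] in \<open>rule eventually_mono, simp only: eq t\<close>)
    qed
  qed
qed

lemma regular_H: "regular_seq k T W \<Longrightarrow> j \<le> k \<Longrightarrow> t \<in> {0..T} \<Longrightarrow> W j t \<in> H_space k \<Omega>"
  by (simp add: regular_seq_def)

lemma regular_Hm: "regular_seq k T W \<Longrightarrow> j \<le> k \<Longrightarrow> t \<in> {0..T} \<Longrightarrow> m \<le> k \<Longrightarrow> W j t \<in> H_space m \<Omega>"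
  using regular_H H_space_mono by blast

lemma regular_L2: "regular_seq k T W \<Longrightarrow> j \<le> k \<Longrightarrow> t \<in> {0..T} \<Longrightarrow> W j t \<in> L2_space \<Omega>"
  using regular_H H_L2 by blast

lemma regular_deriv: "regular_seq k T W \<Longrightarrow> j < k \<Longrightarrow> deriv_in (H_norm k \<Omega>) {0..T} (W j) (W (Suc j))"
  by (simp add: regular_seq_def)

lemma regular_tendsto:
  assumes "regular_seq k T W" "j \<le> k" "t \<in> {0..T}"
  shows "((\<lambda>s. H_norm k \<Omega> (W j s - W j t)) \<longlongrightarrow> 0) (at t within {0..T})"
  using assms by (simp add: regular_seq_def)

lemma regular_deriv_mono:
  assumes W: "regular_seq k T W" "j < k"
    and \<nu>: "\<And>f. f \<in> H_space k \<Omega> \<Longrightarrow> 0 \<le> \<nu> f" "\<And>f. f \<in> H_space k \<Omega> \<Longrightarrow> \<nu> f \<le> H_norm k \<Omega> f"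
  shows "deriv_in \<nu> {0..T} (W j) (W (Suc j))"
  by (rule deriv_in_mono[OF subspace_H _ _ \<nu> regular_deriv[OF W]]) (use regular_H[OF W(1)] W(2) in auto)

lemma regular_tendsto_mono:
  assumes W: "regular_seq k T W" "j \<le> k" and t: "t \<in> {0..T}"
    and \<nu>: "\<And>f. f \<in> H_space k \<Omega> \<Longrightarrow> 0 \<le> \<nu> f" "\<And>f. f \<in> H_space k \<Omega> \<Longrightarrow> \<nu> f \<le> H_norm k \<Omega> f"
  shows "((\<lambda>s. \<nu> (W j s - W j t)) \<longlongrightarrow> 0) (at t within {0..T})"
proof (rule Lim_null_comparison[OF _ regular_tendsto[OF W t]])
  show "\<forall>\<^sub>F s in at t within {0..T}. norm (\<nu> (W j s - W j t)) \<le> H_norm k \<Omega> (W j s - W j t)"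
    unfolding eventually_at_filter
  proof (rule always_eventually, intro allI impI)
    fix s assume "s \<in> {0..T}"
    then have "W j s - W j t \<in> H_space k \<Omega>" using regular_H[OF W] t by (intro H.X_closed) auto
    then show "norm (\<nu> (W j s - W j t)) \<le> H_norm k \<Omega> (W j s - W j t)" using \<nu> by simp
  qed
qed

lemma L2_norm_mono_facts:
  "f \<in> H_space k \<Omega> \<Longrightarrow> 0 \<le> L2_norm \<Omega> f" "f \<in> H_space k \<Omega> \<Longrightarrow> L2_norm \<Omega> f \<le> H_norm k \<Omega> f"
  using H_L2 L2.nrm_nonneg L2_norm_le_H_norm by blast+

lemma grad_norm_mono_facts:
  assumes f: "f \<in> H_space k \<Omega>" and k: "1 \<le> k"
  shows "0 \<le> L2_norm \<Omega> (grad_v \<Omega> f)" "L2_norm \<Omega> (grad_v \<Omega> f) \<le> H_norm k \<Omega> f"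
  using A.nrm_nonneg[OF H_space_mono[OF f k]] grad_norm_le_H1[OF H_space_mono[OF f k]] H_norm_mono[OF k, of f] by auto

lemma regular_bounded:
  assumes W: "regular_seq k T W"
  shows "\<exists>K\<ge>0. \<forall>j\<le>k. \<forall>t\<in>{0..T}. H_norm k \<Omega> (W j t) \<le> K"
proof -
  have "\<exists>K. \<forall>t\<in>{0..T}. H_norm k \<Omega> (W j t) \<le> K" if "j \<le> k" for j
    by (rule H.continuous_imp_bounded[OF regular_H[OF W that] regular_tendsto[OF W that]])
  then obtain K where K: "\<And>j t. j \<le> k \<Longrightarrow> t \<in> {0..T} \<Longrightarrow> H_norm k \<Omega> (W j t) \<le> K j" by metis
  have "H_norm k \<Omega> (W j t) \<le> (\<Sum>j\<le>k. \<bar>K j\<bar>)" if "j \<le> k" "t \<in> {0..T}" for j t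
  proof -
    have "K j \<le> \<bar>K j\<bar>" by simp
    also have "\<dots> \<le> (\<Sum>j\<le>k. \<bar>K j\<bar>)" by (rule member_le_sum) (use that in auto)
    finally show ?thesis using K[OF that] by simp
  qed
  then show ?thesis by (intro exI[of _ "\<Sum>j\<le>k. \<bar>K j\<bar>"]) (auto intro: sum_nonneg)
qed

lemma regular_dt:
  assumes W: "regular_seq k T W" and k: "1 \<le> k" and t: "t \<in> {0..T}" and T: "0 < T"
  shows "dt \<Omega> {0..T} (W 0) t \<in> L2_space \<Omega>" "ae_eq \<Omega> (dt \<Omega> {0..T} (W 0) t) (W 1 t)"
proof -
  have nt: "at t within {0..T} \<noteq> bot" using t T by (simp add: trivial_limit_within islimpt_Icc)
  have ev: "\<forall>\<^sub>F s in at t within {0..T}. W 0 s \<in> L2_space \<Omega>"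
    using regular_L2[OF W] by (simp add: eventually_at_filter)
  have "deriv_in (L2_norm \<Omega>) {0..T} (W 0) (W (Suc 0))"
    by (rule regular_deriv_mono[OF W _ L2_norm_mono_facts]) (use k in auto)
  then have lim: "((\<lambda>s. L2_norm \<Omega> ((W 0 s - W 0 t) /\<^sub>R (s - t) - W 1 t)) \<longlongrightarrow> 0) (at t within {0..T})"
    using t by (simp add: deriv_in_def)
  show "dt \<Omega> {0..T} (W 0) t \<in> L2_space \<Omega>" "ae_eq \<Omega> (dt \<Omega> {0..T} (W 0) t) (W 1 t)"
    by (rule dt_eq[OF regular_L2[OF W k t] nt ev regular_L2[OF W _ t] lim]; simp)+
qed

text \<open>
  For positive times the strong equation is multiplied by \<open>v\<close> and integrated by parts. Every term is
  continuous in time, which extends the identity to \<open>t = 0\<close>, where the first step of the scheme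
  evaluates \<open>f\<close>.
\<close>

theorem weak_formulation:
  assumes W: "regular_seq k T W" and P: "regular_seq k T P" and k: "2 \<le> k" and T: "0 < T"
    and f: "regular_seq 0 T F" and sol: "stokes_solution \<Omega> T (F 0) u0 (W 0) (P 0)"
    and t: "t \<in> {0..T}" and v: "v \<in> V_space \<Omega>"
  shows "L2_inner \<Omega> (W 1 t) v + L2_inner \<Omega> (grad_v \<Omega> (W 0 t)) (grad_v \<Omega> v) - L2_inner \<Omega> (div_v \<Omega> v) (P 0 t)
       = L2_inner \<Omega> (F 0 t) v"
proof -
  have v1: "v \<in> H_space 1 \<Omega>" and vL: "v \<in> L2_space \<Omega>" using v V_H1 V_L2 by auto
  define R where "R s = L2_inner \<Omega> (W 1 s) v + L2_inner \<Omega> (grad_v \<Omega> (W 0 s)) (grad_v \<Omega> v)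
     - L2_inner \<Omega> (P 0 s) (div_v \<Omega> v) - L2_inner \<Omega> (F 0 s) v" for s
  have comm: "L2_inner \<Omega> (P 0 s) (div_v \<Omega> v) = L2_inner \<Omega> (div_v \<Omega> v) (P 0 s)" if "s \<in> {0..T}" for s
    using regular_L2[OF P _ that] div_L2[OF v1] by (intro L2.ip_commute) auto
  have pos: "R s = 0" if s: "s \<in> {0<..T}" for s
  proof -
    have s': "s \<in> {0..T}" using s by auto
    have dtL: "dt \<Omega> {0..T} (W 0) s \<in> L2_space \<Omega>" "ae_eq \<Omega> (dt \<Omega> {0..T} (W 0) s) (W 1 s)"
      using regular_dt[OF W _ s' T] k by auto
    have u2: "W 0 s \<in> H_space 2 \<Omega>" by (rule regular_Hm[OF W _ s' k]) simp
    have p1: "P 0 s \<in> H_space 1 \<Omega>" by (rule regular_Hm[OF P _ s']) (use k in auto)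
    note lap = laplace_weak[OF u2 v] and pg = pressure_gradient_weak[OF p1 v]
    have w1: "W 1 s \<in> L2_space \<Omega>" by (rule regular_L2[OF W _ s']) (use k in auto)
    have fL: "F 0 s \<in> L2_space \<Omega>" by (rule regular_L2[OF f _ s']) simp
    let ?S = "W 1 s - laplace_v \<Omega> (W 0 s) + grad_s \<Omega> (P 0 s)"
    have "ae_eq \<Omega> (\<lambda>x. dt \<Omega> {0..T} (W 0) s x - laplace_v \<Omega> (W 0 s) x + grad_s \<Omega> (P 0 s) x) (F 0 s)"
      using sol s unfolding stokes_solution_def by blast
    with dtL(2) have "ae_eq \<Omega> ?S (F 0 s)" unfolding ae_eq_def by eventually_elim simp
    then have "L2_inner \<Omega> ?S v = L2_inner \<Omega> (F 0 s) v"
      using w1 lap(1) pg(1) fL vL by (intro L2_inner_cong) (auto intro!: L2.X_closed)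
    moreover have "L2_inner \<Omega> ?S v = L2_inner \<Omega> (W 1 s) v - L2_inner \<Omega> (laplace_v \<Omega> (W 0 s)) v + L2_inner \<Omega> (grad_s \<Omega> (P 0 s)) v"
      using w1 lap(1) pg(1) vL by (simp add: L2.ip_add_left L2.ip_diff_left L2.X_closed)
    ultimately show ?thesis using lap(2) pg(2) comm[OF s'] by (simp add: R_def)
  qed
  have zero: "R 0 = 0"
  proof -
    have 0: "0 \<in> {0..T}" using T by simp
    have nt: "at 0 within {0..T} \<noteq> bot" using T by (simp add: trivial_limit_within islimpt_Icc)
    have L1: "((\<lambda>s. L2_inner \<Omega> (W 1 s) v) \<longlongrightarrow> L2_inner \<Omega> (W 1 0) v) (at 0 within {0..T})"
      by (rule L2.ip_tendsto[OF _ _ vL regular_tendsto_mono[OF W _ 0 L2_norm_mono_facts]])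
         (use regular_L2[OF W] k T in auto)
    have L2: "((\<lambda>s. L2_inner \<Omega> (grad_v \<Omega> (W 0 s)) (grad_v \<Omega> v)) \<longlongrightarrow> L2_inner \<Omega> (grad_v \<Omega> (W 0 0)) (grad_v \<Omega> v)) (at 0 within {0..T})"
      by (rule A.ip_tendsto[OF _ _ v1 regular_tendsto_mono[OF W _ 0 grad_norm_mono_facts]])
         (use regular_Hm[OF W, of 0 _ 1] k T in auto)
    have L3: "((\<lambda>s. L2_inner \<Omega> (P 0 s) (div_v \<Omega> v)) \<longlongrightarrow> L2_inner \<Omega> (P 0 0) (div_v \<Omega> v)) (at 0 within {0..T})"
      by (rule L2.ip_tendsto[OF _ _ div_L2[OF v1] regular_tendsto_mono[OF P _ 0 L2_norm_mono_facts]])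
         (use regular_L2[OF P] T in auto)
    have L4: "((\<lambda>s. L2_inner \<Omega> (F 0 s) v) \<longlongrightarrow> L2_inner \<Omega> (F 0 0) v) (at 0 within {0..T})"
      by (rule L2.ip_tendsto[OF _ _ vL regular_tendsto_mono[OF f _ 0 L2_norm_mono_facts]])
         (use regular_L2[OF f] T in auto)
    have "(R \<longlongrightarrow> R 0) (at 0 within {0..T})"
      unfolding R_def[abs_def] by (intro tendsto_diff tendsto_add L1 L2 L3 L4)
    moreover have "(R \<longlongrightarrow> 0) (at 0 within {0..T})"
      by (rule tendsto_eventually) (use pos in \<open>auto simp: eventually_at_filter\<close>)
    ultimately show ?thesis by (rule tendsto_unique[OF nt])
  qed
  have "R t = 0" using pos[of t] zero t by (cases "t = 0") auto
  then show ?thesis using comm[OF t] by (simp add: R_def)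
qed

end

section \<open>The error estimate\<close>

lemma sum_square_le: "(x + y)\<^sup>2 \<le> 2 * x\<^sup>2 + 2 * (y::real)\<^sup>2"
  using sum_squares_bound[of x y] by (simp add: power2_sum)

lemma square_le_if_le_sum:
  fixes z x y :: real
  assumes "0 \<le> z" "z \<le> x + y"
  shows "z\<^sup>2 \<le> 2 * x\<^sup>2 + 2 * y\<^sup>2"
  using power_mono[OF assms(2,1), of 2] sum_square_le[of x y] by linarith

text \<open>
  \<open>u\<close> and \<open>p\<close> are the sequences of time derivatives of the exact solution, starting with order zero. \<open>Ca\<close> is the constant of the
  approximation property for the \<open>H\<^sup>1\<close> norm and \<open>K\<close> bounds all Sobolev norms of the solution; neither depends on the mesh.
\<close>

locale regular_approximation = fe_space \<Omega> M l \<beta>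
  for \<Omega> :: "(real^'d) set" and M :: "'d fe_mesh" and l :: nat and \<beta> :: real +
  fixes r k :: nat and T Ca K :: real and u :: "nat \<Rightarrow> real \<Rightarrow> real^'d \<Rightarrow> real^'d"
    and p :: "nat \<Rightarrow> real \<Rightarrow> real^'d \<Rightarrow> real" and f :: "real \<Rightarrow> real^'d \<Rightarrow> real^'d"
  assumes T: "0 < T" and k: "r + 3 \<le> k" and Ca: "0 \<le> Ca" and K: "0 \<le> K"
    and u: "regular_seq k T u" and p: "regular_seq k T p"
    and uK: "\<And>j s. j \<le> k \<Longrightarrow> s \<in> {0..T} \<Longrightarrow> H_norm k \<Omega> (u j s) \<le> K"
    and pK: "\<And>j s. j \<le> k \<Longrightarrow> s \<in> {0..T} \<Longrightarrow> H_norm k \<Omega> (p j s) \<le> K"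
    and u_div: "\<And>s. s \<in> {0..T} \<Longrightarrow> u 0 s \<in> V_div \<Omega>" and p_Q: "\<And>s. s \<in> {0..T} \<Longrightarrow> p 0 s \<in> Q_space \<Omega>"
    and f_L2: "\<And>s. s \<in> {0..T} \<Longrightarrow> f s \<in> L2_space \<Omega>"
    and weak: "\<And>s v. s \<in> {0..T} \<Longrightarrow> v \<in> V_space \<Omega> \<Longrightarrow>
       L2_inner \<Omega> (u 1 s) v + L2_inner \<Omega> (grad_v \<Omega> (u 0 s)) (grad_v \<Omega> v) - L2_inner \<Omega> (div_v \<Omega> v) (p 0 s)
       = L2_inner \<Omega> (f s) v"
    and approx_V: "\<And>v. v \<in> V_space \<Omega> \<Longrightarrow> v \<in> H_space (r + 1) \<Omega> \<Longrightarrow>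
       \<exists>w\<in>V_h \<Omega> M. H_norm 1 \<Omega> (v - w) \<le> Ca * mesh_size M ^ r * H_norm (r + 1) \<Omega> v"
    and approx_Q: "\<And>q. q \<in> Q_space \<Omega> \<Longrightarrow> q \<in> H_space r \<Omega> \<Longrightarrow>
       \<exists>s\<in>Q_h \<Omega> M. L2_norm \<Omega> (q - s) \<le> Ca * mesh_size M ^ r * H_norm r \<Omega> q"
begin

abbreviation "h \<equiv> mesh_size M"

text \<open>
  The constant of the projection error, from the estimate in terms of the approximation errors of velocity
  and pressure.
\<close>

definition "cR = (2 * (1 + real CARD('d) / \<beta>) + real CARD('d)) * Ca"

lemma cR_nonneg: "0 \<le> cR"
  using Ca \<beta>_pos by (simp add: cR_def)

lemma ritz_approximation:
  assumes R: "DS.ritz v q R" and v: "v \<in> V_div \<Omega>" "v \<in> H_space (r + 1) \<Omega>" and q: "q \<in> Q_space \<Omega>" "q \<in> H_space r \<Omega>"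
    and bd: "H_norm (r + 1) \<Omega> v \<le> B" "H_norm r \<Omega> q \<le> B"
  shows "H_norm 1 \<Omega> (v - R) \<le> cR * h ^ r * B"
proof -
  have vV: "v \<in> V_space \<Omega>" using v by (simp add: V_div_def)
  obtain w where w: "w \<in> V_h \<Omega> M" "H_norm 1 \<Omega> (v - w) \<le> Ca * h ^ r * H_norm (r + 1) \<Omega> v"
    using approx_V[OF vV v(2)] by blast
  obtain s where s: "s \<in> Q_h \<Omega> M" "L2_norm \<Omega> (q - s) \<le> Ca * h ^ r * H_norm r \<Omega> q"
    using approx_Q[OF q] by blast
  have h0: "0 \<le> Ca * h ^ r" using Ca mesh_size_bounds(1) by simp
  have w': "H_norm 1 \<Omega> (v - w) \<le> Ca * h ^ r * B" using w(2) mult_left_mono[OF bd(1) h0] by linarith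
  have s': "L2_norm \<Omega> (q - s) \<le> Ca * h ^ r * B" using s(2) mult_left_mono[OF bd(2) h0] by linarith
  have "H_norm 1 \<Omega> (v - R) \<le> 2 * (1 + real CARD('d) / \<beta>) * H_norm 1 \<Omega> (v - w) + real CARD('d) * L2_norm \<Omega> (q - s)"
    by (rule DS.ritz_error[OF R vV _ Q_L2[OF q(1)] w(1) s(1)])
       (use v(1) in \<open>auto simp: V_div_def Q_h_def\<close>)
  also have "\<dots> \<le> 2 * (1 + real CARD('d) / \<beta>) * (Ca * h ^ r * B) + real CARD('d) * (Ca * h ^ r * B)"
    using w' s' \<beta>_pos by (intro add_mono mult_left_mono) auto
  also have "\<dots> = cR * h ^ r * B" by (simp add: cR_def algebra_simps)
  finally show ?thesis .
qed

end

locale discrete_evolution = regular_approximation +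
  fixes N :: nat and t :: "nat \<Rightarrow> real" and u0h uh ph
  assumes mesh_t: "time_mesh T N t" and u0h: "u0h \<in> V_h_div \<Omega> M"
    and sol: "scheme_solution \<Omega> M T N t f u0h uh ph"
begin

abbreviation "\<tau> \<equiv> max_step N t"

definition R :: "nat \<Rightarrow> real^'a \<Rightarrow> real^'a" where
  "R n = (SOME w. DS.ritz (u 0 (t n)) (p 0 (t n)) w)"

lemma node: "n \<le> N \<Longrightarrow> t n \<in> {0..T}"
  using mesh_mono[OF mesh_t, of 0 n] mesh_mono[OF mesh_t, of n N] mesh_t by (auto simp: time_mesh_def)

lemma u_node:
  assumes "s \<in> {0..T}"
  shows "u 0 s \<in> V_space \<Omega>" "u 0 s \<in> H_space (r + 1) \<Omega>" "p 0 s \<in> L2_space \<Omega>" "p 0 s \<in> H_space r \<Omega>"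
    "j \<le> 3 \<Longrightarrow> u j s \<in> H_space 1 \<Omega>" "j \<le> 3 \<Longrightarrow> u j s \<in> L2_space \<Omega>"
    "j \<le> 3 \<Longrightarrow> u j s \<in> H_space (r + 1) \<Omega>" "j \<le> 3 \<Longrightarrow> p j s \<in> H_space r \<Omega>"
    "j \<le> 3 \<Longrightarrow> L2_norm \<Omega> (u j s) \<le> K" "j \<le> 3 \<Longrightarrow> L2_norm \<Omega> (grad_v \<Omega> (u j s)) \<le> K"
    "j \<le> 3 \<Longrightarrow> H_norm (r + 1) \<Omega> (u j s) \<le> K" "j \<le> 3 \<Longrightarrow> H_norm r \<Omega> (p j s) \<le> K"
proof -
  show "u 0 s \<in> V_space \<Omega>" using u_div[OF assms] by (simp add: V_div_def)
  show "p 0 s \<in> L2_space \<Omega>" using p_Q[OF assms] by (rule Q_L2)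
  show "u 0 s \<in> H_space (r + 1) \<Omega>" "p 0 s \<in> H_space r \<Omega>"
    using regular_Hm[OF u _ assms] regular_Hm[OF p _ assms] k by auto
  assume j: "j \<le> 3"
  then have jk: "j \<le> k" using k by simp
  note uj = regular_H[OF u jk assms] and pj = regular_H[OF p jk assms]
  show "u j s \<in> H_space 1 \<Omega>" "u j s \<in> L2_space \<Omega>" "u j s \<in> H_space (r + 1) \<Omega>" "p j s \<in> H_space r \<Omega>"
    using H_space_mono[OF uj] H_space_mono[OF pj] H_L2[OF uj] k by auto
  show "L2_norm \<Omega> (u j s) \<le> K" using L2_norm_mono_facts(2)[OF uj] uK[OF jk assms] by linarith
  have k1: "1 \<le> k" "r + 1 \<le> k" "r \<le> k" using k by auto
  show "L2_norm \<Omega> (grad_v \<Omega> (u j s)) \<le> K" using grad_norm_mono_facts(2)[OF uj k1(1)] uK[OF jk assms] by linarith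
  show "H_norm (r + 1) \<Omega> (u j s) \<le> K" using H_norm_mono[OF k1(2), of "u j s"] uK[OF jk assms] by linarith
  show "H_norm r \<Omega> (p j s) \<le> K" using H_norm_mono[OF k1(3), of "p j s"] pK[OF jk assms] by linarith
qed

lemma R_ritz: "n \<le> N \<Longrightarrow> DS.ritz (u 0 (t n)) (p 0 (t n)) (R n)"
  unfolding R_def by (rule someI_ex[OF DS.ritz_exists[OF u_node(1)[OF node] u_node(3)[OF node]]])

lemma R_Zh: "n \<le> N \<Longrightarrow> R n \<in> V_h_div \<Omega> M"
  using R_ritz unfolding DS.ritz_def Zh_eq by blast

definition U :: "nat \<Rightarrow> real^'a \<Rightarrow> real^'a" where "U n = uh (t n)"
definition \<rho> :: "nat \<Rightarrow> real^'a \<Rightarrow> real^'a" where "\<rho> n = u 0 (t n) - R n"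
definition \<Theta> :: "nat \<Rightarrow> real^'a \<Rightarrow> real^'a" where "\<Theta> n = R n - U n"
definition B :: real where "B = 2 * cR * K"

lemma B_nonneg: "0 \<le> B" using cR_nonneg K by (simp add: B_def)

lemma U_Zh: "n \<le> N \<Longrightarrow> U n \<in> V_h_div \<Omega> M"
  unfolding U_def by (rule scheme_nodes[OF mesh_t sol u0h])

lemma \<Theta>_Zh: "n \<le> N \<Longrightarrow> \<Theta> n \<in> V_h_div \<Omega> M"
  unfolding \<Theta>_def Zh_eq[symmetric] using R_Zh U_Zh by (intro subspace_diff[OF DS.subspace_Zh]) (simp_all add: Zh_eq)

lemma H1_members: "n \<le> N \<Longrightarrow> R n \<in> H_space 1 \<Omega>" "n \<le> N \<Longrightarrow> U n \<in> H_space 1 \<Omega>"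
  "n \<le> N \<Longrightarrow> \<rho> n \<in> H_space 1 \<Omega>" "n \<le> N \<Longrightarrow> \<Theta> n \<in> H_space 1 \<Omega>"
  using V_h_div_H1[OF R_Zh] V_h_div_H1[OF U_Zh] V_h_div_H1[OF \<Theta>_Zh] u_node(5)[OF node, of _ 0]
  by (auto simp: \<rho>_def intro!: H.X_closed)

lemma h_power_nonneg: "0 \<le> h ^ r" using mesh_size_bounds(1) by simp

lemma \<rho>_bound: "n \<le> N \<Longrightarrow> H_norm 1 \<Omega> (\<rho> n) \<le> B * h ^ r"
proof -
  assume n: "n \<le> N"
  have "H_norm 1 \<Omega> (\<rho> n) \<le> cR * h ^ r * K"
    unfolding \<rho>_def
    by (rule ritz_approximation[OF R_ritz[OF n] u_div[OF node[OF n]] u_node(2)[OF node[OF n]] p_Q[OF node[OF n]]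
          u_node(4)[OF node[OF n]]])
       (use u_node(11,12)[OF node[OF n], of 0] in auto)
  moreover have "0 \<le> cR * h ^ r * K" using cR_nonneg K h_power_nonneg by simp
  moreover have "B * h ^ r = 2 * (cR * h ^ r * K)" by (simp add: B_def)
  ultimately show ?thesis by linarith
qed

text \<open>
  By linearity, the increment of \<open>R\<close> is the projection of the increment of the solution, whose norms
  are proportional to the time step.
\<close>

lemma \<rho>_diff_bound:
  assumes n: "n \<in> {1..N}"
  shows "H_norm 1 \<Omega> (\<rho> n - \<rho> (n - 1)) \<le> B * h ^ r * time_step t n"
proof -
  have nN: "n \<le> N" "n - 1 \<le> N" using n by auto
  note a = node[OF nN(2)] and b = node[OF nN(1)]
  note ab = mesh_node[OF mesh_t n]
  have sub: "{t (n - 1)..t n} \<subseteq> {0..T}" using ab by auto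
  have k1: "r + 1 \<le> k" "r \<le> k" "0 < k" using k by auto
  have du: "deriv_in (H_norm (r + 1) \<Omega>) {0..T} (u 0) (u (Suc 0))"
    by (rule regular_deriv_mono[OF u k1(3)])
       (use H.nrm_nonneg[OF H_space_mono[OF _ k1(1)]] H_norm_mono[OF k1(1)] in auto)
  have dp: "deriv_in (H_norm r \<Omega>) {0..T} (p 0) (p (Suc 0))"
    by (rule regular_deriv_mono[OF p k1(3)])
       (use H.nrm_nonneg[OF H_space_mono[OF _ k1(2)]] H_norm_mono[OF k1(2)] in auto)
  have bu: "H_norm (r + 1) \<Omega> (u 0 (t n) - u 0 (t (n - 1))) \<le> K * (t n - t (n - 1))"
    by (rule H.increment_bound[OF _ _ H.deriv_in_subset[OF du sub]])
       (use sub u_node(7,11) ab(1) in auto)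
  have bp: "H_norm r \<Omega> (p 0 (t n) - p 0 (t (n - 1))) \<le> K * (t n - t (n - 1))"
    by (rule H.increment_bound[OF _ _ H.deriv_in_subset[OF dp sub]])
       (use sub u_node(8,12) ab(1) in auto)
  have st: "t n - t (n - 1) = time_step t n" by (simp add: time_step_def)
  have ritz: "DS.ritz (u 0 (t n) - u 0 (t (n - 1))) (p 0 (t n) - p 0 (t (n - 1))) (R n - R (n - 1))"
    by (rule DS.ritz_diff[OF R_ritz[OF nN(1)] R_ritz[OF nN(2)] u_node(1)[OF b] u_node(1)[OF a] u_node(3)[OF b] u_node(3)[OF a]])
  have ud: "u 0 (t n) - u 0 (t (n - 1)) \<in> V_div \<Omega>"
  proof -
    have "u 0 (t n) - u 0 (t (n - 1)) \<in> V_space \<Omega>"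
      using u_node(1)[OF a] u_node(1)[OF b] by (intro subspace_diff[OF subspace_V])
    moreover have "L2_inner \<Omega> (div_v \<Omega> (u 0 (t n) - u 0 (t (n - 1)))) q = 0" if "q \<in> Q_space \<Omega>" for q
      using DS.b_diff_left[OF u_node(1)[OF b] u_node(1)[OF a] Q_L2[OF that]] u_div[OF a] u_div[OF b] that
      by (simp add: V_div_def)
    ultimately show ?thesis by (simp add: V_div_def)
  qed
  have "H_norm 1 \<Omega> ((u 0 (t n) - u 0 (t (n - 1))) - (R n - R (n - 1))) \<le> cR * h ^ r * (K * time_step t n)"
    by (rule ritz_approximation[OF ritz ud _ subspace_diff[OF subspace_Q p_Q[OF b] p_Q[OF a]]])
       (use bu bp st u_node(2,4)[OF a] u_node(2,4)[OF b] in \<open>auto intro!: H.X_closed\<close>)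
  moreover have "(u 0 (t n) - u 0 (t (n - 1))) - (R n - R (n - 1)) = \<rho> n - \<rho> (n - 1)"
    by (simp add: \<rho>_def)
  moreover have "cR * h ^ r * (K * time_step t n) \<le> B * h ^ r * time_step t n"
  proof -
    have "B * h ^ r * time_step t n = 2 * (cR * h ^ r * (K * time_step t n))" by (simp add: B_def)
    moreover have "0 \<le> cR * h ^ r * (K * time_step t n)" using cR_nonneg K h_power_nonneg ab(4) by simp
    ultimately show ?thesis by linarith
  qed
  ultimately show ?thesis by simp
qed

text \<open>
  The residual of the projected solution in the Crank-Nicolson scheme: its difference quotient minus the
  mean of the exact time derivatives, and \<open>\<rho>\<close> itself, because the projection uses the full \<open>H\<^sup>1\<close> inner
  product whereas the equation only contains the gradient form.
\<close>

definition g :: "nat \<Rightarrow> real^'a \<Rightarrow> real^'a" where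
  "g n = (1 / time_step t n) *\<^sub>R (R n - R (n - 1)) + (1 / 2) *\<^sub>R (\<rho> n + \<rho> (n - 1))
     - (1 / 2) *\<^sub>R (u 1 (t (n - 1)) + u 1 (t n))"

lemma time_consistency:
  assumes n: "n \<in> {1..N}"
  defines "Du \<equiv> (1 / time_step t n) *\<^sub>R (u 0 (t n) - u 0 (t (n - 1)))"
  shows "L2_norm \<Omega> (Du - (1 / 2) *\<^sub>R (u 1 (t (n - 1)) + u 1 (t n))) \<le> 2 * K * \<tau>\<^sup>2"
    and "L2_norm \<Omega> (Du - u 1 (midpoint_t t n)) \<le> 2 * K * \<tau>\<^sup>2"
    and "L2_norm \<Omega> (grad_v \<Omega> (u 0 (midpoint_t t n) - (1 / 2) *\<^sub>R (u 0 (t (n - 1)) + u 0 (t n)))) \<le> K * \<tau>\<^sup>2"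
proof -
  let ?a = "t (n - 1)" and ?b = "t n"
  note ab = mesh_node[OF mesh_t n]
  have sub: "{?a..?b} \<subseteq> {0..T}" using ab by auto
  have mid: "midpoint_t t n = (?a + ?b) / 2" "(?a + ?b) / 2 \<in> {?a..?b}"
    using ab(1) by (auto simp: midpoint_t_def)
  have st: "time_step t n = ?b - ?a" by (simp add: time_step_def)
  have inT: "?a \<in> {0..T}" "?b \<in> {0..T}" "midpoint_t t n \<in> {0..T}" using sub mid ab(1) by auto
  have dL: "deriv_in (L2_norm \<Omega>) {0..T} (u j) (u (Suc j))" if "j < 3" for j
    by (rule regular_deriv_mono[OF u _ L2_norm_mono_facts]) (use k that in auto)
  have dA: "deriv_in (\<lambda>v. L2_norm \<Omega> (grad_v \<Omega> v)) {0..T} (u j) (u (Suc j))" if "j < 3" for j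
    by (rule regular_deriv_mono[OF u _ grad_norm_mono_facts]) (use k that in auto)
  have QL: "L2_norm \<Omega> (u 0 ?b - u 0 ?a - ((?b - ?a) / 2) *\<^sub>R (u 1 ?a + u 1 ?b)) \<le> 2 * K * (?b - ?a) ^ 3"
    "L2_norm \<Omega> (u 0 ?b - u 0 ?a - (?b - ?a) *\<^sub>R u 1 ((?a + ?b) / 2)) \<le> 2 * K * (?b - ?a) ^ 3"
    by (rule L2.quadrature_errors_nrm[where w = u and ?K2.0 = K, OF _ L2.deriv_in_subset[OF dL sub]];
        use sub u_node(6,9) ab(1) in auto)+
  have QA: "L2_norm \<Omega> (grad_v \<Omega> (u 0 ((?a + ?b) / 2) - (1 / 2) *\<^sub>R (u 0 ?a + u 0 ?b))) \<le> K * (?b - ?a)\<^sup>2"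
    by (rule A.quadrature_errors_nrm(3)[where w = u and ?K3.0 = K, OF _ A.deriv_in_subset[OF dA sub]];
        use sub u_node(5,10) ab(1) in auto)
  have pos: "0 < time_step t n" and le: "time_step t n \<le> \<tau>" using ab by auto
  have sq: "(time_step t n)\<^sup>2 \<le> \<tau>\<^sup>2" using pos le by (intro power_mono) auto
  have scale: "L2_norm \<Omega> ((1 / time_step t n) *\<^sub>R y) \<le> 2 * K * \<tau>\<^sup>2"
    if "y \<in> L2_space \<Omega>" "L2_norm \<Omega> y \<le> 2 * K * (time_step t n) ^ 3" for y :: "real^'a \<Rightarrow> real^'a"
  proof -
    have "L2_norm \<Omega> ((1 / time_step t n) *\<^sub>R y) = L2_norm \<Omega> y / time_step t n"
      using pos by (simp add: L2.nrm_scaleR[OF that(1)])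
    also have "\<dots> \<le> 2 * K * (time_step t n)\<^sup>2"
      using that(2) pos by (simp add: divide_le_eq power3_eq_cube power2_eq_square mult.assoc)
    also have "\<dots> \<le> 2 * K * \<tau>\<^sup>2" using sq K by (intro mult_left_mono) auto
    finally show ?thesis .
  qed
  have uL: "u 0 ?a \<in> L2_space \<Omega>" "u 0 ?b \<in> L2_space \<Omega>" "u 1 ?a \<in> L2_space \<Omega>" "u 1 ?b \<in> L2_space \<Omega>"
    "u 1 (midpoint_t t n) \<in> L2_space \<Omega>" using u_node(6) inT by auto
  have "Du - (1 / 2) *\<^sub>R (u 1 ?a + u 1 ?b)
      = (1 / time_step t n) *\<^sub>R (u 0 ?b - u 0 ?a - (time_step t n / 2) *\<^sub>R (u 1 ?a + u 1 ?b))"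
    using pos by (simp add: Du_def scaleR_diff_right)
  then show "L2_norm \<Omega> (Du - (1 / 2) *\<^sub>R (u 1 ?a + u 1 ?b)) \<le> 2 * K * \<tau>\<^sup>2"
    using scale[of "u 0 ?b - u 0 ?a - (time_step t n / 2) *\<^sub>R (u 1 ?a + u 1 ?b)"] QL(1) uL
    by (simp add: st L2.X_closed)
  have "Du - u 1 (midpoint_t t n)
      = (1 / time_step t n) *\<^sub>R (u 0 ?b - u 0 ?a - time_step t n *\<^sub>R u 1 (midpoint_t t n))"
    using pos by (simp add: Du_def scaleR_diff_right)
  then show "L2_norm \<Omega> (Du - u 1 (midpoint_t t n)) \<le> 2 * K * \<tau>\<^sup>2"
    using scale[of "u 0 ?b - u 0 ?a - time_step t n *\<^sub>R u 1 (midpoint_t t n)"] QL(2) uL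
    by (simp add: st mid L2.X_closed)
  show "L2_norm \<Omega> (grad_v \<Omega> (u 0 (midpoint_t t n) - (1 / 2) *\<^sub>R (u 0 ?a + u 0 ?b))) \<le> K * \<tau>\<^sup>2"
    using QA mult_left_mono[OF sq K] unfolding st mid(1) by linarith
qed

definition \<Lambda> :: real where "\<Lambda> = 2 * B + 2 * K"
definition \<delta> :: real where "\<delta> = h ^ r + \<tau>\<^sup>2"

lemma \<Lambda>_nonneg: "0 \<le> \<Lambda>" using B_nonneg K by (simp add: \<Lambda>_def)
lemma \<delta>_nonneg: "0 \<le> \<delta>" using h_power_nonneg by (simp add: \<delta>_def)

lemma \<delta>_sq: "\<delta>\<^sup>2 \<le> 2 * (\<tau> ^ 4 + h ^ (2 * r))"
proof -
  have "\<delta>\<^sup>2 \<le> 2 * (h ^ r)\<^sup>2 + 2 * (\<tau>\<^sup>2)\<^sup>2" unfolding \<delta>_def by (rule sum_square_le)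
  moreover have "(h ^ r)\<^sup>2 = h ^ (2 * r)" "(\<tau>\<^sup>2)\<^sup>2 = \<tau> ^ 4" by (simp_all add: power_mult[symmetric] mult.commute)
  ultimately show ?thesis by simp
qed

text \<open>
  All error contributions are collected in multiples of \<open>h\<^sup>r + \<tau>\<^sup>2\<close> with a common constant \<open>\<Lambda>\<close>.
\<close>

lemma combined_bound:
  assumes "x \<le> 2 * B * h ^ r + 2 * K * \<tau>\<^sup>2"
  shows "x \<le> \<Lambda> * \<delta>"
proof -
  have "\<Lambda> * \<delta> = (2 * B * h ^ r + 2 * K * \<tau>\<^sup>2) + (2 * B * \<tau>\<^sup>2 + 2 * K * h ^ r)"
    by (simp add: \<Lambda>_def \<delta>_def algebra_simps)
  moreover have "0 \<le> 2 * B * \<tau>\<^sup>2 + 2 * K * h ^ r" using B_nonneg K h_power_nonneg by simp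
  ultimately show ?thesis using assms by linarith
qed

lemma K_\<tau>_nonneg: "0 \<le> K * \<tau>\<^sup>2" and B_h_nonneg: "0 \<le> B * h ^ r" using K B_nonneg h_power_nonneg by simp_all

lemma \<rho>_bounds:
  assumes n: "n \<le> N"
  shows "L2_norm \<Omega> (\<rho> n) \<le> B * h ^ r" "L2_norm \<Omega> (grad_v \<Omega> (\<rho> n)) \<le> B * h ^ r"
  using \<rho>_bound[OF n] L2_norm_le_H_norm[OF H_L2[OF H1_members(3)[OF n]], of 1] grad_norm_le_H1[OF H1_members(3)[OF n]]
  by linarith+

lemma D\<rho>_bound:
  assumes n: "n \<in> {1..N}"
  shows "L2_norm \<Omega> ((1 / time_step t n) *\<^sub>R (\<rho> n - \<rho> (n - 1))) \<le> B * h ^ r"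
proof -
  have nN: "n \<le> N" "n - 1 \<le> N" using n by auto
  have d: "\<rho> n - \<rho> (n - 1) \<in> L2_space \<Omega>" using H_L2[OF H1_members(3)] nN by (intro L2.X_closed) auto
  have pos: "0 < time_step t n" using mesh_node[OF mesh_t n] by simp
  have "L2_norm \<Omega> ((1 / time_step t n) *\<^sub>R (\<rho> n - \<rho> (n - 1))) = L2_norm \<Omega> (\<rho> n - \<rho> (n - 1)) / time_step t n"
    using L2.nrm_scaleR[OF d, of "1 / time_step t n"] pos by simp
  also have "\<dots> \<le> B * h ^ r"
    using \<rho>_diff_bound[OF n] L2_norm_le_H_norm[OF d, of 1] pos by (simp add: divide_le_eq)
  finally show ?thesis .
qed

lemma g_L2: "n \<in> {1..N} \<Longrightarrow> g n \<in> L2_space \<Omega>"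
  unfolding g_def using H_L2[OF H1_members(1)] H_L2[OF H1_members(3)] u_node(6)[OF node, of _ 1]
  by (intro L2.X_closed) auto

lemma g_bound:
  assumes n: "n \<in> {1..N}"
  shows "L2_norm \<Omega> (g n) \<le> \<Lambda> * \<delta>"
proof (rule combined_bound)
  have nN: "n \<le> N" "n - 1 \<le> N" using n by auto
  let ?x = "(1 / time_step t n) *\<^sub>R (\<rho> n - \<rho> (n - 1))"
  let ?y = "(1 / time_step t n) *\<^sub>R (u 0 (t n) - u 0 (t (n - 1))) - (1 / 2) *\<^sub>R (u 1 (t (n - 1)) + u 1 (t n))"
  let ?z = "(1 / 2) *\<^sub>R (\<rho> n + \<rho> (n - 1))"
  have \<rho>L: "\<rho> n \<in> L2_space \<Omega>" "\<rho> (n - 1) \<in> L2_space \<Omega>" using H_L2[OF H1_members(3)] nN by auto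
  have uL: "u j (t n) \<in> L2_space \<Omega>" "u j (t (n - 1)) \<in> L2_space \<Omega>" if "j \<le> 3" for j
    using u_node(6)[OF node that] nN by auto
  have L: "?x \<in> L2_space \<Omega>" "?y \<in> L2_space \<Omega>" "?z \<in> L2_space \<Omega>"
    using \<rho>L uL[of 0] uL[of 1] by (auto intro!: L2.X_closed)
  have gx: "g n = (?y - ?x) + ?z"
    by (simp add: g_def \<rho>_def scaleR_diff_right algebra_simps)
  have "L2_norm \<Omega> ?z = (1 / 2) * L2_norm \<Omega> (\<rho> n + \<rho> (n - 1))"
    using L2.nrm_scaleR[OF L2.X_closed(2)[OF \<rho>L], of "1 / 2"] by simp
  then have z: "L2_norm \<Omega> ?z \<le> B * h ^ r"
    using L2.nrm_triangle[OF \<rho>L] \<rho>_bounds(1)[OF nN(1)] \<rho>_bounds(1)[OF nN(2)] by linarith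
  have "L2_norm \<Omega> (g n) \<le> L2_norm \<Omega> (?y - ?x) + L2_norm \<Omega> ?z"
    unfolding gx using L by (intro L2.nrm_triangle) (auto intro!: L2.X_closed)
  also have "\<dots> \<le> L2_norm \<Omega> ?y + L2_norm \<Omega> ?x + L2_norm \<Omega> ?z"
    using L2.nrm_triangle_diff[OF L(2,1)] by simp
  also have "\<dots> \<le> 2 * K * \<tau>\<^sup>2 + B * h ^ r + B * h ^ r"
    using time_consistency(1)[OF n] D\<rho>_bound[OF n] z by linarith
  finally show "L2_norm \<Omega> (g n) \<le> 2 * B * h ^ r + 2 * K * \<tau>\<^sup>2" by (simp add: algebra_simps)
qed

text \<open>
  Adding the defining equations of \<open>R\<close> at two consecutive nodes to the weak form of the exact solution
  cancels gradient and pressure of the solution; subtracting the Crank-Nicolson equation for \<open>U\<close> removes \<open>f\<close>.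
\<close>

lemma error_equation:
  assumes n: "n \<in> {1..N}" and v: "v \<in> V_h_div \<Omega> M"
  shows "L2_inner \<Omega> ((1 / time_step t n) *\<^sub>R (\<Theta> n - \<Theta> (n - 1))) v
     + L2_inner \<Omega> (grad_v \<Omega> ((1 / 2) *\<^sub>R (\<Theta> n + \<Theta> (n - 1)))) (grad_v \<Omega> v) = L2_inner \<Omega> (g n) v"
proof -
  have nN: "n \<le> N" "n - 1 \<le> N" using n by auto
  note a = node[OF nN(2)] and b = node[OF nN(1)]
  have vV: "v \<in> V_space \<Omega>" and v1: "v \<in> H_space 1 \<Omega>" and vL: "v \<in> L2_space \<Omega>"
    using v V_h_div_V_h V_h_V V_h_div_H1 V_h_div_L2 by blast+
  let ?G = "\<lambda>w. L2_inner \<Omega> (grad_v \<Omega> w) (grad_v \<Omega> v)" and ?m = "\<lambda>w. L2_inner \<Omega> w v"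
  let ?c = "1 / time_step t n"
  have R1: "R n \<in> H_space 1 \<Omega>" "R (n - 1) \<in> H_space 1 \<Omega>" and U1: "U n \<in> H_space 1 \<Omega>" "U (n - 1) \<in> H_space 1 \<Omega>"
    using H1_members nN by auto
  have u1: "u 0 (t n) \<in> H_space 1 \<Omega>" "u 0 (t (n - 1)) \<in> H_space 1 \<Omega>" using u_node(5)[OF a, of 0] u_node(5)[OF b, of 0] by auto
  have du: "u 1 (t n) \<in> L2_space \<Omega>" "u 1 (t (n - 1)) \<in> L2_space \<Omega>" using u_node(6)[OF a, of 1] u_node(6)[OF b, of 1] by auto
  note L = H_L2[OF R1(1)] H_L2[OF R1(2)] H_L2[OF U1(1)] H_L2[OF U1(2)] H_L2[OF u1(1)] H_L2[OF u1(2)]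
  have ritz: "?m (R i) + ?G (R i) = ?m (u 0 (t i)) + ?G (u 0 (t i)) - L2_inner \<Omega> (div_v \<Omega> v) (p 0 (t i))" if i: "i \<le> N" for i
  proof -
    have "H_ip 1 (R i) v = H_ip 1 (u 0 (t i)) v - L2_inner \<Omega> (div_v \<Omega> v) (p 0 (t i))"
      using R_ritz[OF i] v unfolding DS.ritz_def Zh_eq by blast
    then show ?thesis
      using H1_ip_eq[OF H1_members(1)[OF i] v1] H1_ip_eq[OF _ v1, of "u 0 (t i)"] u_node(5)[OF node[OF i], of 0] by simp
  qed
  have cn: "?m (?c *\<^sub>R (U n - U (n - 1))) + ?G ((1 / 2) *\<^sub>R (U n + U (n - 1))) = (?m (f (t (n - 1))) + ?m (f (t n))) / 2"
    unfolding U_def by (rule crank_nicolson_nodal(2)[OF mesh_t sol u0h n f_L2 v])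
  have mD: "?m (?c *\<^sub>R (\<Theta> n - \<Theta> (n - 1))) = ?m (?c *\<^sub>R (R n - R (n - 1))) - ?m (?c *\<^sub>R (U n - U (n - 1)))"
    using L vL by (simp add: \<Theta>_def L2.ip_scaleR_left L2.ip_diff_left L2.X_closed diff_divide_distrib)
  have GM: "?G ((1 / 2) *\<^sub>R (\<Theta> n + \<Theta> (n - 1))) = (?G (R n) + ?G (R (n - 1))) / 2 - ?G ((1 / 2) *\<^sub>R (U n + U (n - 1)))"
    using R1 U1 v1 by (simp add: \<Theta>_def A.ip_scaleR_left A.ip_add_left A.ip_diff_left H.X_closed field_simps)
  have mg: "?m (g n) = ?m (?c *\<^sub>R (R n - R (n - 1))) + (?m (u 0 (t n)) - ?m (R n) + (?m (u 0 (t (n - 1))) - ?m (R (n - 1)))) / 2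
      - (?m (u 1 (t (n - 1))) + ?m (u 1 (t n))) / 2"
  proof -
    have 1: "?m (g n) = ?m (?c *\<^sub>R (R n - R (n - 1))) + ?m ((1 / 2) *\<^sub>R (\<rho> n + \<rho> (n - 1))) - ?m ((1 / 2) *\<^sub>R (u 1 (t (n - 1)) + u 1 (t n)))"
      unfolding g_def \<rho>_def using L du vL
      by (subst L2.ip_diff_left, simp_all add: L2.X_closed, subst L2.ip_add_left, simp_all add: L2.X_closed)
    have 2: "?m ((1 / 2) *\<^sub>R (\<rho> n + \<rho> (n - 1))) = (?m (u 0 (t n)) - ?m (R n) + (?m (u 0 (t (n - 1))) - ?m (R (n - 1)))) / 2"
      using L vL by (simp add: \<rho>_def L2.ip_scaleR_left L2.ip_add_left L2.ip_diff_left L2.X_closed)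
    have 3: "?m ((1 / 2) *\<^sub>R (u 1 (t (n - 1)) + u 1 (t n))) = (?m (u 1 (t (n - 1))) + ?m (u 1 (t n))) / 2"
      using du vL by (simp add: L2.ip_scaleR_left L2.ip_add_left L2.X_closed)
    show ?thesis unfolding 1 2 3 ..
  qed
  show ?thesis
    unfolding mD GM mg
    using ritz[OF nN(1)] ritz[OF nN(2)] cn weak[OF a vV] weak[OF b vV] by (simp add: field_simps)
qed

sublocale CN: crank_nicolson "L2_space \<Omega>" "H_space 1 \<Omega>" "L2_inner \<Omega>"
    "\<lambda>u v. L2_inner \<Omega> (grad_v \<Omega> u) (grad_v \<Omega> v)" \<Theta> g "time_step t" N
  rewrites "semi_inner.nrm (L2_inner \<Omega>) = (L2_norm \<Omega> :: (real^'a \<Rightarrow> real^'a) \<Rightarrow> real)"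
    and "semi_inner.nrm (\<lambda>u v. L2_inner \<Omega> (grad_v \<Omega> u) (grad_v \<Omega> v)) = (\<lambda>u. L2_norm \<Omega> (grad_v \<Omega> u))"
proof -
  show "crank_nicolson (L2_space \<Omega>) (H_space 1 \<Omega>) (L2_inner \<Omega>)
     (\<lambda>u v. L2_inner \<Omega> (grad_v \<Omega> u) (grad_v \<Omega> v)) \<Theta> g (time_step t) N"
  proof (intro crank_nicolson.intro crank_nicolson_axioms.intro semi_inner_L2 semi_inner_grad)
    show "H_space 1 \<Omega> \<subseteq> L2_space \<Omega>" using H_L2 by auto
    show "\<Theta> n \<in> H_space 1 \<Omega>" if "n \<le> N" for n using H1_members(4)[OF that] .
    show "g n \<in> L2_space \<Omega>" if "n \<in> {1..N}" for n using g_L2[OF that] .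
    show "0 < time_step t n" if "n \<in> {1..N}" for n using mesh_node[OF mesh_t that] by simp
    fix n assume n: "n \<in> {1..N}"
    have Z: "\<Theta> n \<in> V_h_div \<Omega> M" "\<Theta> (n - 1) \<in> V_h_div \<Omega> M" using \<Theta>_Zh n by auto
    note sub = DS.subspace_Zh[unfolded Zh_eq]
    have "\<Theta> n - \<Theta> (n - 1) \<in> V_h_div \<Omega> M" by (rule subspace_diff[OF sub Z])
    from error_equation[OF n this]
    show "L2_inner \<Omega> ((1 / time_step t n) *\<^sub>R (\<Theta> n - \<Theta> (n - 1))) (\<Theta> n - \<Theta> (n - 1))
         + L2_inner \<Omega> (grad_v \<Omega> ((1 / 2) *\<^sub>R (\<Theta> n + \<Theta> (n - 1)))) (grad_v \<Omega> (\<Theta> n - \<Theta> (n - 1)))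
         = L2_inner \<Omega> (g n) (\<Theta> n - \<Theta> (n - 1))" .
    have "(1 / 2) *\<^sub>R (\<Theta> n + \<Theta> (n - 1)) \<in> V_h_div \<Omega> M" by (rule subspace_scale[OF sub subspace_add[OF sub Z]])
    from error_equation[OF n this]
    show "L2_inner \<Omega> ((1 / time_step t n) *\<^sub>R (\<Theta> n - \<Theta> (n - 1))) ((1 / 2) *\<^sub>R (\<Theta> n + \<Theta> (n - 1)))
         + L2_inner \<Omega> (grad_v \<Omega> ((1 / 2) *\<^sub>R (\<Theta> n + \<Theta> (n - 1)))) (grad_v \<Omega> ((1 / 2) *\<^sub>R (\<Theta> n + \<Theta> (n - 1))))
         = L2_inner \<Omega> (g n) ((1 / 2) *\<^sub>R (\<Theta> n + \<Theta> (n - 1)))" .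
  qed
  show "semi_inner.nrm (L2_inner \<Omega>) = (L2_norm \<Omega> :: (real^'a \<Rightarrow> real^'a) \<Rightarrow> real)"
    by (auto simp: L2_norm_def semi_inner.nrm_def[OF semi_inner_L2])
  show "semi_inner.nrm (\<lambda>u v. L2_inner \<Omega> (grad_v \<Omega> u) (grad_v \<Omega> v)) = (\<lambda>u. L2_norm \<Omega> (grad_v \<Omega> u))"
    by (auto simp: semi_inner.nrm_def[OF semi_inner_grad] L2_norm_def)
qed

end

context discrete_evolution
begin

definition e :: "real \<Rightarrow> real^'a \<Rightarrow> real^'a" where "e s = u 0 s - uh s"

lemma e_node: "e (t n) = \<rho> n + \<Theta> n"
  by (simp add: e_def \<rho>_def \<Theta>_def U_def)

lemma midpoint_inside:
  assumes n: "n \<in> {1..N}"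
  shows "t (n - 1) < midpoint_t t n" "midpoint_t t n < t n" "midpoint_t t n \<in> {0..T}"
  using mesh_node[OF mesh_t n] by (auto simp: midpoint_t_def)

lemma uh_interval:
  assumes n: "n \<in> {1..N}" and s: "t (n - 1) \<le> s" "s \<le> t n"
  shows "ae_eq \<Omega> (uh s) (U (n - 1) + (s - t (n - 1)) *\<^sub>R ((1 / time_step t n) *\<^sub>R (U n - U (n - 1))))"
  unfolding U_def by (rule crank_nicolson_nodal(1)[OF mesh_t sol u0h n f_L2 s])

lemma nodal_members_L2:
  assumes "n \<in> {1..N}"
  shows "U n \<in> L2_space \<Omega>" "U (n - 1) \<in> L2_space \<Omega>" "(1 / time_step t n) *\<^sub>R (U n - U (n - 1)) \<in> L2_space \<Omega>"
proof -
  show 1: "U n \<in> L2_space \<Omega>" "U (n - 1) \<in> L2_space \<Omega>" using H_L2[OF H1_members(2)] assms by auto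
  then show "(1 / time_step t n) *\<^sub>R (U n - U (n - 1)) \<in> L2_space \<Omega>" by (intro L2.X_closed)
qed

text \<open>
  The discrete velocity at the midpoint is the mean of its nodal values. The error there consists of the
  deviation of \<open>u\<close> from its nodal mean, the mean of \<open>\<rho>\<close> and the mean of \<open>\<Theta>\<close>.
\<close>

lemma error_midpoint:
  assumes n: "n \<in> {1..N}"
  shows "L2_norm \<Omega> (grad_v \<Omega> (e (midpoint_t t n))) \<le> \<Lambda> * \<delta> + L2_norm \<Omega> (grad_v \<Omega> (CN.M n))"
proof -
  let ?s = "midpoint_t t n"
  note mid = midpoint_inside[OF n]
  have nN: "n \<le> N" "n - 1 \<le> N" using n by auto
  note a = node[OF nN(2)] and b = node[OF nN(1)] and ab = mesh_node[OF mesh_t n]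
  let ?x = "u 0 ?s - (1 / 2) *\<^sub>R (u 0 (t (n - 1)) + u 0 (t n))"
  let ?y = "(1 / 2) *\<^sub>R (\<rho> n + \<rho> (n - 1))"
  have H1: "?x \<in> H_space 1 \<Omega>" "?y \<in> H_space 1 \<Omega>" "CN.M n \<in> H_space 1 \<Omega>"
    using u_node(5)[OF a, of 0] u_node(5)[OF b, of 0] u_node(5)[OF mid(3), of 0] H1_members(3,4) nN
    by (auto simp: CN.M_def intro!: H.X_closed)
  have half: "(?s - t (n - 1)) *\<^sub>R ((1 / time_step t n) *\<^sub>R (U n - U (n - 1))) = (1 / 2) *\<^sub>R (U n - U (n - 1))"
  proof -
    have "(?s - t (n - 1)) * (1 / time_step t n) = 1 / 2"
      using ab(1) by (simp add: midpoint_t_def time_step_def field_simps)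
    then show ?thesis by (simp only: scaleR_scaleR)
  qed
  have "ae_eq \<Omega> (uh ?s) (U (n - 1) + (1 / 2) *\<^sub>R (U n - U (n - 1)))"
    using uh_interval[OF n less_imp_le[OF mid(1)] less_imp_le[OF mid(2)]] unfolding half .
  then have e1: "ae_eq \<Omega> (e ?s) (u 0 ?s - (U (n - 1) + (1 / 2) *\<^sub>R (U n - U (n - 1))))"
    unfolding e_def by (intro ae_eq_diff ae_eq_refl)
  have e2: "u 0 ?s - (U (n - 1) + (1 / 2) *\<^sub>R (U n - U (n - 1))) = (?x + ?y) + CN.M n"
  proof -
    have "U (n - 1) + (1 / 2) *\<^sub>R (U n - U (n - 1)) = (1 / 2) *\<^sub>R (U n + U (n - 1))"
      by (rule ext) (simp add: vec_eq_iff field_simps)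
    moreover have "(1 / 2) *\<^sub>R (u 0 (t (n - 1)) + u 0 (t n)) = ?y + CN.M n + (1 / 2) *\<^sub>R (U n + U (n - 1))"
      by (rule ext) (simp add: \<rho>_def \<Theta>_def CN.M_def vec_eq_iff field_simps)
    ultimately show ?thesis by simp
  qed
  have eq: "ae_eq \<Omega> ((?x + ?y) + CN.M n) (e ?s)" using ae_eq_sym[OF e1] unfolding e2 .
  have "L2_norm \<Omega> (grad_v \<Omega> (e ?s)) = L2_norm \<Omega> (grad_v \<Omega> ((?x + ?y) + CN.M n))"
    by (rule grad_norm_cong[OF _ eq, symmetric]) (use H1 in \<open>auto intro!: H.X_closed\<close>)
  also have "\<dots> \<le> L2_norm \<Omega> (grad_v \<Omega> (?x + ?y)) + L2_norm \<Omega> (grad_v \<Omega> (CN.M n))"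
    using H1 by (intro A.nrm_triangle) (auto intro!: H.X_closed)
  also have "L2_norm \<Omega> (grad_v \<Omega> (?x + ?y)) \<le> L2_norm \<Omega> (grad_v \<Omega> ?x) + L2_norm \<Omega> (grad_v \<Omega> ?y)"
    using H1 by (intro A.nrm_triangle)
  also have "L2_norm \<Omega> (grad_v \<Omega> ?x) + L2_norm \<Omega> (grad_v \<Omega> ?y) \<le> \<Lambda> * \<delta>"
  proof (rule combined_bound)
    have \<rho>1: "\<rho> n \<in> H_space 1 \<Omega>" "\<rho> (n - 1) \<in> H_space 1 \<Omega>" using H1_members(3) nN by auto
    have "L2_norm \<Omega> (grad_v \<Omega> ?y) = (1 / 2) * L2_norm \<Omega> (grad_v \<Omega> (\<rho> n + \<rho> (n - 1)))"
      using A.nrm_scaleR[OF H.X_closed(2)[OF \<rho>1], of "1 / 2"] by simp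
    then have "L2_norm \<Omega> (grad_v \<Omega> ?y) \<le> B * h ^ r"
      using A.nrm_triangle[OF \<rho>1] \<rho>_bounds(2)[OF nN(1)] \<rho>_bounds(2)[OF nN(2)] by linarith
    then show "L2_norm \<Omega> (grad_v \<Omega> ?x) + L2_norm \<Omega> (grad_v \<Omega> ?y) \<le> 2 * B * h ^ r + 2 * K * \<tau>\<^sup>2"
      using time_consistency(3)[OF n] K_\<tau>_nonneg B_h_nonneg by simp
  qed
  finally show ?thesis by simp
qed

text \<open>
  Near the midpoint the discrete velocity is affine, so its contribution to the difference quotient of
  the error is constant.
\<close>

lemma dt_error_midpoint_eq:
  assumes n: "n \<in> {1..N}"
  defines "DU \<equiv> (1 / time_step t n) *\<^sub>R (U n - U (n - 1))"
  shows "dt \<Omega> {0..T} e (midpoint_t t n) \<in> L2_space \<Omega>"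
    and "ae_eq \<Omega> (dt \<Omega> {0..T} e (midpoint_t t n)) (u 1 (midpoint_t t n) - DU)"
proof -
  let ?m = "midpoint_t t n" and ?a = "t (n - 1)" and ?b = "t n"
  note mid = midpoint_inside[OF n] and ab = mesh_node[OF mesh_t n]
  have nt: "at ?m within {0..T} \<noteq> bot" using mid(3) T by (simp add: trivial_limit_within islimpt_Icc)
  have ev: "\<forall>\<^sub>F s in at ?m within {0..T}. s \<noteq> ?m \<and> ?a < s \<and> s < ?b"
    unfolding eventually_at_topological using mid by (intro exI[of _ "{?a<..<?b}"]) auto
  have inT: "s \<in> {0..T}" if "?a < s" "s < ?b" for s using that ab by auto
  have uL: "u j s \<in> L2_space \<Omega>" if "j \<le> 3" "?a < s" "s < ?b" for s j
    using u_node(6)[OF inT[OF that(2,3)] that(1)] .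
  have DUL: "DU \<in> L2_space \<Omega>" unfolding DU_def by (rule nodal_members_L2(3)[OF n])
  have uhe: "ae_eq \<Omega> (uh s) (U (n - 1) + (s - ?a) *\<^sub>R DU)" if "?a < s" "s < ?b" for s
    unfolding DU_def using uh_interval[OF n] that by auto
  have uhL: "uh s \<in> L2_space \<Omega>" if "?a < s" "s < ?b" for s
    by (rule L2_ae_closed[OF _ ae_eq_sym[OF uhe[OF that]]]) (use nodal_members_L2[OF n] DUL in \<open>auto intro!: L2.X_closed\<close>)
  have eL: "e s \<in> L2_space \<Omega>" if "?a < s" "s < ?b" for s
    unfolding e_def using uL[of 0] uhL that by (auto intro!: L2.X_closed)
  have gL: "u 1 ?m - DU \<in> L2_space \<Omega>" using uL[of 1 ?m] mid DUL by (auto intro!: L2.X_closed)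
  have evL: "\<forall>\<^sub>F s in at ?m within {0..T}. e s \<in> L2_space \<Omega>"
    using ev by (rule eventually_mono) (use eL in auto)
  have dL: "deriv_in (L2_norm \<Omega>) {0..T} (u 0) (u (Suc 0))"
    by (rule regular_deriv_mono[OF u _ L2_norm_mono_facts]) (use k in auto)
  then have lim: "((\<lambda>s. L2_norm \<Omega> ((u 0 s - u 0 ?m) /\<^sub>R (s - ?m) - u 1 ?m)) \<longlongrightarrow> 0) (at ?m within {0..T})"
    using mid(3) by (simp add: deriv_in_def)
  have "((\<lambda>s. L2_norm \<Omega> ((e s - e ?m) /\<^sub>R (s - ?m) - (u 1 ?m - DU))) \<longlongrightarrow> 0) (at ?m within {0..T})"
  proof (rule Lim_transform_eventually[OF lim])
    show "\<forall>\<^sub>F s in at ?m within {0..T}. L2_norm \<Omega> ((u 0 s - u 0 ?m) /\<^sub>R (s - ?m) - u 1 ?m)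
        = L2_norm \<Omega> ((e s - e ?m) /\<^sub>R (s - ?m) - (u 1 ?m - DU))"
      using ev
    proof eventually_elim
      case (elim s)
      then have s: "?a < s" "s < ?b" "s \<noteq> ?m" by auto
      show ?case
      proof (rule L2_norm_cong)
        show "ae_eq \<Omega> ((u 0 s - u 0 ?m) /\<^sub>R (s - ?m) - u 1 ?m) ((e s - e ?m) /\<^sub>R (s - ?m) - (u 1 ?m - DU))"
          using uhe[OF s(1,2)] uhe[OF mid(1,2)] unfolding ae_eq_def
        proof eventually_elim
          case (elim x)
          have 1: "e s x - e ?m x = (u 0 s x - u 0 ?m x) - (s - ?m) *\<^sub>R DU x"
            using elim by (simp add: e_def scaleR_left_diff_distrib)
          have 2: "(e s x - e ?m x) /\<^sub>R (s - ?m) = (u 0 s x - u 0 ?m x) /\<^sub>R (s - ?m) - DU x"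
            unfolding 1 scaleR_diff_right using s(3) by simp
          show ?case unfolding minus_apply scaleR_fun_apply 2 by (simp only: algebra_simps)
        qed
      qed (use uL s mid eL gL in \<open>auto intro!: L2.X_closed\<close>)
    qed
  qed
  then show "dt \<Omega> {0..T} e ?m \<in> L2_space \<Omega>" "ae_eq \<Omega> (dt \<Omega> {0..T} e ?m) (u 1 ?m - DU)"
    using dt_eq[OF gL nt evL eL[OF mid(1,2)]] by blast+
qed

lemma dt_error_midpoint:
  assumes n: "n \<in> {1..N}"
  shows "L2_norm \<Omega> (dt \<Omega> {0..T} e (midpoint_t t n)) \<le> \<Lambda> * \<delta> + L2_norm \<Omega> (CN.D n)"
proof -
  let ?m = "midpoint_t t n" and ?c = "1 / time_step t n"
  note mid = midpoint_inside[OF n]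
  have nN: "n \<le> N" "n - 1 \<le> N" using n by auto
  let ?Du = "?c *\<^sub>R (u 0 (t n) - u 0 (t (n - 1)))" and ?D\<rho> = "?c *\<^sub>R (\<rho> n - \<rho> (n - 1))"
  have uL: "u 1 ?m \<in> L2_space \<Omega>" "u 0 (t n) \<in> L2_space \<Omega>" "u 0 (t (n - 1)) \<in> L2_space \<Omega>"
    using u_node(6)[OF mid(3), of 1] u_node(6)[OF node[OF nN(1)], of 0] u_node(6)[OF node[OF nN(2)], of 0] by auto
  have L: "u 1 ?m - ?Du \<in> L2_space \<Omega>" "?D\<rho> \<in> L2_space \<Omega>" "CN.D n \<in> L2_space \<Omega>" "?Du \<in> L2_space \<Omega>"
    using uL CN.members(5)[OF n] H_L2[OF H1_members(3)] nN by (auto intro!: L2.X_closed)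
  have dd: "u 1 ?m - ?c *\<^sub>R (U n - U (n - 1)) = ((u 1 ?m - ?Du) + ?D\<rho>) + CN.D n"
    by (simp add: \<rho>_def \<Theta>_def CN.D_def scaleR_diff_right)
  have q: "ae_eq \<Omega> (dt \<Omega> {0..T} e ?m) (((u 1 ?m - ?Du) + ?D\<rho>) + CN.D n)"
    using dt_error_midpoint_eq(2)[OF n] unfolding dd .
  have "L2_norm \<Omega> (dt \<Omega> {0..T} e ?m) = L2_norm \<Omega> (((u 1 ?m - ?Du) + ?D\<rho>) + CN.D n)"
    by (rule L2_norm_cong[OF q dt_error_midpoint_eq(1)[OF n]]) (use L in \<open>auto intro!: L2.X_closed\<close>)
  also have "\<dots> \<le> L2_norm \<Omega> ((u 1 ?m - ?Du) + ?D\<rho>) + L2_norm \<Omega> (CN.D n)"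
    using L by (intro L2.nrm_triangle) (auto intro!: L2.X_closed)
  also have "L2_norm \<Omega> ((u 1 ?m - ?Du) + ?D\<rho>) \<le> \<Lambda> * \<delta>"
  proof (rule combined_bound)
    have "L2_norm \<Omega> ((u 1 ?m - ?Du) + ?D\<rho>) \<le> L2_norm \<Omega> (u 1 ?m - ?Du) + L2_norm \<Omega> ?D\<rho>"
      using L by (intro L2.nrm_triangle)
    then show "L2_norm \<Omega> ((u 1 ?m - ?Du) + ?D\<rho>) \<le> 2 * B * h ^ r + 2 * K * \<tau>\<^sup>2"
      using D\<rho>_bound[OF n] time_consistency(2)[OF n] L2.nrm_diff_commute[OF uL(1) L(4)] B_h_nonneg by simp
  qed
  finally show ?thesis by simp
qed

lemma sum_time_steps_le: "n \<le> N \<Longrightarrow> (\<Sum>m=1..n. time_step t m) \<le> T"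
  using sum_time_steps[of t n] node[of n] mesh_t by (auto simp: time_mesh_def)

definition q :: real where "q = (\<Lambda> * \<delta>)\<^sup>2"

lemma q_nonneg: "0 \<le> q" by (simp add: q_def)

lemma weighted_sum_le:
  assumes n: "n \<le> N" and x: "\<And>m. m \<in> {1..n} \<Longrightarrow> x m \<le> c + 2 * y m" and c: "0 \<le> c"
  shows "(\<Sum>m=1..n. time_step t m * x m) \<le> T * c + 2 * (\<Sum>m=1..n. time_step t m * y m)"
proof -
  have "(\<Sum>m=1..n. time_step t m * x m) \<le> (\<Sum>m=1..n. time_step t m * (c + 2 * y m))"
    using mesh_node(4)[OF mesh_t] n x by (intro sum_mono mult_left_mono) (auto intro: less_imp_le)
  also have "\<dots> = (\<Sum>m=1..n. time_step t m) * c + 2 * (\<Sum>m=1..n. time_step t m * y m)"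
    by (simp add: algebra_simps sum.distrib sum_distrib_left)
  also have "\<dots> \<le> T * c + 2 * (\<Sum>m=1..n. time_step t m * y m)"
    using mult_right_mono[OF sum_time_steps_le[OF n] c] by simp
  finally show ?thesis .
qed

lemma first_node: "t 0 = 0" using mesh_t by (simp add: time_mesh_def)

lemma \<rho>_le: "n \<le> N \<Longrightarrow> L2_norm \<Omega> (\<rho> n) \<le> \<Lambda> * \<delta>" "n \<le> N \<Longrightarrow> L2_norm \<Omega> (grad_v \<Omega> (\<rho> n)) \<le> \<Lambda> * \<delta>"
  by (rule combined_bound; use \<rho>_bounds[of n] K_\<tau>_nonneg B_h_nonneg in simp)+

text \<open>
  The triangle inequality transfers the bound for \<open>\<Theta>\<close> to \<open>e\<close>, at the final node and at the midpoints, and the initial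
  value back from \<open>e\<close> to \<open>\<Theta>\<close>. Each transfer costs a factor two and a multiple of \<open>q\<close>.
\<close>

lemma gradient_error:
  assumes n: "n \<in> {1..N}"
  shows "(\<Sum>m=1..n. time_step t m * (L2_norm \<Omega> (dt \<Omega> {0..T} e (midpoint_t t m)))\<^sup>2)
       + (L2_norm \<Omega> (grad_v \<Omega> (e (t n))))\<^sup>2
     \<le> 4 * (L2_norm \<Omega> (grad_v \<Omega> (e 0)))\<^sup>2 + (6 + 4 * T) * q"
proof -
  have nN: "n \<le> N" using n by simp
  have H1: "\<rho> n \<in> H_space 1 \<Omega>" "\<Theta> n \<in> H_space 1 \<Omega>" "\<rho> 0 \<in> H_space 1 \<Omega>" "\<Theta> 0 \<in> H_space 1 \<Omega>" using H1_members nN by auto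
  have e0: "e 0 \<in> H_space 1 \<Omega>" using e_node[of 0] H1 by (auto simp: first_node intro!: H.X_closed)
  have start: "(L2_norm \<Omega> (grad_v \<Omega> (\<Theta> 0)))\<^sup>2 \<le> 2 * (L2_norm \<Omega> (grad_v \<Omega> (e 0)))\<^sup>2 + 2 * q"
    unfolding q_def
  proof (rule square_le_if_le_sum[OF A.nrm_nonneg[OF H1(4)]])
    have "\<Theta> 0 = e 0 - \<rho> 0" using e_node[of 0] by (simp add: first_node)
    then show "L2_norm \<Omega> (grad_v \<Omega> (\<Theta> 0)) \<le> L2_norm \<Omega> (grad_v \<Omega> (e 0)) + \<Lambda> * \<delta>"
      using A.nrm_triangle_diff[OF e0 H1(3)] \<rho>_le(2)[of 0] by simp
  qed
  have fin: "(L2_norm \<Omega> (grad_v \<Omega> (e (t n))))\<^sup>2 \<le> 2 * q + 2 * (L2_norm \<Omega> (grad_v \<Omega> (\<Theta> n)))\<^sup>2"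
    unfolding q_def e_node
    by (rule square_le_if_le_sum[OF A.nrm_nonneg[OF H.X_closed(2)[OF H1(1,2)]]])
       (use A.nrm_triangle[OF H1(1,2)] \<rho>_le(2)[OF nN] in linarith)
  have mids: "(\<Sum>m=1..n. time_step t m * (L2_norm \<Omega> (dt \<Omega> {0..T} e (midpoint_t t m)))\<^sup>2)
      \<le> T * (2 * q) + 2 * (\<Sum>m=1..n. time_step t m * (L2_norm \<Omega> (CN.D m))\<^sup>2)"
  proof (rule weighted_sum_le[OF nN])
    fix m assume "m \<in> {1..n}"
    then have m: "m \<in> {1..N}" using nN by auto
    show "(L2_norm \<Omega> (dt \<Omega> {0..T} e (midpoint_t t m)))\<^sup>2 \<le> 2 * q + 2 * (L2_norm \<Omega> (CN.D m))\<^sup>2"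
      unfolding q_def
      by (rule square_le_if_le_sum[OF L2.nrm_nonneg[OF dt_error_midpoint_eq(1)[OF m]] dt_error_midpoint[OF m]])
  qed (use q_nonneg in simp)
  have gs: "(\<Sum>m=1..n. time_step t m * (L2_norm \<Omega> (g m))\<^sup>2) \<le> T * q + 2 * (\<Sum>m=1..n. time_step t m * 0)"
  proof (rule weighted_sum_le[OF nN _ q_nonneg])
    fix m assume "m \<in> {1..n}"
    then have m: "m \<in> {1..N}" using nN by auto
    show "(L2_norm \<Omega> (g m))\<^sup>2 \<le> q + 2 * 0"
      unfolding q_def using power_mono[OF g_bound[OF m] L2.nrm_nonneg[OF g_L2[OF m]], of 2] by simp
  qed
  show ?thesis
    using start fin mids gs CN.gradient_estimate[OF nN] by (simp add: algebra_simps)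
qed

lemma L2_error:
  assumes n: "n \<in> {1..N}"
  shows "(L2_norm \<Omega> (e (t n)))\<^sup>2 + (\<Sum>m=1..n. time_step t m * (L2_norm \<Omega> (grad_v \<Omega> (e (midpoint_t t m))))\<^sup>2)
     \<le> 12 * (L2_norm \<Omega> (e 0))\<^sup>2 + 14 * (1 + T)\<^sup>2 * q"
proof -
  have nN: "n \<le> N" using n by simp
  have L: "\<rho> n \<in> L2_space \<Omega>" "\<Theta> n \<in> L2_space \<Omega>" "\<rho> 0 \<in> L2_space \<Omega>" "\<Theta> 0 \<in> L2_space \<Omega>"
    using H_L2[OF H1_members(3)] H_L2[OF H1_members(4)] nN by auto
  have e0: "e 0 \<in> L2_space \<Omega>" using e_node[of 0] L by (auto simp: first_node intro!: L2.X_closed)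
  define S where "S = L2_norm \<Omega> (\<Theta> 0) + (\<Sum>m=1..n. time_step t m * L2_norm \<Omega> (g m))"
  have S: "S \<le> L2_norm \<Omega> (e 0) + (1 + T) * (\<Lambda> * \<delta>)"
  proof -
    have "\<Theta> 0 = e 0 - \<rho> 0" using e_node[of 0] by (simp add: first_node)
    then have "L2_norm \<Omega> (\<Theta> 0) \<le> L2_norm \<Omega> (e 0) + \<Lambda> * \<delta>"
      using L2.nrm_triangle_diff[OF e0 L(3)] \<rho>_le(1)[of 0] by simp
    moreover have "(\<Sum>m=1..n. time_step t m * L2_norm \<Omega> (g m)) \<le> T * (\<Lambda> * \<delta>) + 2 * (\<Sum>m=1..n. time_step t m * 0)"
      by (rule weighted_sum_le[OF nN]) (use g_bound nN \<Lambda>_nonneg \<delta>_nonneg in auto)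
    ultimately show ?thesis by (simp add: S_def algebra_simps)
  qed
  have S0: "0 \<le> S" unfolding S_def
    using L mesh_node(4)[OF mesh_t] g_L2 nN
    by (intro add_nonneg_nonneg sum_nonneg mult_nonneg_nonneg L2.nrm_nonneg) (auto intro: less_imp_le)
  have S2: "S\<^sup>2 \<le> 2 * (L2_norm \<Omega> (e 0))\<^sup>2 + 2 * ((1 + T)\<^sup>2 * q)"
    using square_le_if_le_sum[OF S0 S] by (simp add: q_def power_mult_distrib)
  have fin: "(L2_norm \<Omega> (e (t n)))\<^sup>2 \<le> 2 * q + 2 * (L2_norm \<Omega> (\<Theta> n))\<^sup>2"
    unfolding q_def e_node
    by (rule square_le_if_le_sum[OF L2.nrm_nonneg[OF L2.X_closed(2)[OF L(1,2)]]])
       (use L2.nrm_triangle[OF L(1,2)] \<rho>_le(1)[OF nN] in linarith)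
  have mids: "(\<Sum>m=1..n. time_step t m * (L2_norm \<Omega> (grad_v \<Omega> (e (midpoint_t t m))))\<^sup>2)
      \<le> T * (2 * q) + 2 * (\<Sum>m=1..n. time_step t m * (L2_norm \<Omega> (grad_v \<Omega> (CN.M m)))\<^sup>2)"
  proof (rule weighted_sum_le[OF nN])
    fix m assume "m \<in> {1..n}"
    then have m: "m \<in> {1..N}" using nN by auto
    have nonneg: "0 \<le> L2_norm \<Omega> (grad_v \<Omega> (e (midpoint_t t m)))"
      by (simp add: L2_norm_def L2_inner_def integral_nonneg_AE)
    show "(L2_norm \<Omega> (grad_v \<Omega> (e (midpoint_t t m))))\<^sup>2 \<le> 2 * q + 2 * (L2_norm \<Omega> (grad_v \<Omega> (CN.M m)))\<^sup>2"
      unfolding q_def by (rule square_le_if_le_sum[OF nonneg error_midpoint[OF m]])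
  qed (use q_nonneg in simp)
  have est: "(L2_norm \<Omega> (\<Theta> n))\<^sup>2 + (\<Sum>m=1..n. time_step t m * (L2_norm \<Omega> (grad_v \<Omega> (CN.M m)))\<^sup>2) \<le> 3 * S\<^sup>2"
    unfolding S_def by (rule CN.L_estimate[OF nN])
  have "(2 + 2 * T) * q \<le> 2 * (1 + T)\<^sup>2 * q"
  proof (rule mult_right_mono[OF _ q_nonneg])
    have "0 \<le> T * T" using T by simp
    then show "2 + 2 * T \<le> 2 * (1 + T)\<^sup>2" using T by (simp add: power2_eq_square algebra_simps)
  qed
  then show ?thesis using fin mids est S2 by (simp add: algebra_simps)
qed

theorem error_bounds:
  assumes n: "n \<in> {1..N}"
  defines "C \<equiv> 12 + 28 * (1 + T)\<^sup>2 * \<Lambda>\<^sup>2"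
  shows "(\<Sum>m=1..n. time_step t m * (L2_norm \<Omega> (dt \<Omega> {0..T} e (midpoint_t t m)))\<^sup>2)
       + (L2_norm \<Omega> (grad_v \<Omega> (e (t n))))\<^sup>2
     \<le> C * ((L2_norm \<Omega> (grad_v \<Omega> (e 0)))\<^sup>2 + \<tau> ^ 4 + h ^ (2 * r))" (is "?X \<le> _")
    and "(L2_norm \<Omega> (e (t n)))\<^sup>2 + (\<Sum>m=1..n. time_step t m * (L2_norm \<Omega> (grad_v \<Omega> (e (midpoint_t t m))))\<^sup>2)
     \<le> C * ((L2_norm \<Omega> (e 0))\<^sup>2 + \<tau> ^ 4 + h ^ (2 * r))" (is "?Y \<le> _")
proof -
  define d where "d = \<tau> ^ 4 + h ^ (2 * r)"
  have d: "0 \<le> d" using \<delta>_sq by (auto simp: d_def intro: order_trans[OF zero_le_power2[of \<delta>_nonneg]])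
  have qd: "q \<le> 2 * \<Lambda>\<^sup>2 * d"
    using mult_left_mono[OF \<delta>_sq, of "\<Lambda>\<^sup>2"] by (simp add: q_def d_def power_mult_distrib algebra_simps)
  have C: "14 * (1 + T)\<^sup>2 * q \<le> C * d"
  proof -
    have "14 * (1 + T)\<^sup>2 * q \<le> 14 * (1 + T)\<^sup>2 * (2 * \<Lambda>\<^sup>2 * d)" using qd by (intro mult_left_mono) auto
    moreover have "14 * (1 + T)\<^sup>2 * (2 * \<Lambda>\<^sup>2 * d) + 12 * d = C * d" by (simp add: C_def algebra_simps)
    ultimately show ?thesis using d by linarith
  qed
  have C12: "12 \<le> C" by (simp add: C_def)
  have Cx: "12 * x \<le> C * x" if "0 \<le> x" for x using mult_right_mono[OF C12 that] .
  have "(6 + 4 * T) * q \<le> 14 * (1 + T)\<^sup>2 * q"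
  proof (rule mult_right_mono[OF _ q_nonneg])
    have "0 \<le> T * T" using T by simp
    then show "6 + 4 * T \<le> 14 * (1 + T)\<^sup>2" using T by (simp add: power2_eq_square algebra_simps)
  qed
  then have "?X \<le> 4 * (L2_norm \<Omega> (grad_v \<Omega> (e 0)))\<^sup>2 + C * d" using gradient_error[OF n] C by linarith
  also have "\<dots> \<le> C * (L2_norm \<Omega> (grad_v \<Omega> (e 0)))\<^sup>2 + C * d"
    using Cx[of "(L2_norm \<Omega> (grad_v \<Omega> (e 0)))\<^sup>2"] zero_le_power2[of "L2_norm \<Omega> (grad_v \<Omega> (e 0))"] by linarith
  finally show "?X \<le> C * ((L2_norm \<Omega> (grad_v \<Omega> (e 0)))\<^sup>2 + \<tau> ^ 4 + h ^ (2 * r))"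
    by (simp add: d_def algebra_simps)
  have "?Y \<le> C * (L2_norm \<Omega> (e 0))\<^sup>2 + C * d"
    using L2_error[OF n] C Cx[of "(L2_norm \<Omega> (e 0))\<^sup>2"] by simp
  then show "?Y \<le> C * ((L2_norm \<Omega> (e 0))\<^sup>2 + \<tau> ^ 4 + h ^ (2 * r))"
    by (simp add: d_def algebra_simps)
qed

end

text \<open>
  Dividing by the mesh size bounds the gradient by \<open>h\<^sup>r\<close>, and the spare factor \<open>h\<close> in the \<open>L\<^sup>2\<close> part is at
  most the diameter of the domain.
\<close>

lemma (in fe_space) H1_approximation:
  assumes C: "\<And>v. v \<in> V_space \<Omega> \<inter> H_space (r + 1) \<Omega> \<Longrightarrow> \<exists>w\<in>V_h \<Omega> M.
        L2_norm \<Omega> (\<lambda>x. v x - w x) + mesh_size M * L2_norm \<Omega> (grad_v \<Omega> (\<lambda>x. v x - w x))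
          \<le> C * mesh_size M ^ (r + 1) * H_norm (r + 1) \<Omega> v"
    and v: "v \<in> V_space \<Omega>" "v \<in> H_space (r + 1) \<Omega>"
  shows "\<exists>w\<in>V_h \<Omega> M. H_norm 1 \<Omega> (v - w) \<le> (\<bar>C\<bar> * (1 + diameter (closure \<Omega>))) * mesh_size M ^ r * H_norm (r + 1) \<Omega> v"
proof -
  let ?h = "mesh_size M" and ?H = "H_norm (r + 1) \<Omega> v"
  note h = mesh_size_bounds
  obtain w where w: "w \<in> V_h \<Omega> M" "L2_norm \<Omega> (v - w) + ?h * L2_norm \<Omega> (grad_v \<Omega> (v - w)) \<le> C * ?h ^ (r + 1) * ?H"
    using C[of v] v by (auto simp: fun_diff_def)
  have d: "v - w \<in> H_space 1 \<Omega>" using V_H1[OF v(1)] V_H1[OF V_h_V[OF w(1)]] by (rule H.X_closed)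
  have H0: "0 \<le> ?H" by (rule H.nrm_nonneg[OF v(2)])
  have n0: "0 \<le> L2_norm \<Omega> (v - w)" "0 \<le> L2_norm \<Omega> (grad_v \<Omega> (v - w))"
    using L2.nrm_nonneg[OF H_L2[OF d]] A.nrm_nonneg[OF d] by auto
  let ?E = "\<bar>C\<bar> * ?h ^ r * ?H"
  have E0: "0 \<le> ?E" using h H0 by simp
  have "C * ?h ^ (r + 1) * ?H \<le> \<bar>C\<bar> * ?h ^ (r + 1) * ?H"
    using h H0 by (intro mult_right_mono) auto
  also have "\<dots> = ?h * ?E" by (simp add: algebra_simps)
  finally have le: "L2_norm \<Omega> (v - w) + ?h * L2_norm \<Omega> (grad_v \<Omega> (v - w)) \<le> ?h * ?E" using w(2) by linarith
  have "0 \<le> ?h * L2_norm \<Omega> (grad_v \<Omega> (v - w))" using h n0 by simp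
  then have 1: "L2_norm \<Omega> (v - w) \<le> diameter (closure \<Omega>) * ?E"
    using le mult_right_mono[OF h(2) E0] by linarith
  have "?h * L2_norm \<Omega> (grad_v \<Omega> (v - w)) \<le> ?h * ?E" using le n0 by linarith
  then have 2: "L2_norm \<Omega> (grad_v \<Omega> (v - w)) \<le> ?E" using h(1) by simp
  have "H_norm 1 \<Omega> (v - w) \<le> diameter (closure \<Omega>) * ?E + ?E" using H1_norm_le[OF d] 1 2 by linarith
  also have "\<dots> = (\<bar>C\<bar> * (1 + diameter (closure \<Omega>))) * ?h ^ r * ?H" by (simp add: algebra_simps)
  finally show ?thesis using w(1) by blast
qed

text \<open>
  Three time derivatives, \<open>H\<^sup>2\<close> for the Laplacian and \<open>H\<^sup>r\<^sup>+\<^sup>1\<close> for the approximation are all contained in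
  regularity of order \<open>r + 3\<close>. The constant is assembled from bounds that are fixed before the mesh is chosen.
\<close>

theorem theorem3p11:
  fixes r :: nat
  assumes "CARD('d::finite) \<in> {2, 3}" and "1 \<le> r"
  shows "\<exists>k::nat. \<forall>(\<Omega> :: (real^'d) set) (T :: real)
      (f :: real \<Rightarrow> real^'d \<Rightarrow> real^'d) (u0 :: real^'d \<Rightarrow> real^'d)
      (u :: real \<Rightarrow> real^'d \<Rightarrow> real^'d) (p :: real \<Rightarrow> real^'d \<Rightarrow> real)
      (\<F> :: 'd fe_mesh set).
    open \<Omega> \<and> bounded \<Omega> \<and> connected \<Omega> \<and> \<Omega> \<noteq> {} \<and> 0 < T \<and>
    stokes_H2_regular \<Omega> \<and>
    stokes_solution \<Omega> T f u0 u p \<and>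
    Ck_time k k \<Omega> {0..T} u \<and> Ck_time k k \<Omega> {0..T} p \<and> Ck_time 0 0 \<Omega> {0..T} f \<and>
    shape_regular_family \<Omega> \<F> \<and> bounded_degree_family \<F> \<and>
    inf_sup_stable \<Omega> \<F> \<and> approximation_property \<Omega> r \<F>
    \<longrightarrow>
    (\<exists>C>0. \<forall>M\<in>\<F>. \<forall>(N :: nat) (t :: nat \<Rightarrow> real) u0h uh ph.
      time_mesh T N t \<and> u0h \<in> V_h_div \<Omega> M \<and> scheme_solution \<Omega> M T N t f u0h uh ph \<longrightarrow>
      (let e = (\<lambda>s x. u s x - uh s x); h = mesh_size M; \<tau> = max_step N t in
        \<forall>n\<in>{1..N}.
          (\<Sum>m=1..n. time_step t m * (L2_norm \<Omega> (dt \<Omega> {0..T} e (midpoint_t t m)))\<^sup>2)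
            + (L2_norm \<Omega> (grad_v \<Omega> (e (t n))))\<^sup>2
          \<le> C * ((L2_norm \<Omega> (grad_v \<Omega> (e 0)))\<^sup>2 + \<tau> ^ 4 + h ^ (2 * r)) \<and>
          (L2_norm \<Omega> (e (t n)))\<^sup>2
            + (\<Sum>m=1..n. time_step t m * (L2_norm \<Omega> (grad_v \<Omega> (e (midpoint_t t m))))\<^sup>2)
          \<le> C * ((L2_norm \<Omega> (e 0))\<^sup>2 + \<tau> ^ 4 + h ^ (2 * r))))"
proof (rule exI[of _ "r + 3"], intro allI impI, elim conjE)
  fix \<Omega> :: "(real^'d) set" and T f u0 u p and \<F> :: "'d fe_mesh set"
  assume \<Omega>: "open \<Omega>" "bounded \<Omega>" "\<Omega> \<noteq> {}" and T: "0 < T" and sol: "stokes_solution \<Omega> T f u0 u p"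
    and reg: "Ck_time (r + 3) (r + 3) \<Omega> {0..T} u" "Ck_time (r + 3) (r + 3) \<Omega> {0..T} p" "Ck_time 0 0 \<Omega> {0..T} f"
    and shape: "shape_regular_family \<Omega> \<F>" and deg: "bounded_degree_family \<F>"
    and infsup: "inf_sup_stable \<Omega> \<F>" and approx: "approximation_property \<Omega> r \<F>"
  interpret bounded_domain \<Omega> by (unfold_locales) (rule \<Omega>)+
  obtain W where W: "W 0 = u" "regular_seq (r + 3) T W" using Ck_time_regular_seq[OF reg(1)] by blast
  obtain P where P: "P 0 = p" "regular_seq (r + 3) T P" using Ck_time_regular_seq[OF reg(2)] by blast
  obtain F where F: "F 0 = f" "regular_seq 0 T F" using Ck_time_regular_seq[OF reg(3)] by blast
  obtain K1 where K1: "0 \<le> K1" "\<forall>j\<le>r + 3. \<forall>s\<in>{0..T}. H_norm (r + 3) \<Omega> (W j s) \<le> K1"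
    using regular_bounded[OF W(2)] by blast
  obtain K2 where K2: "0 \<le> K2" "\<forall>j\<le>r + 3. \<forall>s\<in>{0..T}. H_norm (r + 3) \<Omega> (P j s) \<le> K2"
    using regular_bounded[OF P(2)] by blast
  define K where "K = max K1 K2"
  obtain l where l: "\<forall>M\<in>\<F>. \<forall>K\<in>cells M.
     mapped_poly_space l (ref_cell M K) (cell_map M K) (V_loc M K) \<and>
     mapped_poly_space l (ref_cell M K) (cell_map M K) (Q_loc M K)"
    using deg unfolding bounded_degree_family_def by (elim exE)
  obtain \<beta> where \<beta>: "\<beta> > 0" "\<forall>M\<in>\<F>. ereal \<beta> \<le> (INF q\<in>{q \<in> Q_h \<Omega> M. \<not> ae_eq \<Omega> q (\<lambda>x. 0)}.
                 SUP v\<in>{v \<in> V_h \<Omega> M. \<not> ae_eq \<Omega> v (\<lambda>x. 0)}.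
                   ereal (- L2_inner \<Omega> (div_v \<Omega> v) q / (H_norm 1 \<Omega> v * L2_norm \<Omega> q)))"
    using infsup unfolding inf_sup_stable_def by (elim exE conjE)
  obtain C0 where C0: "\<forall>M\<in>\<F>.
     (\<forall>v \<in> V_space \<Omega> \<inter> H_space (r + 1) \<Omega>. \<exists>w\<in>V_h \<Omega> M.
        L2_norm \<Omega> (\<lambda>x. v x - w x) + mesh_size M * L2_norm \<Omega> (grad_v \<Omega> (\<lambda>x. v x - w x))
          \<le> C0 * mesh_size M ^ (r + 1) * H_norm (r + 1) \<Omega> v) \<and>
     (\<forall>q \<in> Q_space \<Omega> \<inter> H_space r \<Omega>. \<exists>s\<in>Q_h \<Omega> M.
        L2_norm \<Omega> (\<lambda>x. q x - s x) \<le> C0 * mesh_size M ^ r * H_norm r \<Omega> q)"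
    using approx unfolding approximation_property_def by (elim exE)
  have diam: "0 \<le> diameter (closure \<Omega>)" using \<Omega>(2) by (intro diameter_ge_0) auto
  define Ca where "Ca = \<bar>C0\<bar> * (1 + diameter (closure \<Omega>))"
  have Ca: "0 \<le> Ca" "\<bar>C0\<bar> \<le> Ca" using diam by (auto simp: Ca_def algebra_simps)
  define lam where "lam = 2 * (2 * ((2 * (1 + real CARD('d) / \<beta>) + real CARD('d)) * Ca) * K) + 2 * K"
  \<comment> \<open>The constant of error_bounds, written in terms of the data that do not depend on the mesh.\<close>
  define C where "C = 12 + 28 * (1 + T)\<^sup>2 * lam\<^sup>2"
  have C: "0 < C" unfolding C_def by (intro add_pos_nonneg) auto
  show "\<exists>C>0. \<forall>M\<in>\<F>. \<forall>(N :: nat) (t :: nat \<Rightarrow> real) u0h uh ph.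
      time_mesh T N t \<and> u0h \<in> V_h_div \<Omega> M \<and> scheme_solution \<Omega> M T N t f u0h uh ph \<longrightarrow>
      (let e = (\<lambda>s x. u s x - uh s x); h = mesh_size M; \<tau> = max_step N t in
        \<forall>n\<in>{1..N}.
          (\<Sum>m=1..n. time_step t m * (L2_norm \<Omega> (dt \<Omega> {0..T} e (midpoint_t t m)))\<^sup>2)
            + (L2_norm \<Omega> (grad_v \<Omega> (e (t n))))\<^sup>2
          \<le> C * ((L2_norm \<Omega> (grad_v \<Omega> (e 0)))\<^sup>2 + \<tau> ^ 4 + h ^ (2 * r)) \<and>
          (L2_norm \<Omega> (e (t n)))\<^sup>2
            + (\<Sum>m=1..n. time_step t m * (L2_norm \<Omega> (grad_v \<Omega> (e (midpoint_t t m))))\<^sup>2)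
          \<le> C * ((L2_norm \<Omega> (e 0))\<^sup>2 + \<tau> ^ 4 + h ^ (2 * r)))"
  proof (rule exI[of _ C], rule conjI[OF C], intro ballI allI impI, elim conjE)
    fix M N t u0h uh ph
    assume M: "M \<in> \<F>" and t: "time_mesh T N t" and u0h: "u0h \<in> V_h_div \<Omega> M"
      and scheme: "scheme_solution \<Omega> M T N t f u0h uh ph"
    interpret fe_space \<Omega> M l \<beta>
    proof
      show "is_mesh_of \<Omega> M" using shape M by (auto simp: shape_regular_family_def)
    qed (use \<Omega> M l \<beta> in blast)+
    interpret discrete_evolution \<Omega> M l \<beta> r "r + 3" T Ca K W P f N t u0h uh ph
    proof
      show "0 < T" "r + 3 \<le> r + 3" "0 \<le> Ca" "0 \<le> K" using T Ca K1(1) by (auto simp: K_def)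
      show "regular_seq (r + 3) T W" "regular_seq (r + 3) T P" by (rule W P)+
      show "H_norm (r + 3) \<Omega> (W j s) \<le> K" if "j \<le> r + 3" "s \<in> {0..T}" for j s
        using K1(2) that by (simp add: K_def le_max_iff_disj)
      show "H_norm (r + 3) \<Omega> (P j s) \<le> K" if "j \<le> r + 3" "s \<in> {0..T}" for j s
        using K2(2) that by (simp add: K_def le_max_iff_disj)
      show "W 0 s \<in> V_div \<Omega>" "P 0 s \<in> Q_space \<Omega>" if "s \<in> {0..T}" for s
        using sol that unfolding stokes_solution_def W(1) P(1) by blast+
      show "f s \<in> L2_space \<Omega>" if "s \<in> {0..T}" for s
        using regular_L2[OF F(2) _ that, of 0] F(1) by simp
      show "L2_inner \<Omega> (W 1 s) v + L2_inner \<Omega> (grad_v \<Omega> (W 0 s)) (grad_v \<Omega> v) - L2_inner \<Omega> (div_v \<Omega> v) (P 0 s)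
         = L2_inner \<Omega> (f s) v" if "s \<in> {0..T}" "v \<in> V_space \<Omega>" for s v
        using weak_formulation[OF W(2) P(2) _ T F(2) _ that, of u0] sol W(1) P(1) F(1) by simp
      show "\<exists>w\<in>V_h \<Omega> M. H_norm 1 \<Omega> (v - w) \<le> Ca * mesh_size M ^ r * H_norm (r + 1) \<Omega> v"
        if "v \<in> V_space \<Omega>" "v \<in> H_space (r + 1) \<Omega>" for v
        unfolding Ca_def by (rule H1_approximation[OF _ that]) (use C0 M in blast)
      show "\<exists>s\<in>Q_h \<Omega> M. L2_norm \<Omega> (q - s) \<le> Ca * mesh_size M ^ r * H_norm r \<Omega> q"
        if q: "q \<in> Q_space \<Omega>" "q \<in> H_space r \<Omega>" for q
      proof -
        have "q \<in> Q_space \<Omega> \<inter> H_space r \<Omega>" using q by simp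
        then have "\<exists>s\<in>Q_h \<Omega> M. L2_norm \<Omega> (\<lambda>x. q x - s x) \<le> C0 * mesh_size M ^ r * H_norm r \<Omega> q"
          using C0 M by blast
        then obtain s where s: "s \<in> Q_h \<Omega> M" "L2_norm \<Omega> (q - s) \<le> C0 * mesh_size M ^ r * H_norm r \<Omega> q"
          unfolding fun_diff_def by blast
        have "C0 * mesh_size M ^ r * H_norm r \<Omega> q \<le> Ca * mesh_size M ^ r * H_norm r \<Omega> q"
          using Ca(2) mesh_size_bounds(1) H.nrm_nonneg[OF q(2)] by (intro mult_right_mono) auto
        then show ?thesis using s by (intro bexI[OF _ s(1)]) linarith
      qed
      show "time_mesh T N t" "u0h \<in> V_h_div \<Omega> M" "scheme_solution \<Omega> M T N t f u0h uh ph"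
        by (rule t u0h scheme)+
    qed
    have e_eq: "(\<lambda>s x. u s x - uh s x) = e"
      by (simp add: fun_eq_iff e_def W(1))
    have lam: "lam = \<Lambda>" by (simp add: lam_def \<Lambda>_def B_def cR_def)
    show "let e = (\<lambda>s x. u s x - uh s x); h = mesh_size M; \<tau> = max_step N t in
        \<forall>n\<in>{1..N}.
          (\<Sum>m=1..n. time_step t m * (L2_norm \<Omega> (dt \<Omega> {0..T} e (midpoint_t t m)))\<^sup>2)
            + (L2_norm \<Omega> (grad_v \<Omega> (e (t n))))\<^sup>2
          \<le> C * ((L2_norm \<Omega> (grad_v \<Omega> (e 0)))\<^sup>2 + \<tau> ^ 4 + h ^ (2 * r)) \<and>
          (L2_norm \<Omega> (e (t n)))\<^sup>2
            + (\<Sum>m=1..n. time_step t m * (L2_norm \<Omega> (grad_v \<Omega> (e (midpoint_t t m))))\<^sup>2)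
          \<le> C * ((L2_norm \<Omega> (e 0))\<^sup>2 + \<tau> ^ 4 + h ^ (2 * r))"
      unfolding e_eq unfolding Let_def C_def lam by (intro ballI conjI error_bounds)
  qed
qed

end
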